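(* Let $n=m=1$, so that $A,B,C,D,Q,S,R\in\mathbb{R}$. Set $$\alpha=(B+C)^2-(2A+C^2),\quad \beta=Q-(2A+C^2)R+2(B+C)[(B+C)R-S],\quad \gamma=[(B+C)R-S]^2.$$ Suppose that $D=1$ and $\alpha>0$. Then Problem (LQ)$^0$ is solvable if and only if one of the following conditions holds: (i) $Q=(2A+C^2)R$ and $S=(B+C)R$. In this case, the pairs $$(\Theta,v(\cdot))\quad\text{with}\quad|\Theta+B+C|<\sqrt{\alpha},\quad v(\cdot)\in L^2_{\mathbb{F}}(\mathbb{R})$$ are all the closed-loop optimal strategies of Problem (LQ)$^0$. (ii) $2A+C^2\neq0$, $(2A+C^2)S\geq(B+C)Q$, and $$R>\frac{2(B+C-\sqrt{\alpha})S-Q}{(B+C-\sqrt{\alpha})^2}.$$ (iii) $2A+C^2\neq0$, $(2A+C^2)S<(B+C)Q$, and $$R>\frac{2(B+C+\sqrt{\alpha})S-Q}{(B+C+\sqrt{\alpha})^2}.$$ (iv) $2A+C^2=0$, $Q>0$, and $$R>\frac{4(B+C)S-Q}{4(B+C)^2}.$$ In the cases (ii), (iii), and (iv), $$\left(\frac{2\alpha[(B+C)R-S]}{\beta+\sqrt{\beta^2-4\alpha\gamma}}-(B+C),\ 0\right)$$ is the unique closed-loop optimal strategy of Problem (LQ)$^0$.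
   Context: $(\Omega,\mathcal{F},\mathbb{F},\mathbb{P})$ is a complete filtered probability space carrying a standard one-dimensional Brownian motion $W=\{W(t);t\geq0\}$; $\mathbb{F}$ is the natural filtration of $W$ augmented by all $\mathbb{P}$-null sets. $L^2_{\mathbb{F}}(\mathbb{R})$ is the space of $\mathbb{F}$-progressively measurable $\varphi:[0,\infty)\times\Omega\to\mathbb{R}$ with $\mathbb{E}\int_0^\infty|\varphi(t)|^2dt<\infty$. Problem (LQ)$^0$ (one-dimensional state and control): for $x\in\mathbb{R}$ and $u\in L^2_{\mathbb{F}}(\mathbb{R})$ let $X(\cdot)=X(\cdot;x,u(\cdot))$ solve $$dX(t)=[AX(t)+Bu(t)]dt+[CX(t)+Du(t)]dW(t),\ t\geq0,\qquad X(0)=x.$$ Let $\mathcal{U}_{ad}(x)=\{u(\cdot)\in L^2_{\mathbb{F}}(\mathbb{R}):\mathbb{E}\int_0^\infty|X(t;x,u(\cdot))|^2dt<\infty\}$ and $$J^0(x;u(\cdot))=\mathbb{E}\int_0^\infty\big[QX(t)^2+2SX(t)u(t)+Ru(t)^2\big]dt.$$ The problem is, given $x$, to minimize $J^0(x;\cdot)$ over $\mathcal{U}_{ad}(x)$. A number $\Theta\in\mathbb{R}$ is a stabilizer of $[A,C;B,D]$ if for every $x\in\mathbb{R}$ the solution of $dX=(A+B\Theta)X\,dt+(C+D\Theta)X\,dW$, $X(0)=x$, satisfies $\mathbb{E}\int_0^\infty|X(t)|^2dt<\infty$. (With $D=1$, existence of a stabilizer is equivalent to $\alpha>0$.) The problem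 is open-loop solvable if for every $x\in\mathbb{R}$ there is $u^*\in\mathcal{U}_{ad}(x)$ with $J^0(x;u^* )\leq J^0(x;u)$ for all $u\in\mathcal{U}_{ad}(x)$. A closed-loop optimal strategy is a pair $(\Theta^*,v^*(\cdot))\in\mathbb{R}\times L^2_{\mathbb{F}}(\mathbb{R})$ with $\Theta^*$ a stabilizer of $[A,C;B,D]$ and $J^0(x;\Theta^*X^*+v^* )\leq J^0(x;u)$ for all $x\in\mathbb{R}$, $u\in\mathcal{U}_{ad}(x)$, where $X^*$ solves $dX^*=[(A+B\Theta^* )X^*+Bv^*]dt+[(C+D\Theta^* )X^*+Dv^*]dW$, $X^*(0)=x$. The problem is closed-loop solvable if a closed-loop optimal strategy exists. "Solvable" may be read as open-loop solvable or as closed-loop solvable (the two notions are equivalent when a stabilizer exists, as is the case here). *)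

theory Defs
  imports "HOL-Probability.Probability"
begin

text \<open>
  Processes are functions \<open>\<phi> t \<omega>\<close> with time in \<open>real\<close>; only the values for \<open>t \<ge> 0\<close> matter, and every
  definition below is restricted to these.
\<close>

section \<open>Brownian motion, its augmented filtration, square integrable processes\<close>

definition brownian_motion :: "'a measure \<Rightarrow> (real \<Rightarrow> 'a \<Rightarrow> real) \<Rightarrow> bool" where
  "brownian_motion M W \<longleftrightarrow>
     (\<forall>t\<ge>0. W t \<in> borel_measurable M) \<and>
     (AE \<omega> in M. W 0 \<omega> = 0) \<and>
     (AE \<omega> in M. continuous_on {0..} (\<lambda>t. W t \<omega>)) \<and>
     (\<forall>s t. 0 \<le> s \<and> s < t \<longrightarrow>
        distributed M lborel (\<lambda>\<omega>. W t \<omega> - W s \<omega>) (normal_density 0 (sqrt (t - s)))) \<and>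
     (\<forall>(n::nat) \<tau>. 0 \<le> \<tau> 0 \<and> (\<forall>i<n. \<tau> i < \<tau> (Suc i)) \<longrightarrow>
        prob_space.indep_vars M (\<lambda>_. borel) (\<lambda>i \<omega>. W (\<tau> (Suc i)) \<omega> - W (\<tau> i) \<omega>) {..<n})"

definition aug_filtration :: "'a measure \<Rightarrow> (real \<Rightarrow> 'a \<Rightarrow> real) \<Rightarrow> real \<Rightarrow> 'a measure" where
  "aug_filtration M W t =
     sigma (space M)
       ({W s -` E \<inter> space M | s E. 0 \<le> s \<and> s \<le> t \<and> E \<in> sets borel} \<union> null_sets M)"

lemma filtration_aug_filtration: "filtration (space M) (aug_filtration M W)"
proof
  fix s t :: real
  have gen: "{W r -` E \<inter> space M | r E. 0 \<le> r \<and> r \<le> t' \<and> E \<in> sets borel} \<union> null_sets M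
      \<subseteq> Pow (space M)" for t'
    using sets.sets_into_space[of _ M] by (auto simp: null_sets_def)
  show "space (aug_filtration M W t) = space M"
    unfolding aug_filtration_def by (rule space_measure_of[OF gen])
  assume "s \<le> t"
  then show "sets (aug_filtration M W s) \<subseteq> sets (aug_filtration M W t)"
    unfolding aug_filtration_def sets_measure_of[OF gen]
    by (intro sigma_sets_mono') (auto intro: order_trans)
qed

definition prog_measurable :: "(real \<Rightarrow> 'a measure) \<Rightarrow> (real \<Rightarrow> 'a \<Rightarrow> real) \<Rightarrow> bool" where
  "prog_measurable F \<phi> \<longleftrightarrow>
     (\<forall>T\<ge>0. (\<lambda>(t, \<omega>). \<phi> t \<omega>) \<in> borel_measurable (restrict_space borel {0..T} \<Otimes>\<^sub>M F T))"

definition sq_norm_on :: "'a measure \<Rightarrow> real set \<Rightarrow> (real \<Rightarrow> 'a \<Rightarrow> real) \<Rightarrow> ennreal" where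
  "sq_norm_on M I \<phi> = (\<integral>\<^sup>+\<omega>. (\<integral>\<^sup>+t\<in>I. ennreal ((\<phi> t \<omega>)\<^sup>2) \<partial>lborel) \<partial>M)"

definition L2F :: "'a measure \<Rightarrow> (real \<Rightarrow> 'a \<Rightarrow> real) \<Rightarrow> (real \<Rightarrow> 'a \<Rightarrow> real) set" where
  "L2F M W = {\<phi>. prog_measurable (aug_filtration M W) \<phi> \<and> sq_norm_on M {0..} \<phi> < \<infinity>}"

text \<open>Equality of processes as elements of the \<open>L\<^sup>2\<close> space above.\<close>

definition proc_eq :: "'a measure \<Rightarrow> (real \<Rightarrow> 'a \<Rightarrow> real) \<Rightarrow> (real \<Rightarrow> 'a \<Rightarrow> real) \<Rightarrow> bool" where
  "proc_eq M \<phi> \<psi> \<longleftrightarrow> (AE \<omega> in M. AE t in lborel. 0 \<le> t \<longrightarrow> \<phi> t \<omega> = \<psi> t \<omega>)"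


section \<open>The Ito integral\<close>

text \<open>
  The triple \<open>n\<close>, \<open>\<tau>\<close>, \<open>\<xi>\<close> represents the simple process
  \<open>\<Sum>i<n. \<xi> i * 1\<^bsub>(\<tau> i, \<tau> (i+1)]\<^esub>\<close>.
\<close>

definition simple_integrand ::
  "'a measure \<Rightarrow> (real \<Rightarrow> 'a measure) \<Rightarrow> nat \<Rightarrow> (nat \<Rightarrow> real) \<Rightarrow> (nat \<Rightarrow> 'a \<Rightarrow> real) \<Rightarrow> bool" where
  "simple_integrand M F n \<tau> \<xi> \<longleftrightarrow>
     0 \<le> \<tau> 0 \<and>
     (\<forall>i<n. \<tau> i \<le> \<tau> (Suc i) \<and> \<xi> i \<in> borel_measurable (F (\<tau> i)) \<and> bounded (\<xi> i ` space M))"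

definition simple_process ::
  "nat \<Rightarrow> (nat \<Rightarrow> real) \<Rightarrow> (nat \<Rightarrow> 'a \<Rightarrow> real) \<Rightarrow> real \<Rightarrow> 'a \<Rightarrow> real" where
  "simple_process n \<tau> \<xi> t \<omega> = (\<Sum>i<n. \<xi> i \<omega> * indicator {\<tau> i<..\<tau> (Suc i)} t)"

definition simple_ito ::
  "(real \<Rightarrow> 'a \<Rightarrow> real) \<Rightarrow> nat \<Rightarrow> (nat \<Rightarrow> real) \<Rightarrow> (nat \<Rightarrow> 'a \<Rightarrow> real) \<Rightarrow> real \<Rightarrow> 'a \<Rightarrow> real" where
  "simple_ito W n \<tau> \<xi> t \<omega> =
     (\<Sum>i<n. \<xi> i \<omega> * (W (min t (\<tau> (Suc i))) \<omega> - W (min t (\<tau> i)) \<omega>))"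

text \<open>
  \<open>has_ito_integral M W \<phi> t Y\<close> says that \<open>Y\<close> is (a version of) the integral of \<open>\<phi>\<close> against
  \<open>W\<close> over \<open>[0, t]\<close>, for progressively measurable \<open>\<phi>\<close> that are square integrable on
  \<open>[0, t] \<times> \<Omega>\<close>: the mean square limit of the integrals of simple processes that converge
  to \<open>\<phi>\<close> in mean square.
\<close>

definition has_ito_integral ::
  "'a measure \<Rightarrow> (real \<Rightarrow> 'a \<Rightarrow> real) \<Rightarrow> (real \<Rightarrow> 'a \<Rightarrow> real) \<Rightarrow> real \<Rightarrow> ('a \<Rightarrow> real) \<Rightarrow> bool" where
  "has_ito_integral M W \<phi> t Y \<longleftrightarrow>
     prog_measurable (aug_filtration M W) \<phi> \<and> sq_norm_on M {0..t} \<phi> < \<infinity> \<and>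
     Y \<in> borel_measurable M \<and>
     (\<exists>n \<tau> \<xi>.
        (\<forall>k::nat. simple_integrand M (aug_filtration M W) (n k) (\<tau> k) (\<xi> k)) \<and>
        (\<lambda>k. sq_norm_on M {0..t} (\<lambda>s \<omega>. simple_process (n k) (\<tau> k) (\<xi> k) s \<omega> - \<phi> s \<omega>))
          \<longlonglongrightarrow> 0 \<and>
        (\<lambda>k. \<integral>\<^sup>+\<omega>. ennreal ((simple_ito W (n k) (\<tau> k) (\<xi> k) t \<omega> - Y \<omega>)\<^sup>2) \<partial>M)
          \<longlonglongrightarrow> 0)"


section \<open>The controlled linear equation\<close>

text \<open>
  \<open>X\<close> solves \<open>dX = (A X + B u) dt + (C X + D u) dW\<close>, \<open>X 0 = x\<close>: a continuous, progressively
  measurable process, with \<open>E \<integral>\<^sub>0\<^sup>T |X|\<^sup>2 dt < \<infinity>\<close> for every finite \<open>T\<close> so that the stochastic integral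
  is the one above.  For \<open>u\<close> in \<open>L2F M W\<close> there is such a process, and it is unique up to
  indistinguishability.
\<close>

definition solves_lsde ::
  "'a measure \<Rightarrow> (real \<Rightarrow> 'a \<Rightarrow> real) \<Rightarrow> real \<Rightarrow> real \<Rightarrow> real \<Rightarrow> real \<Rightarrow> real \<Rightarrow>
   (real \<Rightarrow> 'a \<Rightarrow> real) \<Rightarrow> (real \<Rightarrow> 'a \<Rightarrow> real) \<Rightarrow> bool" where
  "solves_lsde M W A B C D x u X \<longleftrightarrow>
     prog_measurable (aug_filtration M W) X \<and>
     (AE \<omega> in M. continuous_on {0..} (\<lambda>t. X t \<omega>)) \<and>
     (\<forall>T\<ge>0. sq_norm_on M {0..T} X < \<infinity>) \<and>
     (\<exists>I. \<forall>t\<ge>0.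
        has_ito_integral M W (\<lambda>s \<omega>. C * X s \<omega> + D * u s \<omega>) t (I t) \<and>
        (AE \<omega> in M. X t \<omega> = x + (LINT s:{0..t}|lborel. A * X s \<omega> + B * u s \<omega>) + I t \<omega>))"

definition lsde_sol ::
  "'a measure \<Rightarrow> (real \<Rightarrow> 'a \<Rightarrow> real) \<Rightarrow> real \<Rightarrow> real \<Rightarrow> real \<Rightarrow> real \<Rightarrow> real \<Rightarrow>
   (real \<Rightarrow> 'a \<Rightarrow> real) \<Rightarrow> real \<Rightarrow> 'a \<Rightarrow> real" where
  "lsde_sol M W A B C D x u = (SOME X. solves_lsde M W A B C D x u X)"


section \<open>The linear-quadratic problem\<close>

definition Uad ::
  "'a measure \<Rightarrow> (real \<Rightarrow> 'a \<Rightarrow> real) \<Rightarrow> real \<Rightarrow> real \<Rightarrow> real \<Rightarrow> real \<Rightarrow> real \<Rightarrow>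
   (real \<Rightarrow> 'a \<Rightarrow> real) set" where
  "Uad M W A B C D x = {u \<in> L2F M W. sq_norm_on M {0..} (lsde_sol M W A B C D x u) < \<infinity>}"

text \<open>Meaningful for \<open>u\<close> in \<open>Uad M W A B C D x\<close>, where the integrand is integrable.\<close>

definition cost ::
  "'a measure \<Rightarrow> (real \<Rightarrow> 'a \<Rightarrow> real) \<Rightarrow> real \<Rightarrow> real \<Rightarrow> real \<Rightarrow> real \<Rightarrow> real \<Rightarrow> real \<Rightarrow> real \<Rightarrow>
   real \<Rightarrow> (real \<Rightarrow> 'a \<Rightarrow> real) \<Rightarrow> real" where
  "cost M W A B C D Q S R x u =
     (let X = lsde_sol M W A B C D x u in
      LINT \<omega>|M. (LINT t:{0..}|lborel.
        Q * (X t \<omega>)\<^sup>2 + 2 * S * X t \<omega> * u t \<omega> + R * (u t \<omega>)\<^sup>2))"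

definition stabilizer ::
  "'a measure \<Rightarrow> (real \<Rightarrow> 'a \<Rightarrow> real) \<Rightarrow> real \<Rightarrow> real \<Rightarrow> real \<Rightarrow> real \<Rightarrow> real \<Rightarrow> bool" where
  "stabilizer M W A B C D \<Theta> \<longleftrightarrow>
     (\<forall>x. sq_norm_on M {0..}
        (lsde_sol M W (A + B * \<Theta>) 0 (C + D * \<Theta>) 0 x (\<lambda>_ _. 0)) < \<infinity>)"

definition open_loop_solvable ::
  "'a measure \<Rightarrow> (real \<Rightarrow> 'a \<Rightarrow> real) \<Rightarrow> real \<Rightarrow> real \<Rightarrow> real \<Rightarrow> real \<Rightarrow> real \<Rightarrow> real \<Rightarrow> real \<Rightarrow> bool" where
  "open_loop_solvable M W A B C D Q S R \<longleftrightarrow>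
     (\<forall>x. \<exists>u' \<in> Uad M W A B C D x. \<forall>u \<in> Uad M W A B C D x.
        cost M W A B C D Q S R x u' \<le> cost M W A B C D Q S R x u)"

definition closed_loop_optimal ::
  "'a measure \<Rightarrow> (real \<Rightarrow> 'a \<Rightarrow> real) \<Rightarrow> real \<Rightarrow> real \<Rightarrow> real \<Rightarrow> real \<Rightarrow> real \<Rightarrow> real \<Rightarrow> real \<Rightarrow>
   real \<Rightarrow> (real \<Rightarrow> 'a \<Rightarrow> real) \<Rightarrow> bool" where
  "closed_loop_optimal M W A B C D Q S R \<Theta> v \<longleftrightarrow>
     stabilizer M W A B C D \<Theta> \<and> v \<in> L2F M W \<and>
     (\<forall>x. \<forall>u \<in> Uad M W A B C D x.
        (let X = lsde_sol M W (A + B * \<Theta>) B (C + D * \<Theta>) D x v in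
         cost M W A B C D Q S R x (\<lambda>t \<omega>. \<Theta> * X t \<omega> + v t \<omega>)
           \<le> cost M W A B C D Q S R x u))"

definition closed_loop_solvable ::
  "'a measure \<Rightarrow> (real \<Rightarrow> 'a \<Rightarrow> real) \<Rightarrow> real \<Rightarrow> real \<Rightarrow> real \<Rightarrow> real \<Rightarrow> real \<Rightarrow> real \<Rightarrow> real \<Rightarrow> bool" where
  "closed_loop_solvable M W A B C D Q S R \<longleftrightarrow>
     (\<exists>\<Theta> v. closed_loop_optimal M W A B C D Q S R \<Theta> v)"

end

theory Submission
  imports Defs
begin

text \<open>
  Write \<open>k = B + C\<close>, \<open>w = u + k X\<close> and \<open>c = k R - S\<close>. The energy identity
  \<open>E X(T)\<^sup>2 = x\<^sup>2 + E \<integral>\<^sub>0\<^sup>T (w\<^sup>2 - \<alpha> X\<^sup>2) dt\<close> gives \<open>\<alpha> \<parallel>X\<parallel>\<^sup>2 = x\<^sup>2 + \<parallel>w\<parallel>\<^sup>2\<close> for an admissible control, and then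
  \<open>J(x; u) = \<beta> \<parallel>X\<parallel>\<^sup>2 - 2 c \<langle>X, w\<rangle> - R x\<^sup>2\<close>. If \<open>\<beta> = c = 0\<close>, the cost does not depend on the control.
  If \<open>\<beta> > 2 \<bar>c\<bar> \<surd>\<alpha>\<close>, let \<open>p\<close> be the larger root of \<open>\<alpha> p\<^sup>2 - \<beta> p + c\<^sup>2\<close>; completing the square,
  \<open>J(x; u) = (p - R) x\<^sup>2 + p \<parallel>w - (c / p) X\<parallel>\<^sup>2\<close>, so exactly the feedback \<open>w = (c / p) X\<close> is optimal.
  Otherwise the feedbacks \<open>w = \<theta> X\<close> with \<open>\<theta> \<rightarrow> \<plusminus>\<surd>\<alpha>\<close> undercut every admissible control.

  The energy identity needs no Ito formula: with \<open>X = x + G + I\<close>, where \<open>G\<close> is the integral of the drift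
  \<open>b\<close> and \<open>I\<close> the stochastic integral, \<open>E X\<^sup>2\<close> is expanded using \<open>G(T)\<^sup>2 = 2 \<integral>\<^sub>0\<^sup>T b G dt\<close>, the Ito isometry and
  \<open>E (b(t) I(T)) = E (b(t) I(t))\<close>.
\<close>

section \<open>Square integrable functions\<close>

text \<open>The state is a chosen solution and the stochastic integral is a bare mean square limit
  of simple integrals, so nothing about \<open>lsde_sol\<close> can be used before existence and
  uniqueness have been derived from the Brownian motion itself; most of the development is this
  construction. Uniqueness is needed only up to null sets of the product of time and probability,
  because admissibility and cost see the state through time integrals alone.

  The choice of \<open>w\<close> comes from \<open>D = 1\<close>: then
  \<open>2 (A X + B u) X + (C X + u)^2 = (u + k X)^2 - \<alpha> X^2\<close>, so one number \<alpha>
  governs the second moment. The quadratic in \<open>p\<close> is the algebraic Riccati equation for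
  \<open>P\<close> in the variable \<open>p = R + P\<close>. It has a positive root whose feedback
  \<open>c / p\<close> lies inside \<open>(- sqrt \<alpha>, sqrt \<alpha>)\<close> exactly when
  \<beta> > 2 |c| sqrt \<alpha>. The delicate point of necessity is the boundary case \<beta> = 2
  |c| sqrt \<alpha> with \<open>c \<noteq> 0\<close>: the cost is bounded below there, and one has
  to show that its infimum is not attained.\<close>

definition sqint :: "'b measure \<Rightarrow> ('b \<Rightarrow> real) \<Rightarrow> bool" where
  "sqint \<mu> f \<longleftrightarrow> f \<in> borel_measurable \<mu> \<and> integrable \<mu> (\<lambda>x. (f x)\<^sup>2)"

lemma sqint_measurable: "sqint \<mu> f \<Longrightarrow> f \<in> borel_measurable \<mu>"
  by (simp add: sqint_def)

lemma sqint_integrable_sq: "sqint \<mu> f \<Longrightarrow> integrable \<mu> (\<lambda>x. (f x)\<^sup>2)"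
  by (simp add: sqint_def)

lemma sqint_mult:
  assumes "sqint \<mu> f" "sqint \<mu> g"
  shows "integrable \<mu> (\<lambda>x. f x * g x)"
proof (rule Bochner_Integration.integrable_bound[where f="\<lambda>x. (f x)\<^sup>2 + (g x)\<^sup>2"])
  show "AE x in \<mu>. norm (f x * g x) \<le> norm ((f x)\<^sup>2 + (g x)\<^sup>2)"
  proof (rule AE_I2)
    fix x
    have "2 * (\<bar>f x\<bar> * \<bar>g x\<bar>) \<le> (f x)\<^sup>2 + (g x)\<^sup>2"
      using sum_squares_bound[of "\<bar>f x\<bar>" "\<bar>g x\<bar>"] by simp
    moreover have "0 \<le> \<bar>f x\<bar> * \<bar>g x\<bar>" by simp
    ultimately have "\<bar>f x\<bar> * \<bar>g x\<bar> \<le> (f x)\<^sup>2 + (g x)\<^sup>2" by linarith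
    then show "norm (f x * g x) \<le> norm ((f x)\<^sup>2 + (g x)\<^sup>2)"
      by (simp add: abs_mult)
  qed
qed (use assms in \<open>auto simp: sqint_def\<close>)

lemma sqint_add:
  assumes "sqint \<mu> f" "sqint \<mu> g"
  shows "sqint \<mu> (\<lambda>x. f x + g x)"
proof -
  have "integrable \<mu> (\<lambda>x. (f x)\<^sup>2 + (g x)\<^sup>2 + 2 * (f x * g x))"
    using assms sqint_mult[OF assms] by (auto simp: sqint_def)
  then show ?thesis
    using assms by (auto simp: sqint_def power2_sum mult.assoc)
qed

lemma sqint_cmult: "sqint \<mu> f \<Longrightarrow> sqint \<mu> (\<lambda>x. c * f x)"
  by (auto simp: sqint_def power_mult_distrib)

lemma sqint_diff: "sqint \<mu> f \<Longrightarrow> sqint \<mu> g \<Longrightarrow> sqint \<mu> (\<lambda>x. f x - g x)"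
  using sqint_add[of \<mu> f "\<lambda>x. (-1) * g x"] sqint_cmult[of \<mu> g "-1"] by simp

lemma sqint_zero [simp]: "sqint \<mu> (\<lambda>_. 0)"
  by (simp add: sqint_def)

lemma sqint_iff_nn:
  assumes "f \<in> borel_measurable \<mu>"
  shows "sqint \<mu> f \<longleftrightarrow> (\<integral>\<^sup>+x. ennreal ((f x)\<^sup>2) \<partial>\<mu>) < \<infinity>"
  using assms by (auto simp: sqint_def integrable_iff_bounded)

lemma nn_sqint:
  assumes "sqint \<mu> f"
  shows "(\<integral>\<^sup>+x. ennreal ((f x)\<^sup>2) \<partial>\<mu>) = ennreal (\<integral>x. (f x)\<^sup>2 \<partial>\<mu>)"
  using assms by (intro nn_integral_eq_integral) (auto simp: sqint_def)

lemma sqint_bounded: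
  assumes "finite_measure \<mu>" "f \<in> borel_measurable \<mu>" "\<And>x. x \<in> space \<mu> \<Longrightarrow> \<bar>f x\<bar> \<le> K"
  shows "sqint \<mu> f"
proof -
  interpret finite_measure \<mu> by fact
  have "\<bar>(f x)\<^sup>2\<bar> \<le> K\<^sup>2" if "x \<in> space \<mu>" for x
    using assms(3)[OF that] by (simp add: abs_le_square_iff[symmetric])
  then have "integrable \<mu> (\<lambda>x. (f x)\<^sup>2)"
    using assms(2) by (intro integrable_const_bound[where B="K\<^sup>2"]) auto
  then show ?thesis using assms(2) by (simp add: sqint_def)
qed

lemma sqint_bounded_mult:
  assumes "sqint \<mu> g" "f \<in> borel_measurable \<mu>" "\<And>x. x \<in> space \<mu> \<Longrightarrow> \<bar>f x\<bar> \<le> K"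
  shows "sqint \<mu> (\<lambda>x. f x * g x)"
proof -
  have "integrable \<mu> (\<lambda>x. (f x * g x)\<^sup>2)"
  proof (rule Bochner_Integration.integrable_bound[where f="\<lambda>x. K\<^sup>2 * (g x)\<^sup>2"])
    show "AE x in \<mu>. norm ((f x * g x)\<^sup>2) \<le> norm (K\<^sup>2 * (g x)\<^sup>2)"
    proof (rule AE_I2)
      fix x assume "x \<in> space \<mu>"
      then have "(f x)\<^sup>2 \<le> K\<^sup>2"
        using assms(3)[of x] by (simp add: abs_le_square_iff[symmetric])
      then show "norm ((f x * g x)\<^sup>2) \<le> norm (K\<^sup>2 * (g x)\<^sup>2)"
        by (simp add: power_mult_distrib mult_right_mono)
    qed
  qed (use assms in \<open>auto simp: sqint_def\<close>)
  then show ?thesis using assms by (auto simp: sqint_def)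
qed

lemma sqint_integrable:
  assumes "finite_measure \<mu>" "sqint \<mu> f"
  shows "integrable \<mu> f"
  using sqint_mult[OF assms(2), of "\<lambda>_. 1"] sqint_bounded[OF assms(1), of "\<lambda>_. 1" 1] by simp

lemma sqint_cong_AE:
  assumes "sqint \<mu> f" "g \<in> borel_measurable \<mu>" "AE x in \<mu>. f x = g x"
  shows "sqint \<mu> g"
proof -
  have "integrable \<mu> (\<lambda>x. (g x)\<^sup>2)"
    by (rule Bochner_Integration.integrable_cong_AE_imp[OF sqint_integrable_sq[OF assms(1)]])
       (use assms in auto)
  then show ?thesis using assms by (simp add: sqint_def)
qed

text \<open>A nonnegative quadratic in \<open>t\<close> cannot change sign. The degenerate case
  \<open>c = 0\<close> is kept because Cauchy-Schwarz must also cover null functions.\<close>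

lemma discriminant_bound:
  fixes a b c :: real
  assumes nn: "\<And>t. 0 \<le> a + 2 * t * b + t\<^sup>2 * c" and c: "c \<ge> 0"
  shows "b\<^sup>2 \<le> a * c"
proof (cases "c = 0")
  case True
  have "b = 0"
  proof (rule ccontr)
    assume "b \<noteq> 0"
    \<comment> \<open>With \<open>c = 0\<close> this \<open>t\<close> gives the polynomial the value
      -1.\<close>
    then show False
      using nn[of "- (a + 1) / (2 * b)"] True nn[of 0] by (simp add: field_simps)
  qed
  then show ?thesis using True by simp
next
  case False
  with c have "c > 0" by simp
  then show ?thesis
    using nn[of "- b / c"] by (simp add: field_simps power2_eq_square)
qed

lemma integral_sq_add:
  assumes "sqint \<mu> f" "sqint \<mu> g"
  shows "(\<integral>x. (f x + g x)\<^sup>2 \<partial>\<mu>) =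
    (\<integral>x. (f x)\<^sup>2 \<partial>\<mu>) + 2 * (\<integral>x. f x * g x \<partial>\<mu>) + (\<integral>x. (g x)\<^sup>2 \<partial>\<mu>)"
proof -
  have "(\<integral>x. (f x + g x)\<^sup>2 \<partial>\<mu>) = (\<integral>x. (f x)\<^sup>2 + 2 * (f x * g x) + (g x)\<^sup>2 \<partial>\<mu>)"
    by (intro Bochner_Integration.integral_cong) (auto simp: power2_sum)
  then show ?thesis
    using assms sqint_mult[OF assms] by (simp add: sqint_def)
qed

lemma Cauchy_Schwarz_integral:
  assumes "sqint \<mu> f" "sqint \<mu> g"
  shows "(\<integral>x. f x * g x \<partial>\<mu>)\<^sup>2 \<le> (\<integral>x. (f x)\<^sup>2 \<partial>\<mu>) * (\<integral>x. (g x)\<^sup>2 \<partial>\<mu>)"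
proof (rule discriminant_bound)
  fix t :: real
  have "0 \<le> (\<integral>x. (f x + t * g x)\<^sup>2 \<partial>\<mu>)" by simp
  also have "\<dots> = (\<integral>x. (f x)\<^sup>2 \<partial>\<mu>) + 2 * t * (\<integral>x. f x * g x \<partial>\<mu>) + t\<^sup>2 * (\<integral>x. (g x)\<^sup>2 \<partial>\<mu>)"
    using integral_sq_add[OF assms(1) sqint_cmult[OF assms(2)], of t]
    by (simp add: power_mult_distrib mult.left_commute[of _ t] mult.assoc)
  finally show "0 \<le> (\<integral>x. (f x)\<^sup>2 \<partial>\<mu>) + 2 * t * (\<integral>x. f x * g x \<partial>\<mu>) + t\<^sup>2 * (\<integral>x. (g x)\<^sup>2 \<partial>\<mu>)" .
qed simp

lemma Cauchy_Schwarz_integral_sqrt: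
  assumes "sqint \<mu> f" "sqint \<mu> g"
  shows "\<bar>\<integral>x. f x * g x \<partial>\<mu>\<bar> \<le> sqrt (\<integral>x. (f x)\<^sup>2 \<partial>\<mu>) * sqrt (\<integral>x. (g x)\<^sup>2 \<partial>\<mu>)"
  using Cauchy_Schwarz_integral[OF assms] by (metis real_sqrt_abs real_sqrt_le_mono real_sqrt_mult)

text \<open>Square integrability is demanded separately because the integral of a non-integrable
  function is 0, so that the last condition alone could hold for unrelated functions.\<close>

definition L2conv :: "'b measure \<Rightarrow> (nat \<Rightarrow> 'b \<Rightarrow> real) \<Rightarrow> ('b \<Rightarrow> real) \<Rightarrow> bool" where
  "L2conv \<mu> f g \<longleftrightarrow> (\<forall>k. sqint \<mu> (f k)) \<and> sqint \<mu> g \<and>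
     (\<lambda>k. \<integral>x. (f k x - g x)\<^sup>2 \<partial>\<mu>) \<longlonglongrightarrow> 0"

text \<open>The product differs from the limit product by one error term of second order and two of
  first order, and Cauchy-Schwarz sends each of them to 0. Identities for elementary integrals reach
  general integrands through this lemma.\<close>

lemma L2conv_inner:
  assumes "L2conv \<mu> f f'" "L2conv \<mu> g g'"
  shows "(\<lambda>k. \<integral>x. f k x * g k x \<partial>\<mu>) \<longlonglongrightarrow> (\<integral>x. f' x * g' x \<partial>\<mu>)"
proof -
  have sq: "sqint \<mu> (f k)" "sqint \<mu> (g k)" "sqint \<mu> f'" "sqint \<mu> g'" for k
    using assms by (auto simp: L2conv_def)
  note D = sqint_diff[OF sq(1,3)] sqint_diff[OF sq(2,4)]
  let ?a = "\<lambda>k. \<integral>x. (f k x - f' x)\<^sup>2 \<partial>\<mu>" and ?b = "\<lambda>k. \<integral>x. (g k x - g' x)\<^sup>2 \<partial>\<mu>"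
  have a: "?a \<longlonglongrightarrow> 0" and b: "?b \<longlonglongrightarrow> 0" using assms by (auto simp: L2conv_def)
  have sa: "(\<lambda>k. sqrt (?a k)) \<longlonglongrightarrow> 0" and sb: "(\<lambda>k. sqrt (?b k)) \<longlonglongrightarrow> 0"
    using tendsto_real_sqrt[OF a] tendsto_real_sqrt[OF b] by simp_all
  have eq: "(\<integral>x. f k x * g k x \<partial>\<mu>) = (\<integral>x. f' x * g' x \<partial>\<mu>) +
      (\<integral>x. (f k x - f' x) * (g k x - g' x) \<partial>\<mu>) + (\<integral>x. (f k x - f' x) * g' x \<partial>\<mu>)
      + (\<integral>x. f' x * (g k x - g' x) \<partial>\<mu>)" for k
  proof -
    have "(\<integral>x. f k x * g k x \<partial>\<mu>) = (\<integral>x. f' x * g' x + (f k x - f' x) * (g k x - g' x)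
        + (f k x - f' x) * g' x + f' x * (g k x - g' x) \<partial>\<mu>)"
      by (intro Bochner_Integration.integral_cong) (auto simp: algebra_simps)
    then show ?thesis
      using sqint_mult[OF sq(3,4)] sqint_mult[OF D(1)[of k] D(2)[of k]] sqint_mult[OF D(1)[of k] sq(4)]
        sqint_mult[OF sq(3) D(2)[of k]]
      by simp
  qed
  have t1: "(\<lambda>k. \<integral>x. (f k x - f' x) * (g k x - g' x) \<partial>\<mu>) \<longlonglongrightarrow> 0"
    by (rule Lim_null_comparison[where g="\<lambda>k. sqrt (?a k) * sqrt (?b k)"])
       (use Cauchy_Schwarz_integral_sqrt[OF D] tendsto_mult[OF sa sb] in auto)
  have t2: "(\<lambda>k. \<integral>x. (f k x - f' x) * g' x \<partial>\<mu>) \<longlonglongrightarrow> 0"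
    by (rule Lim_null_comparison[where g="\<lambda>k. sqrt (?a k) * sqrt (\<integral>x. (g' x)\<^sup>2 \<partial>\<mu>)"])
       (use Cauchy_Schwarz_integral_sqrt[OF D(1) sq(4)] tendsto_mult_left_zero[OF sa] in auto)
  have t3: "(\<lambda>k. \<integral>x. f' x * (g k x - g' x) \<partial>\<mu>) \<longlonglongrightarrow> 0"
    by (rule Lim_null_comparison[where g="\<lambda>k. sqrt (\<integral>x. (f' x)\<^sup>2 \<partial>\<mu>) * sqrt (?b k)"])
       (use Cauchy_Schwarz_integral_sqrt[OF sq(3) D(2)] tendsto_mult_right_zero[OF sb] in auto)
  show ?thesis
    unfolding eq using tendsto_add[OF tendsto_add[OF tendsto_add[OF tendsto_const t1] t2] t3] by simp
qed

lemma L2conv_const: "sqint \<mu> g \<Longrightarrow> L2conv \<mu> (\<lambda>_. g) g"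
  by (simp add: L2conv_def)

lemma integral_sq_add_le:
  assumes "sqint \<mu> f" "sqint \<mu> g"
  shows "(\<integral>x. (f x + g x)\<^sup>2 \<partial>\<mu>) \<le> 2 * (\<integral>x. (f x)\<^sup>2 \<partial>\<mu>) + 2 * (\<integral>x. (g x)\<^sup>2 \<partial>\<mu>)"
proof -
  have "(\<integral>x. (f x + g x)\<^sup>2 \<partial>\<mu>) \<le> (\<integral>x. 2 * (f x)\<^sup>2 + 2 * (g x)\<^sup>2 \<partial>\<mu>)"
  proof (rule integral_mono)
    show "(f x + g x)\<^sup>2 \<le> 2 * (f x)\<^sup>2 + 2 * (g x)\<^sup>2" for x
      using sum_squares_bound[of "f x" "g x"] by (simp add: power2_sum)
  qed (use assms sqint_add[OF assms] in \<open>auto simp: sqint_def\<close>)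
  then show ?thesis using assms by (simp add: sqint_def)
qed

lemma L2conv_add:
  assumes "L2conv \<mu> f f'" "L2conv \<mu> g g'"
  shows "L2conv \<mu> (\<lambda>k x. f k x + g k x) (\<lambda>x. f' x + g' x)"
proof -
  have sq: "sqint \<mu> (f k)" "sqint \<mu> (g k)" "sqint \<mu> f'" "sqint \<mu> g'" for k
    using assms by (auto simp: L2conv_def)
  let ?a = "\<lambda>k. \<integral>x. (f k x - f' x)\<^sup>2 \<partial>\<mu>" and ?b = "\<lambda>k. \<integral>x. (g k x - g' x)\<^sup>2 \<partial>\<mu>"
  have ab: "(\<lambda>k. 2 * ?a k + 2 * ?b k) \<longlonglongrightarrow> 0"
    using assms tendsto_add[OF tendsto_mult_right_zero[of ?a _ 2] tendsto_mult_right_zero[of ?b _ 2]]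
    by (auto simp: L2conv_def)
  have "(\<lambda>k. \<integral>x. (f k x + g k x - (f' x + g' x))\<^sup>2 \<partial>\<mu>) \<longlonglongrightarrow> 0"
  proof (rule Lim_null_comparison[OF _ ab], rule always_eventually, rule allI)
    fix k
    have "(\<integral>x. (f k x + g k x - (f' x + g' x))\<^sup>2 \<partial>\<mu>)
       = (\<integral>x. ((f k x - f' x) + (g k x - g' x))\<^sup>2 \<partial>\<mu>)"
      by (simp add: algebra_simps)
    then show "norm (\<integral>x. (f k x + g k x - (f' x + g' x))\<^sup>2 \<partial>\<mu>) \<le> 2 * ?a k + 2 * ?b k"
      using integral_sq_add_le[OF sqint_diff[OF sq(1,3)] sqint_diff[OF sq(2,4)], of k k] by simp
  qed
  then show ?thesis using sq by (auto simp: L2conv_def intro!: sqint_add)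
qed

lemma L2conv_cmult:
  assumes "L2conv \<mu> f f'"
  shows "L2conv \<mu> (\<lambda>k x. c * f k x) (\<lambda>x. c * f' x)"
proof -
  have "(\<integral>x. (c * f k x - c * f' x)\<^sup>2 \<partial>\<mu>) = c\<^sup>2 * (\<integral>x. (f k x - f' x)\<^sup>2 \<partial>\<mu>)" for k
    by (simp add: right_diff_distrib[symmetric] power_mult_distrib)
  then show ?thesis
    using assms by (auto simp: L2conv_def intro!: sqint_cmult tendsto_mult_right_zero)
qed

lemma L2conv_diff:
  assumes "L2conv \<mu> f f'" "L2conv \<mu> g g'"
  shows "L2conv \<mu> (\<lambda>k x. f k x - g k x) (\<lambda>x. f' x - g' x)"
  using L2conv_add[OF assms(1) L2conv_cmult[OF assms(2), of "-1"]] by simp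

lemma L2conv_nn:
  assumes "\<And>k. f k \<in> borel_measurable \<mu>" "sqint \<mu> g"
  and "(\<lambda>k. \<integral>\<^sup>+x. ennreal ((f k x - g x)\<^sup>2) \<partial>\<mu>) \<longlonglongrightarrow> 0" "\<And>k. sqint \<mu> (f k)"
  shows "L2conv \<mu> f g"
proof -
  have "(\<lambda>k. ennreal (\<integral>x. (f k x - g x)\<^sup>2 \<partial>\<mu>)) \<longlonglongrightarrow> ennreal 0"
    using assms(3) nn_sqint[OF sqint_diff[OF assms(4) assms(2)]] by simp
  then have "(\<lambda>k. \<integral>x. (f k x - g x)\<^sup>2 \<partial>\<mu>) \<longlonglongrightarrow> 0"
    by (subst (asm) tendsto_ennreal_iff) auto
  then show ?thesis using assms by (auto simp: L2conv_def)
qed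

lemma integral_sq_zero_AE:
  assumes "sqint \<mu> f" "(\<integral>x. (f x)\<^sup>2 \<partial>\<mu>) = 0"
  shows "AE x in \<mu>. f x = 0"
  using integral_nonneg_eq_0_iff_AE[OF sqint_integrable_sq[OF assms(1)]] assms(2) by auto

lemma measurable_ennreal_sq:
  "f \<in> borel_measurable \<mu> \<Longrightarrow> (\<lambda>p. ennreal ((f p)\<^sup>2)) \<in> borel_measurable \<mu>"
  by simp

lemma ennreal_sq_add_le: "ennreal ((a + b)\<^sup>2) \<le> 2 * ennreal (a\<^sup>2) + 2 * ennreal (b\<^sup>2)"
proof -
  have "(a + b)\<^sup>2 \<le> 2 * a\<^sup>2 + 2 * b\<^sup>2"
    using sum_squares_bound[of a b] by (simp add: power2_sum)
  then have "ennreal ((a + b)\<^sup>2) \<le> ennreal (2 * a\<^sup>2 + 2 * b\<^sup>2)" by (rule ennreal_leI)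
  then show ?thesis by (simp add: ennreal_plus ennreal_mult)
qed

lemma nn_sq_add_le:
  assumes "f \<in> borel_measurable \<mu>" "g \<in> borel_measurable \<mu>"
  shows "(\<integral>\<^sup>+x. ennreal ((f x + g x)\<^sup>2) \<partial>\<mu>) \<le>
    2 * (\<integral>\<^sup>+x. ennreal ((f x)\<^sup>2) \<partial>\<mu>) + 2 * (\<integral>\<^sup>+x. ennreal ((g x)\<^sup>2) \<partial>\<mu>)"
proof -
  have "(\<integral>\<^sup>+x. ennreal ((f x + g x)\<^sup>2) \<partial>\<mu>) \<le>
      (\<integral>\<^sup>+x. 2 * ennreal ((f x)\<^sup>2) + 2 * ennreal ((g x)\<^sup>2) \<partial>\<mu>)"
    by (intro nn_integral_mono ennreal_sq_add_le)
  then show ?thesis using assms by (simp add: nn_integral_add nn_integral_cmult)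
qed

section \<open>Increments of Brownian motion and the augmented filtration\<close>

text \<open>Supplies the increasing time grid that \<open>W_indep_increments\<close> asks
  for.\<close>

lemma finite_set_enumeration:
  fixes T :: "real set"
  assumes "finite T" "T \<noteq> {}"
  shows "\<exists>(\<tau> :: nat \<Rightarrow> real) k. T = \<tau> ` {..k} \<and> (\<forall>i j. i < j \<longrightarrow> j \<le> k \<longrightarrow> \<tau> i < \<tau> j)"
proof -
  let ?l = "sorted_list_of_set T"
  have len: "length ?l = card T" by simp
  have pos: "card T > 0" using assms by (simp add: card_gt_0_iff)
  have sl: "sorted_wrt (<) ?l" using strict_sorted_list_of_set by blast
  show ?thesis
  proof (intro exI[of _ "\<lambda>i. ?l ! i"] exI[of _ "card T - 1"] conjI allI impI)
    have "T = set ?l" using assms by simp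
    also have "\<dots> = (\<lambda>i. ?l ! i) ` {..<length ?l}"
      by (auto simp: set_conv_nth)
    also have "{..<length ?l} = {..card T - 1}" using pos len by auto
    finally show "T = (\<lambda>i. ?l ! i) ` {..card T - 1}" .
    show "?l ! i < ?l ! j" if "i < j" "j \<le> card T - 1" for i j
      using sorted_wrt_nth_less[OF sl that(1)] that pos len by simp
  qed
qed

locale brownian = prob_space M for M :: "'a measure" +
  fixes W :: "real \<Rightarrow> 'a \<Rightarrow> real"
  assumes brownian_motion: "brownian_motion M W"
begin

abbreviation F :: "real \<Rightarrow> 'a measure" where
  "F \<equiv> aug_filtration M W"

abbreviation F_gen :: "real \<Rightarrow> 'a set set" where
  "F_gen t \<equiv> {W s -` E \<inter> space M | s E. 0 \<le> s \<and> s \<le> t \<and> E \<in> sets borel} \<union> null_sets M"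

lemma F_gen_Pow: "F_gen t \<subseteq> Pow (space M)"
  using sets.sets_into_space[of _ M] by (auto simp: null_sets_def)

lemma W_measurable [measurable]: "0 \<le> t \<Longrightarrow> W t \<in> borel_measurable M"
  using brownian_motion by (simp add: brownian_motion_def)

lemma F_gen_events: "F_gen t \<subseteq> events"
  by (auto intro!: measurable_sets[OF W_measurable])

lemma space_F [simp]: "space (F t) = space M"
  unfolding aug_filtration_def by (rule space_measure_of[OF F_gen_Pow])

lemma sets_F: "sets (F t) = sigma_sets (space M) (F_gen t)"
  unfolding aug_filtration_def by (rule sets_measure_of[OF F_gen_Pow])

lemma sets_F_le: "sets (F t) \<subseteq> events"
  unfolding sets_F using F_gen_events by (intro sets.sigma_sets_subset) auto

lemma sets_F_mono: "s \<le> t \<Longrightarrow> sets (F s) \<subseteq> sets (F t)"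
  unfolding sets_F by (intro sigma_sets_mono') (auto intro: order_trans)

lemma null_sets_F: "N \<in> null_sets M \<Longrightarrow> N \<in> sets (F t)"
  unfolding sets_F by (intro sigma_sets.Basic) auto

lemma F_measurable_M: "f \<in> borel_measurable (F t) \<Longrightarrow> f \<in> borel_measurable M"
  using sets_F_le[of t] by (auto simp: measurable_def)

lemma F_measurable_mono: "f \<in> borel_measurable (F s) \<Longrightarrow> s \<le> t \<Longrightarrow> f \<in> borel_measurable (F t)"
  using sets_F_mono[of s t] by (auto simp: measurable_def)

lemma W_adapted: "0 \<le> s \<Longrightarrow> s \<le> t \<Longrightarrow> W s \<in> borel_measurable (F t)"
proof (rule measurableI)
  fix E :: "real set" assume "E \<in> sets borel" "0 \<le> s" "s \<le> t"
  then show "W s -` E \<inter> space (F t) \<in> sets (F t)"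
    unfolding sets_F space_F by (intro sigma_sets.Basic) auto
qed simp

lemma W_0: "AE \<omega> in M. W 0 \<omega> = 0"
  using brownian_motion by (simp add: brownian_motion_def)

lemma W_continuous_AE: "AE \<omega> in M. continuous_on {0..} (\<lambda>t. W t \<omega>)"
  using brownian_motion by (simp add: brownian_motion_def)

lemma W_normal: "0 \<le> s \<Longrightarrow> s < t \<Longrightarrow>
    distributed M lborel (\<lambda>\<omega>. W t \<omega> - W s \<omega>) (normal_density 0 (sqrt (t - s)))"
  using brownian_motion by (simp add: brownian_motion_def)

lemma W_indep_increments:
  "0 \<le> \<tau> 0 \<Longrightarrow> (\<And>i. i < n \<Longrightarrow> \<tau> i < \<tau> (Suc i)) \<Longrightarrow>
     indep_vars (\<lambda>_. borel) (\<lambda>i \<omega>. W (\<tau> (Suc i)) \<omega> - W (\<tau> i) \<omega>) {..<n::nat}"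
  using brownian_motion by (simp add: brownian_motion_def)

text \<open>
  The finite-dimensional events before time \<open>s\<close>, up to null sets: a generator of \<open>F s\<close> that is
  closed under intersections.
\<close>

definition cylinder :: "real \<Rightarrow> 'a set set" where
  "cylinder s = {A \<in> events. \<exists>J E. finite J \<and> J \<subseteq> {0..s} \<and> (\<forall>r\<in>J. E r \<in> sets borel) \<and>
     (AE \<omega> in M. \<omega> \<in> A \<longleftrightarrow> (\<forall>r\<in>J. W r \<omega> \<in> E r))}"

lemma cylinder_events: "cylinder s \<subseteq> events"
  by (auto simp: cylinder_def)

lemma Int_stable_cylinder: "Int_stable (cylinder s)"
proof (rule Int_stableI)
  fix A A' assume "A \<in> cylinder s" "A' \<in> cylinder s"
  then obtain J E J' E' where
    A: "A \<in> events" "finite J" "J \<subseteq> {0..s}" "\<forall>r\<in>J. E r \<in> sets borel"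
      "AE \<omega> in M. \<omega> \<in> A \<longleftrightarrow> (\<forall>r\<in>J. W r \<omega> \<in> E r)"
    and A': "A' \<in> events" "finite J'" "J' \<subseteq> {0..s}" "\<forall>r\<in>J'. E' r \<in> sets borel"
      "AE \<omega> in M. \<omega> \<in> A' \<longleftrightarrow> (\<forall>r\<in>J'. W r \<omega> \<in> E' r)"
    unfolding cylinder_def by blast
  let ?E = "\<lambda>r. (if r \<in> J then E r else UNIV) \<inter> (if r \<in> J' then E' r else UNIV)"
  have "AE \<omega> in M. \<omega> \<in> A \<inter> A' \<longleftrightarrow> (\<forall>r\<in>J \<union> J'. W r \<omega> \<in> ?E r)"
    using A(5) A'(5) by eventually_elim auto
  moreover have "\<forall>r\<in>J \<union> J'. ?E r \<in> sets borel"
    using A(4) A'(4) by auto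
  ultimately show "A \<inter> A' \<in> cylinder s"
    unfolding cylinder_def using A(1-3) A'(1-3) by (auto intro!: exI[of _ "J \<union> J'"] exI[of _ ?E])
qed

lemma F_gen_cylinder:
  assumes "0 \<le> s"
  shows "F_gen s \<subseteq> cylinder s"
proof
  fix A assume A: "A \<in> F_gen s"
  then have ev: "A \<in> events" using F_gen_events by blast
  from A show "A \<in> cylinder s"
  proof
    assume "A \<in> {W r -` E \<inter> space M | r E. 0 \<le> r \<and> r \<le> s \<and> E \<in> sets borel}"
    then obtain r E where r: "A = W r -` E \<inter> space M" "0 \<le> r" "r \<le> s" "E \<in> sets borel" by blast
    have "AE \<omega> in M. \<omega> \<in> A \<longleftrightarrow> (\<forall>q\<in>{r}. W q \<omega> \<in> (\<lambda>_. E) q)"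
      using r by (intro AE_I2) auto
    then show ?thesis using r ev unfolding cylinder_def
      by (intro CollectI conjI exI[of _ "{r}"] exI[of _ "\<lambda>_. E"]) auto
  next
    assume null: "A \<in> null_sets M"
    \<comment> \<open>Up to null sets, a null set is the impossible condition
      \<open>W 0 \<in> {}\<close>; time 0 is available because \<open>0 \<le> s\<close>.\<close>
    have "AE \<omega> in M. \<omega> \<in> A \<longleftrightarrow> (\<forall>q\<in>{0}. W q \<omega> \<in> (\<lambda>_. {}) q)"
      using AE_not_in[OF null] by eventually_elim simp
    then show ?thesis using ev assms unfolding cylinder_def
      by (intro CollectI conjI exI[of _ "{0}"] exI[of _ "\<lambda>_. {}"]) auto
  qed
qed

text \<open>As \<open>W 0 = 0\<close> almost surely, each \<open>W r\<close> with
  \<open>r \<in> J\<close> is a sum of increments over a grid that leads from 0 to \<open>s\<close>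
  through the points of \<open>J\<close>. So \<open>A\<close> is, up to a null set, an event of the
  increments before \<open>s\<close>, and \<open>B\<close> is an event of the single increment that
  follows.\<close>

lemma cylinder_indep_increment:
  assumes "0 \<le> s" "s < t" and A: "A \<in> cylinder s" and E0: "E0 \<in> sets borel"
  defines "B \<equiv> (\<lambda>\<omega>. W t \<omega> - W s \<omega>) -` E0 \<inter> space M"
  shows "prob (A \<inter> B) = prob A * prob B"
proof -
  obtain J E where J: "finite J" "J \<subseteq> {0..s}" and E: "\<forall>r\<in>J. E r \<in> sets borel"
    and Aev: "A \<in> events" and AE_A: "AE \<omega> in M. \<omega> \<in> A \<longleftrightarrow> (\<forall>r\<in>J. W r \<omega> \<in> E r)"
    using A unfolding cylinder_def by blast
  \<comment> \<open>0 is added so that \<open>W r\<close> telescopes down to \<open>W 0\<close>, and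
    \<open>s\<close> so that the grid ends where the new increment starts.\<close>
  define T where "T = insert 0 (insert s J)"
  have T: "finite T" "T \<noteq> {}" "T \<subseteq> {0..s}" "0 \<in> T" "s \<in> T"
    using J assms by (auto simp: T_def)
  obtain \<tau> :: "nat \<Rightarrow> real" and k where \<tau>': "T = \<tau> ` {..k} \<and> (\<forall>i j. i < j \<longrightarrow> j \<le> k \<longrightarrow> \<tau> i < \<tau> j)"
    using finite_set_enumeration[OF T(1,2)] by blast
  then have \<tau>: "T = \<tau> ` {..k}" "\<And>i j. i < j \<Longrightarrow> j \<le> k \<Longrightarrow> \<tau> i < \<tau> j"
    by auto
  have mono: "\<tau> i \<le> \<tau> j" if "i \<le> j" "j \<le> k" for i j
    using \<tau>(2)[of i j] that by (cases "i = j") auto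
  have \<tau>0: "\<tau> 0 = 0"
  proof -
    obtain j where "j \<le> k" "\<tau> j = 0" using T(4) \<tau>(1) by auto
    then have "\<tau> 0 \<le> 0" using mono[of 0 j] by simp
    moreover have "\<tau> 0 \<in> {0..s}" using T(3) \<tau>(1) by auto
    ultimately show ?thesis by simp
  qed
  have \<tau>k: "\<tau> k = s"
  proof -
    obtain j where "j \<le> k" "\<tau> j = s" using T(5) \<tau>(1) by auto
    then have "s \<le> \<tau> k" using mono[of j k] by simp
    moreover have "\<tau> k \<in> {0..s}" using T(3) \<tau>(1) by auto
    ultimately show ?thesis by simp
  qed
  define \<sigma> where "\<sigma> i = (if i \<le> k then \<tau> i else t)" for i
  define X where "X i \<omega> = W (\<sigma> (Suc i)) \<omega> - W (\<sigma> i) \<omega>" for i \<omega>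
  have "indep_vars (\<lambda>_. borel) X {..<Suc k}"
    unfolding X_def
  proof (rule W_indep_increments)
    show "0 \<le> \<sigma> 0" by (simp add: \<sigma>_def \<tau>0)
    show "\<sigma> i < \<sigma> (Suc i)" if "i < Suc k" for i
    proof (cases "i = k")
      case True then show ?thesis using \<tau>k assms by (simp add: \<sigma>_def)
    next
      case False then show ?thesis using that \<tau>(2)[of i "Suc i"] by (simp add: \<sigma>_def)
    qed
  qed
  then have ind: "indep_var (PiM {..<k} (\<lambda>_. borel)) (\<lambda>\<omega>. restrict (\<lambda>i. X i \<omega>) {..<k})
      (PiM {k} (\<lambda>_. borel)) (\<lambda>\<omega>. restrict (\<lambda>i. X i \<omega>) {k})"
    by (rule indep_var_restrict) auto
  have "\<exists>j\<le>k. \<tau> j = r" if "r \<in> J" for r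
  proof -
    have "r \<in> \<tau> ` {..k}" using that unfolding \<tau>(1)[symmetric] by (simp add: T_def)
    then show ?thesis by auto
  qed
  then obtain idx where idx: "\<And>r. r \<in> J \<Longrightarrow> idx r \<le> k \<and> \<tau> (idx r) = r" by metis
  \<comment> \<open>The conditions of \<open>A\<close>, read off the vector of the first
    \<open>k\<close> increments: \<open>W r\<close> is the sum of the first \<open>idx r\<close> of
    them.\<close>
  define Xa where "Xa = {y \<in> space (PiM {..<k} (\<lambda>_. borel :: real measure)).
      \<forall>r\<in>J. (\<Sum>i<idx r. y i) \<in> E r}"
  define Xb where "Xb = {y \<in> space (PiM {k} (\<lambda>_. borel :: real measure)). y k \<in> E0}"
  have Xa: "Xa \<in> sets (PiM {..<k} (\<lambda>_. borel))"
    unfolding Xa_def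
  proof (rule sets.sets_Collect_finite_All[OF _ J(1)])
    fix r assume r: "r \<in> J"
    have "(\<lambda>y. \<Sum>i<idx r. y i) \<in> borel_measurable (PiM {..<k} (\<lambda>_. borel :: real measure))"
      by (rule borel_measurable_sum, rule measurable_component_singleton) (use idx[OF r] in auto)
    then have "(\<lambda>y. \<Sum>i<idx r. y i) -` E r \<inter> space (PiM {..<k} (\<lambda>_. borel :: real measure))
        \<in> sets (PiM {..<k} (\<lambda>_. borel))"
      by (rule measurable_sets) (use E r in auto)
    moreover have "{y \<in> space (PiM {..<k} (\<lambda>_. borel :: real measure)). (\<Sum>i<idx r. y i) \<in> E r}
      = (\<lambda>y. \<Sum>i<idx r. y i) -` E r \<inter> space (PiM {..<k} (\<lambda>_. borel :: real measure))"
      by auto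
    ultimately show "{y \<in> space (PiM {..<k} (\<lambda>_. borel :: real measure)). (\<Sum>i<idx r. y i) \<in> E r}
        \<in> sets (PiM {..<k} (\<lambda>_. borel))"
      by simp
  qed
  have Xb: "Xb \<in> sets (PiM {k} (\<lambda>_. borel))"
  proof -
    have "(\<lambda>y. y k) -` E0 \<inter> space (PiM {k} (\<lambda>_. borel :: real measure)) \<in> sets (PiM {k} (\<lambda>_. borel))"
      by (rule measurable_sets[OF _ E0], rule measurable_component_singleton) simp
    moreover have "Xb = (\<lambda>y. y k) -` E0 \<inter> space (PiM {k} (\<lambda>_. borel :: real measure))"
      by (auto simp: Xb_def)
    ultimately show ?thesis by simp
  qed
  define A' where "A' = (\<lambda>\<omega>. restrict (\<lambda>i. X i \<omega>) {..<k}) -` Xa \<inter> space M"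
  have B_eq: "(\<lambda>\<omega>. restrict (\<lambda>i. X i \<omega>) {k}) -` Xb \<inter> space M = B"
    by (auto simp: B_def Xb_def X_def \<sigma>_def \<tau>k space_PiM)
  have A'ev: "A' \<in> events" unfolding A'_def
    using Xa indep_var_rv1[OF ind] by (rule measurable_sets[rotated])
  have Bev: "B \<in> events" using E0 assms(1,2) unfolding B_def
    by (intro measurable_sets[of _ M borel]) auto
  have "prob ((\<lambda>\<omega>. (restrict (\<lambda>i. X i \<omega>) {..<k}, restrict (\<lambda>i. X i \<omega>) {k})) -` (Xa \<times> Xb) \<inter> space M)
      = prob A' * prob B"
    using indep_varD[OF ind Xa Xb] unfolding A'_def B_eq .
  moreover have "(\<lambda>\<omega>. (restrict (\<lambda>i. X i \<omega>) {..<k}, restrict (\<lambda>i. X i \<omega>) {k})) -` (Xa \<times> Xb) \<inter> space M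
      = A' \<inter> B"
    unfolding A'_def B_eq[symmetric] by auto
  ultimately have prod: "prob (A' \<inter> B) = prob A' * prob B" by simp
  have AA': "AE \<omega> in M. \<omega> \<in> A \<longleftrightarrow> \<omega> \<in> A'"
    using AE_A W_0 AE_space
  proof eventually_elim
    fix \<omega> assume 1: "\<omega> \<in> A \<longleftrightarrow> (\<forall>r\<in>J. W r \<omega> \<in> E r)" and 2: "W 0 \<omega> = 0" and \<omega>: "\<omega> \<in> space M"
    have "(\<Sum>i<idx r. restrict (\<lambda>i. X i \<omega>) {..<k} i) = W r \<omega>" if "r \<in> J" for r
    proof -
      have "(\<Sum>i<idx r. restrict (\<lambda>i. X i \<omega>) {..<k} i) = (\<Sum>i<idx r. W (\<sigma> (Suc i)) \<omega> - W (\<sigma> i) \<omega>)"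
        using idx[OF that] by (intro sum.cong) (auto simp: X_def)
      also have "\<dots> = W (\<sigma> (idx r)) \<omega> - W (\<sigma> 0) \<omega>"
        by (rule sum_lessThan_telescope)
      finally show ?thesis using idx[OF that] 2 by (simp add: \<sigma>_def \<tau>0)
    qed
    then show "\<omega> \<in> A \<longleftrightarrow> \<omega> \<in> A'"
      using 1 \<omega> by (auto simp: A'_def Xa_def space_PiM)
  qed
  have "prob A = prob A'" using AA' Aev A'ev by (intro finite_measure_eq_AE) auto
  moreover have "prob (A \<inter> B) = prob (A' \<inter> B)"
    using AA' Aev A'ev Bev by (intro finite_measure_eq_AE) auto
  ultimately show ?thesis using prod by simp
qed

text \<open>Dynkin's argument: independence passes from two intersection-stable families to the
  sigma-algebras they generate, and the one generated by the cylinders contains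
  \<open>F s\<close>.\<close>

lemma indep_var_increment:
  assumes st: "0 \<le> s" "s < t" and Z: "Z \<in> borel_measurable (F s)"
  shows "indep_var borel Z borel (\<lambda>\<omega>. W t \<omega> - W s \<omega>)"
proof -
  let ?D = "\<lambda>\<omega>. W t \<omega> - W s \<omega>"
  let ?B = "{?D -` E \<inter> space M | E. E \<in> sets borel}"
  have D[measurable]: "?D \<in> borel_measurable M" using st by auto
  have i1: "indep_set (cylinder s) ?B"
  proof (rule indep_setI)
    show "?B \<subseteq> events" using measurable_sets[OF D] by auto
  qed (use cylinder_events cylinder_indep_increment[OF st] in auto)
  have i2: "Int_stable ?B"
  proof (rule Int_stableI)
    fix a b assume "a \<in> ?B" "b \<in> ?B"
    then obtain E E' where "a = ?D -` E \<inter> space M" "b = ?D -` E' \<inter> space M" "E \<in> sets borel" "E' \<in> sets borel"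
      by blast
    then show "a \<inter> b \<in> ?B" by (intro CollectI exI[of _ "E \<inter> E'"]) auto
  qed
  have ind: "indep_set (sigma_sets (space M) (cylinder s)) (sigma_sets (space M) ?B)"
    by (rule indep_set_sigma_sets[OF i1 Int_stable_cylinder i2])
  have sub: "sigma_sets (space M) {Z -` E \<inter> space M | E. E \<in> sets borel} \<subseteq> sigma_sets (space M) (cylinder s)"
  proof (rule sigma_sets_subseteq[THEN order_trans])
    show "{Z -` E \<inter> space M | E. E \<in> sets borel} \<subseteq> sets (F s)"
      using measurable_sets[OF Z] by auto
    have "sigma_sets (space M) (sets (F s)) = sets (F s)"
      using sets.sigma_sets_eq[of "F s"] by simp
    then show "sigma_sets (space M) (sets (F s)) \<subseteq> sigma_sets (space M) (cylinder s)"
      unfolding sets_F using F_gen_cylinder[OF st(1)] by (simp add: sigma_sets_subseteq)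
  qed
  have "indep_set (sigma_sets (space M) {Z -` E \<inter> space M | E. E \<in> sets borel}) (sigma_sets (space M) ?B)"
  proof (rule indep_setI)
    show "sigma_sets (space M) {Z -` E \<inter> space M | E. E \<in> sets borel} \<subseteq> events"
      using sub indep_setD_ev1[OF ind] by blast
    show "sigma_sets (space M) ?B \<subseteq> events" using indep_setD_ev2[OF ind] .
    show "prob (a \<inter> b) = prob a * prob b"
      if "a \<in> sigma_sets (space M) {Z -` E \<inter> space M | E. E \<in> sets borel}" "b \<in> sigma_sets (space M) ?B" for a b
      by (rule indep_setD[OF ind subsetD[OF sub that(1)] that(2)])
  qed
  then show ?thesis
    unfolding indep_var_eq using F_measurable_M[OF Z] D by auto
qed

lemma increment_moments:
  assumes st: "0 \<le> s" "s < t"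
  shows "expectation (\<lambda>\<omega>. W t \<omega> - W s \<omega>) = 0"
    and "expectation (\<lambda>\<omega>. (W t \<omega> - W s \<omega>)\<^sup>2) = t - s"
    and "sqint M (\<lambda>\<omega>. W t \<omega> - W s \<omega>)"
proof -
  have pos: "sqrt (t - s) > 0" using st by simp
  show 1: "expectation (\<lambda>\<omega>. W t \<omega> - W s \<omega>) = 0"
    by (rule normal_distributed_expectation[OF pos W_normal[OF st]])
  show 2: "expectation (\<lambda>\<omega>. (W t \<omega> - W s \<omega>)\<^sup>2) = t - s"
    using normal_distributed_variance[OF pos W_normal[OF st]] st unfolding 1 by simp
  \<comment> \<open>A non-integrable function would have integral 0, not
    \<open>t - s > 0\<close>.\<close>
  have "integrable M (\<lambda>\<omega>. (W t \<omega> - W s \<omega>)\<^sup>2)"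
    using not_integrable_integral_eq[of M "\<lambda>\<omega>. (W t \<omega> - W s \<omega>)\<^sup>2"] 2 st by (cases "integrable M (\<lambda>\<omega>. (W t \<omega> - W s \<omega>)\<^sup>2)") auto
  then show "sqint M (\<lambda>\<omega>. W t \<omega> - W s \<omega>)" using st by (auto simp: sqint_def)
qed

text \<open>Independence factorises both expectations. The case \<open>s = t\<close> is included
  because simple integrands may have empty steps.\<close>

lemma increment_times:
  assumes st: "0 \<le> s" "s \<le> t" and Z: "Z \<in> borel_measurable (F s)" "integrable M Z"
  shows "integrable M (\<lambda>\<omega>. Z \<omega> * (W t \<omega> - W s \<omega>))"
    and "expectation (\<lambda>\<omega>. Z \<omega> * (W t \<omega> - W s \<omega>)) = 0"
    and "integrable M (\<lambda>\<omega>. Z \<omega> * (W t \<omega> - W s \<omega>)\<^sup>2)"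
    and "expectation (\<lambda>\<omega>. Z \<omega> * (W t \<omega> - W s \<omega>)\<^sup>2) = (t - s) * expectation Z"
proof -
  have "integrable M (\<lambda>\<omega>. Z \<omega> * (W t \<omega> - W s \<omega>)) \<and>
     expectation (\<lambda>\<omega>. Z \<omega> * (W t \<omega> - W s \<omega>)) = 0 \<and>
     integrable M (\<lambda>\<omega>. Z \<omega> * (W t \<omega> - W s \<omega>)\<^sup>2) \<and>
     expectation (\<lambda>\<omega>. Z \<omega> * (W t \<omega> - W s \<omega>)\<^sup>2) = (t - s) * expectation Z"
  proof (cases "s = t")
    case False
    with st have st': "s < t" by simp
    note ind = indep_var_increment[OF st(1) st' Z(1)]
    have ind2: "indep_var borel Z borel (\<lambda>\<omega>. (W t \<omega> - W s \<omega>)\<^sup>2)"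
      using indep_var_compose[OF ind, of "\<lambda>x. x" borel "\<lambda>x. x\<^sup>2" borel] by (simp add: comp_def)
    note m = increment_moments[OF st(1) st']
    have i1: "integrable M (\<lambda>\<omega>. W t \<omega> - W s \<omega>)"
      by (rule sqint_integrable[OF finite_measure_axioms m(3)])
    show ?thesis
      using indep_var_integrable[OF ind Z(2) i1] indep_var_lebesgue_integral[OF ind Z(2) i1]
        indep_var_integrable[OF ind2 Z(2) sqint_integrable_sq[OF m(3)]]
        indep_var_lebesgue_integral[OF ind2 Z(2) sqint_integrable_sq[OF m(3)]] m
      by simp
  qed auto
  then show "integrable M (\<lambda>\<omega>. Z \<omega> * (W t \<omega> - W s \<omega>))"
    and "expectation (\<lambda>\<omega>. Z \<omega> * (W t \<omega> - W s \<omega>)) = 0"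
    and "integrable M (\<lambda>\<omega>. Z \<omega> * (W t \<omega> - W s \<omega>)\<^sup>2)"
    and "expectation (\<lambda>\<omega>. Z \<omega> * (W t \<omega> - W s \<omega>)\<^sup>2) = (t - s) * expectation Z"
    by auto
qed

text \<open>A modification of \<open>W\<close> all of whose paths are continuous; it is adapted because \<open>F 0\<close>
  contains the null sets.\<close>

definition exceptional :: "'a set" where
  "exceptional = (SOME N. N \<in> null_sets M \<and> {\<omega> \<in> space M. \<not> continuous_on {0..} (\<lambda>t. W t \<omega>)} \<subseteq> N)"

lemma exceptional: "exceptional \<in> null_sets M" "{\<omega> \<in> space M. \<not> continuous_on {0..} (\<lambda>t. W t \<omega>)} \<subseteq> exceptional"
proof -
  have "\<exists>N. N \<in> null_sets M \<and> {\<omega> \<in> space M. \<not> continuous_on {0..} (\<lambda>t. W t \<omega>)} \<subseteq> N"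
    using W_continuous_AE unfolding eventually_ae_filter by blast
  from someI_ex[OF this]
  show "exceptional \<in> null_sets M" "{\<omega> \<in> space M. \<not> continuous_on {0..} (\<lambda>t. W t \<omega>)} \<subseteq> exceptional"
    unfolding exceptional_def by auto
qed

definition V :: "real \<Rightarrow> 'a \<Rightarrow> real" where
  "V t \<omega> = (if \<omega> \<in> exceptional then 0 else W t \<omega>)"

lemma V_continuous: "\<omega> \<in> space M \<Longrightarrow> continuous_on {0..} (\<lambda>t. V t \<omega>)"
  using exceptional(2) by (cases "\<omega> \<in> exceptional") (auto simp: V_def)

lemma V_adapted:
  assumes "0 \<le> s" "s \<le> t" shows "V s \<in> borel_measurable (F t)"
proof -
  have [measurable]: "exceptional \<in> sets (F t)" "W s \<in> borel_measurable (F t)"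
    using null_sets_F[OF exceptional(1)] W_adapted[OF assms] by auto
  show ?thesis unfolding V_def[abs_def] by measurable
qed

lemma V_measurable: "0 \<le> t \<Longrightarrow> V t \<in> borel_measurable M"
  using F_measurable_M[OF V_adapted[of t t]] by simp

lemma V_eq_W: "AE \<omega> in M. \<forall>t. V t \<omega> = W t \<omega>"
  using AE_not_in[OF exceptional(1)] by eventually_elim (auto simp: V_def)

lemma V_times:
  assumes st: "0 \<le> s" "s \<le> t" and Z: "Z \<in> borel_measurable (F s)" "integrable M Z"
  shows "integrable M (\<lambda>\<omega>. Z \<omega> * (V t \<omega> - V s \<omega>))"
    and "expectation (\<lambda>\<omega>. Z \<omega> * (V t \<omega> - V s \<omega>)) = 0"
    and "integrable M (\<lambda>\<omega>. Z \<omega> * (V t \<omega> - V s \<omega>)\<^sup>2)"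
    and "expectation (\<lambda>\<omega>. Z \<omega> * (V t \<omega> - V s \<omega>)\<^sup>2) = (t - s) * expectation Z"
proof -
  note [measurable] = F_measurable_M[OF Z(1)]
  have [measurable]: "V t \<in> borel_measurable M" "V s \<in> borel_measurable M"
    "W t \<in> borel_measurable M" "W s \<in> borel_measurable M"
    using st by (auto intro!: V_measurable)
  note I = increment_times[OF st Z]
  have ae1: "AE \<omega> in M. Z \<omega> * (W t \<omega> - W s \<omega>) = Z \<omega> * (V t \<omega> - V s \<omega>)"
    and ae2: "AE \<omega> in M. Z \<omega> * (W t \<omega> - W s \<omega>)\<^sup>2 = Z \<omega> * (V t \<omega> - V s \<omega>)\<^sup>2"
    using V_eq_W by (eventually_elim, simp)+
  show "integrable M (\<lambda>\<omega>. Z \<omega> * (V t \<omega> - V s \<omega>))"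
    by (rule Bochner_Integration.integrable_cong_AE_imp[OF I(1)]) (use ae1 in auto)
  show "integrable M (\<lambda>\<omega>. Z \<omega> * (V t \<omega> - V s \<omega>)\<^sup>2)"
    by (rule Bochner_Integration.integrable_cong_AE_imp[OF I(3)]) (use ae2 in auto)
  show "expectation (\<lambda>\<omega>. Z \<omega> * (V t \<omega> - V s \<omega>)) = 0"
    by (subst integral_cong_AE[OF _ _ ae1, symmetric]) (use I in auto)
  show "expectation (\<lambda>\<omega>. Z \<omega> * (V t \<omega> - V s \<omega>)\<^sup>2) = (t - s) * expectation Z"
    by (subst integral_cong_AE[OF _ _ ae2, symmetric]) (use I in auto)
qed

lemma sqint_V:
  assumes "0 \<le> s" "s \<le> t"
  shows "sqint M (\<lambda>\<omega>. V t \<omega> - V s \<omega>)"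
proof -
  have "V t \<in> borel_measurable M" "V s \<in> borel_measurable M"
    using assms by (auto intro!: V_measurable)
  then have "(\<lambda>\<omega>. V t \<omega> - V s \<omega>) \<in> borel_measurable M"
    by (rule borel_measurable_diff)
  moreover have "integrable M (\<lambda>\<omega>. 1 * (V t \<omega> - V s \<omega>)\<^sup>2)"
    by (rule V_times(3)[OF assms]) auto
  ultimately show ?thesis
    unfolding sqint_def mult_1 by (rule conjI)
qed

end

section \<open>Elementary stochastic integrals\<close>

lemma sigma_finite_restrict_lborel:
  fixes I :: "real set"
  assumes "I \<in> sets borel" shows "sigma_finite_measure (restrict_space lborel I)"
  using assms by (intro sigma_finite_measure_restrict_space) (auto simp: lborel.sigma_finite_measure_axioms)

lemma sets_restrict_lborel: "sets (restrict_space lborel I) = sets (restrict_space borel I)"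
  by (simp add: sets_restrict_space)

context brownian
begin

text \<open>With this product measure, mean square norms of processes on \<open>I\<close> become
  ordinary norms of functions, so that \<open>sqint\<close> and \<open>L2conv\<close> serve
  processes and random variables alike.\<close>

definition PP :: "real set \<Rightarrow> (real \<times> 'a) measure" where
  "PP I = restrict_space lborel I \<Otimes>\<^sub>M M"

abbreviation U :: "(real \<Rightarrow> 'a \<Rightarrow> real) \<Rightarrow> real \<times> 'a \<Rightarrow> real" where
  "U \<phi> \<equiv> \<lambda>p. \<phi> (fst p) (snd p)"

lemma space_PP [simp]: "space (PP I) = I \<times> space M"
  by (simp add: PP_def space_pair_measure space_restrict_space)

lemma pair_sigma_finite_PP: "(I :: real set) \<in> sets borel \<Longrightarrow> pair_sigma_finite (restrict_space lborel I) M"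
  by (intro pair_sigma_finite.intro sigma_finite_restrict_lborel sigma_finite_measure_axioms)

lemma finite_measure_PP: "finite_measure (PP {0..T})"
proof
  have "emeasure (PP {0..T}) (space (PP {0..T})) = emeasure lborel {0..T} * emeasure M (space M)"
    unfolding space_PP unfolding PP_def
    by (subst emeasure_pair_measure_Times)
       (auto simp: emeasure_restrict_space sets_restrict_space intro!: image_eqI[of _ _ UNIV])
  then show "emeasure (PP {0..T}) (space (PP {0..T})) \<noteq> \<infinity>"
    by (cases "0 \<le> T") (auto simp: emeasure_space_1)
qed

lemma nn_integral_PP:
  assumes "I \<in> sets borel" "f \<in> borel_measurable (PP I)"
  shows "(\<integral>\<^sup>+p. f p \<partial>PP I) = (\<integral>\<^sup>+\<omega>. (\<integral>\<^sup>+t\<in>I. f (t, \<omega>) \<partial>lborel) \<partial>M)"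
    and "(\<integral>\<^sup>+p. f p \<partial>PP I) = (\<integral>\<^sup>+t\<in>I. (\<integral>\<^sup>+\<omega>. f (t, \<omega>) \<partial>M) \<partial>lborel)"
proof -
  note fst = nn_integral_fst[OF assms(2)[unfolded PP_def]]
  interpret pair_sigma_finite "restrict_space lborel I" M
    by (rule pair_sigma_finite_PP) fact
  have r: "(\<integral>\<^sup>+t. g t \<partial>restrict_space lborel I) = (\<integral>\<^sup>+t\<in>I. g t \<partial>lborel)" for g
    using assms(1) by (intro nn_integral_restrict_space) auto
  note f = assms(2)[unfolded PP_def]
  show "(\<integral>\<^sup>+p. f p \<partial>PP I) = (\<integral>\<^sup>+\<omega>. (\<integral>\<^sup>+t\<in>I. f (t, \<omega>) \<partial>lborel) \<partial>M)"
    unfolding PP_def nn_integral_snd[OF f, symmetric] r ..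
  show "(\<integral>\<^sup>+p. f p \<partial>PP I) = (\<integral>\<^sup>+t\<in>I. (\<integral>\<^sup>+\<omega>. f (t, \<omega>) \<partial>M) \<partial>lborel)"
    unfolding PP_def fst[symmetric] r ..
qed

lemma sq_norm_on_PP:
  assumes "I \<in> sets borel" "U \<phi> \<in> borel_measurable (PP I)"
  shows "sq_norm_on M I \<phi> = (\<integral>\<^sup>+p. ennreal ((U \<phi> p)\<^sup>2) \<partial>PP I)"
  unfolding sq_norm_on_def nn_integral_PP(1)[OF assms(1) measurable_ennreal_sq[OF assms(2)]] fst_conv snd_conv ..

lemma integral_PP:
  fixes f :: "real \<times> 'a \<Rightarrow> real"
  assumes "I \<in> sets borel" "integrable (PP I) f"
  shows "(\<integral>p. f p \<partial>PP I) = (\<integral>\<omega>. (LINT t:I|lborel. f (t, \<omega>)) \<partial>M)"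
    and "(\<integral>p. f p \<partial>PP I) = (LINT t:I|lborel. (\<integral>\<omega>. f (t, \<omega>) \<partial>M))"
    and "AE \<omega> in M. set_integrable lborel I (\<lambda>t. f (t, \<omega>))"
    and "AE t in lborel. t \<in> I \<longrightarrow> integrable M (\<lambda>\<omega>. f (t, \<omega>))"
proof -
  interpret pair_sigma_finite "restrict_space lborel I" M
    by (rule pair_sigma_finite_PP) fact
  have I: "I \<inter> space lborel \<in> sets lborel" using assms(1) by simp
  have r: "(\<integral>t. g t \<partial>restrict_space lborel I) = (LINT t:I|lborel. g t)" for g :: "real \<Rightarrow> real"
    unfolding set_lebesgue_integral_def by (rule integral_restrict_space[OF I])
  note f = assms(2)[unfolded PP_def]
  then have f': "integrable (restrict_space lborel I \<Otimes>\<^sub>M M) (\<lambda>(x, y). f (x, y))"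
    by (simp only: case_prod_eta)
  show "(\<integral>p. f p \<partial>PP I) = (\<integral>\<omega>. (LINT t:I|lborel. f (t, \<omega>)) \<partial>M)"
    using integral_snd[OF f'] unfolding case_prod_eta PP_def r by (rule sym)
  show "(\<integral>p. f p \<partial>PP I) = (LINT t:I|lborel. (\<integral>\<omega>. f (t, \<omega>) \<partial>M))"
    using integral_fst'[OF f] unfolding PP_def r by (rule sym)
  show "AE \<omega> in M. set_integrable lborel I (\<lambda>t. f (t, \<omega>))"
    using AE_integrable_snd[OF f'] unfolding set_integrable_def integrable_restrict_space[OF I] .
  show "AE t in lborel. t \<in> I \<longrightarrow> integrable M (\<lambda>\<omega>. f (t, \<omega>))"
    using AE_integrable_fst'[OF f] unfolding AE_restrict_space_iff[OF I] .
qed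

lemma measurable_fst_PP: "f \<in> borel_measurable borel \<Longrightarrow> (\<lambda>p. f (fst p)) \<in> borel_measurable (PP I)"
  unfolding PP_def
  by (rule measurable_compose[OF measurable_fst], rule measurable_restrict_space1) simp

lemma measurable_snd_PP: "f \<in> borel_measurable M \<Longrightarrow> (\<lambda>p. f (snd p)) \<in> borel_measurable (PP I)"
  unfolding PP_def by (rule measurable_compose[OF measurable_snd])

lemma integral_PP_times:
  fixes f :: "real \<Rightarrow> real" and g :: "'a \<Rightarrow> real"
  assumes "integrable (PP {0..t}) (\<lambda>p. f (fst p) * g (snd p))"
  shows "(\<integral>p. f (fst p) * g (snd p) \<partial>PP {0..t}) = (LINT s:{0..t}|lborel. f s) * expectation g"
proof -
  have "(\<integral>p. f (fst p) * g (snd p) \<partial>PP {0..t}) = (LINT s:{0..t}|lborel. f s * expectation g)"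
    by (subst integral_PP(2)[OF _ assms]) auto
  also have "\<dots> = (LINT s:{0..t}|lborel. f s) * expectation g"
    by (rule set_integral_mult_left)
  finally show ?thesis .
qed

subsection \<open>The covariance of two increments\<close>

lemma bounded_sqint:
  "0 \<le> a \<Longrightarrow> \<xi> \<in> borel_measurable (F a) \<Longrightarrow> (\<And>\<omega>. \<omega> \<in> space M \<Longrightarrow> \<bar>\<xi> \<omega>\<bar> \<le> K) \<Longrightarrow> sqint M \<xi>"
  by (intro sqint_bounded[OF finite_measure_axioms]) (auto intro: F_measurable_M)

lemma F_measurable_diff_V:
  assumes "0 \<le> a" "a \<le> c" "0 \<le> b" "b \<le> c"
  shows "(\<lambda>\<omega>. V b \<omega> - V a \<omega>) \<in> borel_measurable (F c)"
  by (intro borel_measurable_diff V_adapted assms)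

lemma V_orthogonal:
  assumes "0 \<le> c" "c \<le> d" "Z \<in> borel_measurable (F c)" "integrable M Z"
  shows "expectation (\<lambda>\<omega>. Z \<omega> * (V d \<omega> - V c \<omega>)) = 0"
  by (rule V_times(2)[OF assms])

text \<open>Split \<open>V q - V c\<close> at \<open>p\<close>: the piece after \<open>p\<close> is
  orthogonal to everything known at \<open>p\<close>, and only the square of the first piece
  remains.\<close>

lemma cov_same_start:
  assumes "0 \<le> c" "c \<le> p" "p \<le> q" and Z: "Z \<in> borel_measurable (F c)" "\<And>\<omega>. \<omega> \<in> space M \<Longrightarrow> \<bar>Z \<omega>\<bar> \<le> K"
  shows "expectation (\<lambda>\<omega>. Z \<omega> * ((V p \<omega> - V c \<omega>) * (V q \<omega> - V c \<omega>))) = (p - c) * expectation Z"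
proof -
  have Zs: "sqint M Z" using bounded_sqint[OF assms(1) Z] .
  have Zi: "integrable M Z" by (rule sqint_integrable[OF finite_measure_axioms Zs])
  have p: "sqint M (\<lambda>\<omega>. V p \<omega> - V c \<omega>)" and q: "sqint M (\<lambda>\<omega>. V q \<omega> - V p \<omega>)"
    using assms by (auto intro!: sqint_V)
  have Zp: "sqint M (\<lambda>\<omega>. Z \<omega> * (V p \<omega> - V c \<omega>))"
    using sqint_bounded_mult[OF p F_measurable_M[OF Z(1)] Z(2)] .
  have Zpm: "(\<lambda>\<omega>. Z \<omega> * (V p \<omega> - V c \<omega>)) \<in> borel_measurable (F p)"
    using assms by (intro borel_measurable_times F_measurable_diff_V F_measurable_mono[OF Z(1)]) auto
  have "expectation (\<lambda>\<omega>. Z \<omega> * ((V p \<omega> - V c \<omega>) * (V q \<omega> - V c \<omega>)))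
     = expectation (\<lambda>\<omega>. Z \<omega> * (V p \<omega> - V c \<omega>)\<^sup>2 + Z \<omega> * (V p \<omega> - V c \<omega>) * (V q \<omega> - V p \<omega>))"
    by (intro Bochner_Integration.integral_cong) (auto simp: algebra_simps power2_eq_square)
  also have "\<dots> = expectation (\<lambda>\<omega>. Z \<omega> * (V p \<omega> - V c \<omega>)\<^sup>2) +
      expectation (\<lambda>\<omega>. Z \<omega> * (V p \<omega> - V c \<omega>) * (V q \<omega> - V p \<omega>))"
    by (rule Bochner_Integration.integral_add[OF V_times(3)[OF assms(1,2) Z(1) Zi] sqint_mult[OF Zp q]])
  also have "expectation (\<lambda>\<omega>. Z \<omega> * (V p \<omega> - V c \<omega>) * (V q \<omega> - V p \<omega>)) = 0"
    using assms by (intro V_orthogonal[OF _ _ Zpm sqint_integrable[OF finite_measure_axioms Zp]]) auto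
  finally show ?thesis using V_times(4)[OF assms(1,2) Z(1) Zi] by simp
qed

text \<open>The later coefficient \<eta> is known at \<open>c\<close>, so the earlier increment is
  split at \<open>c\<close>. Its part before \<open>c\<close> is known at \<open>c\<close> and hence
  orthogonal to \<open>V d - V c\<close>; its part after \<open>c\<close> starts together with the
  other increment, which contributes the length of the overlap.\<close>

lemma cov_increments_le:
  assumes ab: "0 \<le> a" "a \<le> b" and cd: "c \<le> d" and ac: "a \<le> c"
    and \<xi>: "\<xi> \<in> borel_measurable (F a)" "\<And>\<omega>. \<omega> \<in> space M \<Longrightarrow> \<bar>\<xi> \<omega>\<bar> \<le> K"
    and \<eta>: "\<eta> \<in> borel_measurable (F c)" "\<And>\<omega>. \<omega> \<in> space M \<Longrightarrow> \<bar>\<eta> \<omega>\<bar> \<le> L"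
  shows "expectation (\<lambda>\<omega>. (\<xi> \<omega> * (V b \<omega> - V a \<omega>)) * (\<eta> \<omega> * (V d \<omega> - V c \<omega>)))
    = measure lborel ({a<..b} \<inter> {c<..d}) * expectation (\<lambda>\<omega>. \<xi> \<omega> * \<eta> \<omega>)"
proof -
  have c0: "0 \<le> c" using ab ac by simp
  have \<xi>c: "\<xi> \<in> borel_measurable (F c)" by (rule F_measurable_mono[OF \<xi>(1) ac])
  have Zm: "(\<lambda>\<omega>. \<xi> \<omega> * \<eta> \<omega>) \<in> borel_measurable (F c)" using \<xi>c \<eta>(1) by simp
  have Zb: "\<bar>\<xi> \<omega> * \<eta> \<omega>\<bar> \<le> K * L" if "\<omega> \<in> space M" for \<omega>
    using \<xi>(2)[OF that] \<eta>(2)[OF that] unfolding abs_mult by (intro mult_mono) auto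
  have dd: "sqint M (\<lambda>\<omega>. V d \<omega> - V c \<omega>)" by (rule sqint_V[OF c0 cd])
  have early: "expectation (\<lambda>\<omega>. (\<xi> \<omega> * \<eta> \<omega> * (V r \<omega> - V a \<omega>)) * (V d \<omega> - V c \<omega>)) = 0"
    and early_s: "sqint M (\<lambda>\<omega>. \<xi> \<omega> * \<eta> \<omega> * (V r \<omega> - V a \<omega>))" if "a \<le> r" "r \<le> c" for r
  proof -
    show s: "sqint M (\<lambda>\<omega>. \<xi> \<omega> * \<eta> \<omega> * (V r \<omega> - V a \<omega>))"
      using ab that by (intro sqint_bounded_mult[OF sqint_V F_measurable_M[OF Zm] Zb]) auto
    have "(\<lambda>\<omega>. \<xi> \<omega> * \<eta> \<omega> * (V r \<omega> - V a \<omega>)) \<in> borel_measurable (F c)"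
      using ab that by (intro borel_measurable_times[OF Zm] F_measurable_diff_V) auto
    then show "expectation (\<lambda>\<omega>. (\<xi> \<omega> * \<eta> \<omega> * (V r \<omega> - V a \<omega>)) * (V d \<omega> - V c \<omega>)) = 0"
      by (rule V_orthogonal[OF c0 cd _ sqint_integrable[OF finite_measure_axioms s]])
  qed
  show ?thesis
  proof (cases "b \<le> c")
    case True
    then have e: "{a<..b} \<inter> {c<..d} = {}" by auto
    show ?thesis
      unfolding e using early[OF ab(2) True] by (simp add: mult_ac)
  next
    case False
    then have cb: "c \<le> b" by simp
    have meas: "measure lborel ({a<..b} \<inter> {c<..d}) = min b d - c"
    proof -
      have "{a<..b} \<inter> {c<..d} = {c<..min b d}" using ac by auto
      then show ?thesis using cb cd by simp
    qed
    have bb: "sqint M (\<lambda>\<omega>. V b \<omega> - V c \<omega>)" by (rule sqint_V[OF c0 cb])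
    have Zbb: "sqint M (\<lambda>\<omega>. \<xi> \<omega> * \<eta> \<omega> * (V b \<omega> - V c \<omega>))"
      by (rule sqint_bounded_mult[OF bb F_measurable_M[OF Zm] Zb])
    have "expectation (\<lambda>\<omega>. (\<xi> \<omega> * (V b \<omega> - V a \<omega>)) * (\<eta> \<omega> * (V d \<omega> - V c \<omega>)))
      = expectation (\<lambda>\<omega>. (\<xi> \<omega> * \<eta> \<omega> * (V c \<omega> - V a \<omega>)) * (V d \<omega> - V c \<omega>)
          + (\<xi> \<omega> * \<eta> \<omega> * (V b \<omega> - V c \<omega>)) * (V d \<omega> - V c \<omega>))"
      by (intro Bochner_Integration.integral_cong) (auto simp: algebra_simps)
    also have "\<dots> = expectation (\<lambda>\<omega>. (\<xi> \<omega> * \<eta> \<omega> * (V c \<omega> - V a \<omega>)) * (V d \<omega> - V c \<omega>))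
          + expectation (\<lambda>\<omega>. (\<xi> \<omega> * \<eta> \<omega> * (V b \<omega> - V c \<omega>)) * (V d \<omega> - V c \<omega>))"
      by (rule Bochner_Integration.integral_add[OF sqint_mult[OF early_s[OF ac order_refl] dd] sqint_mult[OF Zbb dd]])
    also have "\<dots> = expectation (\<lambda>\<omega>. \<xi> \<omega> * \<eta> \<omega> * ((V b \<omega> - V c \<omega>) * (V d \<omega> - V c \<omega>)))"
      unfolding early[OF ac order_refl] by (simp add: mult.assoc)
    also have "\<dots> = (min b d - c) * expectation (\<lambda>\<omega>. \<xi> \<omega> * \<eta> \<omega>)"
    proof (cases "b \<le> d")
      case True
      then show ?thesis using cov_same_start[OF c0 cb True Zm Zb] by simp
    next
      case False
      then show ?thesis using cov_same_start[OF c0 cd _ Zm Zb, of b] by (simp add: mult.commute)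
    qed
    finally show ?thesis unfolding meas .
  qed
qed

lemma cov_increments:
  assumes ab: "0 \<le> a" "a \<le> b" and cd: "0 \<le> c" "c \<le> d"
    and \<xi>: "\<xi> \<in> borel_measurable (F a)" "\<And>\<omega>. \<omega> \<in> space M \<Longrightarrow> \<bar>\<xi> \<omega>\<bar> \<le> K"
    and \<eta>: "\<eta> \<in> borel_measurable (F c)" "\<And>\<omega>. \<omega> \<in> space M \<Longrightarrow> \<bar>\<eta> \<omega>\<bar> \<le> L"
  shows "expectation (\<lambda>\<omega>. (\<xi> \<omega> * (V b \<omega> - V a \<omega>)) * (\<eta> \<omega> * (V d \<omega> - V c \<omega>)))
    = measure lborel ({a<..b} \<inter> {c<..d}) * expectation (\<lambda>\<omega>. \<xi> \<omega> * \<eta> \<omega>)"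
proof (cases "a \<le> c")
  case True
  then show ?thesis using cov_increments_le[OF ab cd(2) True \<xi> \<eta>] by simp
next
  case False
  then have "c \<le> a" by simp
  from cov_increments_le[OF cd ab(2) this \<eta> \<xi>] show ?thesis
    by (simp add: mult.commute Int_commute)
qed

subsection \<open>Elementary processes\<close>

text \<open>
  \<open>elem H I\<close>: \<open>I\<close> is the integral of the elementary process \<open>H\<close>. As a relation it is closed under
  sums without common refinements of the partitions.
\<close>

inductive elem :: "(real \<Rightarrow> 'a \<Rightarrow> real) \<Rightarrow> (real \<Rightarrow> 'a \<Rightarrow> real) \<Rightarrow> bool" where
  elem_zero: "elem (\<lambda>_ _. 0) (\<lambda>_ _. 0)"
| elem_step: "elem H I \<Longrightarrow> 0 \<le> a \<Longrightarrow> a \<le> b \<Longrightarrow> \<xi> \<in> borel_measurable (F a) \<Longrightarrow>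
    (\<And>\<omega>. \<omega> \<in> space M \<Longrightarrow> \<bar>\<xi> \<omega>\<bar> \<le> K) \<Longrightarrow>
    elem (\<lambda>t \<omega>. H t \<omega> + \<xi> \<omega> * indicator {a<..b} t)
      (\<lambda>t \<omega>. I t \<omega> + \<xi> \<omega> * (V (min t b) \<omega> - V (min t a) \<omega>))"

lemma sqint_single:
  assumes "0 \<le> a" "a \<le> b" "\<xi> \<in> borel_measurable (F a)" "\<And>\<omega>. \<omega> \<in> space M \<Longrightarrow> \<bar>\<xi> \<omega>\<bar> \<le> K"
  shows "sqint (PP {0..t}) (U (\<lambda>s \<omega>. \<xi> \<omega> * indicator {a<..b} s))"
proof (rule sqint_bounded[OF finite_measure_PP])
  show "U (\<lambda>s \<omega>. \<xi> \<omega> * indicator {a<..b} s) \<in> borel_measurable (PP {0..t})"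
    by (intro borel_measurable_times measurable_snd_PP measurable_fst_PP[of "indicator {a<..b}"]
        F_measurable_M[OF assms(3)] borel_measurable_indicator) simp
  show "\<bar>\<xi> (snd x) * indicator {a<..b} (fst x)\<bar> \<le> K" if "x \<in> space (PP {0..t})" for x
    using assms(4)[of "snd x"] that by (auto simp: indicator_def abs_mult)
qed

lemma sqint_single_int:
  assumes "0 \<le> a" "a \<le> b" "\<xi> \<in> borel_measurable (F a)" "\<And>\<omega>. \<omega> \<in> space M \<Longrightarrow> \<bar>\<xi> \<omega>\<bar> \<le> K" "0 \<le> t"
  shows "sqint M (\<lambda>\<omega>. \<xi> \<omega> * (V (min t b) \<omega> - V (min t a) \<omega>))"
  using assms by (intro sqint_bounded_mult[OF sqint_V F_measurable_M[OF assms(3)] assms(4)]) auto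

lemma elem_sqint:
  assumes "elem H I" "0 \<le> t"
  shows "sqint (PP {0..t}) (U H)" "sqint M (I t)"
  using assms
proof induction
  case (elem_step H I a b \<xi> K)
  { case 1 then show ?case
      using sqint_add[OF elem_step.IH(1) sqint_single[OF elem_step.hyps(2-4), of K]] elem_step.hyps(5) by blast }
  { case 2 then show ?case
      using sqint_add[OF elem_step.IH(2) sqint_single_int[OF elem_step.hyps(2-4), of K]] elem_step.hyps(5) by blast }
qed auto

lemma elem_adapted:
  assumes "elem H I" "0 \<le> t"
  shows "I t \<in> borel_measurable (F t)"
  using assms
proof induction
  case (elem_step H I a b \<xi> K)
  have "(\<lambda>\<omega>. \<xi> \<omega> * (V (min t b) \<omega> - V (min t a) \<omega>)) \<in> borel_measurable (F t)"
  proof (cases "t \<le> a")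
    case True
    then have "min t a = t" "min t b = t" using elem_step.hyps by auto
    then show ?thesis by simp
  next
    case False
    then show ?thesis using elem_step.hyps elem_step.prems
      by (intro borel_measurable_times F_measurable_diff_V F_measurable_mono[OF elem_step.hyps(4)]) auto
  qed
  then show ?case using elem_step.IH[OF elem_step.prems] by (rule borel_measurable_add[rotated])
qed simp

lemma elem_continuous:
  assumes "elem H I" "\<omega> \<in> space M"
  shows "continuous_on {0..} (\<lambda>t. I t \<omega>)"
  using assms
proof induction
  case (elem_step H I a b \<xi> K)
  have "continuous_on {0..} (\<lambda>t. V (min t c) \<omega>)" if "0 \<le> c" for c
    by (rule continuous_on_compose2[OF V_continuous[OF elem_step.prems]])
      (use that in \<open>auto intro!: continuous_intros\<close>)
  then show ?case using elem_step by (auto intro!: continuous_intros)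
qed simp

lemma elem_add:
  assumes "elem H I" "elem G J"
  shows "elem (\<lambda>t \<omega>. H t \<omega> + G t \<omega>) (\<lambda>t \<omega>. I t \<omega> + J t \<omega>)"
  using assms(2)
proof induction
  case (elem_step G J a b \<xi> K)
  from elem.elem_step[OF elem_step.IH elem_step.hyps(2-5)] show ?case
    by (simp add: add.assoc)
qed (use assms(1) in simp)

lemma elem_cmult:
  assumes "elem H I"
  shows "elem (\<lambda>t \<omega>. c * H t \<omega>) (\<lambda>t \<omega>. c * I t \<omega>)"
  using assms
proof induction
  case (elem_step H I a b \<xi> K)
  have "elem (\<lambda>t \<omega>. c * H t \<omega> + (c * \<xi> \<omega>) * indicator {a<..b} t)
      (\<lambda>t \<omega>. c * I t \<omega> + (c * \<xi> \<omega>) * (V (min t b) \<omega> - V (min t a) \<omega>))"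
  proof (rule elem.elem_step[OF elem_step.IH elem_step.hyps(2,3)])
    show "\<bar>c * \<xi> \<omega>\<bar> \<le> \<bar>c\<bar> * K" if "\<omega> \<in> space M" for \<omega>
      using elem_step.hyps(5)[OF that] by (simp add: abs_mult mult_left_mono)
  qed (use elem_step.hyps(4) in simp)
  then show ?case by (simp add: algebra_simps)
qed (simp add: elem_zero)

lemma elem_diff: "elem H I \<Longrightarrow> elem G J \<Longrightarrow> elem (\<lambda>t \<omega>. H t \<omega> - G t \<omega>) (\<lambda>t \<omega>. I t \<omega> - J t \<omega>)"
  using elem_add[OF _ elem_cmult[of G J "-1"]] by simp

lemma inner_single:
  assumes ab: "0 \<le> a" "a \<le> b" and cd: "0 \<le> c" "c \<le> d" and t: "0 \<le> t"
    and \<xi>: "\<xi> \<in> borel_measurable (F a)" "\<And>\<omega>. \<omega> \<in> space M \<Longrightarrow> \<bar>\<xi> \<omega>\<bar> \<le> K"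
    and \<eta>: "\<eta> \<in> borel_measurable (F c)" "\<And>\<omega>. \<omega> \<in> space M \<Longrightarrow> \<bar>\<eta> \<omega>\<bar> \<le> L"
  shows "expectation (\<lambda>\<omega>. (\<xi> \<omega> * (V (min t b) \<omega> - V (min t a) \<omega>)) * (\<eta> \<omega> * (V (min t d) \<omega> - V (min t c) \<omega>)))
    = (\<integral>p. (\<xi> (snd p) * indicator {a<..b} (fst p)) * (\<eta> (snd p) * indicator {c<..d} (fst p)) \<partial>PP {0..t})"
proof -
  let ?S = "{a<..b} \<inter> {c<..d}"
  have eq: "(\<xi> (snd p) * indicator {a<..b} (fst p)) * (\<eta> (snd p) * indicator {c<..d} (fst p))
      = indicator ?S (fst p) * (\<xi> (snd p) * \<eta> (snd p))" for p :: "real \<times> 'a"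
    by (auto simp: indicator_def)
  have int: "integrable (PP {0..t}) (\<lambda>p. indicator ?S (fst p) * (\<xi> (snd p) * \<eta> (snd p)))"
    using sqint_mult[OF sqint_single[OF ab \<xi>, of t] sqint_single[OF cd \<eta>, of t]] unfolding eq .
  have "(\<integral>p. (\<xi> (snd p) * indicator {a<..b} (fst p)) * (\<eta> (snd p) * indicator {c<..d} (fst p)) \<partial>PP {0..t})
      = (LINT s:{0..t}|lborel. indicator ?S s) * expectation (\<lambda>\<omega>. \<xi> \<omega> * \<eta> \<omega>)"
    unfolding eq by (rule integral_PP_times[OF int])
  also have "(LINT s:{0..t}|lborel. indicator ?S s) = measure lborel (?S \<inter> {0..t})"
    unfolding set_lebesgue_integral_def
    by (subst Bochner_Integration.integral_cong[OF refl, of _ _ "indicator (?S \<inter> {0..t})"])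
       (auto simp: indicator_def)
  finally have R: "(\<integral>p. (\<xi> (snd p) * indicator {a<..b} (fst p)) * (\<eta> (snd p) * indicator {c<..d} (fst p)) \<partial>PP {0..t})
     = measure lborel (?S \<inter> {0..t}) * expectation (\<lambda>\<omega>. \<xi> \<omega> * \<eta> \<omega>)" .
  show ?thesis
  proof (cases "a < t \<and> c < t")
    case True
    have S: "?S \<inter> {0..t} = {a<..min t b} \<inter> {c<..min t d}" using ab cd by auto
    have m: "min t a = a" "min t c = c" using True by auto
    show ?thesis unfolding R S m
      using cov_increments[OF ab(1) _ cd(1) _ \<xi> \<eta>, of "min t b" "min t d"] True ab cd by simp
  next
    case False
    \<comment> \<open>One of the intervals begins at \<open>t\<close> or later: its stopped
      increment is 0 and the overlap within \<open>{0..t}\<close> is empty.\<close>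
    then have S: "?S \<inter> {0..t} = {}" by auto
    have "(min t a = t \<and> min t b = t) \<or> (min t c = t \<and> min t d = t)" using False ab cd by auto
    then show ?thesis unfolding R S by auto
  qed
qed

text \<open>The isometry is proved in polarised form. Being bilinear, it reduces by an induction on
  each factor to two single steps, where both sides equal the length of the overlap times the mean
  of the product of the coefficients.\<close>

lemma elem_inner:
  assumes H: "elem H I" and G: "elem G J" and t: "0 \<le> t"
  shows "expectation (\<lambda>\<omega>. I t \<omega> * J t \<omega>) = (\<integral>p. U H p * U G p \<partial>PP {0..t})"
  using H
proof induction
  case elem_zero show ?case by simp
next
  case (elem_step H I a b \<xi> K)
  note \<xi> = elem_step.hyps(4,5) and ab = elem_step.hyps(2,3)
  note s1 = elem_sqint[OF elem_step.hyps(1) t] elem_sqint[OF G t]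
    sqint_single[OF ab \<xi>, of t] sqint_single_int[OF ab \<xi> t]
  have "expectation (\<lambda>\<omega>. \<xi> \<omega> * (V (min t b) \<omega> - V (min t a) \<omega>) * J t \<omega>)
      = (\<integral>p. \<xi> (snd p) * indicator {a<..b} (fst p) * U G p \<partial>PP {0..t})"
    using G
  proof induction
    case elem_zero show ?case by simp
  next
    case (elem_step G J c d \<eta> L)
    note \<eta> = elem_step.hyps(4,5) and cd = elem_step.hyps(2,3)
    note s2 = elem_sqint[OF elem_step.hyps(1) t] sqint_single[OF cd \<eta>, of t] sqint_single_int[OF cd \<eta> t]
    show ?case
      using elem_step.IH inner_single[OF ab cd t \<xi> \<eta>] sqint_mult[OF s1(5) s2(1)]
        sqint_mult[OF s1(5) s2(3)] sqint_mult[OF s1(6) s2(2)] sqint_mult[OF s1(6) s2(4)]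
      unfolding distrib_left by simp
  qed
  then show ?case
    using elem_step.IH sqint_mult[OF s1(1) s1(3)] sqint_mult[OF s1(2) s1(4)]
      sqint_mult[OF s1(5) s1(3)] sqint_mult[OF s1(6) s1(4)]
    unfolding distrib_right by simp
qed

text \<open>The martingale property is phrased as orthogonality to square integrable variables known
  at \<open>s\<close>; this form needs no conditional expectations and passes to mean square limits.
  Between \<open>s\<close> and \<open>t\<close> a single step contributes either 0 or one increment
  of \<open>V\<close> that starts after both \<open>s\<close> and \<open>a\<close>, when \<xi> and
  \<open>Z\<close> are already known.\<close>

lemma elem_martingale:
  assumes "elem H I" and st: "0 \<le> s" "s \<le> t" and Z: "sqint M Z" "Z \<in> borel_measurable (F s)"
  shows "expectation (\<lambda>\<omega>. (I t \<omega> - I s \<omega>) * Z \<omega>) = 0"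
  using assms(1)
proof induction
  case elem_zero show ?case by simp
next
  case (elem_step H I a b \<xi> K)
  note \<xi> = elem_step.hyps(4,5) and ab = elem_step.hyps(2,3)
  have t: "0 \<le> t" using st by simp
  let ?D = "\<lambda>\<omega>. V (min t b) \<omega> - V (min t a) \<omega> - (V (min s b) \<omega> - V (min s a) \<omega>)"
  have cases: "?D = (\<lambda>_. 0) \<or> (\<exists>p q. a \<le> p \<and> s \<le> p \<and> p \<le> q \<and> ?D = (\<lambda>\<omega>. V q \<omega> - V p \<omega>))"
  proof (cases "t \<le> a \<or> b \<le> s")
    case True
    then have "?D = (\<lambda>_. 0)"
    proof
      assume "t \<le> a"
      then have "min t a = t" "min t b = t" "min s a = s" "min s b = s" using ab st by auto
      then show ?thesis by simp
    next
      assume "b \<le> s"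
      then have "min t a = a" "min t b = b" "min s a = a" "min s b = b" using ab st by auto
      then show ?thesis by simp
    qed
    then show ?thesis by simp
  next
    case False
    have "?D = (\<lambda>\<omega>. V (min t b) \<omega> - V (max s a) \<omega>)"
    proof (cases "s \<le> a")
      case True
      then have "min t a = a" "min s a = s" "min s b = s" "max s a = a" using False ab st by auto
      then show ?thesis by simp
    next
      case s: False
      then have "min t a = a" "min s a = a" "min s b = s" "max s a = s" using False ab st by auto
      then show ?thesis by simp
    qed
    moreover have "max s a \<le> min t b" using False ab st by auto
    ultimately show ?thesis by (intro disjI2 exI[of _ "max s a"] exI[of _ "min t b"]) auto
  qed
  have single: "expectation (\<lambda>\<omega>. \<xi> \<omega> * ?D \<omega> * Z \<omega>) = 0"
    using cases
  proof
    assume "?D = (\<lambda>_. 0)"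
    then have "?D \<omega> = 0" for \<omega> by meson
    then show ?thesis by simp
  next
    assume "\<exists>p q. a \<le> p \<and> s \<le> p \<and> p \<le> q \<and> ?D = (\<lambda>\<omega>. V q \<omega> - V p \<omega>)"
    then obtain p q where pq: "a \<le> p" "s \<le> p" "p \<le> q" and D: "?D = (\<lambda>\<omega>. V q \<omega> - V p \<omega>)" by blast
    have D: "?D \<omega> = V q \<omega> - V p \<omega>" for \<omega> using D by meson
    have m: "(\<lambda>\<omega>. \<xi> \<omega> * Z \<omega>) \<in> borel_measurable (F p)"
      by (intro borel_measurable_times F_measurable_mono[OF \<xi>(1) pq(1)] F_measurable_mono[OF Z(2) pq(2)])
    have "sqint M (\<lambda>\<omega>. \<xi> \<omega> * Z \<omega>)"
      by (rule sqint_bounded_mult[OF Z(1) F_measurable_M[OF \<xi>(1)] \<xi>(2)])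
    then have "expectation (\<lambda>\<omega>. \<xi> \<omega> * Z \<omega> * (V q \<omega> - V p \<omega>)) = 0"
      using pq st by (intro V_orthogonal[OF _ pq(3) m] sqint_integrable[OF finite_measure_axioms]) auto
    then show ?thesis unfolding D by (simp add: mult_ac)
  qed
  note sq = sqint_diff[OF elem_sqint(2)[OF elem_step.hyps(1) t] elem_sqint(2)[OF elem_step.hyps(1) st(1)]]
    sqint_diff[OF sqint_single_int[OF ab \<xi> t] sqint_single_int[OF ab \<xi> st(1)]]
  have "expectation (\<lambda>\<omega>. (I t \<omega> + \<xi> \<omega> * (V (min t b) \<omega> - V (min t a) \<omega>)
        - (I s \<omega> + \<xi> \<omega> * (V (min s b) \<omega> - V (min s a) \<omega>))) * Z \<omega>)
     = expectation (\<lambda>\<omega>. (I t \<omega> - I s \<omega>) * Z \<omega> +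
        (\<xi> \<omega> * (V (min t b) \<omega> - V (min t a) \<omega>) - \<xi> \<omega> * (V (min s b) \<omega> - V (min s a) \<omega>)) * Z \<omega>)"
    by (intro Bochner_Integration.integral_cong) (auto simp: algebra_simps)
  also have "\<dots> = expectation (\<lambda>\<omega>. (I t \<omega> - I s \<omega>) * Z \<omega>) +
       expectation (\<lambda>\<omega>. (\<xi> \<omega> * (V (min t b) \<omega> - V (min t a) \<omega>) - \<xi> \<omega> * (V (min s b) \<omega> - V (min s a) \<omega>)) * Z \<omega>)"
    by (rule Bochner_Integration.integral_add[OF sqint_mult[OF sq(1) Z(1)] sqint_mult[OF sq(2) Z(1)]])
  also have "\<dots> = 0"
    using elem_step.IH single by (simp add: right_diff_distrib)
  finally show ?case .
qed

section \<open>The Ito integral as a limit of elementary integrals\<close>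

text \<open>Compared with \<open>has_ito_integral\<close>, the approximating family is closed under
  linear combinations and is driven by the continuous modification \<open>V\<close>; linearity and
  the isometry then follow from the elementary case.\<close>

definition ito :: "(real \<Rightarrow> 'a \<Rightarrow> real) \<Rightarrow> real \<Rightarrow> ('a \<Rightarrow> real) \<Rightarrow> bool" where
  "ito \<phi> t Y \<longleftrightarrow> (\<exists>H I. (\<forall>k::nat. elem (H k) (I k)) \<and>
     L2conv (PP {0..t}) (\<lambda>k. U (H k)) (U \<phi>) \<and> L2conv M (\<lambda>k. I k t) Y)"

lemma ito_sqint:
  assumes "ito \<phi> t Y" shows "sqint (PP {0..t}) (U \<phi>)" "sqint M Y"
  using assms by (auto simp: ito_def L2conv_def)

lemma ito_inner:
  assumes "0 \<le> t" "ito \<phi> t Y" "ito \<psi> t Z"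
  shows "expectation (\<lambda>\<omega>. Y \<omega> * Z \<omega>) = (\<integral>p. U \<phi> p * U \<psi> p \<partial>PP {0..t})"
proof -
  obtain H I G J where
    1: "\<And>k. elem (H k) (I k)" "L2conv (PP {0..t}) (\<lambda>k. U (H k)) (U \<phi>)" "L2conv M (\<lambda>k. I k t) Y"
    and 2: "\<And>k. elem (G k) (J k)" "L2conv (PP {0..t}) (\<lambda>k. U (G k)) (U \<psi>)" "L2conv M (\<lambda>k. J k t) Z"
    using assms(2,3) unfolding ito_def by blast
  have "(\<lambda>k. expectation (\<lambda>\<omega>. I k t \<omega> * J k t \<omega>)) \<longlonglongrightarrow> (\<integral>p. U \<phi> p * U \<psi> p \<partial>PP {0..t})"
    unfolding elem_inner[OF 1(1) 2(1) assms(1)] by (rule L2conv_inner[OF 1(2) 2(2)])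
  then show ?thesis using L2conv_inner[OF 1(3) 2(3)] LIMSEQ_unique by blast
qed

lemma ito_isometry:
  "0 \<le> t \<Longrightarrow> ito \<phi> t Y \<Longrightarrow> expectation (\<lambda>\<omega>. (Y \<omega>)\<^sup>2) = (\<integral>p. (U \<phi> p)\<^sup>2 \<partial>PP {0..t})"
  using ito_inner[of t \<phi> Y \<phi> Y] by (simp add: power2_eq_square)

lemma ito_add:
  assumes "ito \<phi> t Y" "ito \<psi> t Z"
  shows "ito (\<lambda>s \<omega>. \<phi> s \<omega> + \<psi> s \<omega>) t (\<lambda>\<omega>. Y \<omega> + Z \<omega>)"
proof -
  obtain H I G J where
    1: "\<And>k. elem (H k) (I k)" "L2conv (PP {0..t}) (\<lambda>k. U (H k)) (U \<phi>)" "L2conv M (\<lambda>k. I k t) Y"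
    and 2: "\<And>k. elem (G k) (J k)" "L2conv (PP {0..t}) (\<lambda>k. U (G k)) (U \<psi>)" "L2conv M (\<lambda>k. J k t) Z"
    using assms unfolding ito_def by blast
  show ?thesis unfolding ito_def
    using elem_add[OF 1(1) 2(1)] L2conv_add[OF 1(2) 2(2)] L2conv_add[OF 1(3) 2(3)]
    by (intro exI[of _ "\<lambda>k t \<omega>. H k t \<omega> + G k t \<omega>"] exI[of _ "\<lambda>k t \<omega>. I k t \<omega> + J k t \<omega>"]) auto
qed

lemma ito_cmult:
  assumes "ito \<phi> t Y"
  shows "ito (\<lambda>s \<omega>. c * \<phi> s \<omega>) t (\<lambda>\<omega>. c * Y \<omega>)"
proof -
  obtain H I where
    1: "\<And>k. elem (H k) (I k)" "L2conv (PP {0..t}) (\<lambda>k. U (H k)) (U \<phi>)" "L2conv M (\<lambda>k. I k t) Y"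
    using assms unfolding ito_def by blast
  show ?thesis unfolding ito_def
    using elem_cmult[OF 1(1)] L2conv_cmult[OF 1(2)] L2conv_cmult[OF 1(3)]
    by (intro exI[of _ "\<lambda>k t \<omega>. c * H k t \<omega>"] exI[of _ "\<lambda>k t \<omega>. c * I k t \<omega>"]) auto
qed

lemma ito_diff:
  "ito \<phi> t Y \<Longrightarrow> ito \<psi> t Z \<Longrightarrow> ito (\<lambda>s \<omega>. \<phi> s \<omega> - \<psi> s \<omega>) t (\<lambda>\<omega>. Y \<omega> - Z \<omega>)"
  using ito_add[OF _ ito_cmult[of \<psi> t Z "-1"]] by simp

lemma elem_ito: "elem H I \<Longrightarrow> 0 \<le> t \<Longrightarrow> ito H t (I t)"
  unfolding ito_def
  by (intro exI[of _ "\<lambda>_. H"] exI[of _ "\<lambda>_. I"]) (auto intro!: L2conv_const elem_sqint)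

end

section \<open>Lebesgue differentiation along grid cells\<close>

text \<open>Lebesgue's differentiation theorem for the intervals \<open>[x, x + h]\<close>, applied
  to the reflected function \<open>g\<close>, yields averages to the left of
  \<open>t\<close>.\<close>

lemma lebesgue_left_average:
  fixes f :: "real \<Rightarrow> real"
  assumes f: "integrable lborel f"
  shows "AE t in lborel. \<forall>e>0. \<exists>d>0. \<forall>h. 0 < h \<and> h < d \<longrightarrow>
    \<bar>(LINT s:{t - h..t}|lborel. f s) - h * f t\<bar> \<le> e * h"
proof -
  define g where "g = (\<lambda>x. f (- x))"
  have gi: "integrable lborel g"
    using lborel_integrable_real_affine[OF f, of "-1" 0] by (simp add: g_def)
  have gs: "set_integrable lborel S g" if "S \<in> sets borel" for S
    unfolding set_integrable_def using gi that by (intro integrable_mult_indicator) auto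
  have gI: "g integrable_on cbox a b" for a b
    by (rule set_borel_integral_eq_integral(1)[OF gs]) simp
  obtain N where N: "negligible N" and Nd: "\<And>x e. \<lbrakk>x \<notin> N; 0 < e\<rbrakk> \<Longrightarrow>
      \<exists>d>0. \<forall>h. 0 < h \<and> h < d \<longrightarrow> norm (integral (cbox x (x + h *\<^sub>R One)) g /\<^sub>R h ^ DIM(real) - g x) < e"
    using integrable_ccontinuous_explicit[OF gI] by blast
  have "\<exists>N'\<in>null_sets lborel. N \<subseteq> N'"
    using N unfolding negligible_iff_null_sets null_sets_completion_iff2 .
  then obtain N' where N': "N' \<in> null_sets lborel" "N \<subseteq> N'" by blast
  \<comment> \<open>Reflection preserves Lebesgue measure, so \<open>- t\<close> avoids the
    exceptional set for almost every \<open>t\<close>.\<close>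
  have "AE x in distr lborel borel uminus. x \<notin> N'"
    using AE_not_in[OF N'(1)] unfolding lborel_distr_uminus .
  then have "AE t in lborel. - t \<notin> N'"
    by (subst (asm) AE_distr_iff) (use N' in \<open>auto simp: null_sets_def\<close>)
  then show ?thesis
  proof eventually_elim
    fix t :: real assume "- t \<notin> N'"
    then have t: "- t \<notin> N" using N' by auto
    show "\<forall>e>0. \<exists>d>0. \<forall>h. 0 < h \<and> h < d \<longrightarrow>
        \<bar>(LINT s:{t - h..t}|lborel. f s) - h * f t\<bar> \<le> e * h"
    proof (intro allI impI)
      fix e :: real assume "e > 0"
      from Nd[OF t this] obtain d where d: "d > 0" "\<And>h. 0 < h \<Longrightarrow> h < d \<Longrightarrow>
          norm (integral (cbox (- t) (- t + h *\<^sub>R One)) g /\<^sub>R h ^ DIM(real) - g (- t)) < e" by blast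
      show "\<exists>d>0. \<forall>h. 0 < h \<and> h < d \<longrightarrow> \<bar>(LINT s:{t - h..t}|lborel. f s) - h * f t\<bar> \<le> e * h"
      proof (intro exI[of _ d] conjI allI impI d(1))
        fix h assume h: "0 < h \<and> h < d"
        have "integral (cbox (- t) (- t + h *\<^sub>R One)) g = (LINT s:{- t..- t + h}|lborel. g s)"
          using set_borel_integral_eq_integral(2)[OF gs, of "{- t..- t + h}"] by simp
        also have "\<dots> = (LINT s:{s. - s \<in> {- t..- t + h}}|lborel. g (- s))"
          by (rule set_integral_reflect)
        also have "{s. - s \<in> {- t..- t + h}} = {t - h..t}" by auto
        finally have "integral (cbox (- t) (- t + h *\<^sub>R One)) g = (LINT s:{t - h..t}|lborel. f s)"
          by (simp add: g_def)
        with d(2)[of h] h have "\<bar>(LINT s:{t - h..t}|lborel. f s) / h - f t\<bar> < e"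
          by (simp add: g_def divide_inverse mult.commute)
        moreover have "\<bar>(LINT s:{t - h..t}|lborel. f s) - h * f t\<bar>
            = h * \<bar>(LINT s:{t - h..t}|lborel. f s) / h - f t\<bar>"
          using h by (simp add: abs_mult_pos[symmetric] field_simps flip: abs_mult_pos')
        ultimately show "\<bar>(LINT s:{t - h..t}|lborel. f s) - h * f t\<bar> \<le> e * h"
          using h by (simp add: mult.commute mult_left_mono)
      qed
    qed
  qed
qed

lemma set_integral_Icc_combine:
  fixes f :: "real \<Rightarrow> real"
  assumes "set_integrable lborel {a..c} f" "a \<le> b" "b \<le> c"
  shows "(LINT s:{a..c}|lborel. f s) = (LINT s:{a..b}|lborel. f s) + (LINT s:{b..c}|lborel. f s)"
proof -
  have i: "set_integrable lborel {a..b} f" "set_integrable lborel {b..c} f"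
    using assms by (auto intro: set_integrable_subset[OF assms(1)])
  show ?thesis
    unfolding set_borel_integral_eq_integral(2)[OF i(1)] set_borel_integral_eq_integral(2)[OF i(2)]
      set_borel_integral_eq_integral(2)[OF assms(1)]
    using assms set_borel_integral_eq_integral(1)[OF assms(1)]
    by (intro Henstock_Kurzweil_Integration.integral_combine[symmetric])
qed

text \<open>The index of the grid cell \<open>(i h, (i + 1) h]\<close> that contains \<open>t\<close>.\<close>

definition cell :: "real \<Rightarrow> real \<Rightarrow> nat" where
  "cell h t = nat (\<lceil>t / h\<rceil> - 1)"

lemma cell:
  assumes "h > 0" "t > 0"
  shows "real (cell h t) * h < t" "t \<le> real (Suc (cell h t)) * h"
    and "real j * h < t \<Longrightarrow> t \<le> real (Suc j) * h \<Longrightarrow> j = cell h t"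
proof -
  have pos: "\<lceil>t / h\<rceil> \<ge> 1" using assms by (simp add: less_ceiling_iff)
  then have r: "real (cell h t) = real_of_int \<lceil>t / h\<rceil> - 1" by (simp add: cell_def)
  have "real (cell h t) < t / h" "t / h \<le> real (Suc (cell h t))"
    using r ceiling_correct[of "t / h"] by linarith+
  then show "real (cell h t) * h < t" "t \<le> real (Suc (cell h t)) * h"
    using assms by (auto simp: field_simps)
  assume "real j * h < t" "t \<le> real (Suc j) * h"
  then have "real j < t / h" "t / h \<le> real j + 1"
    using assms by (auto simp: field_simps)
  then have "\<lceil>t / h\<rceil> = int j + 1" by (intro ceiling_unique) auto
  then show "j = cell h t" by (simp add: cell_def)
qed

text \<open>The previous cell \<open>[a, b]\<close> does not contain \<open>t\<close> but lies
  within two cell widths to its left. Its integral is the difference of the integrals over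
  \<open>[a, t]\<close> and \<open>[b, t]\<close>, and left differentiation at \<open>t\<close>
  applies to both.\<close>

lemma previous_cell_average_tendsto:
  fixes f :: "real \<Rightarrow> real"
  assumes f: "integrable lborel f" and T: "T > 0" and t: "t > 0"
    and left: "\<forall>e>0. \<exists>d>0. \<forall>h. 0 < h \<and> h < d \<longrightarrow>
      \<bar>(LINT s:{t - h..t}|lborel. f s) - h * f t\<bar> \<le> e * h"
  defines "h \<equiv> \<lambda>n::nat. T / real (Suc n)"
  shows "(\<lambda>n. ((LINT s:{0..real (cell (h n) t) * h n}|lborel. f s)
      - (LINT s:{0..real (cell (h n) t - 1) * h n}|lborel. f s)) / h n) \<longlonglongrightarrow> f t"
    and "\<forall>\<^sub>F n in sequentially. cell (h n) t \<noteq> 0"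
proof -
  have fs: "set_integrable lborel S f" if "S \<in> sets borel" for S
    unfolding set_integrable_def using f that by (intro integrable_mult_indicator) auto
  have hpos: "h n > 0" for n using T by (simp add: h_def)
  have h0: "h \<longlonglongrightarrow> 0" unfolding h_def
    using tendsto_mult_right_zero[OF LIMSEQ_inverse_real_of_nat, of T] by (simp add: divide_inverse)
  have small: "\<forall>\<^sub>F n in sequentially. h n < d" if "d > 0" for d
    using order_tendstoD(2)[OF h0 that] .
  have cell1: "cell (h n) t \<noteq> 0" if "h n < t" for n
    using cell(2)[OF hpos t, of n] that by (intro notI) simp
  show "\<forall>\<^sub>F n in sequentially. cell (h n) t \<noteq> 0"
    using small[OF t] by eventually_elim (rule cell1)
  show "(\<lambda>n. ((LINT s:{0..real (cell (h n) t) * h n}|lborel. f s)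
      - (LINT s:{0..real (cell (h n) t - 1) * h n}|lborel. f s)) / h n) \<longlonglongrightarrow> f t"
  proof (rule tendstoI)
    fix e :: real assume e: "e > 0"
    \<comment> \<open>The two intervals have lengths at most \<open>2 h\<close> and
      \<open>h\<close>, so \<open>e / 4\<close> leaves a total error of
      \<open>3 / 4 * e * h\<close>; both lengths stay below \<open>d\<close> once
      \<open>h < d / 2\<close>.\<close>
    then have "e / 4 > 0" by simp
    with left obtain d where d: "d > 0"
      "\<And>k. 0 < k \<Longrightarrow> k < d \<Longrightarrow> \<bar>(LINT s:{t - k..t}|lborel. f s) - k * f t\<bar> \<le> e / 4 * k" by blast
    have "\<forall>\<^sub>F n in sequentially. h n < min t (d / 2)"
      using d(1) t by (intro small) auto
    then show "\<forall>\<^sub>F n in sequentially. dist (((LINT s:{0..real (cell (h n) t) * h n}|lborel. f s)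
      - (LINT s:{0..real (cell (h n) t - 1) * h n}|lborel. f s)) / h n) (f t) < e"
    proof eventually_elim
      fix n assume n: "h n < min t (d / 2)"
      define b where "b = real (cell (h n) t) * h n"
      define a where "a = real (cell (h n) t - 1) * h n"
      have ab: "b = a + h n"
      proof -
        have "real (cell (h n) t) = real (cell (h n) t - 1) + 1" using cell1[of n] n by simp
        then show ?thesis unfolding a_def b_def by (simp only: distrib_right mult_1)
      qed
      have a0: "a \<ge> 0" using hpos[of n] by (simp add: a_def)
      have bt: "b < t" "t \<le> b + h n"
        using cell(1,2)[OF hpos t, of n] by (auto simp: b_def algebra_simps)
      have G: "(LINT s:{0..t}|lborel. f s) = (LINT s:{0..c}|lborel. f s) + (LINT s:{c..t}|lborel. f s)"
        if "0 \<le> c" "c \<le> t" for c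
        by (rule set_integral_Icc_combine[OF fs that]) simp
      have "(LINT s:{0..b}|lborel. f s) - (LINT s:{0..a}|lborel. f s)
          = (LINT s:{a..t}|lborel. f s) - (LINT s:{b..t}|lborel. f s)"
        using G[of a] G[of b] a0 ab bt hpos[of n] by linarith
      moreover have "\<bar>(LINT s:{a..t}|lborel. f s) - (t - a) * f t\<bar> \<le> e / 4 * (t - a)"
        using d(2)[of "t - a"] bt ab n hpos[of n] by simp
      moreover have "\<bar>(LINT s:{b..t}|lborel. f s) - (t - b) * f t\<bar> \<le> e / 4 * (t - b)"
        using d(2)[of "t - b"] bt ab n hpos[of n] by simp
      moreover have "(t - a) * f t - (t - b) * f t = h n * f t" using ab by (simp add: algebra_simps)
      moreover have "e / 4 * (t - a) \<le> e / 4 * (2 * h n)" "e / 4 * (t - b) \<le> e / 4 * h n"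
        using e bt ab by (auto intro!: mult_left_mono)
      ultimately have "\<bar>(LINT s:{0..b}|lborel. f s) - (LINT s:{0..a}|lborel. f s) - h n * f t\<bar>
          \<le> e / 4 * (2 * h n) + e / 4 * h n" by linarith
      also have "\<dots> < e * h n" using e hpos[of n] by (simp add: field_simps)
      finally have "\<bar>((LINT s:{0..b}|lborel. f s) - (LINT s:{0..a}|lborel. f s) - h n * f t) / h n\<bar> < e"
        using hpos[of n] by (simp add: field_simps)
      then show "dist (((LINT s:{0..real (cell (h n) t) * h n}|lborel. f s)
          - (LINT s:{0..real (cell (h n) t - 1) * h n}|lborel. f s)) / h n) (f t) < e"
        using hpos[of n] unfolding a_def b_def dist_real_def by (simp add: diff_divide_distrib)
    qed
  qed
qed

section \<open>Progressively measurable processes\<close>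

context brownian
begin

abbreviation prog :: "(real \<Rightarrow> 'a \<Rightarrow> real) \<Rightarrow> bool" where
  "prog \<equiv> prog_measurable F"

abbreviation RF :: "real \<Rightarrow> (real \<times> 'a) measure" where
  "RF T \<equiv> restrict_space borel {0..T} \<Otimes>\<^sub>M F T"

lemma prog_iff: "prog \<phi> \<longleftrightarrow> (\<forall>T\<ge>0. U \<phi> \<in> borel_measurable (RF T))"
  by (simp add: prog_measurable_def case_prod_beta')

lemma progI: "(\<And>T. 0 \<le> T \<Longrightarrow> U \<phi> \<in> borel_measurable (RF T)) \<Longrightarrow> prog \<phi>"
  by (simp add: prog_iff)

lemma progD: "prog \<phi> \<Longrightarrow> 0 \<le> T \<Longrightarrow> U \<phi> \<in> borel_measurable (RF T)"
  by (simp add: prog_iff)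

lemma space_RF [simp]: "space (RF T) = {0..T} \<times> space M"
  by (simp add: space_pair_measure space_restrict_space)

lemma prog_PP:
  assumes "prog \<phi>" "0 \<le> T"
  shows "U \<phi> \<in> borel_measurable (PP {0..T})"
proof -
  have "(\<lambda>p. p) \<in> measurable (PP {0..T}) (RF T)"
  proof (rule measurable_pair)
    have "fst \<in> measurable (PP {0..T}) (restrict_space lborel {0..T})"
      unfolding PP_def by (rule measurable_fst)
    then show "fst \<circ> (\<lambda>p. p) \<in> measurable (PP {0..T}) (restrict_space borel {0..T})"
      unfolding comp_def measurable_cong_sets[OF refl sets_restrict_lborel] .
    have "snd \<in> measurable (PP {0..T}) M" unfolding PP_def by (rule measurable_snd)
    then show "snd \<circ> (\<lambda>p. p) \<in> measurable (PP {0..T}) (F T)"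
      unfolding comp_def measurable_def using sets_F_le[of T] by auto
  qed
  from measurable_compose[OF this progD[OF assms]] show ?thesis .
qed

lemma prog_adapted:
  assumes "prog \<phi>" "0 \<le> t"
  shows "\<phi> t \<in> borel_measurable (F t)"
proof -
  have "(\<lambda>\<omega>. (t, \<omega>)) \<in> measurable (F t) (RF t)"
    using assms(2) by (intro measurable_Pair1') (simp add: space_restrict_space)
  from measurable_compose[OF this progD[OF assms]] show ?thesis by simp
qed

lemma prog_path:
  assumes "prog \<phi>" "0 \<le> T" "\<omega> \<in> space M"
  shows "(\<lambda>s. \<phi> s \<omega>) \<in> borel_measurable (restrict_space borel {0..T})"
    and "(\<lambda>s. indicator {0..T} s * \<phi> s \<omega>) \<in> borel_measurable borel"
proof -
  have "(\<lambda>s. (s, \<omega>)) \<in> measurable (restrict_space borel {0..T}) (RF T)"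
    using assms(3) by (intro measurable_Pair2') simp
  from measurable_compose[OF this progD[OF assms(1,2)]]
  show 1: "(\<lambda>s. \<phi> s \<omega>) \<in> borel_measurable (restrict_space borel {0..T})" by simp
  then show "(\<lambda>s. indicator {0..T} s * \<phi> s \<omega>) \<in> borel_measurable borel"
    by (subst (asm) borel_measurable_restrict_space_iff) auto
qed

lemma prog_compose2:
  assumes "prog \<phi>" "prog \<psi>" "(\<lambda>(x, y). f x y) \<in> borel_measurable (borel \<Otimes>\<^sub>M borel)"
  shows "prog (\<lambda>t \<omega>. f (\<phi> t \<omega>) (\<psi> t \<omega>))"
proof (rule progI)
  fix T :: real assume T: "0 \<le> T"
  have "(\<lambda>p. (U \<phi> p, U \<psi> p)) \<in> measurable (RF T) (borel \<Otimes>\<^sub>M borel)"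
    by (intro measurable_Pair progD[OF assms(1) T] progD[OF assms(2) T])
  from measurable_compose[OF this assms(3)]
  show "U (\<lambda>t \<omega>. f (\<phi> t \<omega>) (\<psi> t \<omega>)) \<in> borel_measurable (RF T)" by simp
qed

lemma prog_add: "prog \<phi> \<Longrightarrow> prog \<psi> \<Longrightarrow> prog (\<lambda>t \<omega>. \<phi> t \<omega> + \<psi> t \<omega>)"
  by (rule prog_compose2[where f="(+)"]) auto

lemma prog_diff: "prog \<phi> \<Longrightarrow> prog \<psi> \<Longrightarrow> prog (\<lambda>t \<omega>. \<phi> t \<omega> - \<psi> t \<omega>)"
  by (rule prog_compose2[where f="(-)"]) auto

lemma prog_cmult: "prog \<phi> \<Longrightarrow> prog (\<lambda>t \<omega>. c * \<phi> t \<omega>)"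
  by (rule prog_compose2[where f="\<lambda>x _. c * x"]) auto

lemma prog_const: "prog (\<lambda>_ _. c)"
  by (rule progI) simp

lemma prog_clip: "prog \<phi> \<Longrightarrow> prog (\<lambda>t \<omega>. max (- K) (min K (\<phi> t \<omega>)))"
  by (rule prog_compose2[where f="\<lambda>x _. max (- K) (min K x)"]) auto

lemma prog_lim:
  assumes "\<And>n. prog (\<phi> n)"
  shows "prog (\<lambda>t \<omega>. lim (\<lambda>n. \<phi> n t \<omega>))"
  by (rule progI, rule borel_measurable_lim_metric, rule progD[OF assms])

text \<open>Time is rounded up to the grid of mesh \<open>1 / (n + 1)\<close> and cut at
  \<open>T\<close>. Continuity gives convergence. For fixed \<open>n\<close> only countably many
  times occur, and since the cut keeps them below \<open>T\<close>, the value at each of them is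
  known at \<open>T\<close>.\<close>

lemma prog_continuous:
  assumes ad: "\<And>t. 0 \<le> t \<Longrightarrow> X t \<in> borel_measurable (F t)"
    and cont: "\<And>\<omega>. \<omega> \<in> space M \<Longrightarrow> continuous_on {0..} (\<lambda>t. X t \<omega>)"
  shows "prog X"
proof (rule progI)
  fix T :: real assume T: "0 \<le> T"
  define r where "r n t = min T (real (nat \<lceil>real (Suc n) * t\<rceil>) / real (Suc n))" for n :: nat and t :: real
  show "U X \<in> borel_measurable (RF T)"
  proof (rule borel_measurable_LIMSEQ_real)
    fix p :: "real \<times> 'a" assume p: "p \<in> space (RF T)"
    then have t: "0 \<le> fst p" "fst p \<le> T" and \<omega>: "snd p \<in> space M" by auto
    have "(\<lambda>n. r n (fst p)) \<longlonglongrightarrow> min T (fst p)"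
      unfolding r_def
    proof (rule tendsto_min[OF tendsto_const])
      have lo: "fst p \<le> real (nat \<lceil>real (Suc n) * fst p\<rceil>) / real (Suc n)"
        and hi: "real (nat \<lceil>real (Suc n) * fst p\<rceil>) / real (Suc n) \<le> fst p + 1 / real (Suc n)" for n
      proof -
        have nn: "0 \<le> real (Suc n) * fst p" using t by simp
        then have e: "real (nat \<lceil>real (Suc n) * fst p\<rceil>) = of_int \<lceil>real (Suc n) * fst p\<rceil>"
          by (simp add: of_nat_nat)
        show "fst p \<le> real (nat \<lceil>real (Suc n) * fst p\<rceil>) / real (Suc n)"
          unfolding e using le_of_int_ceiling[of "real (Suc n) * fst p"]
          by (subst pos_le_divide_eq) (auto simp: mult.commute)
        have "of_int \<lceil>real (Suc n) * fst p\<rceil> \<le> real (Suc n) * fst p + 1"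
          using of_int_ceiling_le_add_one by blast
        then have "of_int \<lceil>real (Suc n) * fst p\<rceil> / real (Suc n) \<le> (real (Suc n) * fst p + 1) / real (Suc n)"
          by (intro divide_right_mono) auto
        then show "real (nat \<lceil>real (Suc n) * fst p\<rceil>) / real (Suc n) \<le> fst p + 1 / real (Suc n)"
          unfolding e by (simp add: add_divide_distrib)
      qed
      have "(\<lambda>n. fst p + 1 / real (Suc n)) \<longlonglongrightarrow> fst p + 0"
        by (intro tendsto_add tendsto_const lim_1_over_n[THEN LIMSEQ_Suc])
      then show "(\<lambda>n. real (nat \<lceil>real (Suc n) * fst p\<rceil>) / real (Suc n)) \<longlonglongrightarrow> fst p"
        using tendsto_sandwich[OF always_eventually always_eventually tendsto_const, of "fst p"
            "\<lambda>n. real (nat \<lceil>real (Suc n) * fst p\<rceil>) / real (Suc n)" "\<lambda>n. fst p + 1 / real (Suc n)"] lo hi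
        by simp
    qed
    then have r: "(\<lambda>n. r n (fst p)) \<longlonglongrightarrow> fst p" using t by (simp only: min_absorb2)
    have r0: "r n (fst p) \<in> {0..}" for n using T by (simp add: r_def)
    show "(\<lambda>n. X (r n (fst p)) (snd p)) \<longlonglongrightarrow> X (fst p) (snd p)"
      by (rule continuous_on_tendsto_compose[OF cont[OF \<omega>] r]) (use t r0 in auto)
  next
    fix n
    show "(\<lambda>p. X (r n (fst p)) (snd p)) \<in> borel_measurable (RF T)"
      unfolding r_def
    proof (rule measurable_compose_countable[where g="\<lambda>p. nat \<lceil>real (Suc n) * fst p\<rceil>"
          and f="\<lambda>i p. X (min T (real i / real (Suc n))) (snd p)"])
      fix i :: nat
      have "X (min T (real i / real (Suc n))) \<in> borel_measurable (F T)"
        using T by (intro F_measurable_mono[OF ad]) auto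
      then show "(\<lambda>p. X (min T (real i / real (Suc n))) (snd p)) \<in> borel_measurable (RF T)"
        by (rule measurable_compose[OF measurable_snd])
    next
      have "fst \<in> borel_measurable (RF T)"
        by (rule measurable_compose[OF measurable_fst, of "\<lambda>x. x", OF measurable_restrict_space1]) simp
      then have "(\<lambda>p. \<lceil>real (Suc n) * fst p\<rceil>) \<in> measurable (RF T) (count_space UNIV)"
        by (intro measurable_compose[OF _ measurable_real_ceiling] borel_measurable_times) auto
      then show "(\<lambda>p. nat \<lceil>real (Suc n) * fst p\<rceil>) \<in> measurable (RF T) (count_space UNIV)"
        by (rule measurable_compose) simp
    qed
  qed
qed

text \<open>On a fixed horizon the moving upper limit becomes the condition \<open>s \<le> t\<close>
  in an integral over all of \<open>[0, T]\<close>, whose measurability in the parameters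
  \<open>(t, \<omega>)\<close> belongs to Fubini's theorem.\<close>

lemma prog_integral:
  assumes "prog \<phi>"
  shows "prog (\<lambda>t \<omega>. LINT s:{0..t}|lborel. \<phi> s \<omega>)"
proof (rule progI)
  fix T :: real assume T: "0 \<le> T"
  let ?R = "restrict_space lborel {0..T}"
  interpret R: sigma_finite_measure ?R by (rule sigma_finite_restrict_lborel) simp
  have idR: "(\<lambda>x. x) \<in> borel_measurable ?R"
    by (rule measurable_restrict_space1) simp
  have m: "(\<lambda>q. (snd q, snd (fst q))) \<in> measurable (RF T \<Otimes>\<^sub>M ?R) (RF T)"
  proof (rule measurable_Pair)
    have "snd \<in> measurable (RF T \<Otimes>\<^sub>M ?R) ?R" by (rule measurable_snd)
    then show "(\<lambda>q. snd q) \<in> measurable (RF T \<Otimes>\<^sub>M ?R) (restrict_space borel {0..T})"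
      unfolding measurable_cong_sets[OF refl sets_restrict_lborel] .
    show "(\<lambda>q. snd (fst q)) \<in> measurable (RF T \<Otimes>\<^sub>M ?R) (F T)"
      by (rule measurable_compose[OF measurable_fst measurable_snd])
  qed
  have p: "(\<lambda>q. \<phi> (snd q) (snd (fst q))) \<in> borel_measurable (RF T \<Otimes>\<^sub>M ?R)"
    using measurable_compose[OF m progD[OF assms T]] by simp
  have m1: "(\<lambda>q. fst (fst q)) \<in> borel_measurable (RF T \<Otimes>\<^sub>M ?R)"
    by (rule measurable_compose[OF measurable_fst], rule measurable_compose[OF measurable_fst],
        rule measurable_restrict_space1) simp
  have m2: "(\<lambda>q. snd q) \<in> borel_measurable (RF T \<Otimes>\<^sub>M ?R)"
    by (rule measurable_compose[OF measurable_snd idR])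
  have "(\<lambda>q. if snd q \<le> fst (fst q) then \<phi> (snd q) (snd (fst q)) else 0) \<in> borel_measurable (RF T \<Otimes>\<^sub>M ?R)"
    by (rule measurable_If[OF p measurable_const borel_measurable_le[OF m2 m1]]) simp
  then have "(\<lambda>p. \<integral>s. (if s \<le> fst p then \<phi> s (snd p) else 0) \<partial>?R) \<in> borel_measurable (RF T)"
    by (intro R.borel_measurable_lebesgue_integral) (simp add: case_prod_beta')
  then show "U (\<lambda>t \<omega>. LINT s:{0..t}|lborel. \<phi> s \<omega>) \<in> borel_measurable (RF T)"
  proof (rule measurable_cong[THEN iffD1, rotated])
    fix p :: "real \<times> 'a" assume "p \<in> space (RF T)"
    then have p: "0 \<le> fst p" "fst p \<le> T" by auto
    show "(\<integral>s. (if s \<le> fst p then \<phi> s (snd p) else 0) \<partial>?R) = (LINT s:{0..fst p}|lborel. \<phi> s (snd p))"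
      unfolding set_lebesgue_integral_def
      by (subst integral_restrict_space) (use p in \<open>auto intro!: Bochner_Integration.integral_cong simp: indicator_def\<close>)
  qed
qed

section \<open>Simple integrands are dense\<close>

text \<open>
  A process is discretised by its averages over the \<^emph>\<open>previous\<close> grid cell, which are known at the left
  end point of the current one.
\<close>

definition grid :: "real \<Rightarrow> nat \<Rightarrow> nat \<Rightarrow> real" where
  "grid T n i = real i * (T / real (Suc n))"

text \<open>The average is written as a difference of integrals from 0, so that
  \<open>prog_integral\<close> gives its measurability. The clip yields the bound \<open>K\<close>
  without any argument about the paths and disappears in the limit when the process itself is
  bounded by \<open>K\<close>. The first cell has no predecessor; its value 0 is invisible in the
  limit, since each \<open>t > 0\<close> eventually lies in a later cell.\<close>

definition grid_average :: "(real \<Rightarrow> 'a \<Rightarrow> real) \<Rightarrow> real \<Rightarrow> real \<Rightarrow> nat \<Rightarrow> nat \<Rightarrow> 'a \<Rightarrow> real" where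
  "grid_average \<phi> K T n i \<omega> = (if i = 0 then 0 else max (- K) (min K
     (((LINT s:{0..grid T n i}|lborel. \<phi> s \<omega>) - (LINT s:{0..grid T n (i - 1)}|lborel. \<phi> s \<omega>)) / (T / real (Suc n)))))"

lemma grid_average_bound: "0 \<le> K \<Longrightarrow> \<bar>grid_average \<phi> K T n i \<omega>\<bar> \<le> K"
  by (auto simp: grid_average_def)

lemma grid_average_simple:
  assumes "prog \<phi>" "0 \<le> K" "T > 0"
  shows "simple_integrand M F (Suc n) (grid T n) (grid_average \<phi> K T n)"
  unfolding simple_integrand_def
proof (intro conjI allI impI)
  show "0 \<le> grid T n 0" by (simp add: grid_def)
  fix i
  show "grid T n i \<le> grid T n (Suc i)"
    unfolding grid_def using assms by (intro mult_right_mono) auto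
  show "bounded (grid_average \<phi> K T n i ` space M)"
    using grid_average_bound[OF assms(2)] by (auto simp: bounded_iff intro!: exI[of _ K])
  have ge: "0 \<le> grid T n j" for j using assms by (simp add: grid_def)
  have "(\<lambda>\<omega>. LINT s:{0..grid T n j}|lborel. \<phi> s \<omega>) \<in> borel_measurable (F (grid T n i))" if "j \<le> i" for j
  proof (rule F_measurable_mono[OF prog_adapted[OF prog_integral[OF assms(1)] ge]])
    show "grid T n j \<le> grid T n i"
      unfolding grid_def using that assms by (intro mult_right_mono) auto
  qed
  then show "grid_average \<phi> K T n i \<in> borel_measurable (F (grid T n i))"
    unfolding grid_average_def[abs_def] by (cases "i = 0") (auto intro!: borel_measurable_max borel_measurable_min)
qed

lemma grid_process_eq:
  assumes "T > 0" "0 < t" "t \<le> T"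
  shows "simple_process (Suc n) (grid T n) \<xi> t \<omega> = \<xi> (cell (T / real (Suc n)) t) \<omega>"
proof -
  let ?h = "T / real (Suc n)" and ?i = "cell (T / real (Suc n)) t"
  have h: "?h > 0" using assms by simp
  have eq: "indicator {grid T n j<..grid T n (Suc j)} t = (if j = ?i then 1 else 0 :: real)" for j
  proof (cases "j = ?i")
    case True
    then show ?thesis using cell(1,2)[OF h assms(2)] by (simp add: grid_def indicator_def)
  next
    case False
    then have "\<not> (real j * ?h < t \<and> t \<le> real (Suc j) * ?h)" using cell(3)[OF h assms(2)] by blast
    then show ?thesis using False by (auto simp: grid_def indicator_def)
  qed
  have "real ?i * ?h < real (Suc n) * ?h" using cell(1)[OF h assms(2)] assms(3) by simp
  then have "?i < Suc n" using h by (simp only: mult_less_cancel_right_pos of_nat_less_iff)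
  then show ?thesis unfolding simple_process_def eq by (simp add: sum.delta if_distrib cong: if_cong)
qed

lemma grid_process_bound:
  assumes "T > 0" "0 \<le> t" "t \<le> T" "0 \<le> K"
  shows "\<bar>simple_process (Suc n) (grid T n) (grid_average \<phi> K T n) t \<omega>\<bar> \<le> K"
proof (cases "t = 0")
  case True
  have "indicator {grid T n j<..grid T n (Suc j)} t = (0 :: real)" for j
    using assms True by (simp add: grid_def indicator_def not_less)
  then show ?thesis using assms by (simp add: simple_process_def)
next
  case False
  then have "0 < t" using assms(2) by simp
  then show ?thesis
    by (subst grid_process_eq[OF assms(1) _ assms(3)]) (use grid_average_bound[OF assms(4)] in auto)
qed


section \<open>Restriction of the time interval, and simple integrands as elementary
  processes\<close>

lemma PP_identity:
  assumes "I \<subseteq> J"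
  shows "(\<lambda>p. p) \<in> measurable (PP I) (PP J)"
proof -
  have "fst \<in> borel_measurable (PP I)"
    using measurable_fst_PP[of "\<lambda>x. x" I] by simp
  then have "fst \<in> measurable (PP I) lborel" by simp
  then have 1: "fst \<in> measurable (PP I) (restrict_space lborel J)"
    using assms by (intro measurable_restrict_space2) auto
  have 2: "snd \<in> measurable (PP I) M" unfolding PP_def by (rule measurable_snd)
  have "(\<lambda>p. (fst p, snd p)) \<in> measurable (PP I) (PP J)"
    unfolding PP_def[of J] by (rule measurable_Pair[OF 1 2])
  then show ?thesis unfolding prod.collapse .
qed

lemma PP_measurable_mono: "I \<subseteq> J \<Longrightarrow> f \<in> borel_measurable (PP J) \<Longrightarrow> f \<in> borel_measurable (PP I)"
  by (rule measurable_compose[OF PP_identity])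

lemma PP_nn_mono:
  assumes "I \<subseteq> J" "I \<in> sets borel" "J \<in> sets borel" "f \<in> borel_measurable (PP J)"
  shows "(\<integral>\<^sup>+p. f p \<partial>PP I) \<le> (\<integral>\<^sup>+p. f p \<partial>PP J)"
  unfolding nn_integral_PP(1)[OF assms(2) PP_measurable_mono[OF assms(1,4)]] nn_integral_PP(1)[OF assms(3,4)]
  by (intro nn_integral_mono) (use assms(1) in \<open>auto simp: indicator_def\<close>)

lemma sqint_PP_mono:
  assumes "I \<subseteq> J" "I \<in> sets borel" "J \<in> sets borel" "sqint (PP J) f"
  shows "sqint (PP I) f" "(\<integral>p. (f p)\<^sup>2 \<partial>PP I) \<le> (\<integral>p. (f p)\<^sup>2 \<partial>PP J)"
proof -
  have m: "f \<in> borel_measurable (PP I)" "f \<in> borel_measurable (PP J)"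
    using PP_measurable_mono[OF assms(1)] assms(4) by (auto simp: sqint_def)
  have le: "(\<integral>\<^sup>+p. ennreal ((f p)\<^sup>2) \<partial>PP I) \<le> (\<integral>\<^sup>+p. ennreal ((f p)\<^sup>2) \<partial>PP J)"
    by (rule PP_nn_mono[OF assms(1-3) measurable_ennreal_sq[OF m(2)]])
  show 1: "sqint (PP I) f"
    using le assms(4) sqint_iff_nn[OF m(1)] sqint_iff_nn[OF m(2)] by (auto intro: le_less_trans)
  show "(\<integral>p. (f p)\<^sup>2 \<partial>PP I) \<le> (\<integral>p. (f p)\<^sup>2 \<partial>PP J)"
    using le unfolding nn_sqint[OF 1] nn_sqint[OF assms(4)] by (simp add: ennreal_le_iff)
qed

lemma sq_norm_on_mono: "I \<subseteq> J \<Longrightarrow> sq_norm_on M I \<phi> \<le> sq_norm_on M J \<phi>"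
  unfolding sq_norm_on_def by (intro nn_integral_mono) (auto simp: indicator_def)

lemma PP_path_measurable:
  assumes "f \<in> borel_measurable (PP I)" "\<omega> \<in> space M"
  shows "(\<lambda>t. f (t, \<omega>)) \<in> borel_measurable (restrict_space lborel I)"
  using assms measurable_compose[OF measurable_Pair2'[of \<omega> M "restrict_space lborel I"]]
  unfolding PP_def by blast

lemma sq_norm_on_restrict:
  assumes "I \<in> sets borel"
  shows "sq_norm_on M I \<phi> = (\<integral>\<^sup>+\<omega>. (\<integral>\<^sup>+t. ennreal ((\<phi> t \<omega>)\<^sup>2) \<partial>restrict_space lborel I) \<partial>M)"
  unfolding sq_norm_on_def using assms by (subst nn_integral_restrict_space) auto

text \<open>\<open>0 \<le> \<tau> n\<close> is carried through the induction because
  \<open>elem_step\<close> asks for a nonnegative left end point, whereas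
  \<open>simple_integrand\<close> states this only for \<open>\<tau> 0\<close>.\<close>

lemma simple_integrand_elem_nonneg:
  "simple_integrand M F n \<tau> \<xi> \<Longrightarrow> elem (simple_process n \<tau> \<xi>) (simple_ito V n \<tau> \<xi>) \<and> 0 \<le> \<tau> n"
proof (induction n)
  case 0
  have "simple_process 0 \<tau> \<xi> = (\<lambda>_ _. 0)" "simple_ito V 0 \<tau> \<xi> = (\<lambda>_ _. 0)"
    by (auto simp: simple_process_def simple_ito_def fun_eq_iff)
  then show ?case using 0 elem_zero by (simp add: simple_integrand_def)
next
  case (Suc n)
  then have "simple_integrand M F n \<tau> \<xi>" by (simp add: simple_integrand_def)
  with Suc.IH have IH: "elem (simple_process n \<tau> \<xi>) (simple_ito V n \<tau> \<xi>)" "0 \<le> \<tau> n" by auto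
  have n: "\<tau> n \<le> \<tau> (Suc n)" "\<xi> n \<in> borel_measurable (F (\<tau> n))" "bounded (\<xi> n ` space M)"
    using Suc.prems by (auto simp: simple_integrand_def)
  obtain K where K: "\<bar>\<xi> n \<omega>\<bar> \<le> K" if "\<omega> \<in> space M" for \<omega>
    using n(3) by (auto simp: bounded_iff)
  have "simple_process (Suc n) \<tau> \<xi> = (\<lambda>t \<omega>. simple_process n \<tau> \<xi> t \<omega> + \<xi> n \<omega> * indicator {\<tau> n<..\<tau> (Suc n)} t)"
    by (auto simp: simple_process_def fun_eq_iff)
  moreover have "simple_ito V (Suc n) \<tau> \<xi> = (\<lambda>t \<omega>. simple_ito V n \<tau> \<xi> t \<omega> +
      \<xi> n \<omega> * (V (min t (\<tau> (Suc n))) \<omega> - V (min t (\<tau> n)) \<omega>))"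
    by (auto simp: simple_ito_def fun_eq_iff)
  ultimately show ?case
    using elem_step[OF IH n(1,2) K] IH(2) n(1) by simp
qed

lemma simple_integrand_elem:
  "simple_integrand M F n \<tau> \<xi> \<Longrightarrow> elem (simple_process n \<tau> \<xi>) (simple_ito V n \<tau> \<xi>)"
  using simple_integrand_elem_nonneg by blast

lemma simple_ito_V_eq_W: "AE \<omega> in M. \<forall>t. simple_ito V n \<tau> \<xi> t \<omega> = simple_ito W n \<tau> \<xi> t \<omega>"
  using V_eq_W by eventually_elim (simp add: simple_ito_def)

text \<open>Dominated convergence is used twice: along each path, where the averages over the
  previous cell converge for almost every \<open>t\<close>, and then over \<omega>. Boundedness by
  \<open>K\<close> provides constant dominating functions on the finite horizon.\<close>

lemma grid_average_converges:
  assumes \<phi>: "prog \<phi>" and K: "0 \<le> K" "\<And>t \<omega>. \<bar>\<phi> t \<omega>\<bar> \<le> K" and T: "T > 0"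
  shows "(\<lambda>n. sq_norm_on M {0..T} (\<lambda>t \<omega>. simple_process (Suc n) (grid T n) (grid_average \<phi> K T n) t \<omega> - \<phi> t \<omega>))
    \<longlonglongrightarrow> 0"
proof -
  define D where "D n t \<omega> = simple_process (Suc n) (grid T n) (grid_average \<phi> K T n) t \<omega> - \<phi> t \<omega>" for n t \<omega>
  let ?R = "restrict_space lborel {0..T}"
  interpret R: sigma_finite_measure ?R by (rule sigma_finite_restrict_lborel) simp
  have emR: "emeasure ?R (space ?R) = ennreal T"
    using T by (simp add: emeasure_restrict_space space_restrict_space)
  have Dm: "U (D n) \<in> borel_measurable (PP {0..T})" for n
    unfolding D_def using T
    by (intro borel_measurable_diff prog_PP[OF \<phi>]
        sqint_measurable[OF elem_sqint(1)[OF simple_integrand_elem[OF grid_average_simple[OF \<phi> K(1) T]]]]) auto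
  have Db: "(D n t \<omega>)\<^sup>2 \<le> (2 * K)\<^sup>2" if "t \<in> {0..T}" for n t \<omega>
  proof -
    have "\<bar>D n t \<omega>\<bar> \<le> 2 * K"
      using grid_process_bound[OF T, of t K n \<phi> \<omega>] K(1) K(2)[of t \<omega>] that by (simp add: D_def)
    then show ?thesis using power_mono[OF _ abs_ge_zero, of "D n t \<omega>" "2 * K" 2] by simp
  qed
  have inner: "(\<lambda>n. \<integral>\<^sup>+t. ennreal ((D n t \<omega>)\<^sup>2) \<partial>?R) \<longlonglongrightarrow> 0" if \<omega>: "\<omega> \<in> space M" for \<omega>
  proof -
    \<comment> \<open>The path is set to 0 outside \<open>[0, T]\<close> to be integrable on the
      whole line; the cells involved lie inside \<open>[0, T]\<close>, so their averages do not
      change.\<close>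
    define f where "f s = indicator {0..T} s * \<phi> s \<omega>" for s
    have fm: "f \<in> borel_measurable borel"
      unfolding f_def using prog_path(2)[OF \<phi> _ \<omega>, of T] T by simp
    have fi: "integrable lborel f"
    proof (rule Bochner_Integration.integrable_bound)
      show "integrable lborel (\<lambda>s. K * indicator {0..T} s :: real)"
        using T by (intro integrable_mult_right integrable_real_indicator) auto
      show "AE s in lborel. norm (f s) \<le> norm (K * indicator {0..T} s :: real)"
        using K by (auto simp: f_def indicator_def)
    qed (use fm in simp)
    have "AE t in lborel. t \<in> {0..T} \<longrightarrow> (\<lambda>n. D n t \<omega>) \<longlonglongrightarrow> 0"
      using lebesgue_left_average[OF fi] AE_lborel_singleton[of 0]
    proof eventually_elim
      fix t :: real
      assume left: "\<forall>e>0. \<exists>d>0. \<forall>h. 0 < h \<and> h < d \<longrightarrow>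
          \<bar>(LINT s:{t - h..t}|lborel. f s) - h * f t\<bar> \<le> e * h" and t0: "t \<noteq> 0"
      show "t \<in> {0..T} \<longrightarrow> (\<lambda>n. D n t \<omega>) \<longlonglongrightarrow> 0"
      proof
        assume "t \<in> {0..T}"
        with t0 have t: "t > 0" "t \<le> T" by auto
        let ?h = "\<lambda>n. T / real (Suc n)"
        let ?A = "\<lambda>n. ((LINT s:{0..real (cell (?h n) t) * ?h n}|lborel. f s)
          - (LINT s:{0..real (cell (?h n) t - 1) * ?h n}|lborel. f s)) / ?h n"
        have A: "?A \<longlonglongrightarrow> f t" and ev: "\<forall>\<^sub>F n in sequentially. cell (?h n) t \<noteq> 0"
          using previous_cell_average_tendsto[OF fi T t(1) left] by auto
        have ft: "f t = \<phi> t \<omega>" using t by (simp add: f_def)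
        have "(\<lambda>n. max (- K) (min K (?A n)) - \<phi> t \<omega>) \<longlonglongrightarrow> max (- K) (min K (f t)) - \<phi> t \<omega>"
          by (intro tendsto_intros tendsto_max tendsto_min A)
        moreover have "max (- K) (min K (f t)) = \<phi> t \<omega>"
          using K(2)[of t \<omega>] unfolding ft by auto
        ultimately have lim: "(\<lambda>n. max (- K) (min K (?A n)) - \<phi> t \<omega>) \<longlonglongrightarrow> 0" by simp
        have "\<forall>\<^sub>F n in sequentially. max (- K) (min K (?A n)) - \<phi> t \<omega> = D n t \<omega>"
          using ev
        proof eventually_elim
          fix n assume c: "cell (?h n) t \<noteq> 0"
          have h: "?h n > 0" using T by simp
          have le: "real (cell (?h n) t) * ?h n \<le> T"
            using cell(1)[OF h t(1)] t(2) by simp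
          have le': "real (cell (?h n) t - 1) * ?h n \<le> T"
            by (rule order_trans[OF mult_right_mono le]) (use h in auto)
          have eq: "(LINT s:{0..b}|lborel. f s) = (LINT s:{0..b}|lborel. \<phi> s \<omega>)" if "b \<le> T" for b
            by (rule set_lebesgue_integral_cong) (use that in \<open>auto simp: f_def\<close>)
          show "max (- K) (min K (?A n)) - \<phi> t \<omega> = D n t \<omega>"
            unfolding D_def grid_process_eq[OF T t] grid_average_def grid_def
            using c by (simp only: if_False eq[OF le] eq[OF le'])
        qed
        then show "(\<lambda>n. D n t \<omega>) \<longlonglongrightarrow> 0"
          by (rule Lim_transform_eventually[OF lim])
      qed
    qed
    then have ae: "AE t in ?R. (\<lambda>n. D n t \<omega>) \<longlonglongrightarrow> 0"
      by (subst AE_restrict_space_iff) auto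
    have "(\<lambda>n. \<integral>\<^sup>+t. ennreal (norm (0 - (D n t \<omega>)\<^sup>2)) \<partial>?R) \<longlonglongrightarrow> 0"
    proof (rule nn_integral_dominated_convergence_norm[where w="\<lambda>_. (2 * K)\<^sup>2"])
      show "(\<lambda>t. (D n t \<omega>)\<^sup>2) \<in> borel_measurable ?R" for n
        using PP_path_measurable[OF Dm \<omega>, of n] by (intro borel_measurable_power) simp
      show "AE t in ?R. norm ((D n t \<omega>)\<^sup>2) \<le> (2 * K)\<^sup>2" for n
        using Db[of _ n \<omega>] by (intro AE_I2) (simp add: space_restrict_space)
      show "(\<integral>\<^sup>+t. ennreal ((2 * K)\<^sup>2) \<partial>?R) < \<infinity>"
        unfolding nn_integral_const emR by (simp add: ennreal_mult_less_top)
      show "AE t in ?R. (\<lambda>n. (D n t \<omega>)\<^sup>2) \<longlonglongrightarrow> 0"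
        using ae
      proof eventually_elim
        fix t assume "(\<lambda>n. D n t \<omega>) \<longlonglongrightarrow> 0"
        from tendsto_power[OF this, of 2] show "(\<lambda>n. (D n t \<omega>)\<^sup>2) \<longlonglongrightarrow> 0" by simp
      qed
    qed simp_all
    then show ?thesis by simp
  qed
  have "(\<lambda>n. \<integral>\<^sup>+\<omega>. (\<integral>\<^sup>+t. ennreal ((D n t \<omega>)\<^sup>2) \<partial>?R) \<partial>M) \<longlonglongrightarrow> (\<integral>\<^sup>+\<omega>. 0 \<partial>M)"
  proof (rule nn_integral_dominated_convergence[where w="\<lambda>_. ennreal ((2 * K)\<^sup>2) * ennreal T"])
    show "(\<lambda>\<omega>. \<integral>\<^sup>+t. ennreal ((D n t \<omega>)\<^sup>2) \<partial>?R) \<in> borel_measurable M" for n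
    proof (rule R.borel_measurable_nn_integral)
      have "(\<lambda>(\<omega>, t). (\<lambda>p. ennreal ((U (D n) p)\<^sup>2)) (t, \<omega>)) \<in> borel_measurable (M \<Otimes>\<^sub>M ?R)"
        using measurable_ennreal_sq[OF Dm[of n]] unfolding PP_def by (rule measurable_pair_swap)
      then show "(\<lambda>(\<omega>, t). ennreal ((D n t \<omega>)\<^sup>2)) \<in> borel_measurable (M \<Otimes>\<^sub>M ?R)" by simp
    qed
    show "AE \<omega> in M. (\<integral>\<^sup>+t. ennreal ((D n t \<omega>)\<^sup>2) \<partial>?R) \<le> ennreal ((2 * K)\<^sup>2) * ennreal T" for n
    proof (rule AE_I2)
      fix \<omega>
      have "(\<integral>\<^sup>+t. ennreal ((D n t \<omega>)\<^sup>2) \<partial>?R) \<le> (\<integral>\<^sup>+t. ennreal ((2 * K)\<^sup>2) \<partial>?R)"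
        by (intro nn_integral_mono ennreal_leI Db) (simp add: space_restrict_space)
      then show "(\<integral>\<^sup>+t. ennreal ((D n t \<omega>)\<^sup>2) \<partial>?R) \<le> ennreal ((2 * K)\<^sup>2) * ennreal T"
        unfolding nn_integral_const emR .
    qed
    show "(\<integral>\<^sup>+\<omega>. ennreal ((2 * K)\<^sup>2) * ennreal T \<partial>M) < \<infinity>"
      unfolding nn_integral_const by (simp add: emeasure_space_1 ennreal_mult_less_top)
    show "AE \<omega> in M. (\<lambda>n. \<integral>\<^sup>+t. ennreal ((D n t \<omega>)\<^sup>2) \<partial>?R) \<longlonglongrightarrow> 0"
      using inner by (intro AE_I2)
  qed simp_all
  then show ?thesis
    unfolding D_def by (subst sq_norm_on_restrict) auto
qed

text \<open>The error is dominated by the process itself and vanishes at each point as soon as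
  \<open>k\<close> exceeds the absolute value there.\<close>

lemma clip_converges:
  assumes "U \<phi> \<in> borel_measurable (PP {0..T})" "sq_norm_on M {0..T} \<phi> < \<infinity>"
  shows "(\<lambda>k. sq_norm_on M {0..T} (\<lambda>t \<omega>. max (- real k) (min (real k) (\<phi> t \<omega>)) - \<phi> t \<omega>)) \<longlonglongrightarrow> 0"
proof -
  let ?d = "\<lambda>k p. max (- real k) (min (real k) (U \<phi> p)) - U \<phi> p"
  note m = assms(1)
  have dm: "?d k \<in> borel_measurable (PP {0..T})" for k
    by (intro borel_measurable_diff borel_measurable_max borel_measurable_min m) auto
  have "(\<lambda>k. \<integral>\<^sup>+p. ennreal (norm (0 - (?d k p)\<^sup>2)) \<partial>PP {0..T}) \<longlonglongrightarrow> 0"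
  proof (rule nn_integral_dominated_convergence_norm[where w="\<lambda>p. (U \<phi> p)\<^sup>2"])
    show "AE p in PP {0..T}. norm ((?d k p)\<^sup>2) \<le> (U \<phi> p)\<^sup>2" for k
    proof (rule AE_I2)
      fix p
      have "\<bar>?d k p\<bar> \<le> \<bar>U \<phi> p\<bar>" by (auto simp: max_def min_def)
      then show "norm ((?d k p)\<^sup>2) \<le> (U \<phi> p)\<^sup>2" by (simp add: abs_le_square_iff)
    qed
    show "(\<integral>\<^sup>+p. ennreal ((U \<phi> p)\<^sup>2) \<partial>PP {0..T}) < \<infinity>"
      using assms(2) sq_norm_on_PP[OF _ m] by simp
    show "AE p in PP {0..T}. (\<lambda>k. (?d k p)\<^sup>2) \<longlonglongrightarrow> 0"
    proof (rule AE_I2)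
      fix p
      have "\<forall>\<^sub>F k in sequentially. 0 = (?d k p)\<^sup>2"
        using eventually_ge_at_top[of "nat \<lceil>\<bar>U \<phi> p\<bar>\<rceil>"]
      proof eventually_elim
        fix k assume "nat \<lceil>\<bar>U \<phi> p\<bar>\<rceil> \<le> k"
        then have "\<bar>U \<phi> p\<bar> \<le> real k" by linarith
        then have "?d k p = 0" by auto
        then show "0 = (?d k p)\<^sup>2" by simp
      qed
      then show "(\<lambda>k. (?d k p)\<^sup>2) \<longlonglongrightarrow> 0"
        by (rule Lim_transform_eventually[OF tendsto_const])
    qed
    show "(\<lambda>p. (?d k p)\<^sup>2) \<in> borel_measurable (PP {0..T})" for k
      by (rule borel_measurable_power[OF dm])
    show "(\<lambda>p. (U \<phi> p)\<^sup>2) \<in> borel_measurable (PP {0..T})"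
      by (rule borel_measurable_power[OF m])
  qed simp
  then show ?thesis by (subst sq_norm_on_PP) (use dm in auto)
qed

lemma simple_integrands_dense:
  assumes \<phi>: "prog \<phi>" and fin: "sq_norm_on M {0..T} \<phi> < \<infinity>" and T: "T > 0" and e: "(e::real) > 0"
  shows "\<exists>n \<tau> \<xi>. simple_integrand M F n \<tau> \<xi> \<and>
    sq_norm_on M {0..T} (\<lambda>t \<omega>. simple_process n \<tau> \<xi> t \<omega> - \<phi> t \<omega>) < ennreal e"
proof -
  have m: "U \<phi> \<in> borel_measurable (PP {0..T})" using prog_PP[OF \<phi>] T by simp
  \<comment> \<open>Two approximation errors, each doubled by
    \<open>(a + b)^2 \<le> 2 a^2 + 2 b^2\<close>, add up to \<open>e\<close>.\<close>
  have e4: "ennreal (e / 4) > 0" using e by simp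
  obtain k where k: "sq_norm_on M {0..T} (\<lambda>t \<omega>. max (- real k) (min (real k) (\<phi> t \<omega>)) - \<phi> t \<omega>) < ennreal (e / 4)"
    using order_tendstoD(2)[OF clip_converges[OF m fin] e4] eventually_sequentially by auto
  let ?\<psi> = "\<lambda>t \<omega>. max (- real k) (min (real k) (\<phi> t \<omega>))"
  have \<psi>: "prog ?\<psi>" by (rule prog_clip[OF \<phi>])
  have \<psi>b: "\<bar>?\<psi> t \<omega>\<bar> \<le> real k" for t \<omega> by auto
  let ?S = "\<lambda>n. simple_process (Suc n) (grid T n) (grid_average ?\<psi> (real k) T n)"
  obtain n where n: "sq_norm_on M {0..T} (\<lambda>t \<omega>. ?S n t \<omega> - ?\<psi> t \<omega>) < ennreal (e / 4)"
    using order_tendstoD(2)[OF grid_average_converges[OF \<psi> _ \<psi>b T] e4] eventually_sequentially by auto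
  have si: "simple_integrand M F (Suc n) (grid T n) (grid_average ?\<psi> (real k) T n)"
    by (rule grid_average_simple[OF \<psi> _ T]) simp
  have Sm: "U (?S n) \<in> borel_measurable (PP {0..T})"
    using sqint_measurable[OF elem_sqint(1)[OF simple_integrand_elem[OF si]]] T by simp
  have \<psi>m: "U ?\<psi> \<in> borel_measurable (PP {0..T})" using prog_PP[OF \<psi>] T by simp
  note dm = borel_measurable_diff[OF Sm \<psi>m] borel_measurable_diff[OF \<psi>m m] borel_measurable_diff[OF Sm m]
  have "sq_norm_on M {0..T} (\<lambda>t \<omega>. ?S n t \<omega> - \<phi> t \<omega>)
      = (\<integral>\<^sup>+p. ennreal (((U (?S n) p - U ?\<psi> p) + (U ?\<psi> p - U \<phi> p))\<^sup>2) \<partial>PP {0..T})"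
    using sq_norm_on_PP[OF _ dm(3)] by simp
  also have "\<dots> \<le> 2 * (\<integral>\<^sup>+p. ennreal ((U (?S n) p - U ?\<psi> p)\<^sup>2) \<partial>PP {0..T}) +
      2 * (\<integral>\<^sup>+p. ennreal ((U ?\<psi> p - U \<phi> p)\<^sup>2) \<partial>PP {0..T})"
    by (rule nn_sq_add_le[OF dm(1,2)])
  also have "\<dots> = 2 * sq_norm_on M {0..T} (\<lambda>t \<omega>. ?S n t \<omega> - ?\<psi> t \<omega>) +
      2 * sq_norm_on M {0..T} (\<lambda>t \<omega>. ?\<psi> t \<omega> - \<phi> t \<omega>)"
    using sq_norm_on_PP[OF _ dm(1)] sq_norm_on_PP[OF _ dm(2)] by simp
  also have "\<dots> < 2 * ennreal (e / 4) + 2 * ennreal (e / 4)"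
    using n k by (intro add_strict_mono) (simp_all add: ennreal_mult_strict_left_mono)
  also have "2 * ennreal (e / 4) = ennreal (e / 2)"
    using e by (subst ennreal_numeral[symmetric], subst ennreal_mult[symmetric]) auto
  also have "ennreal (e / 2) + ennreal (e / 2) = ennreal e"
    using e by (subst ennreal_plus[symmetric]) auto
  finally show ?thesis using si by blast
qed

section \<open>Properties of the Ito integral\<close>

lemma has_ito_integral_ito:
  assumes h: "has_ito_integral M W \<phi> t Y" and t: "0 \<le> t"
  shows "ito \<phi> t Y"
proof -
  obtain n \<tau> \<xi> where
    \<phi>: "prog \<phi>" "sq_norm_on M {0..t} \<phi> < \<infinity>" and Y: "Y \<in> borel_measurable M"
    and si: "\<And>k::nat. simple_integrand M F (n k) (\<tau> k) (\<xi> k)"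
    and l1: "(\<lambda>k. sq_norm_on M {0..t} (\<lambda>s \<omega>. simple_process (n k) (\<tau> k) (\<xi> k) s \<omega> - \<phi> s \<omega>)) \<longlonglongrightarrow> 0"
    and l2: "(\<lambda>k. \<integral>\<^sup>+\<omega>. ennreal ((simple_ito W (n k) (\<tau> k) (\<xi> k) t \<omega> - Y \<omega>)\<^sup>2) \<partial>M) \<longlonglongrightarrow> 0"
    using h unfolding has_ito_integral_def by blast
  let ?H = "\<lambda>k. simple_process (n k) (\<tau> k) (\<xi> k)" and ?I = "\<lambda>k. simple_ito V (n k) (\<tau> k) (\<xi> k)"
  have el: "elem (?H k) (?I k)" for k by (rule simple_integrand_elem[OF si])
  note m = prog_PP[OF \<phi>(1) t]
  have s\<phi>: "sqint (PP {0..t}) (U \<phi>)"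
    using \<phi>(2) sqint_iff_nn[OF m] sq_norm_on_PP[OF _ m] by simp
  note sH = elem_sqint(1)[OF el t] and sI = elem_sqint(2)[OF el t]
  have c1: "L2conv (PP {0..t}) (\<lambda>k. U (?H k)) (U \<phi>)"
  proof (rule L2conv_nn[OF sqint_measurable[OF sH] s\<phi> _ sH])
    show "(\<lambda>k. \<integral>\<^sup>+p. ennreal ((U (?H k) p - U \<phi> p)\<^sup>2) \<partial>PP {0..t}) \<longlonglongrightarrow> 0"
      using l1 sq_norm_on_PP[OF _ borel_measurable_diff[OF sqint_measurable[OF sH] m]] by simp
  qed
  have "(\<integral>\<^sup>+\<omega>. ennreal ((simple_ito W (n k) (\<tau> k) (\<xi> k) t \<omega> - Y \<omega>)\<^sup>2) \<partial>M)
      = (\<integral>\<^sup>+\<omega>. ennreal ((?I k t \<omega> - Y \<omega>)\<^sup>2) \<partial>M)" for k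
    by (rule nn_integral_cong_AE) (use simple_ito_V_eq_W[of "n k" "\<tau> k" "\<xi> k"] in \<open>eventually_elim, simp\<close>)
  with l2 have l3: "(\<lambda>k. \<integral>\<^sup>+\<omega>. ennreal ((?I k t \<omega> - Y \<omega>)\<^sup>2) \<partial>M) \<longlonglongrightarrow> 0" by simp
  have "\<forall>\<^sub>F k in sequentially. (\<integral>\<^sup>+\<omega>. ennreal ((?I k t \<omega> - Y \<omega>)\<^sup>2) \<partial>M) < 1"
    by (rule order_tendstoD(2)[OF l3]) simp
  then obtain k where "(\<integral>\<^sup>+\<omega>. ennreal ((?I k t \<omega> - Y \<omega>)\<^sup>2) \<partial>M) < 1"
    unfolding eventually_sequentially by blast
  \<comment> \<open>\<open>has_ito_integral\<close> does not state that \<open>Y\<close> is square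
    integrable; a single approximation at finite distance from \<open>Y\<close> yields it.\<close>
  then have "sqint M (\<lambda>\<omega>. ?I k t \<omega> - Y \<omega>)"
    using sqint_iff_nn[OF borel_measurable_diff[OF sqint_measurable[OF sI] Y], of k] 
    by (simp add: less_trans[OF _ ennreal_one_less_top])
  then have sY: "sqint M Y" using sqint_diff[OF sI[of k]] by fastforce
  have "L2conv M (\<lambda>k. ?I k t) Y"
    by (rule L2conv_nn[OF sqint_measurable[OF sI] sY l3 sI])
  with el c1 show ?thesis unfolding ito_def
    by (intro exI[of _ ?H] exI[of _ ?I]) auto
qed

text \<open>By the isometry on \<open>[0, s]\<close>, a sequence chosen for the later time also
  approximates the integral at the earlier time. The values at two times, which come with unrelated
  sequences, can thus be compared along one.\<close>

lemma ito_restrict_L2conv: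
  assumes st: "0 \<le> s" "s \<le> t" and el: "\<And>k. elem (H k) (I k)"
    and H: "L2conv (PP {0..t}) (\<lambda>k. U (H k)) (U \<phi>)" and Y: "ito \<phi> s Y"
  shows "L2conv M (\<lambda>k. I k s) Y"
proof -
  have eq: "expectation (\<lambda>\<omega>. (I k s \<omega> - Y \<omega>)\<^sup>2) = (\<integral>p. (U (H k) p - U \<phi> p)\<^sup>2 \<partial>PP {0..s})" for k
    by (rule ito_isometry[OF st(1) ito_diff[OF elem_ito[OF el st(1)] Y]])
  have le: "(\<integral>p. (U (H k) p - U \<phi> p)\<^sup>2 \<partial>PP {0..s}) \<le> (\<integral>p. (U (H k) p - U \<phi> p)\<^sup>2 \<partial>PP {0..t})" for k
    using st H by (intro sqint_PP_mono(2) sqint_diff) (auto simp: L2conv_def)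
  have lim: "(\<lambda>k. \<integral>p. (U (H k) p - U \<phi> p)\<^sup>2 \<partial>PP {0..t}) \<longlonglongrightarrow> 0"
    using H unfolding L2conv_def by (elim conjE)
  have "(\<lambda>k. expectation (\<lambda>\<omega>. (I k s \<omega> - Y \<omega>)\<^sup>2)) \<longlonglongrightarrow> 0"
  proof (rule tendsto_sandwich[OF always_eventually always_eventually tendsto_const lim]; rule allI)
    show "0 \<le> expectation (\<lambda>\<omega>. (I k s \<omega> - Y \<omega>)\<^sup>2)" for k by simp
    show "expectation (\<lambda>\<omega>. (I k s \<omega> - Y \<omega>)\<^sup>2) \<le> (\<integral>p. (U (H k) p - U \<phi> p)\<^sup>2 \<partial>PP {0..t})" for k
      unfolding eq by (rule le)
  qed
  then show ?thesis
    using ito_sqint(2)[OF Y] elem_sqint(2)[OF el st(1)] by (simp add: L2conv_def)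
qed

lemma ito_martingale:
  assumes st: "0 \<le> s" "s \<le> t" and Y: "ito \<phi> t Y" and Y': "ito \<phi> s Y'"
    and Z: "sqint M Z" "Z \<in> borel_measurable (F s)"
  shows "expectation (\<lambda>\<omega>. (Y \<omega> - Y' \<omega>) * Z \<omega>) = 0"
proof -
  obtain H I where el: "\<And>k. elem (H k) (I k)" and H: "L2conv (PP {0..t}) (\<lambda>k. U (H k)) (U \<phi>)"
    and I: "L2conv M (\<lambda>k. I k t) Y"
    using Y unfolding ito_def by blast
  have "(\<lambda>k. expectation (\<lambda>\<omega>. (I k t \<omega> - I k s \<omega>) * Z \<omega>)) \<longlonglongrightarrow> expectation (\<lambda>\<omega>. (Y \<omega> - Y' \<omega>) * Z \<omega>)"
    by (rule L2conv_inner[OF L2conv_diff[OF I ito_restrict_L2conv[OF st el H Y']] L2conv_const[OF Z(1)]])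
  then show ?thesis
    unfolding elem_martingale[OF el st Z] by (simp add: LIMSEQ_const_iff)
qed

end

section \<open>Limits\<close>

text \<open>Fatou's lemma, in the form that carries a Cauchy estimate in mean square over to a
  pointwise limit.\<close>

lemma nn_sq_le_of_tendsto:
  fixes u :: "nat \<Rightarrow> 'b \<Rightarrow> real"
  assumes "\<And>n. u n \<in> borel_measurable \<mu>"
    and lim: "AE x in \<mu>. (\<lambda>n. u n x) \<longlonglongrightarrow> v x"
    and bound: "\<forall>\<^sub>F n in sequentially. (\<integral>\<^sup>+x. ennreal ((u n x)\<^sup>2) \<partial>\<mu>) \<le> C"
  shows "(\<integral>\<^sup>+x. ennreal ((v x)\<^sup>2) \<partial>\<mu>) \<le> C"
proof -
  have "(\<integral>\<^sup>+x. ennreal ((v x)\<^sup>2) \<partial>\<mu>) = (\<integral>\<^sup>+x. liminf (\<lambda>n. ennreal ((u n x)\<^sup>2)) \<partial>\<mu>)"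
  proof (rule nn_integral_cong_AE)
    show "AE x in \<mu>. ennreal ((v x)\<^sup>2) = liminf (\<lambda>n. ennreal ((u n x)\<^sup>2))"
      using lim
    proof eventually_elim
      fix x assume "(\<lambda>n. u n x) \<longlonglongrightarrow> v x"
      then have "(\<lambda>n. ennreal ((u n x)\<^sup>2)) \<longlonglongrightarrow> ennreal ((v x)\<^sup>2)"
        by (intro tendsto_ennrealI tendsto_power)
      then show "ennreal ((v x)\<^sup>2) = liminf (\<lambda>n. ennreal ((u n x)\<^sup>2))"
        using lim_imp_Liminf[OF sequentially_bot] by metis
    qed
  qed
  also have "\<dots> \<le> liminf (\<lambda>n. \<integral>\<^sup>+x. ennreal ((u n x)\<^sup>2) \<partial>\<mu>)"
    using assms(1) by (intro nn_integral_liminf) auto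
  also have "\<dots> \<le> limsup (\<lambda>n. \<integral>\<^sup>+x. ennreal ((u n x)\<^sup>2) \<partial>\<mu>)"
    by (intro Liminf_le_Limsup) simp
  also have "\<dots> \<le> C" by (rule Limsup_bounded[OF bound])
  finally show ?thesis .
qed

lemma uniform_limit_of_geometric_steps:
  fixes f :: "nat \<Rightarrow> 'b \<Rightarrow> real"
  assumes step: "\<And>k t. K \<le> k \<Longrightarrow> t \<in> S \<Longrightarrow> \<bar>f (Suc k) t - f k t\<bar> \<le> (1/2) ^ k"
  shows "uniform_limit S f (\<lambda>t. lim (\<lambda>k. f k t)) sequentially"
    and "t \<in> S \<Longrightarrow> (\<lambda>k. f k t) \<longlonglongrightarrow> lim (\<lambda>k. f k t)"
proof -
  \<comment> \<open>Subtracting the remaining tail of the geometric series is what lets the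
    induction on \<open>j\<close> close.\<close>
  have dist_le: "\<bar>f (k + j) t - f k t\<bar> \<le> 2 * (1/2) ^ k - 2 * (1/2) ^ (k + j)" if "K \<le> k" "t \<in> S" for k j t
  proof (induction j)
    case (Suc j)
    have "\<bar>f (Suc (k + j)) t - f (k + j) t\<bar> \<le> (1/2) ^ (k + j)"
      using that by (intro step) auto
    with Suc show ?case by simp
  qed simp
  have le2: "\<bar>f (k + j) t - f k t\<bar> \<le> 2 * (1/2) ^ k" if "K \<le> k" "t \<in> S" for k j t
    using dist_le[OF that, of j] zero_le_power[of "1/2::real" "k + j"] by linarith
  have z: "(\<lambda>k. 2 * (1/2) ^ k :: real) \<longlonglongrightarrow> 0"
    by (intro tendsto_mult_right_zero LIMSEQ_realpow_zero) auto
  have lim: "(\<lambda>k. f k t) \<longlonglongrightarrow> lim (\<lambda>k. f k t)" if t: "t \<in> S" for t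
  proof -
    have "Cauchy (\<lambda>k. f k t)"
    proof (rule CauchyI')
      fix e :: real assume "e > 0"
      then have "\<forall>\<^sub>F k in sequentially. 2 * (1/2) ^ k < e \<and> K \<le> k"
        using order_tendstoD(2)[OF z] eventually_ge_at_top by (intro eventually_conj) auto
      then obtain k where k: "2 * (1/2) ^ k < e" "K \<le> k"
        unfolding eventually_sequentially by blast
      show "\<exists>M. \<forall>m\<ge>M. \<forall>n>m. dist (f m t) (f n t) < e"
      proof (intro exI[of _ k] allI impI)
        fix m n assume mn: "k \<le> m" "m < n"
        have "\<bar>f (m + (n - m)) t - f m t\<bar> \<le> 2 * (1/2) ^ m"
          using k mn t by (intro le2) auto
        moreover have "m + (n - m) = n" using mn by simp
        ultimately have "\<bar>f n t - f m t\<bar> \<le> 2 * (1/2) ^ m" by metis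
        moreover have "(1/2::real) ^ m \<le> (1/2) ^ k" using mn by (intro power_decreasing) auto
        ultimately show "dist (f m t) (f n t) < e"
          using k(1) unfolding dist_real_def by linarith
      qed
    qed
    then show ?thesis by (simp add: Cauchy_convergent_iff convergent_LIMSEQ_iff)
  qed
  show "t \<in> S \<Longrightarrow> (\<lambda>k. f k t) \<longlonglongrightarrow> lim (\<lambda>k. f k t)" by (rule lim)
  show "uniform_limit S f (\<lambda>t. lim (\<lambda>k. f k t)) sequentially"
  proof (rule uniform_limitI)
    fix e :: real assume "e > 0"
    then have "\<forall>\<^sub>F k in sequentially. 2 * (1/2) ^ k < e" by (rule order_tendstoD(2)[OF z])
    then show "\<forall>\<^sub>F k in sequentially. \<forall>t\<in>S. dist (f k t) (lim (\<lambda>k. f k t)) < e"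
      using eventually_ge_at_top[of K]
    proof eventually_elim
      fix k assume k: "2 * (1/2) ^ k < e" "K \<le> k"
      show "\<forall>t\<in>S. dist (f k t) (lim (\<lambda>k. f k t)) < e"
      proof
        fix t assume t: "t \<in> S"
        have "(\<lambda>j. \<bar>f (j + k) t - f k t\<bar>) \<longlonglongrightarrow> \<bar>lim (\<lambda>k. f k t) - f k t\<bar>"
          by (intro tendsto_intros LIMSEQ_ignore_initial_segment lim t)
        then have "\<bar>lim (\<lambda>k. f k t) - f k t\<bar> \<le> 2 * (1/2) ^ k"
          by (rule LIMSEQ_le_const2) (use le2[OF k(2) t] in \<open>auto simp: add.commute\<close>)
        then show "dist (f k t) (lim (\<lambda>k. f k t)) < e"
          using k by (simp add: dist_real_def abs_minus_commute)
      qed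
    qed
  qed
qed

lemma continuous_on_atLeast_0:
  fixes f :: "real \<Rightarrow> real"
  assumes "\<And>n::nat. continuous_on {0..real n} f"
  shows "continuous_on {0..} f"
  unfolding continuous_on_eq_continuous_within
proof
  fix t :: real assume t: "t \<in> {0..}"
  obtain n where n: "t < real n" using reals_Archimedean2 by blast
  have "continuous (at t within {0..real n}) f"
    using assms[of n] t n by (simp add: continuous_on_eq_continuous_within)
  moreover have "at t within {0..real n} = at t within {0..}"
    by (rule at_within_nhd[of _ "{..<real n}"]) (use t n in auto)
  ultimately show "continuous (at t within {0..}) f" by simp
qed

context brownian
begin

section \<open>The maximal inequality\<close>

text \<open>Square integrable martingales, with orthogonality of increments in place of conditional
  expectations.\<close>

definition mart :: "(real \<Rightarrow> 'a \<Rightarrow> real) \<Rightarrow> bool" where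
  "mart I \<longleftrightarrow> (\<forall>t\<ge>0. I t \<in> borel_measurable (F t) \<and> sqint M (I t)) \<and>
     (\<forall>s t Z. 0 \<le> s \<longrightarrow> s \<le> t \<longrightarrow> sqint M Z \<longrightarrow> Z \<in> borel_measurable (F s) \<longrightarrow>
        expectation (\<lambda>\<omega>. (I t \<omega> - I s \<omega>) * Z \<omega>) = 0)"

lemma elem_mart: "elem H I \<Longrightarrow> mart I"
  unfolding mart_def using elem_adapted elem_sqint(2) elem_martingale by blast

lemma mart_adapted: "mart I \<Longrightarrow> 0 \<le> t \<Longrightarrow> I t \<in> borel_measurable (F t)"
  unfolding mart_def by (elim conjE allE[of _ t] impE) auto

lemma mart_sqint: "mart I \<Longrightarrow> 0 \<le> t \<Longrightarrow> sqint M (I t)"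
  unfolding mart_def by (elim conjE allE[of _ t] impE) auto

text \<open>Expand \<open>(I t)^2\<close> around \<open>I s\<close>: on an event known at
  \<open>s\<close> the mixed term has mean 0, because the increment is orthogonal to
  \<open>indicator A * I s\<close>, and the square of the increment only helps.\<close>

lemma mart_sq_indicator:
  assumes I: "mart I" and st: "0 \<le> s" "s \<le> t" and A: "A \<in> sets (F s)"
    and c: "0 \<le> c" "\<And>\<omega>. \<omega> \<in> A \<Longrightarrow> c < \<bar>I s \<omega>\<bar>"
  shows "c\<^sup>2 * prob A \<le> expectation (\<lambda>\<omega>. indicator A \<omega> * (I t \<omega>)\<^sup>2)"
proof -
  have t: "0 \<le> t" using st by simp
  have Is: "sqint M (I s)" "I s \<in> borel_measurable (F s)" and It: "sqint M (I t)"
    using mart_sqint[OF I] mart_adapted[OF I] st t by auto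
  have AM: "A \<in> events" using A sets_F_le by blast
  have ind_F: "indicator A \<in> borel_measurable (F s)" using A by simp
  have ind_M: "indicator A \<in> borel_measurable M" using AM by simp
  have ind_b: "\<bar>indicator A \<omega> :: real\<bar> \<le> 1" for \<omega> by (simp add: indicator_def)
  note sq = sqint_bounded_mult[OF _ ind_M ind_b]
  have Z: "sqint M (\<lambda>\<omega>. indicator A \<omega> * I s \<omega>)" "(\<lambda>\<omega>. indicator A \<omega> * I s \<omega>) \<in> borel_measurable (F s)"
    using sq[OF Is(1)] borel_measurable_times[OF ind_F Is(2)] by auto
  note D = sqint_diff[OF It Is(1)]
  have orth: "expectation (\<lambda>\<omega>. (I t \<omega> - I s \<omega>) * (indicator A \<omega> * I s \<omega>)) = 0"
    using I st Z by (auto simp: mart_def)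
  have i1: "integrable M (\<lambda>\<omega>. indicator A \<omega> * (I s \<omega>)\<^sup>2)"
    using sqint_mult[OF Z(1) Is(1)] by (simp add: power2_eq_square mult.assoc)
  have i2: "integrable M (\<lambda>\<omega>. indicator A \<omega> * (I t \<omega> - I s \<omega>)\<^sup>2)"
    using sqint_mult[OF sq[OF D] D] by (simp add: power2_eq_square mult.assoc)
  have "c\<^sup>2 * prob A = expectation (\<lambda>\<omega>. c\<^sup>2 * indicator A \<omega>)" using AM by simp
  also have "\<dots> \<le> expectation (\<lambda>\<omega>. indicator A \<omega> * (I s \<omega>)\<^sup>2)"
  proof (rule integral_mono[OF _ i1])
    show "integrable M (\<lambda>\<omega>. c\<^sup>2 * indicator A \<omega>)"
      by (intro integrable_mult_right integrable_real_indicator AM) (simp add: emeasure_eq_measure)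
    show "c\<^sup>2 * indicator A \<omega> \<le> indicator A \<omega> * (I s \<omega>)\<^sup>2" for \<omega>
      using c(2)[of \<omega>] c(1) power_mono[of c "\<bar>I s \<omega>\<bar>" 2] by (auto simp: indicator_def)
  qed
  also have "\<dots> \<le> expectation (\<lambda>\<omega>. indicator A \<omega> * (I s \<omega>)\<^sup>2) + expectation (\<lambda>\<omega>. indicator A \<omega> * (I t \<omega> - I s \<omega>)\<^sup>2)"
    by simp
  also have "\<dots> = expectation (\<lambda>\<omega>. indicator A \<omega> * (I s \<omega>)\<^sup>2 + indicator A \<omega> * (I t \<omega> - I s \<omega>)\<^sup>2)
      + 2 * expectation (\<lambda>\<omega>. (I t \<omega> - I s \<omega>) * (indicator A \<omega> * I s \<omega>))"
    unfolding orth using i1 i2 by simp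
  also have "\<dots> = expectation (\<lambda>\<omega>. (indicator A \<omega> * (I s \<omega>)\<^sup>2 + indicator A \<omega> * (I t \<omega> - I s \<omega>)\<^sup>2)
      + 2 * ((I t \<omega> - I s \<omega>) * (indicator A \<omega> * I s \<omega>)))"
    using i1 i2 sqint_mult[OF D Z(1)] by simp
  also have "\<dots> = expectation (\<lambda>\<omega>. indicator A \<omega> * (I t \<omega>)\<^sup>2)"
    by (intro Bochner_Integration.integral_cong) (auto simp: power2_eq_square algebra_simps)
  finally show ?thesis .
qed

text \<open>Decompose according to the first index at which the level is exceeded. Each
  \<open>A j\<close> is known at \<open>s j\<close>, so \<open>mart_sq_indicator\<close> bounds its
  probability by the part of the second moment at \<open>T\<close> carried by \<open>A j\<close>,
  and these parts are disjoint.\<close>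

lemma maximal_discrete:
  assumes I: "mart I" and s: "\<And>j. 0 \<le> s j" "\<And>i j. i \<le> j \<Longrightarrow> s i \<le> s j" "\<And>j. j \<le> n \<Longrightarrow> s j \<le> T" and c: "0 \<le> c"
  shows "{\<omega> \<in> space M. \<exists>j\<le>n. c < \<bar>I (s j) \<omega>\<bar>} \<in> events"
    and "c\<^sup>2 * prob {\<omega> \<in> space M. \<exists>j\<le>(n::nat). c < \<bar>I (s j) \<omega>\<bar>} \<le> expectation (\<lambda>\<omega>. (I T \<omega>)\<^sup>2)"
proof -
  have T: "0 \<le> T" using s(1)[of 0] s(3)[of 0] by simp
  define A where "A j = {\<omega> \<in> space M. c < \<bar>I (s j) \<omega>\<bar> \<and> (\<forall>i<j. \<not> c < \<bar>I (s i) \<omega>\<bar>)}" for j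
  have gt: "{\<omega> \<in> space M. c < \<bar>I (s i) \<omega>\<bar>} \<in> sets (F (s j))" if "i \<le> j" for i j
  proof -
    have "I (s i) \<in> borel_measurable (F (s j))"
      by (rule F_measurable_mono[OF mart_adapted[OF I s(1)] s(2)[OF that]])
    then have "{\<omega> \<in> space (F (s j)). c < \<bar>I (s i) \<omega>\<bar>} \<in> sets (F (s j))"
      by (intro borel_measurable_less) auto
    then show ?thesis by simp
  qed
  have A_F: "A j \<in> sets (F (s j))" for j
  proof -
    have "A j = {\<omega> \<in> space M. c < \<bar>I (s j) \<omega>\<bar>} - (\<Union>i\<in>{..<j}. {\<omega> \<in> space M. c < \<bar>I (s i) \<omega>\<bar>})"
      by (auto simp: A_def)
    moreover have "(\<Union>i\<in>{..<j}. {\<omega> \<in> space M. c < \<bar>I (s i) \<omega>\<bar>}) \<in> sets (F (s j))"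
      by (intro sets.finite_UN) (auto intro!: gt)
    ultimately show ?thesis using gt[of j j] by auto
  qed
  then have A_M: "A j \<in> events" for j using sets_F_le by blast
  have dis: "disjoint_family_on A {..n}"
    unfolding disjoint_family_on_def
  proof (intro ballI impI)
    fix i j :: nat assume "i \<noteq> j"
    then show "A i \<inter> A j = {}"
      by (cases i j rule: linorder_cases) (auto simp: A_def)
  qed
  have un: "{\<omega> \<in> space M. \<exists>j\<le>n. c < \<bar>I (s j) \<omega>\<bar>} = (\<Union>j\<in>{..n}. A j)"
  proof (intro equalityI subsetI)
    fix \<omega> assume "\<omega> \<in> {\<omega> \<in> space M. \<exists>j\<le>n. c < \<bar>I (s j) \<omega>\<bar>}"
    then obtain j where j: "\<omega> \<in> space M" "j \<le> n" "c < \<bar>I (s j) \<omega>\<bar>" by blast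
    define i where "i = (LEAST i. c < \<bar>I (s i) \<omega>\<bar>)"
    have "c < \<bar>I (s i) \<omega>\<bar>" unfolding i_def by (rule LeastI[of _ j], rule j(3))
    moreover have "i \<le> j" unfolding i_def by (rule Least_le, rule j(3))
    moreover have "\<not> c < \<bar>I (s l) \<omega>\<bar>" if "l < i" for l using not_less_Least that unfolding i_def by blast
    ultimately have "\<omega> \<in> A i" "i \<le> n" using j by (auto simp: A_def)
    then show "\<omega> \<in> (\<Union>j\<in>{..n}. A j)" by blast
  qed (auto simp: A_def)
  show "{\<omega> \<in> space M. \<exists>j\<le>n. c < \<bar>I (s j) \<omega>\<bar>} \<in> events"
    unfolding un using A_M by (intro sets.finite_UN) auto
  have IT: "sqint M (I T)" by (rule mart_sqint[OF I T])
  have iA: "integrable M (\<lambda>\<omega>. indicator (A j) \<omega> * (I T \<omega>)\<^sup>2)" for j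
    using integrable_mult_indicator[OF A_M sqint_integrable_sq[OF IT], of j] by simp
  have "c\<^sup>2 * prob (\<Union>j\<in>{..n}. A j) = (\<Sum>j\<in>{..n}. c\<^sup>2 * prob (A j))"
    using finite_measure_finite_Union[OF _ _ dis] A_M by (simp add: sum_distrib_left image_subset_iff)
  also have "\<dots> \<le> (\<Sum>j\<in>{..n}. expectation (\<lambda>\<omega>. indicator (A j) \<omega> * (I T \<omega>)\<^sup>2))"
  proof (rule sum_mono)
    fix j assume "j \<in> {..n}"
    then show "c\<^sup>2 * prob (A j) \<le> expectation (\<lambda>\<omega>. indicator (A j) \<omega> * (I T \<omega>)\<^sup>2)"
      using s c by (intro mart_sq_indicator[OF I _ _ A_F]) (auto simp: A_def)
  qed
  also have "\<dots> = expectation (\<lambda>\<omega>. \<Sum>j\<in>{..n}. indicator (A j) \<omega> * (I T \<omega>)\<^sup>2)"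
    using iA by (intro Bochner_Integration.integral_sum[symmetric])
  also have "\<dots> \<le> expectation (\<lambda>\<omega>. (I T \<omega>)\<^sup>2)"
  proof (rule integral_mono)
    show "integrable M (\<lambda>\<omega>. \<Sum>j\<in>{..n}. indicator (A j) \<omega> * (I T \<omega>)\<^sup>2)"
      by (rule Bochner_Integration.integrable_sum[OF iA])
    show "integrable M (\<lambda>\<omega>. (I T \<omega>)\<^sup>2)" by (rule sqint_integrable_sq[OF IT])
    fix \<omega>
    have "(\<Sum>j\<in>{..n}. indicator (A j) \<omega>) = (indicator (\<Union>j\<in>{..n}. A j) \<omega> :: real)"
      by (rule indicator_UN_disjoint[OF _ dis, symmetric]) simp
    then have "(\<Sum>j\<in>{..n}. indicator (A j) \<omega> * (I T \<omega>)\<^sup>2) = indicator (\<Union>j\<in>{..n}. A j) \<omega> * (I T \<omega>)\<^sup>2"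
      unfolding sum_distrib_right[symmetric] by (rule arg_cong)
    also have "\<dots> \<le> (I T \<omega>)\<^sup>2" by (simp add: indicator_def)
    finally show "(\<Sum>j\<in>{..n}. indicator (A j) \<omega> * (I T \<omega>)\<^sup>2) \<le> (I T \<omega>)\<^sup>2" .
  qed
  finally show "c\<^sup>2 * prob {\<omega> \<in> space M. \<exists>j\<le>n. c < \<bar>I (s j) \<omega>\<bar>} \<le> expectation (\<lambda>\<omega>. (I T \<omega>)\<^sup>2)"
    unfolding un .
qed

text \<open>A continuous path that strictly exceeds \<open>c\<close> at some time does so at a point
  of every sufficiently fine grid. The discrete inequality, uniform in the grid, therefore passes to
  the limit.\<close>

lemma maximal_inequality:
  assumes I: "mart I" and cont: "\<And>\<omega>. \<omega> \<in> space M \<Longrightarrow> continuous_on {0..} (\<lambda>t. I t \<omega>)"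
    and T: "0 \<le> T" and c: "0 \<le> c"
  shows "{\<omega> \<in> space M. \<exists>t\<in>{0..T}. c < \<bar>I t \<omega>\<bar>} \<in> events"
    and "c\<^sup>2 * prob {\<omega> \<in> space M. \<exists>t\<in>{0..T}. c < \<bar>I t \<omega>\<bar>} \<le> expectation (\<lambda>\<omega>. (I T \<omega>)\<^sup>2)"
proof -
  let ?A = "{\<omega> \<in> space M. \<exists>t\<in>{0..T}. c < \<bar>I t \<omega>\<bar>}"
  define g where "g n j = real j * (T / real (Suc n))" for n j :: nat
  define B where "B n = {\<omega> \<in> space M. \<exists>j\<le>Suc n. c < \<bar>I (g n j) \<omega>\<bar>}" for n
  have g: "0 \<le> g n j" "i \<le> j \<Longrightarrow> g n i \<le> g n j" "j \<le> Suc n \<Longrightarrow> g n j \<le> T" for n i j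
  proof -
    show "0 \<le> g n j" using T by (simp add: g_def)
    show mono: "i \<le> j \<Longrightarrow> g n i \<le> g n j" for i j using T unfolding g_def by (intro mult_right_mono) auto
    have "g n (Suc n) = T" by (simp add: g_def)
    then show "j \<le> Suc n \<Longrightarrow> g n j \<le> T" using mono[of j "Suc n"] by simp
  qed
  have Bev: "B n \<in> events" for n unfolding B_def
    by (rule maximal_discrete(1)[OF I, of "g n" "Suc n" T c]) (use g c in auto)
  have Bp: "c\<^sup>2 * prob (B n) \<le> expectation (\<lambda>\<omega>. (I T \<omega>)\<^sup>2)" for n unfolding B_def
    by (rule maximal_discrete(2)[OF I, of "g n" "Suc n" T c]) (use g c in auto)
  have B_A: "B n \<subseteq> ?A" for n
  proof
    fix \<omega> assume "\<omega> \<in> B n"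
    then obtain j where "\<omega> \<in> space M" "j \<le> Suc n" "c < \<bar>I (g n j) \<omega>\<bar>" by (auto simp: B_def)
    then show "\<omega> \<in> ?A" using g(1)[of n j] g(3)[of j n] by (auto intro!: bexI[of _ "g n j"])
  qed
  have A_B: "\<exists>m. \<forall>n\<ge>m. \<omega> \<in> B n" if \<omega>: "\<omega> \<in> ?A" for \<omega>
  proof -
    from \<omega> obtain t where t: "0 \<le> t" "t \<le> T" "c < \<bar>I t \<omega>\<bar>" and sp: "\<omega> \<in> space M" by auto
    define j where "j n = nat \<lfloor>t / (T / real (Suc n))\<rfloor>" for n
    have fl: "g n (j n) \<le> t \<and> t \<le> g n (j n) + T / real (Suc n) \<and> j n \<le> Suc n" for n
    proof (cases "T = 0")
      case True then show ?thesis using t by (simp add: g_def j_def)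
    next
      case False
      then have h: "T / real (Suc n) > 0" using T by simp
      have q: "t / (T / real (Suc n)) \<ge> 0" using t h by (intro divide_nonneg_pos)
      then have e: "real (j n) = of_int \<lfloor>t / (T / real (Suc n))\<rfloor>" by (simp add: j_def)
      have 1: "real (j n) \<le> t / (T / real (Suc n))" "t / (T / real (Suc n)) \<le> real (j n) + 1"
        unfolding e by linarith+
      have 2: "g n (j n) \<le> t" using 1(1) unfolding g_def pos_le_divide_eq[OF h] .
      have 3: "t \<le> (real (j n) + 1) * (T / real (Suc n))" using 1(2) unfolding pos_divide_le_eq[OF h] .
      have "t / (T / real (Suc n)) \<le> T / (T / real (Suc n))" using t h by (intro divide_right_mono) auto
      then have "real (j n) \<le> real (Suc n)" using 1(1) False by simp
      then show ?thesis using 2 3 by (simp add: g_def distrib_right add_divide_distrib)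
    qed
    have "(\<lambda>n. g n (j n)) \<longlonglongrightarrow> t"
    proof (rule tendsto_sandwich[OF always_eventually always_eventually])
      have "(\<lambda>n. t - T * inverse (real (Suc n))) \<longlonglongrightarrow> t - T * 0"
        by (intro tendsto_intros LIMSEQ_inverse_real_of_nat)
      then show "(\<lambda>n. t - T / real (Suc n)) \<longlonglongrightarrow> t" by (simp add: divide_inverse)
      show "(\<lambda>n. t) \<longlonglongrightarrow> t" by simp
      show "\<forall>n. t - T / real (Suc n) \<le> g n (j n)" using fl by (simp add: algebra_simps)
      show "\<forall>n. g n (j n) \<le> t" using fl by blast
    qed
    then have "(\<lambda>n. I (g n (j n)) \<omega>) \<longlonglongrightarrow> I t \<omega>"
      by (intro continuous_on_tendsto_compose[OF cont[OF sp]]) (use t g(1) in auto)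
    then have "(\<lambda>n. \<bar>I (g n (j n)) \<omega>\<bar>) \<longlonglongrightarrow> \<bar>I t \<omega>\<bar>" by (rule tendsto_rabs)
    then have "\<forall>\<^sub>F n in sequentially. c < \<bar>I (g n (j n)) \<omega>\<bar>" using t(3) by (rule order_tendstoD(1))
    then obtain m where m: "\<And>n. m \<le> n \<Longrightarrow> c < \<bar>I (g n (j n)) \<omega>\<bar>"
      unfolding eventually_sequentially by blast
    then have "\<forall>n\<ge>m. \<omega> \<in> B n"
      using sp fl unfolding B_def by blast
    then show ?thesis by blast
  qed
  \<comment> \<open>The grids are not nested, so \<open>B n\<close> need not increase in
    \<open>n\<close>; the intersections of its tails do.\<close>
  define C where "C m = (\<Inter>n\<in>{m..}. B n)" for m
  have Cev: "C m \<in> events" for m unfolding C_def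
    using Bev by (intro sets.countable_INT') auto
  have A_eq: "?A = (\<Union>m. C m)"
  proof (intro equalityI subsetI)
    fix \<omega> assume "\<omega> \<in> ?A"
    from A_B[OF this] show "\<omega> \<in> (\<Union>m. C m)" by (auto simp: C_def)
  next
    fix \<omega> assume "\<omega> \<in> (\<Union>m. C m)"
    then obtain m where "\<omega> \<in> B m" by (auto simp: C_def)
    then show "\<omega> \<in> ?A" using B_A by blast
  qed
  show "?A \<in> events" unfolding A_eq using Cev by (intro sets.countable_UN') auto
  have "incseq C" unfolding incseq_def C_def by (auto intro!: INF_superset_mono)
  then have lim: "(\<lambda>m. c\<^sup>2 * prob (C m)) \<longlonglongrightarrow> c\<^sup>2 * prob (\<Union>m. C m)"
    using Cev by (intro tendsto_mult_left finite_Lim_measure_incseq) auto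
  have "c\<^sup>2 * prob (C m) \<le> expectation (\<lambda>\<omega>. (I T \<omega>)\<^sup>2)" for m
  proof -
    have "C m \<subseteq> B m" by (auto simp: C_def)
    then have "prob (C m) \<le> prob (B m)" using Bev by (intro finite_measure_mono) auto
    then have "c\<^sup>2 * prob (C m) \<le> c\<^sup>2 * prob (B m)" by (intro mult_left_mono) auto
    then show ?thesis using Bp[of m] by simp
  qed
  then show "c\<^sup>2 * prob ?A \<le> expectation (\<lambda>\<omega>. (I T \<omega>)\<^sup>2)"
    unfolding A_eq by (intro LIMSEQ_le_const2[OF lim]) auto
qed

section \<open>Existence of a continuous version of the integral\<close>

text \<open>Approximations are chosen within \<open>16^-k\<close> in squared norm on
  \<open>[0, k + 1]\<close>. The maximal inequality at level \<open>2^-k\<close> bounds the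
  exceptional probability by \<open>4 * 16^-k / 4^-k = 4 * 4^-k\<close>. This is summable, and
  Borel-Cantelli gives locally uniform convergence of almost every path, hence continuity of the
  limit.\<close>

lemma ito_integral_exists:
  assumes \<phi>: "prog \<phi>" and fin: "\<And>T. 0 \<le> T \<Longrightarrow> sq_norm_on M {0..T} \<phi> < \<infinity>"
  shows "\<exists>N. prog N \<and> (AE \<omega> in M. continuous_on {0..} (\<lambda>t. N t \<omega>)) \<and>
     (\<forall>t\<ge>0. has_ito_integral M W \<phi> t (N t))"
proof -
  have "\<forall>k::nat. \<exists>n \<tau> \<xi>. simple_integrand M F n \<tau> \<xi> \<and>
      sq_norm_on M {0..real (Suc k)} (\<lambda>t \<omega>. simple_process n \<tau> \<xi> t \<omega> - \<phi> t \<omega>) < ennreal ((1/16) ^ k)"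
    by (intro allI simple_integrands_dense[OF \<phi>] fin) auto
  then obtain n \<tau> \<xi> where
    si: "\<And>k::nat. simple_integrand M F (n k) (\<tau> k) (\<xi> k)" and
    close: "\<And>k. sq_norm_on M {0..real (Suc k)} (\<lambda>t \<omega>. simple_process (n k) (\<tau> k) (\<xi> k) t \<omega> - \<phi> t \<omega>) < ennreal ((1/16) ^ k)"
    by metis
  define H where "H k = simple_process (n k) (\<tau> k) (\<xi> k)" for k
  define I where "I k = simple_ito V (n k) (\<tau> k) (\<xi> k)" for k
  have el: "elem (H k) (I k)" for k unfolding H_def I_def by (rule simple_integrand_elem[OF si])
  have Icont: "continuous_on {0..} (\<lambda>t. I k t \<omega>)" if "\<omega> \<in> space M" for k \<omega>
    by (rule elem_continuous[OF el that])
  have Iprog: "prog (I k)" for k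
    by (rule prog_continuous[OF elem_adapted[OF el] Icont])
  have \<phi>m: "U \<phi> \<in> borel_measurable (PP {0..t})" if "0 \<le> t" for t by (rule prog_PP[OF \<phi> that])
  have Hm: "U (H k) \<in> borel_measurable (PP {0..t})" if "0 \<le> t" for k t
    by (rule sqint_measurable[OF elem_sqint(1)[OF el that]])
  have s\<phi>: "sqint (PP {0..t}) (U \<phi>)" if "0 \<le> t" for t
    using fin[OF that] sqint_iff_nn[OF \<phi>m[OF that]] sq_norm_on_PP[OF _ \<phi>m[OF that]] by simp
  have sd: "sqint (PP {0..t}) (\<lambda>p. U (H k) p - U \<phi> p)" if "0 \<le> t" for k t
    by (rule sqint_diff[OF elem_sqint(1)[OF el that] s\<phi>[OF that]])
  have c: "(\<integral>p. (U (H k) p - U \<phi> p)\<^sup>2 \<partial>PP {0..t}) \<le> (1/16) ^ k" if t: "0 \<le> t" "t \<le> real (Suc k)" for k t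
  proof -
    have k0: "0 \<le> real (Suc k)" by simp
    have "ennreal (\<integral>p. (U (H k) p - U \<phi> p)\<^sup>2 \<partial>PP {0..real (Suc k)}) < ennreal ((1/16) ^ k)"
      using close[of k] unfolding H_def[symmetric] nn_sqint[OF sd[OF k0], symmetric]
      using sq_norm_on_PP[OF _ borel_measurable_diff[OF Hm[OF k0, of k] \<phi>m[OF k0]]] by simp
    then have "(\<integral>p. (U (H k) p - U \<phi> p)\<^sup>2 \<partial>PP {0..real (Suc k)}) \<le> (1/16) ^ k"
      by (subst (asm) ennreal_less_iff) auto
    moreover have "(\<integral>p. (U (H k) p - U \<phi> p)\<^sup>2 \<partial>PP {0..t}) \<le> (\<integral>p. (U (H k) p - U \<phi> p)\<^sup>2 \<partial>PP {0..real (Suc k)})"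
      using t by (intro sqint_PP_mono(2) sd) auto
    ultimately show ?thesis by simp
  qed
  have dist: "expectation (\<lambda>\<omega>. (I k t \<omega> - I m t \<omega>)\<^sup>2) \<le> 4 * (1/16) ^ k"
    if t: "0 \<le> t" "t \<le> real (Suc k)" and km: "k \<le> m" for k m t
  proof -
    have "expectation (\<lambda>\<omega>. (I k t \<omega> - I m t \<omega>)\<^sup>2) = (\<integral>p. (U (H k) p - U (H m) p)\<^sup>2 \<partial>PP {0..t})"
      by (rule ito_isometry[OF t(1) elem_ito[OF elem_diff[OF el el] t(1)]])
    also have "\<dots> = (\<integral>p. ((U (H k) p - U \<phi> p) + (-1) * (U (H m) p - U \<phi> p))\<^sup>2 \<partial>PP {0..t})"
      by simp
    also have "\<dots> \<le> 2 * (\<integral>p. (U (H k) p - U \<phi> p)\<^sup>2 \<partial>PP {0..t}) + 2 * (\<integral>p. ((-1) * (U (H m) p - U \<phi> p))\<^sup>2 \<partial>PP {0..t})"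
      by (rule integral_sq_add_le[OF sd[OF t(1)] sqint_cmult[OF sd[OF t(1)]]])
    also have "\<dots> = 2 * (\<integral>p. (U (H k) p - U \<phi> p)\<^sup>2 \<partial>PP {0..t}) + 2 * (\<integral>p. (U (H m) p - U \<phi> p)\<^sup>2 \<partial>PP {0..t})"
      by (simp only: power_mult_distrib) simp
    also have "\<dots> \<le> 2 * (1/16) ^ k + 2 * (1/16) ^ m"
      using c[OF t] c[OF t(1), of m] t km by (intro add_mono mult_left_mono) auto
    also have "\<dots> \<le> 4 * (1/16) ^ k"
      using power_decreasing[OF km, of "1/16::real"] by simp
    finally show ?thesis .
  qed
  \<comment> \<open>The horizon grows with \<open>k\<close>: eventually avoiding \<open>A k\<close>
    controls the path on every bounded interval at once.\<close>
  define A where "A k = {\<omega> \<in> space M. \<exists>t\<in>{0..real k}. (1/2) ^ k < \<bar>I (Suc k) t \<omega> - I k t \<omega>\<bar>}" for k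
  have Dcont: "continuous_on {0..} (\<lambda>t. I (Suc k) t \<omega> - I k t \<omega>)" if "\<omega> \<in> space M" for k \<omega>
    by (intro continuous_on_diff Icont that)
  have Dmart: "mart (\<lambda>t \<omega>. I (Suc k) t \<omega> - I k t \<omega>)" for k
    by (rule elem_mart[OF elem_diff[OF el el]])
  have Aev: "A k \<in> events" for k
    unfolding A_def by (rule maximal_inequality(1)[OF Dmart Dcont]) auto
  have Ap: "prob (A k) \<le> 4 * (1/4) ^ k" for k
  proof -
    have "((1/2) ^ k)\<^sup>2 * prob (A k) \<le> expectation (\<lambda>\<omega>. (I (Suc k) (real k) \<omega> - I k (real k) \<omega>)\<^sup>2)"
      unfolding A_def by (rule maximal_inequality(2)[OF Dmart Dcont]) auto
    also have "\<dots> = expectation (\<lambda>\<omega>. (I k (real k) \<omega> - I (Suc k) (real k) \<omega>)\<^sup>2)"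
      by (simp add: power2_commute)
    also have "\<dots> \<le> 4 * (1/16) ^ k" by (rule dist) auto
    also have "\<dots> = (1/4) ^ k * (4 * (1/4) ^ k)" by (simp flip: power_mult_distrib)
    also have "((1/2) ^ k)\<^sup>2 = (1/4::real) ^ k" by (simp add: power2_eq_square flip: power_mult_distrib)
    finally show ?thesis by (rule mult_left_le_imp_le) simp
  qed
  have "AE \<omega> in M. \<forall>\<^sub>F k in sequentially. \<omega> \<in> space M - A k"
  proof (rule borel_cantelli_AE1[OF Aev])
    show "emeasure M (A k) < \<infinity>" for k by (simp add: emeasure_eq_measure)
    show "summable (\<lambda>k. prob (A k))"
      by (rule summable_comparison_test'[of "\<lambda>k. 4 * (1/4) ^ k" 0])
        (use Ap in \<open>auto intro!: summable_mult summable_geometric\<close>)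
  qed
  then have good: "AE \<omega> in M. \<omega> \<in> space M \<and> (\<exists>K. \<forall>k\<ge>K. \<omega> \<notin> A k)"
    using AE_space by eventually_elim (auto simp: eventually_sequentially)
  \<comment> \<open>\<open>lim\<close> is taken at every \<omega>, whether the sequence converges or
    not; this makes \<open>N\<close> progressively measurable without an exceptional set.\<close>
  define N where "N t \<omega> = lim (\<lambda>k. I k t \<omega>)" for t \<omega>
  have Nprog: "prog N" unfolding N_def by (rule prog_lim[OF Iprog])
  have steps: "\<exists>K'. \<forall>k\<ge>K'. \<forall>t\<in>{0..T}. \<bar>I (Suc k) t \<omega> - I k t \<omega>\<bar> \<le> (1/2) ^ k"
    if sp: "\<omega> \<in> space M" and ev: "\<exists>K. \<forall>k\<ge>K. \<omega> \<notin> A k" for \<omega> T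
  proof -
    obtain K where K: "\<And>k. K \<le> k \<Longrightarrow> \<omega> \<notin> A k" using ev by blast
    obtain j :: nat where j: "T \<le> real j" using real_arch_simple by blast
    have "\<bar>I (Suc k) t \<omega> - I k t \<omega>\<bar> \<le> (1/2) ^ k" if k: "max K j \<le> k" and t: "t \<in> {0..T}" for k t
    proof -
      have "\<omega> \<notin> A k" using K k by simp
      moreover have "t \<in> {0..real k}" using t j k by auto
      ultimately show ?thesis using sp unfolding A_def by (auto simp: not_less)
    qed
    then show ?thesis by blast
  qed
  have Ncont: "AE \<omega> in M. continuous_on {0..} (\<lambda>t. N t \<omega>)"
    using good
  proof eventually_elim
    fix \<omega> assume \<omega>: "\<omega> \<in> space M \<and> (\<exists>K. \<forall>k\<ge>K. \<omega> \<notin> A k)"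
    show "continuous_on {0..} (\<lambda>t. N t \<omega>)"
    proof (rule continuous_on_atLeast_0)
      fix j :: nat
      obtain K' where K': "\<forall>k\<ge>K'. \<forall>t\<in>{0..real j}. \<bar>I (Suc k) t \<omega> - I k t \<omega>\<bar> \<le> (1/2) ^ k"
        using steps \<omega> by blast
      have ul: "uniform_limit {0..real j} (\<lambda>k t. I k t \<omega>) (\<lambda>t. lim (\<lambda>k. I k t \<omega>)) sequentially"
        by (rule uniform_limit_of_geometric_steps(1)[of K']) (use K' in auto)
      have "\<forall>\<^sub>F k in sequentially. continuous_on {0..real j} (\<lambda>t. I k t \<omega>)"
        using \<omega> by (intro always_eventually allI continuous_on_subset[OF Icont]) auto
      from uniform_limit_theorem[OF this ul] show "continuous_on {0..real j} (\<lambda>t. N t \<omega>)"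
        unfolding N_def by simp
    qed
  qed
  have Nlim: "AE \<omega> in M. (\<lambda>k. I k t \<omega>) \<longlonglongrightarrow> N t \<omega>" if "0 \<le> t" for t
    using good
  proof eventually_elim
    fix \<omega> assume \<omega>: "\<omega> \<in> space M \<and> (\<exists>K. \<forall>k\<ge>K. \<omega> \<notin> A k)"
    obtain K' where K': "\<forall>k\<ge>K'. \<forall>s\<in>{0..t}. \<bar>I (Suc k) s \<omega> - I k s \<omega>\<bar> \<le> (1/2) ^ k"
      using steps \<omega> by blast
    show "(\<lambda>k. I k t \<omega>) \<longlonglongrightarrow> N t \<omega>"
      unfolding N_def
      by (rule uniform_limit_of_geometric_steps(2)[of K' "{0..t}" "\<lambda>k t. I k t \<omega>" t]) (use K' that in auto)
  qed
  have p0: "(\<lambda>k. ennreal (4 * (1/16) ^ k)) \<longlonglongrightarrow> 0"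
    using tendsto_ennrealI[OF tendsto_mult_right_zero[OF LIMSEQ_realpow_zero[of "1/16::real"], of 4]] by simp
  have "has_ito_integral M W \<phi> t (N t)" if t: "0 \<le> t" for t
    unfolding has_ito_integral_def
  proof (intro conjI exI[of _ n] exI[of _ \<tau>] exI[of _ \<xi>] allI si \<phi> fin[OF t])
    show Nm: "N t \<in> borel_measurable M" by (rule F_measurable_M[OF prog_adapted[OF Nprog t]])
    have ge: "\<forall>\<^sub>F k in sequentially. t \<le> real (Suc k)"
      using eventually_ge_at_top[of "nat \<lceil>t\<rceil>"] by eventually_elim linarith
    show "(\<lambda>k. sq_norm_on M {0..t} (\<lambda>s \<omega>. simple_process (n k) (\<tau> k) (\<xi> k) s \<omega> - \<phi> s \<omega>)) \<longlonglongrightarrow> 0"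
    proof (rule tendsto_sandwich[OF always_eventually _ tendsto_const p0])
      show "\<forall>\<^sub>F k in sequentially. sq_norm_on M {0..t} (\<lambda>s \<omega>. simple_process (n k) (\<tau> k) (\<xi> k) s \<omega> - \<phi> s \<omega>)
          \<le> ennreal (4 * (1/16) ^ k)"
        using ge
      proof eventually_elim
        fix k assume k: "t \<le> real (Suc k)"
        have "sq_norm_on M {0..t} (\<lambda>s \<omega>. H k s \<omega> - \<phi> s \<omega>) = ennreal (\<integral>p. (U (H k) p - U \<phi> p)\<^sup>2 \<partial>PP {0..t})"
          using sq_norm_on_PP[OF _ borel_measurable_diff[OF Hm[OF t, of k] \<phi>m[OF t]]] nn_sqint[OF sd[OF t]] by simp
        also have "\<dots> \<le> ennreal (4 * (1/16) ^ k)"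
        proof (rule ennreal_leI)
          show "(\<integral>p. (U (H k) p - U \<phi> p)\<^sup>2 \<partial>PP {0..t}) \<le> 4 * (1/16) ^ k"
            using c[OF t k] zero_le_power[of "1/16::real" k] by linarith
        qed
        finally show "sq_norm_on M {0..t} (\<lambda>s \<omega>. simple_process (n k) (\<tau> k) (\<xi> k) s \<omega> - \<phi> s \<omega>)
          \<le> ennreal (4 * (1/16) ^ k)" unfolding H_def .
      qed
    qed simp
    show "(\<lambda>k. \<integral>\<^sup>+\<omega>. ennreal ((simple_ito W (n k) (\<tau> k) (\<xi> k) t \<omega> - N t \<omega>)\<^sup>2) \<partial>M) \<longlonglongrightarrow> 0"
    proof (rule tendsto_sandwich[OF always_eventually _ tendsto_const p0])
      show "\<forall>\<^sub>F k in sequentially. (\<integral>\<^sup>+\<omega>. ennreal ((simple_ito W (n k) (\<tau> k) (\<xi> k) t \<omega> - N t \<omega>)\<^sup>2) \<partial>M)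
          \<le> ennreal (4 * (1/16) ^ k)"
        using ge
      proof eventually_elim
        fix k assume k: "t \<le> real (Suc k)"
        have "(\<integral>\<^sup>+\<omega>. ennreal ((simple_ito W (n k) (\<tau> k) (\<xi> k) t \<omega> - N t \<omega>)\<^sup>2) \<partial>M)
            = (\<integral>\<^sup>+\<omega>. ennreal ((I k t \<omega> - N t \<omega>)\<^sup>2) \<partial>M)"
          unfolding I_def
          by (rule nn_integral_cong_AE) (use simple_ito_V_eq_W[of "n k" "\<tau> k" "\<xi> k"] in \<open>eventually_elim, simp\<close>)
        also have "\<dots> \<le> ennreal (4 * (1/16) ^ k)"
        proof (rule nn_sq_le_of_tendsto[where u="\<lambda>m \<omega>. I k t \<omega> - I m t \<omega>"])
          show "(\<lambda>\<omega>. I k t \<omega> - I m t \<omega>) \<in> borel_measurable M" for m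
            by (rule sqint_measurable[OF sqint_diff[OF elem_sqint(2)[OF el t] elem_sqint(2)[OF el t]]])
          show "AE \<omega> in M. (\<lambda>m. I k t \<omega> - I m t \<omega>) \<longlonglongrightarrow> I k t \<omega> - N t \<omega>"
            using Nlim[OF t] by eventually_elim (intro tendsto_intros)
          show "\<forall>\<^sub>F m in sequentially. (\<integral>\<^sup>+\<omega>. ennreal ((I k t \<omega> - I m t \<omega>)\<^sup>2) \<partial>M) \<le> ennreal (4 * (1/16) ^ k)"
            using eventually_ge_at_top[of k]
          proof eventually_elim
            fix m assume "k \<le> m"
            from dist[OF t k this] show "(\<integral>\<^sup>+\<omega>. ennreal ((I k t \<omega> - I m t \<omega>)\<^sup>2) \<partial>M) \<le> ennreal (4 * (1/16) ^ k)"
              unfolding nn_sqint[OF sqint_diff[OF elem_sqint(2)[OF el[of k] t] elem_sqint(2)[OF el[of m] t]]]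
              by (rule ennreal_leI)
          qed
        qed
        finally show "(\<integral>\<^sup>+\<omega>. ennreal ((simple_ito W (n k) (\<tau> k) (\<xi> k) t \<omega> - N t \<omega>)\<^sup>2) \<partial>M)
          \<le> ennreal (4 * (1/16) ^ k)" .
      qed
    qed simp
  qed
  then show ?thesis using Nprog Ncont by blast
qed

end

section \<open>Iterated integral bounds and completeness\<close>

text \<open>Iterating a linear Volterra inequality produces the factorial. The lemma serves twice:
  with successive Picard differences for existence, and with a constant sequence in place of
  Gronwall's inequality for uniqueness.\<close>

lemma iterated_integral_bound:
  fixes a :: "nat \<Rightarrow> real \<Rightarrow> ennreal"
  assumes K: "0 \<le> K" and L: "0 \<le> L"
    and a0: "\<And>t. 0 \<le> t \<Longrightarrow> t \<le> T \<Longrightarrow> a 0 t \<le> ennreal K"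
    and step: "\<And>n t. 0 \<le> t \<Longrightarrow> t \<le> T \<Longrightarrow> a (Suc n) t \<le> ennreal L * (\<integral>\<^sup>+s\<in>{0..t}. a n s \<partial>lborel)"
  shows "0 \<le> t \<Longrightarrow> t \<le> T \<Longrightarrow> a n t \<le> ennreal (K * (L * t) ^ n / fact n)"
proof (induction n arbitrary: t)
  case 0
  then show ?case using a0 by simp
next
  case (Suc n)
  have "(\<integral>\<^sup>+s\<in>{0..t}. a n s \<partial>lborel) \<le> (\<integral>\<^sup>+s. ennreal (K * (L * s) ^ n / fact n) * indicator {0..t} s \<partial>lborel)"
    by (intro nn_integral_mono) (use Suc in \<open>auto simp: indicator_def\<close>)
  also have "\<dots> = ennreal (K * L ^ n * t ^ Suc n / fact (Suc n) - K * L ^ n * 0 ^ Suc n / fact (Suc n))"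
  proof (rule nn_integral_FTC_Icc)
    fix s assume s: "s \<in> {0..t}"
    show "((\<lambda>s. K * L ^ n * s ^ Suc n / fact (Suc n)) has_real_derivative (K * (L * s) ^ n / fact n)) (at s)"
    proof -
      have e: "K * L ^ n / fact (Suc n) * (real (Suc n) * s ^ n) = K * (L * s) ^ n / fact n"
        by (simp add: power_mult_distrib fact_Suc del: of_nat_Suc)
      have "((\<lambda>s. K * L ^ n / fact (Suc n) * s ^ Suc n) has_real_derivative
          K * L ^ n / fact (Suc n) * (real (Suc n) * s ^ (Suc n - Suc 0))) (at s)"
        by (rule DERIV_cmult[OF DERIV_pow])
      then show ?thesis unfolding diff_Suc_Suc diff_zero e by (simp only: times_divide_eq_left)
    qed
    show "0 \<le> K * (L * s) ^ n / fact n" using K L s by simp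
  qed (use Suc.prems in auto)
  finally have "ennreal L * (\<integral>\<^sup>+s\<in>{0..t}. a n s \<partial>lborel) \<le> ennreal L * ennreal (K * L ^ n * t ^ Suc n / fact (Suc n))"
    by (intro mult_left_mono) auto
  also have "\<dots> = ennreal (L * (K * L ^ n * t ^ Suc n / fact (Suc n)))"
    by (rule ennreal_mult'[OF L, symmetric])
  also have "L * (K * L ^ n * t ^ Suc n / fact (Suc n)) = K * (L * t) ^ Suc n / fact (Suc n)"
    by (simp add: power_mult_distrib)
  finally show ?case using step[OF Suc.prems, of n] by (rule order_trans[rotated])
qed

lemma power_div_fact_le_exp:
  fixes y :: real
  assumes "0 \<le> y"
  shows "y ^ n / fact n \<le> exp y"
proof -
  have s: "(\<lambda>n. y ^ n / fact n) sums exp y"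
    using exp_converges[of y] by (simp add: divide_inverse mult.commute)
  have "(\<Sum>k\<in>{n}. y ^ k / fact k) \<le> (\<Sum>k. y ^ k / fact k)"
    by (rule sum_le_suminf[OF sums_summable[OF s]]) (use assms in auto)
  then show ?thesis using sums_unique[OF s] by simp
qed

text \<open>Completeness with a pointwise limit: Chebyshev's inequality at level \<open>2^-n\<close>
  bounds the exceptional sets by \<open>C * 4^-n\<close>, and Borel-Cantelli applies. A pointwise
  limit is one function for all horizons and inherits progressive measurability, which a limit of
  equivalence classes would not provide.\<close>

lemma L2_geometric_limit:
  fixes g :: "nat \<Rightarrow> 'b \<Rightarrow> real"
  assumes "finite_measure \<mu>" and g: "\<And>n. sqint \<mu> (g n)"
    and step: "\<And>n. (\<integral>x. (g (Suc n) x - g n x)\<^sup>2 \<partial>\<mu>) \<le> C * (1/16) ^ n"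
  shows "sqint \<mu> (\<lambda>x. lim (\<lambda>n. g n x))"
    and "L2conv \<mu> g (\<lambda>x. lim (\<lambda>n. g n x))"
proof -
  interpret finite_measure \<mu> by fact
  define d where "d n x = g (Suc n) x - g n x" for n x
  have d: "sqint \<mu> (d n)" for n unfolding d_def by (rule sqint_diff[OF g g])
  define A where "A n = {x \<in> space \<mu>. (1/2) ^ n < \<bar>d n x\<bar>}" for n
  have A: "A n \<in> sets \<mu>" for n
    unfolding A_def using sqint_measurable[OF d[of n]] by (intro borel_measurable_less) auto
  have C0: "0 \<le> C" using order_trans[OF integral_nonneg_AE step[of 0]] by simp
  have Am: "measure \<mu> (A n) \<le> C * (1/4) ^ n" for n
  proof -
    have "(1/4) ^ n * measure \<mu> (A n) = (\<integral>x. (1/4) ^ n * indicator (A n) x \<partial>\<mu>)" using A by simp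
    also have "\<dots> \<le> (\<integral>x. (d n x)\<^sup>2 \<partial>\<mu>)"
    proof (rule integral_mono[OF _ sqint_integrable_sq[OF d]])
      show "integrable \<mu> (\<lambda>x. (1/4) ^ n * indicator (A n) x :: real)"
        by (intro integrable_mult_right integrable_real_indicator A) (simp add: emeasure_eq_measure)
      show "(1/4) ^ n * indicator (A n) x \<le> (d n x)\<^sup>2" for x
      proof (cases "x \<in> A n")
        case True
        then have "((1/2) ^ n)\<^sup>2 \<le> \<bar>d n x\<bar>\<^sup>2" unfolding A_def by (intro power_mono) auto
        moreover have "((1/2) ^ n)\<^sup>2 = (1/4 :: real) ^ n" by (simp add: power2_eq_square flip: power_mult_distrib)
        ultimately show ?thesis using True by simp
      qed simp
    qed
    also have "\<dots> \<le> C * (1/16) ^ n" unfolding d_def by (rule step)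
    also have "\<dots> = (1/4) ^ n * (C * (1/4) ^ n)" by (simp flip: power_mult_distrib)
    finally show ?thesis by (rule mult_left_le_imp_le) simp
  qed
  have "AE x in \<mu>. \<forall>\<^sub>F n in sequentially. x \<in> space \<mu> - A n"
  proof (rule borel_cantelli_AE1[OF A])
    show "emeasure \<mu> (A n) < \<infinity>" for n by (simp add: emeasure_eq_measure)
    show "summable (\<lambda>n. measure \<mu> (A n))"
      by (rule summable_comparison_test'[of "\<lambda>n. C * (1/4) ^ n" 0])
        (use Am in \<open>auto intro!: summable_mult summable_geometric\<close>)
  qed
  then have lim: "AE x in \<mu>. (\<lambda>n. g n x) \<longlonglongrightarrow> lim (\<lambda>n. g n x)"
    using AE_space
  proof eventually_elim
    fix x assume "\<forall>\<^sub>F n in sequentially. x \<in> space \<mu> - A n" and x: "x \<in> space \<mu>"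
    then obtain K where K: "\<And>n. K \<le> n \<Longrightarrow> x \<notin> A n" unfolding eventually_sequentially by blast
    show "(\<lambda>n. g n x) \<longlonglongrightarrow> lim (\<lambda>n. g n x)"
    proof (rule uniform_limit_of_geometric_steps(2)[of K "{x}" g x])
      show "\<bar>g (Suc k) t - g k t\<bar> \<le> (1/2) ^ k" if "K \<le> k" "t \<in> {x}" for k t
        using K[OF that(1)] x that(2) unfolding A_def d_def by (simp add: not_less)
    qed simp
  qed
  have dist: "(\<integral>x. (g n x - g (n + j) x)\<^sup>2 \<partial>\<mu>) \<le> 4 * C * (1/16) ^ n" for n j
  proof (induction j arbitrary: n)
    case 0 then show ?case using C0 by simp
  next
    case (Suc j)
    have "(\<integral>x. (g n x - g (n + Suc j) x)\<^sup>2 \<partial>\<mu>) =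
        (\<integral>x. ((- 1) * d n x + (g (Suc n) x - g (Suc n + j) x))\<^sup>2 \<partial>\<mu>)"
      by (simp add: d_def)
    also have "\<dots> \<le> 2 * (\<integral>x. ((- 1) * d n x)\<^sup>2 \<partial>\<mu>) + 2 * (\<integral>x. (g (Suc n) x - g (Suc n + j) x)\<^sup>2 \<partial>\<mu>)"
      by (rule integral_sq_add_le[OF sqint_cmult[OF d] sqint_diff[OF g g]])
    also have "\<dots> = 2 * (\<integral>x. (d n x)\<^sup>2 \<partial>\<mu>) + 2 * (\<integral>x. (g (Suc n) x - g (Suc n + j) x)\<^sup>2 \<partial>\<mu>)" by simp
    \<comment> \<open>The constant 4 survives the induction because
      \<open>2 + 2 * 4 / 16 \<le> 4\<close>.\<close>
    also have "\<dots> \<le> 2 * (C * (1/16) ^ n) + 2 * (4 * C * (1/16) ^ Suc n)"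
      using step[of n] Suc.IH[of "Suc n"] unfolding d_def by (intro add_mono mult_left_mono) auto
    also have "\<dots> \<le> 4 * C * (1/16) ^ n" using mult_nonneg_nonneg[OF C0, of "(1/16) ^ n"] by simp
    finally show ?case .
  qed
  have nn: "(\<integral>\<^sup>+x. ennreal ((g n x - lim (\<lambda>n. g n x))\<^sup>2) \<partial>\<mu>) \<le> ennreal (4 * C * (1/16) ^ n)" for n
  proof (rule nn_sq_le_of_tendsto[where u="\<lambda>m x. g n x - g m x"])
    show "(\<lambda>x. g n x - g m x) \<in> borel_measurable \<mu>" for m by (rule sqint_measurable[OF sqint_diff[OF g g]])
    show "AE x in \<mu>. (\<lambda>m. g n x - g m x) \<longlonglongrightarrow> g n x - lim (\<lambda>n. g n x)"
      using lim by eventually_elim (intro tendsto_intros)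
    show "\<forall>\<^sub>F m in sequentially. (\<integral>\<^sup>+x. ennreal ((g n x - g m x)\<^sup>2) \<partial>\<mu>) \<le> ennreal (4 * C * (1/16) ^ n)"
      using eventually_ge_at_top[of n]
    proof eventually_elim
      fix m assume "n \<le> m"
      then have "n + (m - n) = m" by simp
      then have "(\<integral>x. (g n x - g m x)\<^sup>2 \<partial>\<mu>) \<le> 4 * C * (1/16) ^ n" using dist[of n "m - n"] by metis
      then show "(\<integral>\<^sup>+x. ennreal ((g n x - g m x)\<^sup>2) \<partial>\<mu>) \<le> ennreal (4 * C * (1/16) ^ n)"
        unfolding nn_sqint[OF sqint_diff[OF g g]] by (rule ennreal_leI)
    qed
  qed
  have lm: "(\<lambda>x. lim (\<lambda>n. g n x)) \<in> borel_measurable \<mu>"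
    by (rule borel_measurable_lim_metric[OF sqint_measurable[OF g]])
  have sd: "sqint \<mu> (\<lambda>x. g n x - lim (\<lambda>n. g n x))" for n
    using sqint_iff_nn[OF borel_measurable_diff[OF sqint_measurable[OF g[of n]] lm]] nn[of n]
    by (simp add: le_less_trans)
  show sl: "sqint \<mu> (\<lambda>x. lim (\<lambda>n. g n x))"
    using sqint_diff[OF g[of 0] sd[of 0]] by simp
  have le: "(\<integral>x. (g n x - lim (\<lambda>n. g n x))\<^sup>2 \<partial>\<mu>) \<le> 4 * C * (1/16) ^ n" for n
    using nn[of n] C0 unfolding nn_sqint[OF sd] by (subst (asm) ennreal_le_iff) auto
  have z: "(\<lambda>n. 4 * C * (1/16) ^ n) \<longlonglongrightarrow> 0"
    by (intro tendsto_mult_right_zero LIMSEQ_realpow_zero) auto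
  have "(\<lambda>n. \<integral>x. (g n x - lim (\<lambda>n. g n x))\<^sup>2 \<partial>\<mu>) \<longlonglongrightarrow> 0"
  proof (rule tendsto_sandwich[OF always_eventually always_eventually tendsto_const z]; rule allI)
    show "0 \<le> (\<integral>x. (g n x - lim (\<lambda>n. g n x))\<^sup>2 \<partial>\<mu>)" for n by simp
  qed (rule le)
  then show "L2conv \<mu> g (\<lambda>x. lim (\<lambda>n. g n x))"
    using g sl by (simp add: L2conv_def)
qed

lemma set_integrable_Icc_nat:
  fixes f :: "real \<Rightarrow> real"
  assumes "\<forall>n::nat. set_integrable lborel {0..real n} f"
  shows "set_integrable lborel {0..t} f"
proof -
  obtain n :: nat where "t \<le> real n" using real_arch_simple by blast
  then show ?thesis by (intro set_integrable_subset[OF spec[OF assms, of n]]) auto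
qed

context brownian
begin

section \<open>Locally square integrable processes and their integrals\<close>

definition locL2 :: "(real \<Rightarrow> 'a \<Rightarrow> real) \<Rightarrow> bool" where
  "locL2 \<phi> \<longleftrightarrow> prog \<phi> \<and> (\<forall>T\<ge>0. sqint (PP {0..T}) (U \<phi>))"

lemma locL2_prog: "locL2 \<phi> \<Longrightarrow> prog \<phi>"
  unfolding locL2_def by (elim conjE)

lemma locL2_sqint: "locL2 \<phi> \<Longrightarrow> 0 \<le> T \<Longrightarrow> sqint (PP {0..T}) (U \<phi>)"
  unfolding locL2_def by (elim conjE allE[of _ T] impE)

lemma locL2_intro: "prog \<phi> \<Longrightarrow> (\<And>T. 0 \<le> T \<Longrightarrow> sqint (PP {0..T}) (U \<phi>)) \<Longrightarrow> locL2 \<phi>"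
  by (simp add: locL2_def)

lemma locL2_add: "locL2 \<phi> \<Longrightarrow> locL2 \<psi> \<Longrightarrow> locL2 (\<lambda>t \<omega>. \<phi> t \<omega> + \<psi> t \<omega>)"
  by (rule locL2_intro[OF prog_add[OF locL2_prog locL2_prog] sqint_add[OF locL2_sqint locL2_sqint]])

lemma locL2_diff: "locL2 \<phi> \<Longrightarrow> locL2 \<psi> \<Longrightarrow> locL2 (\<lambda>t \<omega>. \<phi> t \<omega> - \<psi> t \<omega>)"
  by (rule locL2_intro[OF prog_diff[OF locL2_prog locL2_prog] sqint_diff[OF locL2_sqint locL2_sqint]])

lemma locL2_cmult: "locL2 \<phi> \<Longrightarrow> locL2 (\<lambda>t \<omega>. c * \<phi> t \<omega>)"
  by (rule locL2_intro[OF prog_cmult[OF locL2_prog] sqint_cmult[OF locL2_sqint]])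

lemma locL2_const: "locL2 (\<lambda>_ _. c)"
  unfolding locL2_def using prog_const sqint_bounded[OF finite_measure_PP, of "\<lambda>_. c" _ "\<bar>c\<bar>"] by simp

lemma sq_norm_on_locL2:
  assumes "locL2 \<phi>" "0 \<le> T"
  shows "sq_norm_on M {0..T} \<phi> = ennreal (\<integral>p. (U \<phi> p)\<^sup>2 \<partial>PP {0..T})"
  using sq_norm_on_PP[OF _ sqint_measurable[OF locL2_sqint[OF assms]]] nn_sqint[OF locL2_sqint[OF assms]] by simp

lemma locL2I:
  assumes "prog \<phi>" "\<And>T. 0 \<le> T \<Longrightarrow> sq_norm_on M {0..T} \<phi> < \<infinity>"
  shows "locL2 \<phi>"
  unfolding locL2_def
proof (intro conjI allI impI assms(1))
  fix T :: real assume T: "0 \<le> T"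
  note m = prog_PP[OF assms(1) T]
  show "sqint (PP {0..T}) (U \<phi>)"
    using assms(2)[OF T] sqint_iff_nn[OF m] sq_norm_on_PP[OF _ m] by simp
qed

lemma L2F_locL2: "u \<in> L2F M W \<Longrightarrow> locL2 u"
proof (rule locL2I)
  fix T :: real assume "u \<in> L2F M W"
  then have "sq_norm_on M {0..} u < \<infinity>" by (simp add: L2F_def)
  moreover have "sq_norm_on M {0..T} u \<le> sq_norm_on M {0..} u" by (rule sq_norm_on_mono) auto
  ultimately show "sq_norm_on M {0..T} u < \<infinity>" by (rule le_less_trans[rotated])
qed (simp add: L2F_def)

section \<open>Time integrals of a process\<close>

definition drift :: "(real \<Rightarrow> 'a \<Rightarrow> real) \<Rightarrow> real \<Rightarrow> 'a \<Rightarrow> real" where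
  "drift b t \<omega> = (LINT s:{0..t}|lborel. b s \<omega>)"

lemma prog_drift: "prog b \<Longrightarrow> prog (drift b)"
  unfolding drift_def[abs_def] by (rule prog_integral)

lemma drift_0: "drift b 0 \<omega> = 0"
  unfolding drift_def set_lebesgue_integral_def
  by (rule integral_eq_zero_AE) (use AE_lborel_singleton[of 0] in \<open>eventually_elim, simp\<close>)

text \<open>Cauchy-Schwarz on the path against the constant 1. No integrability of the path is
  assumed: for \<open>t > 0\<close> an infinite integral makes the bound trivial.\<close>

lemma drift_sq_le:
  assumes b: "prog b" and t: "0 \<le> t" and \<omega>: "\<omega> \<in> space M"
  shows "ennreal ((drift b t \<omega>)\<^sup>2) \<le> ennreal t * (\<integral>\<^sup>+s\<in>{0..t}. ennreal ((b s \<omega>)\<^sup>2) \<partial>lborel)"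
proof (cases "t = 0")
  case True then show ?thesis by (simp add: drift_0)
next
  case False
  let ?R = "restrict_space lborel {0..t}"
  have emR: "emeasure ?R (space ?R) = ennreal t"
    using t by (simp add: emeasure_restrict_space space_restrict_space)
  have fR: "finite_measure ?R" by (rule finite_measureI) (simp only: emR, simp)
  have bm: "(\<lambda>s. b s \<omega>) \<in> borel_measurable ?R"
    using prog_path(1)[OF b t \<omega>] unfolding measurable_cong_sets[OF sets_restrict_lborel refl] .
  have D: "drift b t \<omega> = (\<integral>s. b s \<omega> \<partial>?R)"
    unfolding drift_def set_lebesgue_integral_def by (subst integral_restrict_space) auto
  have nn: "(\<integral>\<^sup>+s\<in>{0..t}. ennreal ((b s \<omega>)\<^sup>2) \<partial>lborel) = (\<integral>\<^sup>+s. ennreal ((b s \<omega>)\<^sup>2) \<partial>?R)"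
    by (subst nn_integral_restrict_space) auto
  show ?thesis
  proof (cases "(\<integral>\<^sup>+s. ennreal ((b s \<omega>)\<^sup>2) \<partial>?R) = \<infinity>")
    case True
    then show ?thesis unfolding nn using False t by (simp add: ennreal_mult_top)
  next
    case fin: False
    then have s: "sqint ?R (\<lambda>s. b s \<omega>)" using sqint_iff_nn[OF bm] by (simp add: less_top)
    have s1: "sqint ?R (\<lambda>_. 1)" by (rule sqint_bounded[OF fR, of _ 1]) auto
    have "measure ?R (space ?R) = t" using emR t by (simp add: measure_def)
    then have "(drift b t \<omega>)\<^sup>2 \<le> (\<integral>s. (b s \<omega>)\<^sup>2 \<partial>?R) * t"
      using Cauchy_Schwarz_integral[OF s s1] unfolding D by simp
    then have "ennreal ((drift b t \<omega>)\<^sup>2) \<le> ennreal (t * (\<integral>s. (b s \<omega>)\<^sup>2 \<partial>?R))"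
      by (intro ennreal_leI) (simp add: mult.commute)
    also have "\<dots> = ennreal t * (\<integral>\<^sup>+s. ennreal ((b s \<omega>)\<^sup>2) \<partial>?R)"
      unfolding nn_sqint[OF s] using t by (intro ennreal_mult) auto
    finally show ?thesis unfolding nn .
  qed
qed

lemma path_nn_measurable:
  assumes "I \<in> sets borel" "U b \<in> borel_measurable (PP I)"
  shows "(\<lambda>\<omega>. \<integral>\<^sup>+s\<in>I. ennreal ((b s \<omega>)\<^sup>2) \<partial>lborel) \<in> borel_measurable M"
proof -
  interpret R: sigma_finite_measure "restrict_space lborel I" by (rule sigma_finite_restrict_lborel[OF assms(1)])
  have "(\<lambda>(\<omega>, t). (\<lambda>p. ennreal ((U b p)\<^sup>2)) (t, \<omega>)) \<in> borel_measurable (M \<Otimes>\<^sub>M restrict_space lborel I)"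
    using measurable_ennreal_sq[OF assms(2)] unfolding PP_def by (rule measurable_pair_swap)
  then have "(\<lambda>\<omega>. \<integral>\<^sup>+s. ennreal ((b s \<omega>)\<^sup>2) \<partial>restrict_space lborel I) \<in> borel_measurable M"
    by (intro R.borel_measurable_nn_integral) simp
  then show ?thesis using assms(1) by (subst (asm) nn_integral_restrict_space) auto
qed

lemma drift_nn_le:
  assumes b: "prog b" and t: "0 \<le> t"
  shows "(\<integral>\<^sup>+\<omega>. ennreal ((drift b t \<omega>)\<^sup>2) \<partial>M) \<le> ennreal t * sq_norm_on M {0..t} b"
proof -
  have "(\<integral>\<^sup>+\<omega>. ennreal ((drift b t \<omega>)\<^sup>2) \<partial>M) \<le>
      (\<integral>\<^sup>+\<omega>. ennreal t * (\<integral>\<^sup>+s\<in>{0..t}. ennreal ((b s \<omega>)\<^sup>2) \<partial>lborel) \<partial>M)"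
    by (intro nn_integral_mono drift_sq_le b t)
  also have "\<dots> = ennreal t * sq_norm_on M {0..t} b"
    unfolding sq_norm_on_def
    by (rule nn_integral_cmult[OF path_nn_measurable[OF _ prog_PP[OF b t]]]) simp
  finally show ?thesis .
qed

lemma sq_norm_on_section:
  assumes "prog \<phi>" "0 \<le> T"
  shows "sq_norm_on M {0..T} \<phi> = (\<integral>\<^sup>+t\<in>{0..T}. (\<integral>\<^sup>+\<omega>. ennreal ((\<phi> t \<omega>)\<^sup>2) \<partial>M) \<partial>lborel)"
  using nn_integral_PP(2)[OF _ measurable_ennreal_sq[OF prog_PP[OF assms]]]
    sq_norm_on_PP[OF _ prog_PP[OF assms]] by simp

lemma sq_norm_on_le:
  assumes "prog \<phi>" "0 \<le> T" "\<And>t. 0 \<le> t \<Longrightarrow> t \<le> T \<Longrightarrow> (\<integral>\<^sup>+\<omega>. ennreal ((\<phi> t \<omega>)\<^sup>2) \<partial>M) \<le> c"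
  shows "sq_norm_on M {0..T} \<phi> \<le> c * ennreal T"
proof -
  have "sq_norm_on M {0..T} \<phi> \<le> (\<integral>\<^sup>+t. c * indicator {0..T} t \<partial>lborel)"
    unfolding sq_norm_on_section[OF assms(1,2)]
    by (intro nn_integral_mono) (use assms(3) in \<open>auto simp: indicator_def\<close>)
  also have "\<dots> = c * ennreal T" using assms(2) by (subst nn_integral_cmult_indicator) auto
  finally show ?thesis .
qed

lemma locL2_drift:
  assumes "locL2 b" shows "locL2 (drift b)"
proof (rule locL2I)
  show p: "prog (drift b)" by (rule prog_drift[OF locL2_prog[OF assms]])
  fix T :: real assume T: "0 \<le> T"
  have "sq_norm_on M {0..T} (drift b) \<le> (ennreal T * sq_norm_on M {0..T} b) * ennreal T"
  proof (rule sq_norm_on_le[OF p T])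
    fix t assume t: "0 \<le> t" "t \<le> T"
    have "(\<integral>\<^sup>+\<omega>. ennreal ((drift b t \<omega>)\<^sup>2) \<partial>M) \<le> ennreal t * sq_norm_on M {0..t} b"
      by (rule drift_nn_le[OF locL2_prog[OF assms] t(1)])
    also have "\<dots> \<le> ennreal T * sq_norm_on M {0..T} b"
      using t by (intro mult_mono sq_norm_on_mono ennreal_leI) auto
    finally show "(\<integral>\<^sup>+\<omega>. ennreal ((drift b t \<omega>)\<^sup>2) \<partial>M) \<le> ennreal T * sq_norm_on M {0..T} b" .
  qed
  also have "\<dots> < \<infinity>" unfolding sq_norm_on_locL2[OF assms T] by (simp add: ennreal_mult_less_top)
  finally show "sq_norm_on M {0..T} (drift b) < \<infinity>" .
qed

lemma sqint_drift:
  assumes "locL2 b" "0 \<le> t" shows "sqint M (drift b t)"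
proof -
  have m: "drift b t \<in> borel_measurable M"
    by (rule F_measurable_M[OF prog_adapted[OF prog_drift[OF locL2_prog[OF assms(1)]] assms(2)]])
  have "(\<integral>\<^sup>+\<omega>. ennreal ((drift b t \<omega>)\<^sup>2) \<partial>M) \<le> ennreal t * sq_norm_on M {0..t} b"
    by (rule drift_nn_le[OF locL2_prog[OF assms(1)] assms(2)])
  also have "\<dots> < \<infinity>" unfolding sq_norm_on_locL2[OF assms] by (simp add: ennreal_mult_less_top)
  finally show ?thesis using sqint_iff_nn[OF m] by simp
qed

text \<open>Only countably many horizons are asked for, so that one null set serves all times;
  \<open>set_integrable_Icc_nat\<close> recovers the others.\<close>

lemma drift_integrable_AE:
  assumes "locL2 b"
  shows "AE \<omega> in M. \<forall>n::nat. set_integrable lborel {0..real n} (\<lambda>s. b s \<omega>)"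
proof -
  have "AE \<omega> in M. set_integrable lborel {0..real n} (\<lambda>s. b s \<omega>)" for n :: nat
    using integral_PP(3)[OF _ sqint_integrable[OF finite_measure_PP locL2_sqint[OF assms, of "real n"]]] by simp
  then show ?thesis by (simp add: AE_all_countable)
qed

lemma drift_continuous:
  assumes "locL2 b"
  shows "AE \<omega> in M. continuous_on {0..} (\<lambda>t. drift b t \<omega>)"
  using drift_integrable_AE[OF assms]
proof eventually_elim
  fix \<omega> assume i: "\<forall>n::nat. set_integrable lborel {0..real n} (\<lambda>s. b s \<omega>)"
  have eq: "drift b t \<omega> = integral {0..t} (\<lambda>s. b s \<omega>)" for t
    unfolding drift_def by (rule set_borel_integral_eq_integral(2)[OF set_integrable_Icc_nat[OF i]])
  show "continuous_on {0..} (\<lambda>t. drift b t \<omega>)"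
    unfolding eq
    by (rule continuous_on_atLeast_0, rule indefinite_integral_continuous_1,
        rule set_borel_integral_eq_integral(1)) (use i in blast)
qed

lemma drift_diff:
  assumes "locL2 a" "locL2 b"
  shows "AE \<omega> in M. \<forall>t. drift (\<lambda>s \<omega>. a s \<omega> - b s \<omega>) t \<omega> = drift a t \<omega> - drift b t \<omega>"
  using drift_integrable_AE[OF assms(1)] drift_integrable_AE[OF assms(2)]
proof eventually_elim
  fix \<omega> assume i: "\<forall>n::nat. set_integrable lborel {0..real n} (\<lambda>s. a s \<omega>)"
    "\<forall>n::nat. set_integrable lborel {0..real n} (\<lambda>s. b s \<omega>)"
  show "\<forall>t. drift (\<lambda>s \<omega>. a s \<omega> - b s \<omega>) t \<omega> = drift a t \<omega> - drift b t \<omega>"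
    unfolding drift_def
    by (rule allI, rule set_integral_diff(2)[OF set_integrable_Icc_nat[OF i(1)] set_integrable_Icc_nat[OF i(2)]])
qed

lemma drift_cong:
  assumes ab: "locL2 a" "locL2 b" and t: "0 \<le> t" and eq: "AE p in PP {0..t}. U a p = U b p"
  shows "AE \<omega> in M. drift a t \<omega> = drift b t \<omega>"
proof -
  let ?d = "\<lambda>s \<omega>. a s \<omega> - b s \<omega>"
  note d = locL2_diff[OF ab]
  have "(\<integral>p. (U ?d p)\<^sup>2 \<partial>PP {0..t}) = 0"
    by (rule integral_eq_zero_AE) (use eq in \<open>eventually_elim, simp\<close>)
  then have "sq_norm_on M {0..t} ?d = 0" unfolding sq_norm_on_locL2[OF d t] by simp
  then have "(\<integral>\<^sup>+\<omega>. ennreal ((drift ?d t \<omega>)\<^sup>2) \<partial>M) = 0"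
    using drift_nn_le[OF locL2_prog[OF d] t] by simp
  then have "AE \<omega> in M. ennreal ((drift ?d t \<omega>)\<^sup>2) = 0"
    using nn_integral_0_iff_AE[OF measurable_ennreal_sq[OF sqint_measurable[OF sqint_drift[OF d t]]]] by simp
  then show ?thesis using drift_diff[OF ab] by eventually_elim simp
qed

section \<open>Stochastic integrals as processes\<close>

lemma ito_nn:
  assumes "locL2 \<phi>" "0 \<le> t" "ito \<phi> t Y"
  shows "(\<integral>\<^sup>+\<omega>. ennreal ((Y \<omega>)\<^sup>2) \<partial>M) = sq_norm_on M {0..t} \<phi>"
  unfolding sq_norm_on_locL2[OF assms(1,2)] nn_sqint[OF ito_sqint(2)[OF assms(3)]] ito_isometry[OF assms(2,3)] ..

text \<open>Turns the integral of the Picard limit into the integral of the solution built from it,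
  which agrees with the limit only almost everywhere.\<close>

lemma has_ito_integral_cong:
  assumes h: "has_ito_integral M W \<phi> t Y" and \<psi>: "prog \<psi>" and t: "0 \<le> t"
    and eq: "AE p in PP {0..t}. U \<phi> p = U \<psi> p"
  shows "has_ito_integral M W \<psi> t Y"
proof -
  obtain n \<tau> \<xi> where
    \<phi>: "prog \<phi>" "sq_norm_on M {0..t} \<phi> < \<infinity>" and Y: "Y \<in> borel_measurable M"
    and si: "\<forall>k::nat. simple_integrand M F (n k) (\<tau> k) (\<xi> k)"
    and l1: "(\<lambda>k. sq_norm_on M {0..t} (\<lambda>s \<omega>. simple_process (n k) (\<tau> k) (\<xi> k) s \<omega> - \<phi> s \<omega>)) \<longlonglongrightarrow> 0"
    and l2: "(\<lambda>k. \<integral>\<^sup>+\<omega>. ennreal ((simple_ito W (n k) (\<tau> k) (\<xi> k) t \<omega> - Y \<omega>)\<^sup>2) \<partial>M) \<longlonglongrightarrow> 0"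
    using h unfolding has_ito_integral_def by blast
  note m = prog_PP[OF \<phi>(1) t] prog_PP[OF \<psi> t]
  have Hm: "U (simple_process (n k) (\<tau> k) (\<xi> k)) \<in> borel_measurable (PP {0..t})" for k
    using si by (intro sqint_measurable[OF elem_sqint(1)[OF simple_integrand_elem t]]) blast
  have e: "sq_norm_on M {0..t} (\<lambda>s \<omega>. simple_process (n k) (\<tau> k) (\<xi> k) s \<omega> - \<phi> s \<omega>)
     = sq_norm_on M {0..t} (\<lambda>s \<omega>. simple_process (n k) (\<tau> k) (\<xi> k) s \<omega> - \<psi> s \<omega>)" for k
    unfolding sq_norm_on_PP[OF borel_closed[OF closed_atLeastAtMost] borel_measurable_diff[OF Hm[of k] m(1)]]
      sq_norm_on_PP[OF borel_closed[OF closed_atLeastAtMost] borel_measurable_diff[OF Hm[of k] m(2)]]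
    by (rule nn_integral_cong_AE) (use eq in \<open>eventually_elim, simp\<close>)
  have "sq_norm_on M {0..t} \<phi> = sq_norm_on M {0..t} \<psi>"
    unfolding sq_norm_on_PP[OF borel_closed[OF closed_atLeastAtMost] m(1)]
      sq_norm_on_PP[OF borel_closed[OF closed_atLeastAtMost] m(2)]
    by (rule nn_integral_cong_AE) (use eq in \<open>eventually_elim, simp\<close>)
  then show ?thesis
    unfolding has_ito_integral_def using \<psi> \<phi>(2) Y si l1[unfolded e] l2 by auto
qed

text \<open>A continuous version is fixed once for each integrand, so that the integral is a process
  and not a separate random variable for each time.\<close>

definition stoch :: "(real \<Rightarrow> 'a \<Rightarrow> real) \<Rightarrow> real \<Rightarrow> 'a \<Rightarrow> real" where
  "stoch \<phi> = (SOME N. prog N \<and> (AE \<omega> in M. continuous_on {0..} (\<lambda>t. N t \<omega>)) \<and>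
     (\<forall>t\<ge>0. has_ito_integral M W \<phi> t (N t)))"

lemma stoch:
  assumes "locL2 \<phi>"
  shows "prog (stoch \<phi>)" "AE \<omega> in M. continuous_on {0..} (\<lambda>t. stoch \<phi> t \<omega>)"
    "0 \<le> t \<Longrightarrow> has_ito_integral M W \<phi> t (stoch \<phi> t)" "0 \<le> t \<Longrightarrow> ito \<phi> t (stoch \<phi> t)"
proof -
  have "\<exists>N. prog N \<and> (AE \<omega> in M. continuous_on {0..} (\<lambda>t. N t \<omega>)) \<and>
     (\<forall>t\<ge>0. has_ito_integral M W \<phi> t (N t))"
    by (rule ito_integral_exists[OF locL2_prog[OF assms]]) (simp add: sq_norm_on_locL2[OF assms])
  from someI_ex[OF this]
  show 1: "prog (stoch \<phi>)" "AE \<omega> in M. continuous_on {0..} (\<lambda>t. stoch \<phi> t \<omega>)"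
    "0 \<le> t \<Longrightarrow> has_ito_integral M W \<phi> t (stoch \<phi> t)"
    unfolding stoch_def by auto
  then show "0 \<le> t \<Longrightarrow> ito \<phi> t (stoch \<phi> t)" by (intro has_ito_integral_ito)
qed

lemma locL2_stoch:
  assumes "locL2 \<phi>" shows "locL2 (stoch \<phi>)"
proof (rule locL2I[OF stoch(1)[OF assms]])
  fix T :: real assume T: "0 \<le> T"
  have "sq_norm_on M {0..T} (stoch \<phi>) \<le> sq_norm_on M {0..T} \<phi> * ennreal T"
  proof (rule sq_norm_on_le[OF stoch(1)[OF assms] T])
    fix t assume t: "0 \<le> t" "t \<le> T"
    show "(\<integral>\<^sup>+\<omega>. ennreal ((stoch \<phi> t \<omega>)\<^sup>2) \<partial>M) \<le> sq_norm_on M {0..T} \<phi>"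
      unfolding ito_nn[OF assms t(1) stoch(4)[OF assms t(1)]] using t by (intro sq_norm_on_mono) auto
  qed
  also have "\<dots> < \<infinity>" unfolding sq_norm_on_locL2[OF assms T] by (simp add: ennreal_mult_less_top)
  finally show "sq_norm_on M {0..T} (stoch \<phi>) < \<infinity>" .
qed

lemma sq_norm_on_cmult:
  assumes "locL2 d" "0 \<le> t"
  shows "sq_norm_on M {0..t} (\<lambda>s \<omega>. c * d s \<omega>) = ennreal (c\<^sup>2) * sq_norm_on M {0..t} d"
  unfolding sq_norm_on_locL2[OF locL2_cmult[OF assms(1)] assms(2)] sq_norm_on_locL2[OF assms]
  by (simp add: power_mult_distrib ennreal_mult')

text \<open>Covers both the difference of two images under the Picard map and the difference of two
  given solutions; for the latter \<open>S\<close> has to be an arbitrary version of the integral.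
  The two summands of the constant come from Cauchy-Schwarz for the drift and from the
  isometry.\<close>

lemma linear_step_estimate:
  assumes d: "locL2 d" and t: "0 \<le> t" "t \<le> T" and S: "ito (\<lambda>s \<omega>. C * d s \<omega>) t S"
    and Y: "AE \<omega> in M. Y \<omega> = drift (\<lambda>s \<omega>. A * d s \<omega>) t \<omega> + S \<omega>"
  shows "(\<integral>\<^sup>+\<omega>. ennreal ((Y \<omega>)\<^sup>2) \<partial>M) \<le> ennreal (2 * T * A\<^sup>2 + 2 * C\<^sup>2) * sq_norm_on M {0..t} d"
proof -
  note Ad = locL2_cmult[OF d, of A]
  let ?n = "\<integral>p. (U d p)\<^sup>2 \<partial>PP {0..t}"
  have "(\<integral>\<^sup>+\<omega>. ennreal ((Y \<omega>)\<^sup>2) \<partial>M) = (\<integral>\<^sup>+\<omega>. ennreal ((drift (\<lambda>s \<omega>. A * d s \<omega>) t \<omega> + S \<omega>)\<^sup>2) \<partial>M)"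
    by (rule nn_integral_cong_AE) (use Y in \<open>eventually_elim, simp\<close>)
  also have "\<dots> \<le> 2 * (\<integral>\<^sup>+\<omega>. ennreal ((drift (\<lambda>s \<omega>. A * d s \<omega>) t \<omega>)\<^sup>2) \<partial>M) + 2 * (\<integral>\<^sup>+\<omega>. ennreal ((S \<omega>)\<^sup>2) \<partial>M)"
    by (rule nn_sq_add_le[OF sqint_measurable[OF sqint_drift[OF Ad t(1)]] sqint_measurable[OF ito_sqint(2)[OF S]]])
  also have "\<dots> \<le> 2 * (ennreal T * (ennreal (A\<^sup>2) * ennreal ?n)) + 2 * (ennreal (C\<^sup>2) * ennreal ?n)"
  proof (intro add_mono mult_left_mono)
    have "(\<integral>\<^sup>+\<omega>. ennreal ((drift (\<lambda>s \<omega>. A * d s \<omega>) t \<omega>)\<^sup>2) \<partial>M) \<le> ennreal t * (ennreal (A\<^sup>2) * ennreal ?n)"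
      using drift_nn_le[OF locL2_prog[OF Ad] t(1)] unfolding sq_norm_on_cmult[OF d t(1)] sq_norm_on_locL2[OF d t(1)] .
    also have "\<dots> \<le> ennreal T * (ennreal (A\<^sup>2) * ennreal ?n)"
      using t by (intro mult_right_mono ennreal_leI) auto
    finally show "(\<integral>\<^sup>+\<omega>. ennreal ((drift (\<lambda>s \<omega>. A * d s \<omega>) t \<omega>)\<^sup>2) \<partial>M) \<le> ennreal T * (ennreal (A\<^sup>2) * ennreal ?n)" .
    show "(\<integral>\<^sup>+\<omega>. ennreal ((S \<omega>)\<^sup>2) \<partial>M) \<le> ennreal (C\<^sup>2) * ennreal ?n"
      unfolding ito_nn[OF locL2_cmult[OF d] t(1) S] sq_norm_on_cmult[OF d t(1)] sq_norm_on_locL2[OF d t(1)] ..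
  qed simp_all
  also have "\<dots> = ennreal (2 * (T * (A\<^sup>2 * ?n)) + 2 * (C\<^sup>2 * ?n))"
  proof -
    have T: "0 \<le> T" using t by simp
    have two: "2 * ennreal r = ennreal (2 * r)" if "0 \<le> r" for r
      using that by (subst ennreal_numeral[symmetric], subst ennreal_mult[symmetric]) auto
    show ?thesis using T by (simp add: two ennreal_mult'[symmetric] del: ennreal_mult')
  qed
  also have "2 * (T * (A\<^sup>2 * ?n)) + 2 * (C\<^sup>2 * ?n) = (2 * T * A\<^sup>2 + 2 * C\<^sup>2) * ?n"
    by (simp add: algebra_simps)
  also have "ennreal ((2 * T * A\<^sup>2 + 2 * C\<^sup>2) * ?n) = ennreal (2 * T * A\<^sup>2 + 2 * C\<^sup>2) * ennreal ?n"
    using t by (intro ennreal_mult) auto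
  finally show ?thesis unfolding sq_norm_on_locL2[OF d t(1)] .
qed

end

lemma L2conv_unique:
  assumes "L2conv \<mu> f g" "L2conv \<mu> f h"
  shows "AE x in \<mu>. g x = h x"
proof -
  have s: "sqint \<mu> (\<lambda>x. g x - h x)" using assms by (auto simp: L2conv_def intro: sqint_diff)
  have "(\<lambda>k::nat. \<integral>x. (f k x - f k x - (g x - h x))\<^sup>2 \<partial>\<mu>) \<longlonglongrightarrow> 0"
    using L2conv_diff[OF assms] by (simp add: L2conv_def)
  then have "(\<integral>x. (g x - h x)\<^sup>2 \<partial>\<mu>) = 0"
    by (simp add: LIMSEQ_const_iff power2_commute)
  from integral_sq_zero_AE[OF s this] show ?thesis by eventually_elim simp
qed

lemma ennreal_geometric_zero:
  assumes "\<And>n. m \<le> ennreal (C * (1/16) ^ n)"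
  shows "m = 0"
proof -
  have "(\<lambda>n. ennreal (C * (1/16) ^ n)) \<longlonglongrightarrow> ennreal 0"
    by (intro tendsto_ennrealI tendsto_mult_right_zero LIMSEQ_realpow_zero) auto
  then have "m \<le> ennreal 0"
    by (rule tendsto_lowerbound) (use assms in auto)
  then show ?thesis by simp
qed

text \<open>A factor \<open>16^n\<close> is traded for an exponential, since
  \<open>(16 y)^n / n!\<close> is at most \<open>exp (16 y)\<close>; factorial decay becomes the
  ratio 1/16 that \<open>L2_geometric_limit\<close> expects.\<close>

lemma factorial_geometric_bound:
  fixes K L t T :: real
  assumes "0 \<le> K" "0 \<le> L" "0 \<le> t" "t \<le> T"
  shows "K * (L * t) ^ n / fact n \<le> K * exp (16 * L * T) * (1/16) ^ n"
proof -
  have "(L * t) ^ n / fact n = (16 * L * t) ^ n / fact n * (1/16) ^ n"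
    by (simp add: power_mult_distrib power_divide)
  also have "\<dots> \<le> exp (16 * L * t) * (1/16) ^ n"
    using assms by (intro mult_right_mono power_div_fact_le_exp) auto
  also have "\<dots> \<le> exp (16 * L * T) * (1/16) ^ n"
    using assms by (intro mult_right_mono) (auto intro: mult_left_mono)
  finally have "K * ((L * t) ^ n / fact n) \<le> K * (exp (16 * L * T) * (1/16) ^ n)"
    using assms by (intro mult_left_mono) auto
  then show ?thesis by (simp add: mult.assoc)
qed

context brownian
begin

section \<open>Existence and uniqueness for the controlled linear equation\<close>

text \<open>The Picard map of the equation.\<close>

definition lmap :: "real \<Rightarrow> real \<Rightarrow> real \<Rightarrow> real \<Rightarrow> real \<Rightarrow> (real \<Rightarrow> 'a \<Rightarrow> real) \<Rightarrow>
    (real \<Rightarrow> 'a \<Rightarrow> real) \<Rightarrow> real \<Rightarrow> 'a \<Rightarrow> real" where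
  "lmap A B C D x u X t \<omega> = x + drift (\<lambda>s \<omega>. A * X s \<omega> + B * u s \<omega>) t \<omega>
     + stoch (\<lambda>s \<omega>. C * X s \<omega> + D * u s \<omega>) t \<omega>"

lemma locL2_lin: "locL2 X \<Longrightarrow> locL2 u \<Longrightarrow> locL2 (\<lambda>s \<omega>. a * X s \<omega> + b * u s \<omega>)"
  by (rule locL2_add[OF locL2_cmult locL2_cmult])

lemma locL2_lmap: "locL2 X \<Longrightarrow> locL2 u \<Longrightarrow> locL2 (lmap A B C D x u X)"
  unfolding lmap_def[abs_def]
  by (rule locL2_add[OF locL2_add[OF locL2_const locL2_drift[OF locL2_lin]] locL2_stoch[OF locL2_lin]])

lemma lmap_continuous:
  assumes "locL2 X" "locL2 u"
  shows "AE \<omega> in M. continuous_on {0..} (\<lambda>t. lmap A B C D x u X t \<omega>)"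
  using drift_continuous[OF locL2_lin[OF assms, of A B]] stoch(2)[OF locL2_lin[OF assms, of C D]]
  unfolding lmap_def by eventually_elim (intro continuous_on_add continuous_on_const)

lemma drift_lin_diff:
  assumes "locL2 X" "locL2 Y" "locL2 u"
  shows "AE \<omega> in M. drift (\<lambda>s \<omega>. A * (X s \<omega> - Y s \<omega>)) t \<omega> =
    drift (\<lambda>s \<omega>. A * X s \<omega> + B * u s \<omega>) t \<omega> - drift (\<lambda>s \<omega>. A * Y s \<omega> + B * u s \<omega>) t \<omega>"
proof -
  have e: "(\<lambda>s \<omega>. A * X s \<omega> + B * u s \<omega> - (A * Y s \<omega> + B * u s \<omega>)) = (\<lambda>s \<omega>. A * (X s \<omega> - Y s \<omega>))"
    by (simp add: fun_eq_iff algebra_simps)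
  from drift_diff[OF locL2_lin[OF assms(1,3), of A B] locL2_lin[OF assms(2,3), of A B]]
  show ?thesis unfolding e by eventually_elim simp
qed

lemma ito_lin_diff:
  assumes "ito (\<lambda>s \<omega>. C * X s \<omega> + D * u s \<omega>) t S" "ito (\<lambda>s \<omega>. C * Y s \<omega> + D * u s \<omega>) t S'"
  shows "ito (\<lambda>s \<omega>. C * (X s \<omega> - Y s \<omega>)) t (\<lambda>\<omega>. S \<omega> - S' \<omega>)"
proof -
  have e: "(\<lambda>s \<omega>. C * X s \<omega> + D * u s \<omega> - (C * Y s \<omega> + D * u s \<omega>)) = (\<lambda>s \<omega>. C * (X s \<omega> - Y s \<omega>))"
    by (simp add: fun_eq_iff algebra_simps)
  from ito_diff[OF assms] show ?thesis unfolding e .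
qed

lemma lmap_estimate:
  assumes X: "locL2 X" and Y: "locL2 Y" and u: "locL2 u" and t: "0 \<le> t" "t \<le> T"
  shows "(\<integral>\<^sup>+\<omega>. ennreal ((lmap A B C D x u X t \<omega> - lmap A B C D x u Y t \<omega>)\<^sup>2) \<partial>M)
    \<le> ennreal (2 * T * A\<^sup>2 + 2 * C\<^sup>2) * sq_norm_on M {0..t} (\<lambda>s \<omega>. X s \<omega> - Y s \<omega>)"
proof (rule linear_step_estimate[OF locL2_diff[OF X Y] t])
  show "ito (\<lambda>s \<omega>. C * (X s \<omega> - Y s \<omega>)) t
      (\<lambda>\<omega>. stoch (\<lambda>s \<omega>. C * X s \<omega> + D * u s \<omega>) t \<omega> - stoch (\<lambda>s \<omega>. C * Y s \<omega> + D * u s \<omega>) t \<omega>)"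
    by (rule ito_lin_diff[OF stoch(4)[OF locL2_lin[OF X u] t(1)] stoch(4)[OF locL2_lin[OF Y u] t(1)]])
  show "AE \<omega> in M. lmap A B C D x u X t \<omega> - lmap A B C D x u Y t \<omega> =
      drift (\<lambda>s \<omega>. A * (X s \<omega> - Y s \<omega>)) t \<omega> +
      (stoch (\<lambda>s \<omega>. C * X s \<omega> + D * u s \<omega>) t \<omega> - stoch (\<lambda>s \<omega>. C * Y s \<omega> + D * u s \<omega>) t \<omega>)"
    using drift_lin_diff[OF X Y u, of A t B] unfolding lmap_def by eventually_elim simp
qed

text \<open>Picard iteration. The pointwise limit \<open>Xl\<close> is fixed by \<Phi> only almost
  everywhere, and nothing is known about the continuity of its paths. The solution is therefore
  \<open>Y = \<Phi> Xl\<close>, which has continuous paths; its integrals are those of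
  \<open>Xl\<close>, because the integrands agree almost everywhere.\<close>

lemma lsde_exists:
  assumes u: "locL2 u"
  shows "\<exists>X. solves_lsde M W A B C D x u X"
proof -
  define \<Phi> where "\<Phi> = lmap A B C D x u"
  define X where "X n = (\<Phi> ^^ n) (\<lambda>_ _. 0)" for n :: nat
  have XS: "X (Suc n) = \<Phi> (X n)" for n by (simp add: X_def)
  have X: "locL2 (X n)" for n
    by (induction n) (simp_all add: X_def \<Phi>_def locL2_const locL2_lmap u)
  have est: "(\<integral>\<^sup>+\<omega>. ennreal ((\<Phi> Y t \<omega> - \<Phi> Z t \<omega>)\<^sup>2) \<partial>M)
      \<le> ennreal (2 * T * A\<^sup>2 + 2 * C\<^sup>2) * sq_norm_on M {0..t} (\<lambda>s \<omega>. Y s \<omega> - Z s \<omega>)"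
    if "locL2 Y" "locL2 Z" "0 \<le> t" "t \<le> T" for Y Z t T
    unfolding \<Phi>_def by (rule lmap_estimate[OF that(1,2) u that(3,4)])
  define Xl where "Xl t \<omega> = lim (\<lambda>n. X (Suc n) t \<omega>)" for t \<omega>
  have conv: "sqint (PP {0..T}) (U Xl) \<and> L2conv (PP {0..T}) (\<lambda>n. U (X (Suc n))) (U Xl)" if T: "0 \<le> T" for T
  proof -
    define L where "L = 2 * T * A\<^sup>2 + 2 * C\<^sup>2"
    have L0: "0 \<le> L" using T by (simp add: L_def)
    \<comment> \<open>The first difference is controlled only in the time-integrated norm. One
      application of \<open>est\<close> turns this into a bound uniform in \<open>t\<close>, which
      is why \<open>a\<close> begins with the second difference.\<close>
    define K where "K = L * (\<integral>p. (X (Suc 0) (fst p) (snd p) - X 0 (fst p) (snd p))\<^sup>2 \<partial>PP {0..T})"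
    have K0: "0 \<le> K" using L0 by (simp add: K_def)
    define a where "a n t = (\<integral>\<^sup>+\<omega>. ennreal ((X (Suc (Suc n)) t \<omega> - X (Suc n) t \<omega>)\<^sup>2) \<partial>M)" for n t
    note dX = locL2_diff[OF X X]
    have a_le: "a n t \<le> ennreal (K * (L * t) ^ n / fact n)" if "0 \<le> t" "t \<le> T" for n t
    proof (rule iterated_integral_bound[OF K0 L0 _ _ that])
      fix t assume t: "0 \<le> t" "t \<le> T"
      have "a 0 t \<le> ennreal L * sq_norm_on M {0..t} (\<lambda>s \<omega>. X (Suc 0) s \<omega> - X 0 s \<omega>)"
        using est[OF X[of "Suc 0"] X[of 0] t] unfolding a_def XS[symmetric] L_def .
      also have "\<dots> \<le> ennreal L * sq_norm_on M {0..T} (\<lambda>s \<omega>. X (Suc 0) s \<omega> - X 0 s \<omega>)"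
        using t by (intro mult_left_mono sq_norm_on_mono) auto
      also have "\<dots> = ennreal K"
        unfolding sq_norm_on_locL2[OF dX T] K_def by (rule ennreal_mult'[OF L0, symmetric])
      finally show "a 0 t \<le> ennreal K" .
      fix n
      have "a (Suc n) t \<le> ennreal L * sq_norm_on M {0..t} (\<lambda>s \<omega>. X (Suc (Suc n)) s \<omega> - X (Suc n) s \<omega>)"
        using est[OF X[of "Suc (Suc n)"] X[of "Suc n"] t] unfolding a_def XS[symmetric] L_def .
      then show "a (Suc n) t \<le> ennreal L * (\<integral>\<^sup>+s\<in>{0..t}. a n s \<partial>lborel)"
        unfolding sq_norm_on_section[OF locL2_prog[OF dX] t(1)] a_def .
    qed
    define c where "c = K * exp (16 * L * T) * T"
    have step: "(\<integral>p. (U (X (Suc (Suc n))) p - U (X (Suc n)) p)\<^sup>2 \<partial>PP {0..T}) \<le> c * (1/16) ^ n" for n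
    proof -
      have "sq_norm_on M {0..T} (\<lambda>s \<omega>. X (Suc (Suc n)) s \<omega> - X (Suc n) s \<omega>)
          \<le> ennreal (K * exp (16 * L * T) * (1/16) ^ n) * ennreal T"
      proof (rule sq_norm_on_le[OF locL2_prog[OF dX] T])
        fix t assume t: "0 \<le> t" "t \<le> T"
        show "(\<integral>\<^sup>+\<omega>. ennreal ((X (Suc (Suc n)) t \<omega> - X (Suc n) t \<omega>)\<^sup>2) \<partial>M)
            \<le> ennreal (K * exp (16 * L * T) * (1/16) ^ n)"
          using a_le[OF t, of n] ennreal_leI[OF factorial_geometric_bound[OF K0 L0 t, of n]]
          unfolding a_def by (rule order_trans)
      qed
      also have "\<dots> = ennreal (c * (1/16) ^ n)"
        unfolding c_def using K0 T by (subst ennreal_mult[symmetric]) (auto simp: mult_ac)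
      finally show ?thesis
        unfolding sq_norm_on_locL2[OF dX T] using K0 T
        by (subst (asm) ennreal_le_iff) (auto simp: c_def)
    qed
    show ?thesis
      unfolding Xl_def
      by (rule conjI;
          rule L2_geometric_limit[where g="\<lambda>n. U (X (Suc n))", OF finite_measure_PP locL2_sqint[OF X T] step])
  qed
  have Xl: "locL2 Xl"
  proof (rule locL2_intro)
    show "prog Xl" unfolding Xl_def by (rule prog_lim[OF locL2_prog[OF X]])
  qed (use conv in blast)
  define Y where "Y = \<Phi> Xl"
  have Y: "locL2 Y" unfolding Y_def \<Phi>_def by (rule locL2_lmap[OF Xl u])
  \<comment> \<open>The iterates converge to \<open>Xl\<close>; applying \<Phi> to them and using
    the estimate, the same sequence one index further converges to \<open>Y\<close>.\<close>
  have eq: "AE p in PP {0..T}. U Xl p = U Y p" if T: "0 \<le> T" for T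
  proof (rule L2conv_unique)
    show "L2conv (PP {0..T}) (\<lambda>n. U (X (Suc (Suc n)))) (U Xl)"
      using conv[OF T] LIMSEQ_Suc unfolding L2conv_def by blast
    let ?r = "\<lambda>n. \<integral>p. (U (X (Suc n)) p - U Xl p)\<^sup>2 \<partial>PP {0..T}"
    let ?L = "2 * T * A\<^sup>2 + 2 * C\<^sup>2"
    have L0: "0 \<le> ?L" using T by simp
    have le: "(\<integral>p. (U (X (Suc (Suc n))) p - U Y p)\<^sup>2 \<partial>PP {0..T}) \<le> ?L * ?r n * T" for n
    proof -
      have "sq_norm_on M {0..T} (\<lambda>s \<omega>. X (Suc (Suc n)) s \<omega> - Y s \<omega>)
          \<le> (ennreal ?L * ennreal (?r n)) * ennreal T"
      proof (rule sq_norm_on_le[OF locL2_prog[OF locL2_diff[OF X Y]] T])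
        fix t assume t: "0 \<le> t" "t \<le> T"
        have "(\<integral>\<^sup>+\<omega>. ennreal ((X (Suc (Suc n)) t \<omega> - Y t \<omega>)\<^sup>2) \<partial>M)
            \<le> ennreal ?L * sq_norm_on M {0..t} (\<lambda>s \<omega>. X (Suc n) s \<omega> - Xl s \<omega>)"
          using est[OF X[of "Suc n"] Xl t] unfolding Y_def XS[symmetric] .
        also have "\<dots> \<le> ennreal ?L * sq_norm_on M {0..T} (\<lambda>s \<omega>. X (Suc n) s \<omega> - Xl s \<omega>)"
          using t by (intro mult_left_mono sq_norm_on_mono) auto
        finally show "(\<integral>\<^sup>+\<omega>. ennreal ((X (Suc (Suc n)) t \<omega> - Y t \<omega>)\<^sup>2) \<partial>M) \<le> ennreal ?L * ennreal (?r n)"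
          unfolding sq_norm_on_locL2[OF locL2_diff[OF X Xl] T] .
      qed
      also have "\<dots> = ennreal (?L * ?r n * T)"
        using L0 T by (subst ennreal_mult[symmetric], simp, simp, subst ennreal_mult[symmetric]) auto
      finally show ?thesis
        unfolding sq_norm_on_locL2[OF locL2_diff[OF X Y] T] using L0 T
        by (subst (asm) ennreal_le_iff) auto
    qed
    have r0: "?r \<longlonglongrightarrow> 0" using conv[OF T] by (simp add: L2conv_def)
    have z: "(\<lambda>n. ?L * ?r n * T) \<longlonglongrightarrow> 0"
      by (intro tendsto_mult_left_zero tendsto_mult_right_zero r0)
    have "(\<lambda>n. \<integral>p. (U (X (Suc (Suc n))) p - U Y p)\<^sup>2 \<partial>PP {0..T}) \<longlonglongrightarrow> 0"
    proof (rule tendsto_sandwich[OF always_eventually always_eventually tendsto_const z]; rule allI)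
      show "0 \<le> (\<integral>p. (U (X (Suc (Suc n))) p - U Y p)\<^sup>2 \<partial>PP {0..T})" for n by simp
    qed (rule le)
    then show "L2conv (PP {0..T}) (\<lambda>n. U (X (Suc (Suc n)))) (U Y)"
      unfolding L2conv_def using locL2_sqint[OF X T] locL2_sqint[OF Y T] by blast
  qed
  have "solves_lsde M W A B C D x u Y"
    unfolding solves_lsde_def
  proof (intro conjI exI[of _ "stoch (\<lambda>s \<omega>. C * Xl s \<omega> + D * u s \<omega>)"] allI impI)
    show "prog Y" by (rule locL2_prog[OF Y])
    show "AE \<omega> in M. continuous_on {0..} (\<lambda>t. Y t \<omega>)"
      unfolding Y_def \<Phi>_def by (rule lmap_continuous[OF Xl u])
    show "sq_norm_on M {0..T} Y < \<infinity>" if "0 \<le> T" for T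
      unfolding sq_norm_on_locL2[OF Y that] by simp
    fix t :: real assume t: "0 \<le> t"
    show "has_ito_integral M W (\<lambda>s \<omega>. C * Y s \<omega> + D * u s \<omega>) t (stoch (\<lambda>s \<omega>. C * Xl s \<omega> + D * u s \<omega>) t)"
    proof (rule has_ito_integral_cong[OF stoch(3)[OF locL2_lin[OF Xl u] t] locL2_prog[OF locL2_lin[OF Y u]] t])
      show "AE p in PP {0..t}. U (\<lambda>s \<omega>. C * Xl s \<omega> + D * u s \<omega>) p = U (\<lambda>s \<omega>. C * Y s \<omega> + D * u s \<omega>) p"
        using eq[OF t] by eventually_elim simp
    qed
    have "AE \<omega> in M. drift (\<lambda>s \<omega>. A * Xl s \<omega> + B * u s \<omega>) t \<omega> = drift (\<lambda>s \<omega>. A * Y s \<omega> + B * u s \<omega>) t \<omega>"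
    proof (rule drift_cong[OF locL2_lin[OF Xl u] locL2_lin[OF Y u] t])
      show "AE p in PP {0..t}. U (\<lambda>s \<omega>. A * Xl s \<omega> + B * u s \<omega>) p = U (\<lambda>s \<omega>. A * Y s \<omega> + B * u s \<omega>) p"
        using eq[OF t] by eventually_elim simp
    qed
    then show "AE \<omega> in M. Y t \<omega> = x + (LINT s:{0..t}|lborel. A * Y s \<omega> + B * u s \<omega>)
        + stoch (\<lambda>s \<omega>. C * Xl s \<omega> + D * u s \<omega>) t \<omega>"
    proof eventually_elim
      fix \<omega> assume e: "drift (\<lambda>s \<omega>. A * Xl s \<omega> + B * u s \<omega>) t \<omega> = drift (\<lambda>s \<omega>. A * Y s \<omega> + B * u s \<omega>) t \<omega>"
      have "Y t \<omega> = x + drift (\<lambda>s \<omega>. A * Xl s \<omega> + B * u s \<omega>) t \<omega> + stoch (\<lambda>s \<omega>. C * Xl s \<omega> + D * u s \<omega>) t \<omega>"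
        by (simp add: Y_def \<Phi>_def lmap_def)
      then show "Y t \<omega> = x + (LINT s:{0..t}|lborel. A * Y s \<omega> + B * u s \<omega>)
        + stoch (\<lambda>s \<omega>. C * Xl s \<omega> + D * u s \<omega>) t \<omega>"
        unfolding e unfolding drift_def .
    qed
  qed
  then show ?thesis by blast
qed

lemma solves_lsdeD:
  assumes "solves_lsde M W A B C D x u X"
  shows "locL2 X"
    and "\<exists>I. \<forall>t\<ge>0. ito (\<lambda>s \<omega>. C * X s \<omega> + D * u s \<omega>) t (I t) \<and>
      (AE \<omega> in M. X t \<omega> = x + drift (\<lambda>s \<omega>. A * X s \<omega> + B * u s \<omega>) t \<omega> + I t \<omega>)"
proof -
  obtain I where p: "prog X" "\<forall>T\<ge>0. sq_norm_on M {0..T} X < \<infinity>"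
    and I: "\<forall>t\<ge>0. has_ito_integral M W (\<lambda>s \<omega>. C * X s \<omega> + D * u s \<omega>) t (I t) \<and>
        (AE \<omega> in M. X t \<omega> = x + (LINT s:{0..t}|lborel. A * X s \<omega> + B * u s \<omega>) + I t \<omega>)"
    using assms unfolding solves_lsde_def by (elim conjE exE)
  show "locL2 X" by (rule locL2I[OF p(1)]) (use p(2) in simp)
  show "\<exists>I. \<forall>t\<ge>0. ito (\<lambda>s \<omega>. C * X s \<omega> + D * u s \<omega>) t (I t) \<and>
      (AE \<omega> in M. X t \<omega> = x + drift (\<lambda>s \<omega>. A * X s \<omega> + B * u s \<omega>) t \<omega> + I t \<omega>)"
    unfolding drift_def
    by (intro exI[of _ I] allI impI conjI has_ito_integral_ito) (use I in auto)
qed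

text \<open>The difference of two solutions satisfies the homogeneous linear equation with initial
  value 0, so its second moment is bounded by a multiple of its own time integral.\<close>

lemma lsde_unique:
  assumes u: "locL2 u" and X: "solves_lsde M W A B C D x u X" and Y: "solves_lsde M W A B C D x u Y"
    and T: "0 \<le> T"
  shows "AE p in PP {0..T}. U X p = U Y p"
proof -
  note lX = solves_lsdeD(1)[OF X] and lY = solves_lsdeD(1)[OF Y]
  obtain I where I: "\<forall>t\<ge>0. ito (\<lambda>s \<omega>. C * X s \<omega> + D * u s \<omega>) t (I t) \<and>
      (AE \<omega> in M. X t \<omega> = x + drift (\<lambda>s \<omega>. A * X s \<omega> + B * u s \<omega>) t \<omega> + I t \<omega>)"
    using solves_lsdeD(2)[OF X] by (elim exE)
  obtain J where J: "\<forall>t\<ge>0. ito (\<lambda>s \<omega>. C * Y s \<omega> + D * u s \<omega>) t (J t) \<and>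
      (AE \<omega> in M. Y t \<omega> = x + drift (\<lambda>s \<omega>. A * Y s \<omega> + B * u s \<omega>) t \<omega> + J t \<omega>)"
    using solves_lsdeD(2)[OF Y] by (elim exE)
  let ?d = "\<lambda>t \<omega>. X t \<omega> - Y t \<omega>"
  note d = locL2_diff[OF lX lY]
  define L where "L = 2 * T * A\<^sup>2 + 2 * C\<^sup>2"
  have L0: "0 \<le> L" using T by (simp add: L_def)
  define K where "K = L * (\<integral>p. (U ?d p)\<^sup>2 \<partial>PP {0..T})"
  have K0: "0 \<le> K" using L0 by (simp add: K_def)
  define m where "m t = (\<integral>\<^sup>+\<omega>. ennreal ((?d t \<omega>)\<^sup>2) \<partial>M)" for t
  have est: "m t \<le> ennreal L * sq_norm_on M {0..t} ?d" if t: "0 \<le> t" "t \<le> T" for t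
    unfolding m_def L_def
  proof (rule linear_step_estimate[OF d t])
    show "ito (\<lambda>s \<omega>. C * ?d s \<omega>) t (\<lambda>\<omega>. I t \<omega> - J t \<omega>)"
      by (rule ito_lin_diff) (use I J t in auto)
    have "AE \<omega> in M. X t \<omega> = x + drift (\<lambda>s \<omega>. A * X s \<omega> + B * u s \<omega>) t \<omega> + I t \<omega>"
      "AE \<omega> in M. Y t \<omega> = x + drift (\<lambda>s \<omega>. A * Y s \<omega> + B * u s \<omega>) t \<omega> + J t \<omega>"
      using I J t by auto
    with drift_lin_diff[OF lX lY u, of A t B]
    show "AE \<omega> in M. ?d t \<omega> = drift (\<lambda>s \<omega>. A * ?d s \<omega>) t \<omega> + (I t \<omega> - J t \<omega>)"
      by eventually_elim simp
  qed
  have m0: "m t = 0" if t: "0 \<le> t" "t \<le> T" for t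
  proof (rule ennreal_geometric_zero)
    fix n
    \<comment> \<open>The constant sequence satisfies the recursion, so \<open>m t\<close> lies
      below every term of a sequence that tends to 0.\<close>
    have "(\<lambda>n::nat. m) n t \<le> ennreal (K * (L * t) ^ n / fact n)"
    proof (rule iterated_integral_bound[OF K0 L0 _ _ t])
      fix t assume t: "0 \<le> t" "t \<le> T"
      have "m t \<le> ennreal L * sq_norm_on M {0..T} ?d"
        by (rule order_trans[OF est[OF t] mult_left_mono[OF sq_norm_on_mono]]) (use t in auto)
      also have "\<dots> = ennreal K"
        unfolding sq_norm_on_locL2[OF d T] K_def by (rule ennreal_mult'[OF L0, symmetric])
      finally show "m t \<le> ennreal K" .
      show "m t \<le> ennreal L * (\<integral>\<^sup>+s\<in>{0..t}. m s \<partial>lborel)"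
        using est[OF t] unfolding sq_norm_on_section[OF locL2_prog[OF d] t(1)] m_def .
    qed
    also have "\<dots> \<le> ennreal (K * exp (16 * L * T) * (1/16) ^ n)"
      by (rule ennreal_leI[OF factorial_geometric_bound[OF K0 L0 t]])
    finally show "m t \<le> ennreal (K * exp (16 * L * T) * (1/16) ^ n)" .
  qed
  have "sq_norm_on M {0..T} ?d \<le> 0 * ennreal T"
    by (rule sq_norm_on_le[OF locL2_prog[OF d] T]) (use m0 in \<open>simp add: m_def\<close>)
  then have "(\<integral>p. (U ?d p)\<^sup>2 \<partial>PP {0..T}) = 0"
    unfolding sq_norm_on_locL2[OF d T] by (simp add: ennreal_eq_0_iff integral_nonneg_AE antisym)
  from integral_sq_zero_AE[OF locL2_sqint[OF d T] this] show ?thesis by eventually_elim simp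
qed

lemma lsde_sol:
  assumes "locL2 u"
  shows "solves_lsde M W A B C D x u (lsde_sol M W A B C D x u)"
  unfolding lsde_sol_def by (rule someI_ex[OF lsde_exists[OF assms]])

end

section \<open>The energy identity\<close>

text \<open>Fubini on the square \<open>[0, t]^2\<close>, cut along the diagonal into two triangles
  with equal contributions. It does the work of the chain rule for an \<open>f\<close> that is
  merely integrable.\<close>

lemma integral_Icc_squared:
  fixes f :: "real \<Rightarrow> real"
  assumes f: "set_integrable lborel {0..t} f"
  shows "(LINT s:{0..t}|lborel. f s)\<^sup>2 = 2 * (LINT s:{0..t}|lborel. f s * (LINT r:{0..s}|lborel. f r))"
proof -
  let ?R = "restrict_space lborel {0..t}"
  interpret R: pair_sigma_finite ?R ?R
    by (intro pair_sigma_finite.intro sigma_finite_restrict_lborel) auto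
  have I: "{0..t} \<inter> space lborel \<in> sets lborel" by simp
  have r: "(\<integral>s. g s \<partial>?R) = (LINT s:{0..t}|lborel. g s)" for g :: "real \<Rightarrow> real"
    unfolding set_lebesgue_integral_def by (rule integral_restrict_space[OF I])
  have fR: "integrable ?R f"
    using f unfolding set_integrable_def integrable_restrict_space[OF I] .
  have fm: "f \<in> borel_measurable ?R" using fR by (rule borel_measurable_integrable)
  have m1: "(\<lambda>p. f (fst p)) \<in> borel_measurable (?R \<Otimes>\<^sub>M ?R)" and m2: "(\<lambda>p. f (snd p)) \<in> borel_measurable (?R \<Otimes>\<^sub>M ?R)"
    by (rule measurable_compose[OF measurable_fst fm], rule measurable_compose[OF measurable_snd fm])
  have id: "(\<lambda>x. x) \<in> borel_measurable ?R" by (rule measurable_restrict_space1) simp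
  have i1: "fst \<in> borel_measurable (?R \<Otimes>\<^sub>M ?R)" and i2: "snd \<in> borel_measurable (?R \<Otimes>\<^sub>M ?R)"
    by (rule measurable_compose[OF measurable_fst id], rule measurable_compose[OF measurable_snd id])
  let ?g = "\<lambda>p. f (fst p) * f (snd p)"
  have gi: "integrable (?R \<Otimes>\<^sub>M ?R) ?g"
  proof (rule R.Fubini_integrable)
    show "?g \<in> borel_measurable (?R \<Otimes>\<^sub>M ?R)" by (rule borel_measurable_times[OF m1 m2])
    show "integrable ?R (\<lambda>x. \<integral>y. norm (?g (x, y)) \<partial>?R)"
      using fR by (simp add: abs_mult)
    show "AE x in ?R. integrable ?R (\<lambda>y. ?g (x, y))" using fR by simp
  qed
  let ?h1 = "\<lambda>p. if fst p \<le> snd p then ?g p else 0" and ?h2 = "\<lambda>p. if snd p < fst p then ?g p else 0"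
  have le: "{p \<in> space (?R \<Otimes>\<^sub>M ?R). fst p \<le> snd p} \<in> sets (?R \<Otimes>\<^sub>M ?R)"
    by (rule borel_measurable_le[OF i1 i2])
  have less: "{p \<in> space (?R \<Otimes>\<^sub>M ?R). snd p < fst p} \<in> sets (?R \<Otimes>\<^sub>M ?R)"
    by (rule borel_measurable_less[OF i2 i1])
  have h1i: "integrable (?R \<Otimes>\<^sub>M ?R) ?h1"
    by (rule Bochner_Integration.integrable_bound[OF gi])
      (use measurable_If[OF borel_measurable_integrable[OF gi] measurable_const le] in auto)
  have h2i: "integrable (?R \<Otimes>\<^sub>M ?R) ?h2"
    by (rule Bochner_Integration.integrable_bound[OF gi])
      (use measurable_If[OF borel_measurable_integrable[OF gi] measurable_const less] in auto)
  have partial: "(\<integral>r. (if r \<le> s then f r else 0) \<partial>?R) = (LINT r:{0..s}|lborel. f r)" if "s \<in> {0..t}" for s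
    unfolding r unfolding set_lebesgue_integral_def
    by (intro Bochner_Integration.integral_cong) (use that in \<open>auto simp: indicator_def\<close>)
  \<comment> \<open>The second triangle has a strict inequality; it differs from the weak one in a
    single point.\<close>
  have partial': "(\<integral>r. (if r < s then f r else 0) \<partial>?R) = (LINT r:{0..s}|lborel. f r)" if s: "s \<in> {0..t}" for s
  proof -
    have "AE r in ?R. r \<noteq> s"
      using AE_lborel_singleton[of s] by (subst AE_restrict_space_iff[OF I]) auto
    then have ae: "AE r in ?R. (if r < s then f r else 0) = (if r \<le> s then f r else 0)"
      by eventually_elim auto
    have ms: "{r \<in> space ?R. r < s} \<in> sets ?R" "{r \<in> space ?R. r \<le> s} \<in> sets ?R"
      by (rule borel_measurable_less[OF id borel_measurable_const], rule borel_measurable_le[OF id borel_measurable_const])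
    show ?thesis
      unfolding partial[OF s, symmetric]
      by (rule integral_cong_AE[OF _ _ ae]) (intro measurable_If[OF fm measurable_const] ms, simp)+
  qed
  have H1: "(\<integral>p. ?h1 p \<partial>(?R \<Otimes>\<^sub>M ?R)) = (LINT s:{0..t}|lborel. f s * (LINT r:{0..s}|lborel. f r))"
  proof -
    have h1': "integrable (?R \<Otimes>\<^sub>M ?R) (\<lambda>(x, y). ?h1 (x, y))" using h1i by (simp only: case_prod_beta' fst_conv snd_conv prod.collapse)
    have "(\<integral>p. ?h1 p \<partial>(?R \<Otimes>\<^sub>M ?R)) = (\<integral>s. (\<integral>r. ?h1 (r, s) \<partial>?R) \<partial>?R)"
      using R.integral_snd[OF h1', symmetric] by (simp only: case_prod_beta' fst_conv snd_conv prod.collapse)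
    also have "\<dots> = (\<integral>s. f s * (LINT r:{0..s}|lborel. f r) \<partial>?R)"
    proof (rule Bochner_Integration.integral_cong[OF refl])
      fix s assume "s \<in> space ?R"
      then have s: "s \<in> {0..t}" by (simp add: space_restrict_space)
      have "(\<integral>r. ?h1 (r, s) \<partial>?R) = (\<integral>r. f s * (if r \<le> s then f r else 0) \<partial>?R)"
        by (intro Bochner_Integration.integral_cong) auto
      then show "(\<integral>r. ?h1 (r, s) \<partial>?R) = f s * (LINT r:{0..s}|lborel. f r)"
        unfolding partial[OF s, symmetric] by simp
    qed
    finally show ?thesis unfolding r .
  qed
  have H2: "(\<integral>p. ?h2 p \<partial>(?R \<Otimes>\<^sub>M ?R)) = (LINT s:{0..t}|lborel. f s * (LINT r:{0..s}|lborel. f r))"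
  proof -
    have "(\<integral>p. ?h2 p \<partial>(?R \<Otimes>\<^sub>M ?R)) = (\<integral>s. (\<integral>r. ?h2 (s, r) \<partial>?R) \<partial>?R)"
      using R.integral_fst'[OF h2i] by (rule sym)
    also have "\<dots> = (\<integral>s. f s * (LINT r:{0..s}|lborel. f r) \<partial>?R)"
    proof (rule Bochner_Integration.integral_cong[OF refl])
      fix s assume "s \<in> space ?R"
      then have s: "s \<in> {0..t}" by (simp add: space_restrict_space)
      have "(\<integral>r. ?h2 (s, r) \<partial>?R) = (\<integral>r. f s * (if r < s then f r else 0) \<partial>?R)"
        by (intro Bochner_Integration.integral_cong) auto
      then show "(\<integral>r. ?h2 (s, r) \<partial>?R) = f s * (LINT r:{0..s}|lborel. f r)"
        unfolding partial'[OF s, symmetric] by simp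
    qed
    finally show ?thesis unfolding r .
  qed
  have "(\<integral>p. ?g p \<partial>(?R \<Otimes>\<^sub>M ?R)) = (\<integral>s. (\<integral>r. ?g (s, r) \<partial>?R) \<partial>?R)"
    using R.integral_fst'[OF gi] by (rule sym)
  also have "\<dots> = (LINT s:{0..t}|lborel. f s)\<^sup>2" by (simp add: r power2_eq_square)
  finally have "(LINT s:{0..t}|lborel. f s)\<^sup>2 = (\<integral>p. ?g p \<partial>(?R \<Otimes>\<^sub>M ?R))" ..
  also have "\<dots> = (\<integral>p. ?h1 p + ?h2 p \<partial>(?R \<Otimes>\<^sub>M ?R))"
    by (intro Bochner_Integration.integral_cong) auto
  also have "\<dots> = (\<integral>p. ?h1 p \<partial>(?R \<Otimes>\<^sub>M ?R)) + (\<integral>p. ?h2 p \<partial>(?R \<Otimes>\<^sub>M ?R))"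
    by (rule Bochner_Integration.integral_add[OF h1i h2i])
  finally show ?thesis unfolding H1 H2 by simp
qed

context brownian
begin

lemma sqint_snd_PP:
  assumes "sqint M Y"
  shows "sqint (PP {0..t}) (\<lambda>p. Y (snd p))"
proof -
  have m: "(\<lambda>p. Y (snd p)) \<in> borel_measurable (PP {0..t})"
    by (rule measurable_snd_PP[OF sqint_measurable[OF assms]])
  have "(\<integral>\<^sup>+p. ennreal ((Y (snd p))\<^sup>2) \<partial>PP {0..t}) = (\<integral>\<^sup>+s. (\<integral>\<^sup>+\<omega>. ennreal ((Y \<omega>)\<^sup>2) \<partial>M) * indicator {0..t} s \<partial>lborel)"
    using nn_integral_PP(2)[OF _ measurable_ennreal_sq[OF m]] by simp
  also have "\<dots> = ennreal (\<integral>\<omega>. (Y \<omega>)\<^sup>2 \<partial>M) * emeasure lborel {0..t}"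
    unfolding nn_sqint[OF assms] by (rule nn_integral_cmult_indicator) simp
  also have "\<dots> < \<infinity>" by (cases "0 \<le> t") (simp_all add: ennreal_mult_less_top)
  finally show ?thesis using sqint_iff_nn[OF m] by simp
qed

text \<open>Orthogonality of the increment from 0 to \<open>t\<close> to the constant 1. The value
  at time 0 vanishes almost surely, since by the isometry its norm is an integral over
  \<open>{0..0}\<close>.\<close>

lemma ito_mean_zero:
  assumes \<phi>: "locL2 \<phi>" and t: "0 \<le> t" and Y: "ito \<phi> t Y"
  shows "expectation Y = 0"
proof -
  note S = stoch(4)[OF \<phi> order_refl]
  have "sq_norm_on M {0..0} \<phi> \<le> top * ennreal 0"
    by (rule sq_norm_on_le[OF locL2_prog[OF \<phi>]]) auto
  then have "(\<integral>\<^sup>+\<omega>. ennreal ((stoch \<phi> 0 \<omega>)\<^sup>2) \<partial>M) = 0"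
    unfolding ito_nn[OF \<phi> order_refl S] by simp
  then have "AE \<omega> in M. ennreal ((stoch \<phi> 0 \<omega>)\<^sup>2) = 0"
    using nn_integral_0_iff_AE[OF measurable_ennreal_sq[OF sqint_measurable[OF ito_sqint(2)[OF S]]]] by simp
  then have z: "AE \<omega> in M. stoch \<phi> 0 \<omega> = 0" by eventually_elim simp
  have s1: "sqint M (\<lambda>_. 1)" by (rule sqint_bounded[OF finite_measure_axioms, of _ 1]) auto
  have "expectation (\<lambda>\<omega>. (Y \<omega> - stoch \<phi> 0 \<omega>) * 1) = 0"
    by (rule ito_martingale[OF order_refl t Y S s1]) simp
  moreover have "expectation (\<lambda>\<omega>. (Y \<omega> - stoch \<phi> 0 \<omega>) * 1) = expectation Y"
    by (rule integral_cong_AE)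
      (use z sqint_measurable[OF ito_sqint(2)[OF Y]] sqint_measurable[OF ito_sqint(2)[OF S]] in auto)
  ultimately show ?thesis by simp
qed

lemma drift_square_mean:
  assumes b: "locL2 b" and t: "0 \<le> t"
  shows "expectation (\<lambda>\<omega>. (drift b t \<omega>)\<^sup>2) = 2 * (\<integral>p. U b p * U (drift b) p \<partial>PP {0..t})"
proof -
  let ?f = "\<lambda>s \<omega>. b s \<omega> * drift b s \<omega>"
  have pf: "prog ?f"
    by (rule prog_compose2[OF locL2_prog[OF b] prog_drift[OF locL2_prog[OF b]]]) simp
  have m: "(\<lambda>\<omega>. LINT s:{0..t}|lborel. ?f s \<omega>) \<in> borel_measurable M"
    by (rule F_measurable_M[OF prog_adapted[OF prog_integral[OF pf] t]])
  have "AE \<omega> in M. (drift b t \<omega>)\<^sup>2 = 2 * (LINT s:{0..t}|lborel. ?f s \<omega>)"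
    using drift_integrable_AE[OF b]
  proof eventually_elim
    fix \<omega> assume "\<forall>n::nat. set_integrable lborel {0..real n} (\<lambda>s. b s \<omega>)"
    from integral_Icc_squared[OF set_integrable_Icc_nat[OF this]]
    show "(drift b t \<omega>)\<^sup>2 = 2 * (LINT s:{0..t}|lborel. ?f s \<omega>)" unfolding drift_def .
  qed
  then have "expectation (\<lambda>\<omega>. (drift b t \<omega>)\<^sup>2) = expectation (\<lambda>\<omega>. 2 * (LINT s:{0..t}|lborel. ?f s \<omega>))"
    by (intro integral_cong_AE borel_measurable_power borel_measurable_times m
        sqint_measurable[OF sqint_drift[OF b t]] borel_measurable_const)
  also have "\<dots> = 2 * (\<integral>p. U b p * U (drift b) p \<partial>PP {0..t})"
    using integral_PP(1)[OF _ sqint_mult[OF locL2_sqint[OF b t] locL2_sqint[OF locL2_drift[OF b] t]]] by simp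
  finally show ?thesis .
qed

lemma energy_identity:
  assumes u: "locL2 u" and sol: "solves_lsde M W A B C D x u X" and t: "0 \<le> t"
  shows "expectation (\<lambda>\<omega>. (X t \<omega>)\<^sup>2) = x\<^sup>2 +
    (\<integral>p. 2 * (A * U X p + B * U u p) * U X p + (C * U X p + D * U u p)\<^sup>2 \<partial>PP {0..t})"
proof -
  note X = solves_lsdeD(1)[OF sol]
  define b where "b = (\<lambda>s \<omega>. A * X s \<omega> + B * u s \<omega>)"
  define \<sigma> where "\<sigma> = (\<lambda>s \<omega>. C * X s \<omega> + D * u s \<omega>)"
  have b: "locL2 b" and \<sigma>: "locL2 \<sigma>" unfolding b_def \<sigma>_def by (rule locL2_lin[OF X u])+
  obtain I where "\<forall>t\<ge>0. ito \<sigma> t (I t) \<and> (AE \<omega> in M. X t \<omega> = x + drift b t \<omega> + I t \<omega>)"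
    using solves_lsdeD(2)[OF sol] unfolding b_def \<sigma>_def by (elim exE)
  then have I: "ito \<sigma> s (I s)" and XI: "AE \<omega> in M. X s \<omega> = x + drift b s \<omega> + I s \<omega>" if "0 \<le> s" for s
    using that by auto
  let ?P = "PP {0..t}"
  note G = locL2_drift[OF b]
  note sX = locL2_sqint[OF X t] and sb = locL2_sqint[OF b t] and sG = locL2_sqint[OF G t] and s\<sigma> = locL2_sqint[OF \<sigma> t]
  have sx: "sqint ?P (\<lambda>p. x)" using locL2_sqint[OF locL2_const t] by simp
  note sIt = ito_sqint(2)[OF I[OF t]] and sGt = sqint_drift[OF b t]
  note sIs = sqint_snd_PP[OF sIt]
  note int = sqint_integrable[OF finite_measure_axioms] and intP = sqint_integrable[OF finite_measure_PP]
  have EI: "expectation (I t) = 0" by (rule ito_mean_zero[OF \<sigma> t I[OF t]])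
  have EG: "expectation (drift b t) = (\<integral>p. U b p \<partial>?P)"
    using integral_PP(1)[OF _ intP[OF sb]] by (simp add: drift_def[abs_def])
  have EI2: "expectation (\<lambda>\<omega>. (I t \<omega>)\<^sup>2) = (\<integral>p. (U \<sigma> p)\<^sup>2 \<partial>?P)"
    by (rule ito_isometry[OF t I[OF t]])
  \<comment> \<open>\<open>?J\<close> at time \<open>s\<close> is almost surely \<open>I s\<close>.
    It stands in for \<open>I\<close>, which is given separately for each time and is not known to
    be jointly measurable, whereas \<open>X\<close> and the drift are.\<close>
  let ?J = "\<lambda>p. U X p - x - U (drift b) p"
  have sJ: "sqint ?P ?J" by (rule sqint_diff[OF sqint_diff[OF sX sx] sG])
  have EGI: "expectation (\<lambda>\<omega>. drift b t \<omega> * I t \<omega>) = (\<integral>p. U b p * ?J p \<partial>?P)"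
  proof -
    have "expectation (\<lambda>\<omega>. drift b t \<omega> * I t \<omega>) = expectation (\<lambda>\<omega>. LINT s:{0..t}|lborel. b s \<omega> * I t \<omega>)"
      by (simp add: drift_def set_integral_mult_left)
    also have "\<dots> = (\<integral>p. U b p * I t (snd p) \<partial>?P)"
      using integral_PP(1)[OF _ sqint_mult[OF sb sIs]] by simp
    finally have 1: "expectation (\<lambda>\<omega>. drift b t \<omega> * I t \<omega>) = (\<integral>p. U b p * I t (snd p) \<partial>?P)" .
    have i: "integrable ?P (\<lambda>p. U b p * (I t (snd p) - ?J p))"
      by (rule sqint_mult[OF sb sqint_diff[OF sIs sJ]])
    \<comment> \<open>The martingale property needs \<open>b s\<close> to be square integrable at
      the fixed time \<open>s\<close>; this holds for almost every \<open>s\<close>, which suffices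
      under the time integral.\<close>
    have bs: "AE s in lborel. s \<in> {0..t} \<longrightarrow> integrable M (\<lambda>\<omega>. (b s \<omega>)\<^sup>2)"
      using integral_PP(4)[OF _ sqint_integrable_sq[OF sb]] by simp
    have "(\<integral>p. U b p * (I t (snd p) - ?J p) \<partial>?P)
        = (LINT s:{0..t}|lborel. expectation (\<lambda>\<omega>. b s \<omega> * (I t \<omega> - (X s \<omega> - x - drift b s \<omega>))))"
      using integral_PP(2)[OF _ i] by simp
    also have "\<dots> = 0"
      unfolding set_lebesgue_integral_def
    proof (rule integral_eq_zero_AE)
      show "AE s in lborel. indicator {0..t} s *\<^sub>R
          expectation (\<lambda>\<omega>. b s \<omega> * (I t \<omega> - (X s \<omega> - x - drift b s \<omega>))) = 0"
        using bs
      proof eventually_elim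
        fix s assume bs: "s \<in> {0..t} \<longrightarrow> integrable M (\<lambda>\<omega>. (b s \<omega>)\<^sup>2)"
        show "indicator {0..t} s *\<^sub>R expectation (\<lambda>\<omega>. b s \<omega> * (I t \<omega> - (X s \<omega> - x - drift b s \<omega>))) = 0"
        proof (cases "s \<in> {0..t}")
          case True
          then have s: "0 \<le> s" "s \<le> t" by auto
          note ad = prog_adapted[OF locL2_prog[OF b] s(1)]
          have sqb: "sqint M (b s)" using bs True F_measurable_M[OF ad] by (simp add: sqint_def)
          have mX: "X s \<in> borel_measurable M" by (rule F_measurable_M[OF prog_adapted[OF locL2_prog[OF X] s(1)]])
          have mG: "drift b s \<in> borel_measurable M" by (rule sqint_measurable[OF sqint_drift[OF b s(1)]])
          note mI = sqint_measurable[OF sIt] sqint_measurable[OF ito_sqint(2)[OF I[OF s(1)]]]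
          have "expectation (\<lambda>\<omega>. b s \<omega> * (I t \<omega> - (X s \<omega> - x - drift b s \<omega>)))
              = expectation (\<lambda>\<omega>. (I t \<omega> - I s \<omega>) * b s \<omega>)"
          proof (rule integral_cong_AE)
            show "(\<lambda>\<omega>. b s \<omega> * (I t \<omega> - (X s \<omega> - x - drift b s \<omega>))) \<in> borel_measurable M"
              by (intro borel_measurable_times borel_measurable_diff borel_measurable_const mX mG mI F_measurable_M[OF ad])
            show "(\<lambda>\<omega>. (I t \<omega> - I s \<omega>) * b s \<omega>) \<in> borel_measurable M"
              by (intro borel_measurable_times borel_measurable_diff mI F_measurable_M[OF ad])
            show "AE \<omega> in M. b s \<omega> * (I t \<omega> - (X s \<omega> - x - drift b s \<omega>)) = (I t \<omega> - I s \<omega>) * b s \<omega>"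
              using XI[OF s(1)] by eventually_elim simp
          qed
          also have "\<dots> = 0" by (rule ito_martingale[OF s I[OF t] I[OF s(1)] sqb ad])
          finally show ?thesis by simp
        qed simp
      qed
    qed
    finally have "(\<integral>p. U b p * I t (snd p) - U b p * ?J p \<partial>?P) = 0" by (simp add: right_diff_distrib)
    then show ?thesis
      unfolding 1 using sqint_mult[OF sb sIs] sqint_mult[OF sb sJ] by simp
  qed
  note mXt = F_measurable_M[OF prog_adapted[OF locL2_prog[OF X] t]]
  have "expectation (\<lambda>\<omega>. (X t \<omega>)\<^sup>2) = expectation (\<lambda>\<omega>. x\<^sup>2 + 2 * x * drift b t \<omega> + 2 * x * I t \<omega>
      + (drift b t \<omega>)\<^sup>2 + 2 * (drift b t \<omega> * I t \<omega>) + (I t \<omega>)\<^sup>2)"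
  proof (rule integral_cong_AE)
    show "(\<lambda>\<omega>. (X t \<omega>)\<^sup>2) \<in> borel_measurable M" by (rule borel_measurable_power[OF mXt])
    show "(\<lambda>\<omega>. x\<^sup>2 + 2 * x * drift b t \<omega> + 2 * x * I t \<omega>
      + (drift b t \<omega>)\<^sup>2 + 2 * (drift b t \<omega> * I t \<omega>) + (I t \<omega>)\<^sup>2) \<in> borel_measurable M"
      by (intro borel_measurable_add borel_measurable_times borel_measurable_power borel_measurable_const
          sqint_measurable[OF sIt] sqint_measurable[OF sGt])
    show "AE \<omega> in M. (X t \<omega>)\<^sup>2 = x\<^sup>2 + 2 * x * drift b t \<omega> + 2 * x * I t \<omega>
      + (drift b t \<omega>)\<^sup>2 + 2 * (drift b t \<omega> * I t \<omega>) + (I t \<omega>)\<^sup>2"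
      using XI[OF t] by eventually_elim (simp add: power2_eq_square algebra_simps)
  qed
  also have "\<dots> = x\<^sup>2 + 2 * x * expectation (drift b t) + 2 * x * expectation (I t)
      + expectation (\<lambda>\<omega>. (drift b t \<omega>)\<^sup>2) + 2 * expectation (\<lambda>\<omega>. drift b t \<omega> * I t \<omega>) + expectation (\<lambda>\<omega>. (I t \<omega>)\<^sup>2)"
    using int[OF sIt] int[OF sGt] sqint_integrable_sq[OF sIt] sqint_integrable_sq[OF sGt] sqint_mult[OF sGt sIt]
    by (simp add: prob_space)
  also have "\<dots> = x\<^sup>2 + 2 * x * (\<integral>p. U b p \<partial>?P) + 2 * (\<integral>p. U b p * U (drift b) p \<partial>?P)
      + 2 * (\<integral>p. U b p * ?J p \<partial>?P) + (\<integral>p. (U \<sigma> p)\<^sup>2 \<partial>?P)"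
    unfolding EI EG EI2 EGI drift_square_mean[OF b t] by simp
  \<comment> \<open>Inserting \<open>X - x - G\<close> for the integral cancels the terms with
    \<open>x\<close> and with \<open>G\<close>, and only \<open>2 b X + \<sigma>^2\<close> is
    left.\<close>
  also have "(\<integral>p. U b p * ?J p \<partial>?P) = (\<integral>p. U b p * U X p \<partial>?P) - x * (\<integral>p. U b p \<partial>?P) - (\<integral>p. U b p * U (drift b) p \<partial>?P)"
  proof -
    have "(\<integral>p. U b p * ?J p \<partial>?P) = (\<integral>p. U b p * U X p - x * U b p - U b p * U (drift b) p \<partial>?P)"
      by (simp add: algebra_simps)
    then show ?thesis using sqint_mult[OF sb sX] sqint_mult[OF sb sG] intP[OF sb] by simp
  qed
  also have "x\<^sup>2 + 2 * x * (\<integral>p. U b p \<partial>?P) + 2 * (\<integral>p. U b p * U (drift b) p \<partial>?P)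
      + 2 * ((\<integral>p. U b p * U X p \<partial>?P) - x * (\<integral>p. U b p \<partial>?P) - (\<integral>p. U b p * U (drift b) p \<partial>?P)) + (\<integral>p. (U \<sigma> p)\<^sup>2 \<partial>?P)
     = x\<^sup>2 + (2 * (\<integral>p. U b p * U X p \<partial>?P) + (\<integral>p. (U \<sigma> p)\<^sup>2 \<partial>?P))"
    by (simp add: algebra_simps)
  also have "2 * (\<integral>p. U b p * U X p \<partial>?P) + (\<integral>p. (U \<sigma> p)\<^sup>2 \<partial>?P)
     = (\<integral>p. 2 * (U b p * U X p) + (U \<sigma> p)\<^sup>2 \<partial>?P)"
    using sqint_mult[OF sb sX] sqint_integrable_sq[OF s\<sigma>] by simp
  finally show ?thesis unfolding b_def \<sigma>_def by (simp only: mult.assoc)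
qed

section \<open>The infinite horizon\<close>

lemma prog_PP_infinite:
  assumes "prog \<phi>"
  shows "U \<phi> \<in> borel_measurable (PP {0..})"
proof (rule borel_measurable_LIMSEQ_real)
  fix n :: nat
  have 1: "(\<lambda>p. min (real n) (fst p)) \<in> borel_measurable (PP {0..})"
    by (rule measurable_fst_PP[of "\<lambda>x. min (real n) x"]) simp
  then have "(\<lambda>p. min (real n) (fst p)) \<in> measurable (PP {0..}) (restrict_space lborel {0..real n})"
    by (intro measurable_restrict_space2) auto
  moreover have "snd \<in> measurable (PP {0..}) M" unfolding PP_def by (rule measurable_snd)
  ultimately have "(\<lambda>p. (min (real n) (fst p), snd p)) \<in> measurable (PP {0..}) (PP {0..real n})"
    unfolding PP_def[of "{0..real n}"] by (rule measurable_Pair)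
  from measurable_compose[OF this prog_PP[OF assms]]
  show "(\<lambda>p. \<phi> (min (real n) (fst p)) (snd p)) \<in> borel_measurable (PP {0..})" by simp
next
  fix p :: "real \<times> 'a"
  have "\<forall>\<^sub>F n in sequentially. U \<phi> p = \<phi> (min (real n) (fst p)) (snd p)"
    using eventually_ge_at_top[of "nat \<lceil>fst p\<rceil>"]
  proof eventually_elim
    fix n assume "nat \<lceil>fst p\<rceil> \<le> n"
    then have "min (real n) (fst p) = fst p" by linarith
    then show "U \<phi> p = \<phi> (min (real n) (fst p)) (snd p)" by simp
  qed
  then show "(\<lambda>n. \<phi> (min (real n) (fst p)) (snd p)) \<longlonglongrightarrow> U \<phi> p"
    by (rule Lim_transform_eventually[OF tendsto_const])
qed

lemma sqint_infinite_iff: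
  assumes "prog \<phi>"
  shows "sqint (PP {0..}) (U \<phi>) \<longleftrightarrow> sq_norm_on M {0..} \<phi> < \<infinity>"
  using sqint_iff_nn[OF prog_PP_infinite[OF assms]] sq_norm_on_PP[OF _ prog_PP_infinite[OF assms]] by simp

lemma sq_norm_on_infinite_le:
  assumes X: "prog X" and le: "\<And>n::nat. sq_norm_on M {0..real n} X \<le> c"
  shows "sq_norm_on M {0..} X \<le> c"
proof -
  let ?Y = "\<lambda>n t \<omega>. indicator {..real n} t * X t \<omega>"
  have m: "U (?Y n) \<in> borel_measurable (PP {0..})" for n
    by (intro borel_measurable_times measurable_fst_PP[of "indicator {..real n}"] prog_PP_infinite[OF X]) simp
  have e: "sq_norm_on M {0..} (?Y n) = sq_norm_on M {0..real n} X" for n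
    unfolding sq_norm_on_def by (intro nn_integral_cong) (auto simp: indicator_def)
  have "(\<integral>\<^sup>+p. ennreal ((U X p)\<^sup>2) \<partial>PP {0..}) \<le> c"
  proof (rule nn_sq_le_of_tendsto[where u="\<lambda>n. U (?Y n)", OF m])
    show "AE p in PP {0..}. (\<lambda>n. U (?Y n) p) \<longlonglongrightarrow> U X p"
    proof (rule AE_I2)
      fix p :: "real \<times> 'a"
      have "\<forall>\<^sub>F n in sequentially. U X p = U (?Y n) p"
        using eventually_ge_at_top[of "nat \<lceil>fst p\<rceil>"]
      proof eventually_elim
        fix n assume "nat \<lceil>fst p\<rceil> \<le> n"
        then have "fst p \<le> real n" by linarith
        then show "U X p = U (?Y n) p" by simp
      qed
      then show "(\<lambda>n. U (?Y n) p) \<longlonglongrightarrow> U X p"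
        by (rule Lim_transform_eventually[OF tendsto_const])
    qed
    show "\<forall>\<^sub>F n in sequentially. (\<integral>\<^sup>+p. ennreal ((U (?Y n) p)\<^sup>2) \<partial>PP {0..}) \<le> c"
      using le unfolding sq_norm_on_PP[OF borel_closed[OF closed_atLeast] m, symmetric] e by simp
  qed
  then show ?thesis using sq_norm_on_PP[OF _ prog_PP_infinite[OF X]] by simp
qed

lemma integral_PP_tendsto:
  fixes f :: "real \<times> 'a \<Rightarrow> real"
  assumes f: "integrable (PP {0..}) f" and fT: "\<And>T. 0 \<le> T \<Longrightarrow> integrable (PP {0..T}) f"
  shows "((\<lambda>T. \<integral>p. f p \<partial>PP {0..T}) \<longlongrightarrow> (\<integral>p. f p \<partial>PP {0..})) at_top"
proof -
  interpret pair_sigma_finite "restrict_space lborel {0::real..}" M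
    by (rule pair_sigma_finite_PP) simp
  have I: "{0..} \<inter> space lborel \<in> sets (lborel :: real measure)" by simp
  have "set_integrable lborel {0..} (\<lambda>t. \<integral>\<omega>. f (t, \<omega>) \<partial>M)"
    using integrable_fst'[OF f[unfolded PP_def]] unfolding set_integrable_def integrable_restrict_space[OF I] .
  then have "((\<lambda>T. LINT t:{0..T}|lborel. (\<integral>\<omega>. f (t, \<omega>) \<partial>M)) \<longlongrightarrow> (LINT t:{0..}|lborel. (\<integral>\<omega>. f (t, \<omega>) \<partial>M))) at_top"
    by (intro tendsto_set_lebesgue_integral_at_top) auto
  moreover have "\<forall>\<^sub>F T in at_top. (LINT t:{0..T}|lborel. (\<integral>\<omega>. f (t, \<omega>) \<partial>M)) = (\<integral>p. f p \<partial>PP {0..T})"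
    using eventually_ge_at_top[of "0::real"] by eventually_elim (rule integral_PP(2)[OF _ fT, symmetric], auto)
  ultimately show ?thesis
    unfolding integral_PP(2)[OF borel_closed[OF closed_atLeast] f] by (rule Lim_transform_eventually)
qed

lemma AE_PP_infinite:
  assumes X: "prog X" and Y: "prog Y" and eq: "\<And>T. 0 \<le> T \<Longrightarrow> AE p in PP {0..T}. U X p = U Y p"
  shows "AE p in PP {0..}. U X p = U Y p"
proof -
  let ?d = "\<lambda>t \<omega>. X t \<omega> - Y t \<omega>"
  note d = prog_diff[OF X Y]
  have "sq_norm_on M {0..real n} ?d = 0" for n :: nat
  proof -
    have "AE p in PP {0..real n}. ennreal ((U ?d p)\<^sup>2) = 0"
      using eq[OF of_nat_0_le_iff, of n] by eventually_elim simp
    then show ?thesis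
      unfolding sq_norm_on_PP[OF borel_closed[OF closed_atLeastAtMost] prog_PP[OF d of_nat_0_le_iff]]
      using nn_integral_0_iff_AE[OF measurable_ennreal_sq[OF prog_PP[OF d of_nat_0_le_iff[of n]]]] by simp
  qed
  then have "sq_norm_on M {0..} ?d \<le> 0" by (intro sq_norm_on_infinite_le[OF d]) simp
  then have "(\<integral>\<^sup>+p. ennreal ((U ?d p)\<^sup>2) \<partial>PP {0..}) = 0"
    unfolding sq_norm_on_PP[OF borel_closed[OF closed_atLeast] prog_PP_infinite[OF d]] by simp
  then have "AE p in PP {0..}. ennreal ((U ?d p)\<^sup>2) = 0"
    using nn_integral_0_iff_AE[OF measurable_ennreal_sq[OF prog_PP_infinite[OF d]]] by simp
  then show ?thesis by eventually_elim simp
qed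

end

section \<open>The linear-quadratic problem\<close>

text \<open>\<open>N\<close>, \<open>V\<close> and \<open>P\<close> stand for the squared norms of
  \<open>X\<close> and \<open>w\<close> and for their inner product under a minimiser from state 1;
  \<open>le\<close> compares it with the feedback \<theta>. As |\<theta>| tends to
  \<open>sqrt \<alpha>\<close> the left side vanishes, whence \<beta> \<ge> 2 |c| sqrt \<alpha>. In
  the case of equality a factor \<open>sqrt \<alpha> - |\<theta>|\<close> cancels, and the sharper
  limit contradicts Cauchy-Schwarz.\<close>

lemma no_minimiser:
  fixes \<alpha> \<beta> c N P V :: real
  assumes \<alpha>: "0 < \<alpha>" and N: "\<alpha> * N = 1 + V" "0 \<le> N" "0 \<le> V" and P: "P\<^sup>2 \<le> N * V"
    and le: "\<And>\<theta>. \<bar>\<theta>\<bar> < sqrt \<alpha> \<Longrightarrow> (\<beta> * N - 2 * c * P) * (\<alpha> - \<theta>\<^sup>2) \<le> \<beta> - 2 * c * \<theta>"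
  shows "(\<beta> = 0 \<and> c = 0) \<or> 2 * \<bar>c\<bar> * sqrt \<alpha> < \<beta>"
proof (rule ccontr)
  assume contra: "\<not> ?thesis"
  define s where "s = sqrt \<alpha>"
  have s: "0 < s" "s * s = \<alpha>" using \<alpha> by (auto simp: s_def)
  define E where "E = \<beta> * N - 2 * c * P"
  \<comment> \<open>The sign of \<theta> is chosen to agree with that of \<open>c\<close>, so that
    \<open>c \<theta> = |c| r\<close>.\<close>
  have E: "E * (\<alpha> - r\<^sup>2) \<le> \<beta> - 2 * \<bar>c\<bar> * r" if "0 \<le> r" "r < s" for r
    using le[of r] le[of "- r"] that by (cases "0 \<le> c") (auto simp: E_def s_def)
  define r where "r n = s * (1 - inverse (real (Suc n)))" for n
  have r: "0 \<le> r n" "r n < s" for n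
    using s by (auto simp: r_def inverse_le_1_iff)
  have "r \<longlonglongrightarrow> s * (1 - 0)"
    unfolding r_def by (intro tendsto_intros LIMSEQ_inverse_real_of_nat)
  then have rlim: "r \<longlonglongrightarrow> s" by simp
  have "E * (\<alpha> - s\<^sup>2) \<le> \<beta> - 2 * \<bar>c\<bar> * s"
    by (rule LIMSEQ_le[of "\<lambda>n. E * (\<alpha> - (r n)\<^sup>2)" _ "\<lambda>n. \<beta> - 2 * \<bar>c\<bar> * r n"])
      (use E r in \<open>auto intro!: tendsto_intros rlim\<close>)
  then have "2 * \<bar>c\<bar> * s \<le> \<beta>" using s by (simp add: power2_eq_square)
  \<comment> \<open>Only the boundary case is left, and there \<open>c = 0\<close> would give the
    first alternative.\<close>
  with contra have \<beta>: "\<beta> = 2 * \<bar>c\<bar> * s" and c: "c \<noteq> 0" by (auto simp: s_def)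
  have E2: "E * (s + r n) \<le> 2 * \<bar>c\<bar>" for n
  proof -
    have "(s - r n) * (E * (s + r n)) = E * (\<alpha> - (r n)\<^sup>2)"
      using s by (simp add: power2_eq_square algebra_simps)
    also have "\<dots> \<le> (s - r n) * (2 * \<bar>c\<bar>)" using E[OF r] unfolding \<beta> by (simp add: algebra_simps)
    finally show ?thesis by (rule mult_left_le_imp_le) (use r in simp)
  qed
  have "E * (s + s) \<le> 2 * \<bar>c\<bar>"
  proof (rule LIMSEQ_le_const2)
    show "(\<lambda>n. E * (s + r n)) \<longlonglongrightarrow> E * (s + s)" by (intro tendsto_intros rlim)
  qed (use E2 in blast)
  moreover have "2 * \<bar>c\<bar> * (s * N - \<bar>P\<bar>) \<le> E"
  proof -
    have "c * P \<le> \<bar>c\<bar> * \<bar>P\<bar>" by (metis abs_ge_self abs_mult)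
    then show ?thesis unfolding E_def \<beta> by (simp add: algebra_simps)
  qed
  then have "2 * \<bar>c\<bar> * (s * N - \<bar>P\<bar>) * (s + s) \<le> E * (s + s)" using s by (intro mult_right_mono) auto
  ultimately have "(2 * \<bar>c\<bar>) * ((s * N - \<bar>P\<bar>) * (s + s)) \<le> (2 * \<bar>c\<bar>) * 1" by simp
  then have "(s * N - \<bar>P\<bar>) * (s + s) \<le> 1" by (rule mult_left_le_imp_le) (use c in simp)
  moreover have "(s * N - \<bar>P\<bar>) * (s + s) = 2 * (\<alpha> * N) - 2 * s * \<bar>P\<bar>"
    unfolding s(2)[symmetric] by (simp add: algebra_simps)
  ultimately have "1 + 2 * V \<le> 2 * s * \<bar>P\<bar>" using N(1) by simp
  \<comment> \<open>Cauchy-Schwarz will bound the right side by \<open>4 (1 + V) V\<close>, which is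
    \<open>(1 + 2 V)^2 - 1\<close>.\<close>
  then have "(1 + 2 * V)\<^sup>2 \<le> (2 * s * \<bar>P\<bar>)\<^sup>2" using N by (intro power_mono) auto
  also have "\<dots> = 4 * (\<alpha> * P\<^sup>2)"
    unfolding s(2)[symmetric] by (simp add: power_mult_distrib power2_eq_square[of s])
  also have "\<dots> \<le> 4 * (\<alpha> * (N * V))" using \<alpha> P by simp
  also have "\<dots> = 4 * ((1 + V) * V)" using N(1) by (simp add: mult.assoc[symmetric])
  finally show False by (simp add: power2_eq_square algebra_simps)
qed

lemma closed_loop_solves:
  assumes "solves_lsde M W (A + B * \<Theta>) B (C + D * \<Theta>) D x v X"
  shows "solves_lsde M W A B C D x (\<lambda>t \<omega>. \<Theta> * X t \<omega> + v t \<omega>) X"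
proof -
  have e: "(C + D * \<Theta>) * X s \<omega> + D * v s \<omega> = C * X s \<omega> + D * (\<Theta> * X s \<omega> + v s \<omega>)"
    "(A + B * \<Theta>) * X s \<omega> + B * v s \<omega> = A * X s \<omega> + B * (\<Theta> * X s \<omega> + v s \<omega>)" for s \<omega>
    by (simp_all add: algebra_simps)
  show ?thesis using assms unfolding solves_lsde_def e .
qed

text \<open>Under the zero control both equations are the same predicate, so the choice operator
  picks the same process. This links the uncontrolled equation in \<open>stabilizer\<close> to the
  closed loop with \<open>v = 0\<close>.\<close>

lemma lsde_sol_no_control:
  "lsde_sol M W A 0 C 0 x (\<lambda>_ _. 0) = lsde_sol M W A B C D x (\<lambda>_ _. 0)"
  unfolding lsde_sol_def solves_lsde_def by simp

context brownian
begin

text \<open>The notion of solution bounds only time integrals of the second moment; at a fixed time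
  the bound is read off the equation.\<close>

lemma solves_sqint:
  assumes u: "locL2 u" and sol: "solves_lsde M W A B C D x u X" and t: "0 \<le> t"
  shows "sqint M (X t)"
proof -
  note X = solves_lsdeD(1)[OF sol]
  obtain I where I: "\<forall>t\<ge>0. ito (\<lambda>s \<omega>. C * X s \<omega> + D * u s \<omega>) t (I t) \<and>
      (AE \<omega> in M. X t \<omega> = x + drift (\<lambda>s \<omega>. A * X s \<omega> + B * u s \<omega>) t \<omega> + I t \<omega>)"
    using solves_lsdeD(2)[OF sol] by (elim exE)
  have It: "ito (\<lambda>s \<omega>. C * X s \<omega> + D * u s \<omega>) t (I t)"
    and e: "AE \<omega> in M. X t \<omega> = x + drift (\<lambda>s \<omega>. A * X s \<omega> + B * u s \<omega>) t \<omega> + I t \<omega>"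
    using I t by auto
  have sx: "sqint M (\<lambda>_. x)" by (rule sqint_bounded[OF finite_measure_axioms, of _ "\<bar>x\<bar>"]) auto
  note s = sqint_add[OF sqint_add[OF sx sqint_drift[OF locL2_lin[OF X u] t]] ito_sqint(2)[OF It]]
  show ?thesis
    by (rule sqint_cong_AE[OF s F_measurable_M[OF prog_adapted[OF locL2_prog[OF X] t]]])
      (use e in \<open>eventually_elim, simp\<close>)
qed

lemma integral_PP_cong:
  fixes f g :: "real \<times> 'a \<Rightarrow> real"
  assumes "\<And>p. f p = g p"
  shows "(\<integral>p. f p \<partial>PP I) = (\<integral>p. g p \<partial>PP I)"
  using assms by simp

end

text \<open>
  With \<open>D = 1\<close> and the control \<open>w = u + k X\<close>, \<open>k = B + C\<close>, the second moment of the state satisfies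
  \<open>d E X\<^sup>2 = E (w\<^sup>2 - \<alpha> X\<^sup>2) dt\<close>, and a feedback \<open>\<Theta>\<close> becomes \<open>w = \<theta> X\<close> with \<open>\<theta> = \<Theta> + k\<close>.
\<close>

locale lq = brownian M W for M :: "'a measure" and W +
  fixes A B C Q S R k \<alpha> \<beta> c :: real
  assumes k: "k = B + C" and \<alpha>: "\<alpha> = k\<^sup>2 - (2 * A + C\<^sup>2)" and \<alpha>_pos: "0 < \<alpha>"
    and \<beta>: "\<beta> = Q - (2 * A + C\<^sup>2) * R + 2 * k * c" and c: "c = k * R - S"
begin

abbreviation sol :: "real \<Rightarrow> (real \<Rightarrow> 'a \<Rightarrow> real) \<Rightarrow> real \<Rightarrow> 'a \<Rightarrow> real" where
  "sol \<equiv> lsde_sol M W A B C 1"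

abbreviation adm :: "real \<Rightarrow> (real \<Rightarrow> 'a \<Rightarrow> real) set" where
  "adm \<equiv> Uad M W A B C 1"

abbreviation J :: "real \<Rightarrow> (real \<Rightarrow> 'a \<Rightarrow> real) \<Rightarrow> real" where
  "J \<equiv> cost M W A B C 1 Q S R"

abbreviation P_inf :: "(real \<times> 'a) measure" where
  "P_inf \<equiv> PP {0..}"

lemma energy:
  assumes u: "locL2 u" and X: "solves_lsde M W A B C 1 x u X" and t: "0 \<le> t"
  shows "expectation (\<lambda>\<omega>. (X t \<omega>)\<^sup>2) = x\<^sup>2 + (\<integral>p. (U u p + k * U X p)\<^sup>2 - \<alpha> * (U X p)\<^sup>2 \<partial>PP {0..t})"
proof -
  have "2 * (A * U X p + B * U u p) * U X p + (C * U X p + 1 * U u p)\<^sup>2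
      = (U u p + k * U X p)\<^sup>2 - \<alpha> * (U X p)\<^sup>2" for p
    unfolding \<alpha> k by (simp add: power2_eq_square algebra_simps)
  then show ?thesis using energy_identity[OF u X t] by simp
qed

text \<open>If \<open>X\<close> is square integrable on the half line, then \<open>E X\<^sup>2\<close>, which converges, tends to \<open>0\<close>.\<close>

lemma energy_infinite:
  assumes u: "locL2 u" and X: "solves_lsde M W A B C 1 x u X"
    and su: "sqint P_inf (U u)" and sX: "sqint P_inf (U X)"
  shows "\<alpha> * (\<integral>p. (U X p)\<^sup>2 \<partial>P_inf) = x\<^sup>2 + (\<integral>p. (U u p + k * U X p)\<^sup>2 \<partial>P_inf)"
proof -
  note lX = solves_lsdeD(1)[OF X]
  let ?f = "\<lambda>p. (U u p + k * U X p)\<^sup>2 - \<alpha> * (U X p)\<^sup>2"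
  have sw: "sqint P_inf (\<lambda>p. U u p + k * U X p)" by (rule sqint_add[OF su sqint_cmult[OF sX]])
  have f: "integrable P_inf ?f"
    using sqint_integrable_sq[OF sw] sqint_integrable_sq[OF sX] by simp
  have fT: "integrable (PP {0..T}) ?f" if "0 \<le> T" for T
    using sqint_integrable_sq[OF sqint_add[OF locL2_sqint[OF u that] sqint_cmult[OF locL2_sqint[OF lX that]]]]
      sqint_integrable_sq[OF locL2_sqint[OF lX that]] by simp
  define m where "m t = expectation (\<lambda>\<omega>. (X t \<omega>)\<^sup>2)" for t
  define l where "l = x\<^sup>2 + (\<integral>p. ?f p \<partial>P_inf)"
  have "((\<lambda>T. x\<^sup>2 + (\<integral>p. ?f p \<partial>PP {0..T})) \<longlongrightarrow> l) at_top"
    unfolding l_def by (intro tendsto_intros integral_PP_tendsto f fT)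
  moreover have "\<forall>\<^sub>F T in at_top. x\<^sup>2 + (\<integral>p. ?f p \<partial>PP {0..T}) = m T"
    using eventually_ge_at_top[of "0::real"]
  proof eventually_elim
    fix T :: real assume T: "0 \<le> T"
    show "x\<^sup>2 + (\<integral>p. ?f p \<partial>PP {0..T}) = m T" unfolding m_def energy[OF u X T] ..
  qed
  ultimately have lim: "(m \<longlongrightarrow> l) at_top" by (rule Lim_transform_eventually)
  have "0 \<le> l" by (rule tendsto_lowerbound[OF lim]) (auto simp: m_def)
  moreover have "\<not> 0 < l"
  proof
    assume l: "0 < l"
    then have "\<forall>\<^sub>F t in at_top. l / 2 < m t" using order_tendstoD(1)[OF lim, of "l / 2"] by simp
    then obtain T0 where T0: "\<And>t. T0 \<le> t \<Longrightarrow> l / 2 < m t" unfolding eventually_at_top_linorder by blast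
    define T1 where "T1 = max 0 T0"
    \<comment> \<open>From \<open>T1\<close> on the second moment exceeds \<open>l / 2\<close>, so
      every further unit of time adds at least \<open>l / 2\<close> to the squared norm.\<close>
    have bound: "l / 2 * real n \<le> (\<integral>p. (U X p)\<^sup>2 \<partial>P_inf)" for n :: nat
    proof -
      have n0: "0 \<le> T1 + real n" by (simp add: T1_def)
      have "ennreal (l / 2) * ennreal (real n) = (\<integral>\<^sup>+t. ennreal (l / 2) * indicator {T1..T1 + real n} t \<partial>lborel)"
        by (subst nn_integral_cmult_indicator) auto
      also have "\<dots> \<le> (\<integral>\<^sup>+t\<in>{0..T1 + real n}. (\<integral>\<^sup>+\<omega>. ennreal ((X t \<omega>)\<^sup>2) \<partial>M) \<partial>lborel)"
      proof (rule nn_integral_mono)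
        fix t
        show "ennreal (l / 2) * indicator {T1..T1 + real n} t
            \<le> (\<integral>\<^sup>+\<omega>. ennreal ((X t \<omega>)\<^sup>2) \<partial>M) * indicator {0..T1 + real n} t"
        proof (cases "t \<in> {T1..T1 + real n}")
          case True
          then have t: "0 \<le> t" "T0 \<le> t" by (auto simp: T1_def)
          have "(\<integral>\<^sup>+\<omega>. ennreal ((X t \<omega>)\<^sup>2) \<partial>M) = ennreal (m t)"
            unfolding m_def by (rule nn_sqint[OF solves_sqint[OF u X t(1)]])
          then show ?thesis using True t(1) T0[OF t(2)] by (simp add: ennreal_leI)
        qed simp
      qed
      also have "\<dots> = sq_norm_on M {0..T1 + real n} X"
        by (rule sq_norm_on_section[OF locL2_prog[OF lX] n0, symmetric])
      also have "\<dots> \<le> sq_norm_on M {0..} X" by (rule sq_norm_on_mono) auto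
      also have "\<dots> = ennreal (\<integral>p. (U X p)\<^sup>2 \<partial>P_inf)"
        using sq_norm_on_PP[OF _ sqint_measurable[OF sX]] nn_sqint[OF sX] by simp
      finally show ?thesis
        using l by (subst (asm) ennreal_mult[symmetric], simp, simp, subst (asm) ennreal_le_iff) auto
    qed
    obtain n :: nat where "(\<integral>p. (U X p)\<^sup>2 \<partial>P_inf) / (l / 2) < real n" using reals_Archimedean2 by blast
    then have "(\<integral>p. (U X p)\<^sup>2 \<partial>P_inf) < l / 2 * real n" using l by (simp add: field_simps)
    then show False using bound[of n] by simp
  qed
  ultimately have "l = 0" by simp
  then show ?thesis
    unfolding l_def using sqint_integrable_sq[OF sw] sqint_integrable_sq[OF sX] by simp
qed

text \<open>The left side of the energy identity is nonnegative. For
  \<open>w = \<theta> X + v\<close> with |\<theta>| < sqrt \<alpha> the term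
  \<open>- \<alpha> X^2\<close> dominates \<open>\<theta>^2 X^2\<close>, which bounds the norm of
  \<open>X\<close> uniformly in the horizon.\<close>

lemma closed_loop_square_integrable:
  assumes \<theta>: "\<bar>\<Theta> + k\<bar> < sqrt \<alpha>" and v: "locL2 v" and sv: "sqint P_inf (U v)"
    and sol: "solves_lsde M W (A + B * \<Theta>) B (C + \<Theta>) 1 x v X"
  shows "sq_norm_on M {0..} X < \<infinity>"
proof -
  let ?\<theta> = "\<Theta> + k" and ?u = "\<lambda>t \<omega>. \<Theta> * X t \<omega> + v t \<omega>"
  note lX = solves_lsdeD(1)[OF sol]
  have u: "locL2 ?u" by (rule locL2_add[OF locL2_cmult[OF lX] v])
  have X: "solves_lsde M W A B C 1 x ?u X"
    using closed_loop_solves[of M W A B \<Theta> C 1 x v X] sol by simp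
  \<comment> \<open>Half of the gap \<open>\<alpha> - \<theta>^2\<close> absorbs the mixed term
    \<open>2 \<theta> X v\<close>; the other half remains as decay.\<close>
  define \<delta> where "\<delta> = (\<alpha> - ?\<theta>\<^sup>2) / 2"
  have "?\<theta>\<^sup>2 < \<alpha>" using \<theta> by (metis real_sqrt_abs real_sqrt_less_iff)
  then have \<delta>: "0 < \<delta>" by (simp add: \<delta>_def)
  define K where "K = 1 + ?\<theta>\<^sup>2 / \<delta>"
  have K: "0 \<le> K" using \<delta> by (simp add: K_def)
  have pw: "(?u t \<omega> + k * X t \<omega>)\<^sup>2 - \<alpha> * (X t \<omega>)\<^sup>2 \<le> K * (v t \<omega>)\<^sup>2 - \<delta> * (X t \<omega>)\<^sup>2" for t \<omega>
  proof -
    have "0 \<le> (\<delta> * X t \<omega> - ?\<theta> * v t \<omega>)\<^sup>2 / \<delta>" using \<delta> by simp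
    also have "\<dots> = \<delta> * (X t \<omega>)\<^sup>2 - 2 * ?\<theta> * X t \<omega> * v t \<omega> + ?\<theta>\<^sup>2 / \<delta> * (v t \<omega>)\<^sup>2"
      using \<delta> by (simp add: power2_eq_square field_simps)
    finally have am: "2 * ?\<theta> * X t \<omega> * v t \<omega> \<le> \<delta> * (X t \<omega>)\<^sup>2 + ?\<theta>\<^sup>2 / \<delta> * (v t \<omega>)\<^sup>2" by simp
    have "(?u t \<omega> + k * X t \<omega>)\<^sup>2 = ?\<theta>\<^sup>2 * (X t \<omega>)\<^sup>2 + 2 * ?\<theta> * X t \<omega> * v t \<omega> + (v t \<omega>)\<^sup>2"
      by (simp add: power2_eq_square algebra_simps)
    also have "\<dots> \<le> ?\<theta>\<^sup>2 * (X t \<omega>)\<^sup>2 + \<delta> * (X t \<omega>)\<^sup>2 + K * (v t \<omega>)\<^sup>2"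
      using am by (simp add: K_def distrib_right)
    also have "?\<theta>\<^sup>2 * (X t \<omega>)\<^sup>2 = (\<alpha> - 2 * \<delta>) * (X t \<omega>)\<^sup>2"
      by (simp add: \<delta>_def field_simps)
    finally show ?thesis by (simp add: algebra_simps)
  qed
  let ?n = "\<integral>p. (U v p)\<^sup>2 \<partial>P_inf"
  have bound: "(\<integral>p. (U X p)\<^sup>2 \<partial>PP {0..T}) \<le> (x\<^sup>2 + K * ?n) / \<delta>" if T: "0 \<le> T" for T
  proof -
    note sqX = locL2_sqint[OF lX T] and squ = locL2_sqint[OF u T] and sqv = locL2_sqint[OF v T]
    have "0 \<le> expectation (\<lambda>\<omega>. (X T \<omega>)\<^sup>2)" by simp
    also have "\<dots> = x\<^sup>2 + (\<integral>p. (U ?u p + k * U X p)\<^sup>2 - \<alpha> * (U X p)\<^sup>2 \<partial>PP {0..T})"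
      by (rule energy[OF u X T])
    also have "\<dots> \<le> x\<^sup>2 + (\<integral>p. K * (U v p)\<^sup>2 - \<delta> * (U X p)\<^sup>2 \<partial>PP {0..T})"
    proof (intro add_left_mono integral_mono pw)
      show "integrable (PP {0..T}) (\<lambda>p. (U ?u p + k * U X p)\<^sup>2 - \<alpha> * (U X p)\<^sup>2)"
        using sqint_integrable_sq[OF sqint_add[OF squ sqint_cmult[OF sqX, of k]]] sqint_integrable_sq[OF sqX] by simp
      show "integrable (PP {0..T}) (\<lambda>p. K * (U v p)\<^sup>2 - \<delta> * (U X p)\<^sup>2)"
        using sqint_integrable_sq[OF sqv] sqint_integrable_sq[OF sqX] by simp
    qed
    also have "\<dots> = x\<^sup>2 + (K * (\<integral>p. (U v p)\<^sup>2 \<partial>PP {0..T}) - \<delta> * (\<integral>p. (U X p)\<^sup>2 \<partial>PP {0..T}))"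
      using sqint_integrable_sq[OF sqv] sqint_integrable_sq[OF sqX] by simp
    also have "(\<integral>p. (U v p)\<^sup>2 \<partial>PP {0..T}) \<le> ?n" by (rule sqint_PP_mono(2)[OF _ _ _ sv]) auto
    finally have "\<delta> * (\<integral>p. (U X p)\<^sup>2 \<partial>PP {0..T}) \<le> x\<^sup>2 + K * ?n"
      using K by (simp add: mult_left_mono)
    then show ?thesis using \<delta> by (simp add: field_simps)
  qed
  have "sq_norm_on M {0..} X \<le> ennreal ((x\<^sup>2 + K * ?n) / \<delta>)"
  proof (rule sq_norm_on_infinite_le[OF locL2_prog[OF lX]])
    show "sq_norm_on M {0..real n} X \<le> ennreal ((x\<^sup>2 + K * ?n) / \<delta>)" for n
      unfolding sq_norm_on_locL2[OF lX of_nat_0_le_iff] by (rule ennreal_leI[OF bound]) simp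
  qed
  then show ?thesis by (rule le_less_trans) simp
qed

lemma zero_L2F: "(\<lambda>_ _. 0) \<in> L2F M W"
  unfolding L2F_def sq_norm_on_def using prog_const by simp

lemma L2F_sqint: "u \<in> L2F M W \<Longrightarrow> sqint P_inf (U u)"
  using sqint_infinite_iff unfolding L2F_def by blast

lemma L2FI: "prog u \<Longrightarrow> sqint P_inf (U u) \<Longrightarrow> u \<in> L2F M W"
  using sqint_infinite_iff unfolding L2F_def by blast

text \<open>For necessity, the energy identity with \<open>w = \<theta> X\<close> and initial state
  1 says that \<open>\<alpha> - \<theta>^2\<close> times the squared norm of \<open>X\<close> equals
  1, which forces a positive factor.\<close>

lemma stabilizer_iff: "stabilizer M W A B C 1 \<Theta> \<longleftrightarrow> \<bar>\<Theta> + k\<bar> < sqrt \<alpha>"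
proof
  assume "\<bar>\<Theta> + k\<bar> < sqrt \<alpha>"
  then show "stabilizer M W A B C 1 \<Theta>"
    unfolding stabilizer_def mult_1 lsde_sol_no_control[of M W "A + B * \<Theta>" "C + \<Theta>" _ B 1]
    using closed_loop_square_integrable[OF _ L2F_locL2[OF zero_L2F] L2F_sqint[OF zero_L2F]
        lsde_sol[OF L2F_locL2[OF zero_L2F]]] by blast
next
  let ?X = "lsde_sol M W (A + B * \<Theta>) B (C + 1 * \<Theta>) 1 1 (\<lambda>_ _. 0)"
  assume "stabilizer M W A B C 1 \<Theta>"
  then have fin: "sq_norm_on M {0..} ?X < \<infinity>"
    unfolding stabilizer_def lsde_sol_no_control[of M W "A + B * \<Theta>" "C + 1 * \<Theta>" _ B 1] by blast
  have s: "solves_lsde M W (A + B * \<Theta>) B (C + 1 * \<Theta>) 1 1 (\<lambda>_ _. 0) ?X"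
    by (rule lsde_sol[OF L2F_locL2[OF zero_L2F]])
  note lX = solves_lsdeD(1)[OF s]
  have sX: "sqint P_inf (U ?X)" using fin sqint_infinite_iff[OF locL2_prog[OF lX]] by simp
  let ?u = "\<lambda>t \<omega>. \<Theta> * ?X t \<omega> + 0"
  have u: "locL2 ?u" by (rule locL2_add[OF locL2_cmult[OF lX] locL2_const])
  have su: "sqint P_inf (U ?u)" using sqint_cmult[OF sX, of \<Theta>] by simp
  have "\<alpha> * (\<integral>p. (U ?X p)\<^sup>2 \<partial>P_inf) = 1\<^sup>2 + (\<integral>p. (U ?u p + k * U ?X p)\<^sup>2 \<partial>P_inf)"
    by (rule energy_infinite[OF u closed_loop_solves[OF s] su sX])
  also have "(\<integral>p. (U ?u p + k * U ?X p)\<^sup>2 \<partial>P_inf) = (\<integral>p. (\<Theta> + k)\<^sup>2 * (U ?X p)\<^sup>2 \<partial>P_inf)"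
    by (rule integral_PP_cong) (simp add: power2_eq_square algebra_simps)
  finally have e: "(\<alpha> - (\<Theta> + k)\<^sup>2) * (\<integral>p. (U ?X p)\<^sup>2 \<partial>P_inf) = 1" by (simp add: algebra_simps)
  have "0 \<le> (\<integral>p. (U ?X p)\<^sup>2 \<partial>P_inf)" by simp
  then have "0 < \<alpha> - (\<Theta> + k)\<^sup>2"
    using e mult_nonpos_nonneg[of "\<alpha> - (\<Theta> + k)\<^sup>2" "\<integral>p. (U ?X p)\<^sup>2 \<partial>P_inf"] by linarith
  then show "\<bar>\<Theta> + k\<bar> < sqrt \<alpha>" using real_less_rsqrt[of "\<bar>\<Theta> + k\<bar>" \<alpha>] by simp
qed

section \<open>Admissible controls and their cost\<close>

lemma admD:
  assumes "u \<in> adm x"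
  shows "locL2 u" "sqint P_inf (U u)" "solves_lsde M W A B C 1 x u (sol x u)"
    "locL2 (sol x u)" "sqint P_inf (U (sol x u))"
proof -
  have u: "u \<in> L2F M W" and fin: "sq_norm_on M {0..} (sol x u) < \<infinity>"
    using assms by (auto simp: Uad_def)
  show 1: "locL2 u" by (rule L2F_locL2[OF u])
  show "sqint P_inf (U u)" by (rule L2F_sqint[OF u])
  show 2: "solves_lsde M W A B C 1 x u (sol x u)" by (rule lsde_sol[OF 1])
  show 3: "locL2 (sol x u)" by (rule solves_lsdeD(1)[OF 2])
  show "sqint P_inf (U (sol x u))" using fin sqint_infinite_iff[OF locL2_prog[OF 3]] by simp
qed

definition w :: "real \<Rightarrow> (real \<Rightarrow> 'a \<Rightarrow> real) \<Rightarrow> real \<times> 'a \<Rightarrow> real" where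
  "w x u p = U u p + k * U (sol x u) p"

lemma sqint_w: "u \<in> adm x \<Longrightarrow> sqint P_inf (w x u)"
  unfolding w_def[abs_def] by (rule sqint_add[OF admD(2) sqint_cmult[OF admD(5)]])

lemma adm_energy:
  assumes "u \<in> adm x"
  shows "\<alpha> * (\<integral>p. (U (sol x u) p)\<^sup>2 \<partial>P_inf) = x\<^sup>2 + (\<integral>p. (w x u p)\<^sup>2 \<partial>P_inf)"
  unfolding w_def by (rule energy_infinite[OF admD(1,3,2,5)[OF assms]])

text \<open>Written in \<open>X\<close> and \<open>w\<close>, the integrand is
  \<open>(\<beta> - \<alpha> R) X^2 - 2 c X w + R w^2\<close>. The energy identity trades the last
  term for \<open>\<alpha> R X^2\<close> and the constant \<open>- R x^2\<close>; this is where
  \<beta> and \<open>c\<close> come from.\<close>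

lemma J_eq:
  assumes u: "u \<in> adm x"
  shows "J x u = \<beta> * (\<integral>p. (U (sol x u) p)\<^sup>2 \<partial>P_inf) - 2 * c * (\<integral>p. U (sol x u) p * w x u p \<partial>P_inf) - R * x\<^sup>2"
proof -
  note su = admD(2)[OF u] and sX = admD(5)[OF u] and sw = sqint_w[OF u]
  let ?X = "U (sol x u)"
  let ?q = "\<lambda>p. Q * (?X p)\<^sup>2 + 2 * S * ?X p * U u p + R * (U u p)\<^sup>2"
  have q: "integrable P_inf ?q"
    using sqint_integrable_sq[OF sX] sqint_integrable_sq[OF su] sqint_mult[OF sX su] by (simp add: mult.assoc)
  have "J x u = (\<integral>p. ?q p \<partial>P_inf)"
    unfolding cost_def Let_def using integral_PP(1)[OF _ q] by simp
  also have "\<dots> = (\<integral>p. (\<beta> - \<alpha> * R) * (?X p)\<^sup>2 - 2 * c * (?X p * w x u p) + R * (w x u p)\<^sup>2 \<partial>P_inf)"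
    by (rule integral_PP_cong) (simp add: w_def \<beta> c \<alpha> power2_eq_square algebra_simps)
  also have "\<dots> = (\<beta> - \<alpha> * R) * (\<integral>p. (?X p)\<^sup>2 \<partial>P_inf) - 2 * c * (\<integral>p. ?X p * w x u p \<partial>P_inf) + R * (\<integral>p. (w x u p)\<^sup>2 \<partial>P_inf)"
    using sqint_integrable_sq[OF sX] sqint_integrable_sq[OF sw] sqint_mult[OF sX sw] by simp
  also have "(\<integral>p. (w x u p)\<^sup>2 \<partial>P_inf) = \<alpha> * (\<integral>p. (?X p)\<^sup>2 \<partial>P_inf) - x\<^sup>2" using adm_energy[OF u] by simp
  finally show ?thesis by (simp add: algebra_simps)
qed

text \<open>Cost and admissibility refer to the chosen solution \<open>sol x u\<close>, not to the
  closed loop process \<open>X\<close> from which \<open>u\<close> is formed; uniqueness identifies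
  the two almost everywhere.\<close>

lemma closed_loop_control:
  fixes x :: real
  assumes \<theta>: "\<bar>\<Theta> + k\<bar> < sqrt \<alpha>" and v: "v \<in> L2F M W"
  defines "X \<equiv> lsde_sol M W (A + B * \<Theta>) B (C + \<Theta>) 1 x v"
  defines "u \<equiv> \<lambda>t \<omega>. \<Theta> * X t \<omega> + v t \<omega>"
  shows "u \<in> adm x" "AE p in P_inf. U (sol x u) p = U X p"
proof -
  have s: "solves_lsde M W (A + B * \<Theta>) B (C + \<Theta>) 1 x v X"
    unfolding X_def by (rule lsde_sol[OF L2F_locL2[OF v]])
  note lX = solves_lsdeD(1)[OF s]
  have fin: "sq_norm_on M {0..} X < \<infinity>"
    by (rule closed_loop_square_integrable[OF \<theta> L2F_locL2[OF v] L2F_sqint[OF v] s])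
  have sX: "sqint P_inf (U X)" using fin sqint_infinite_iff[OF locL2_prog[OF lX]] by simp
  have lu: "locL2 u" unfolding u_def by (rule locL2_add[OF locL2_cmult[OF lX] L2F_locL2[OF v]])
  have su: "sqint P_inf (U u)" unfolding u_def by (rule sqint_add[OF sqint_cmult[OF sX] L2F_sqint[OF v]])
  have uL: "u \<in> L2F M W" by (rule L2FI[OF locL2_prog[OF lu] su])
  have sol1: "solves_lsde M W A B C 1 x u X"
    unfolding u_def using closed_loop_solves[of M W A B \<Theta> C 1 x v X] s by simp
  have sol2: "solves_lsde M W A B C 1 x u (sol x u)" by (rule lsde_sol[OF lu])
  note lY = solves_lsdeD(1)[OF sol2]
  show ae: "AE p in P_inf. U (sol x u) p = U X p"
    by (rule AE_PP_infinite[OF locL2_prog[OF lY] locL2_prog[OF lX] lsde_unique[OF lu sol2 sol1]])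
  have "sqint P_inf (U (sol x u))"
    by (rule sqint_cong_AE[OF sX prog_PP_infinite[OF locL2_prog[OF lY]]]) (use ae in \<open>eventually_elim, simp\<close>)
  then have "sq_norm_on M {0..} (sol x u) < \<infinity>" using sqint_infinite_iff[OF locL2_prog[OF lY]] by simp
  then show "u \<in> adm x" using uL by (simp add: Uad_def)
qed

lemma closed_loop_w:
  fixes x :: real
  assumes \<theta>: "\<bar>\<Theta> + k\<bar> < sqrt \<alpha>" and v: "v \<in> L2F M W"
  defines "X \<equiv> lsde_sol M W (A + B * \<Theta>) B (C + \<Theta>) 1 x v"
  defines "u \<equiv> \<lambda>t \<omega>. \<Theta> * X t \<omega> + v t \<omega>"
  shows "AE p in P_inf. w x u p = (\<Theta> + k) * U (sol x u) p + U v p"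
  using closed_loop_control(2)[OF \<theta> v, of x] unfolding X_def[symmetric] u_def[symmetric]
proof eventually_elim
  fix p assume "U (sol x u) p = U X p"
  then show "w x u p = (\<Theta> + k) * U (sol x u) p + U v p"
    unfolding w_def by (simp add: u_def algebra_simps)
qed

text \<open>Under \<open>w = \<theta> X\<close> the energy identity becomes
  \<open>(\<alpha> - \<theta>^2) * N = x^2\<close> for the squared norm \<open>N\<close> of the
  state, and the cost, apart from the constant \<open>- R x^2\<close>, is a multiple of
  \<open>N\<close>.\<close>

lemma feedback_cost:
  assumes \<theta>: "\<bar>\<theta>\<bar> < sqrt \<alpha>"
  shows "\<exists>u\<in>adm x. (J x u + R * x\<^sup>2) * (\<alpha> - \<theta>\<^sup>2) = (\<beta> - 2 * c * \<theta>) * x\<^sup>2"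
proof -
  define \<Theta> where "\<Theta> = \<theta> - k"
  have \<theta>': "\<bar>\<Theta> + k\<bar> < sqrt \<alpha>" using \<theta> by (simp add: \<Theta>_def)
  define u where "u = (\<lambda>t \<omega>. \<Theta> * lsde_sol M W (A + B * \<Theta>) B (C + \<Theta>) 1 x (\<lambda>_ _. 0) t \<omega> + 0)"
  have u: "u \<in> adm x" unfolding u_def by (rule closed_loop_control(1)[OF \<theta>' zero_L2F])
  let ?X = "U (sol x u)"
  have ae: "AE p in P_inf. w x u p = \<theta> * ?X p"
    using closed_loop_w[OF \<theta>' zero_L2F, of x] unfolding u_def[symmetric] by eventually_elim (simp add: \<Theta>_def)
  note mX = sqint_measurable[OF admD(5)[OF u]] and mw = sqint_measurable[OF sqint_w[OF u]]
  let ?N = "\<integral>p. (?X p)\<^sup>2 \<partial>P_inf"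
  have "(\<integral>p. (w x u p)\<^sup>2 \<partial>P_inf) = (\<integral>p. \<theta>\<^sup>2 * (?X p)\<^sup>2 \<partial>P_inf)"
    by (intro integral_cong_AE borel_measurable_power borel_measurable_times borel_measurable_const mX mw)
      (use ae in \<open>eventually_elim, simp add: power_mult_distrib\<close>)
  then have 1: "(\<alpha> - \<theta>\<^sup>2) * ?N = x\<^sup>2" using adm_energy[OF u] by (simp add: algebra_simps)
  have "(\<integral>p. ?X p * w x u p \<partial>P_inf) = (\<integral>p. \<theta> * (?X p)\<^sup>2 \<partial>P_inf)"
    by (intro integral_cong_AE borel_measurable_power borel_measurable_times borel_measurable_const mX mw)
      (use ae in \<open>eventually_elim, simp add: power2_eq_square\<close>)
  then have "J x u + R * x\<^sup>2 = (\<beta> - 2 * c * \<theta>) * ?N" using J_eq[OF u] by (simp add: algebra_simps)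
  then have "(J x u + R * x\<^sup>2) * (\<alpha> - \<theta>\<^sup>2) = (\<beta> - 2 * c * \<theta>) * x\<^sup>2" unfolding 1[symmetric] by simp
  then show ?thesis using u by blast
qed

lemma open_loop_necessary:
  assumes "open_loop_solvable M W A B C 1 Q S R"
  shows "(\<beta> = 0 \<and> c = 0) \<or> 2 * \<bar>c\<bar> * sqrt \<alpha> < \<beta>"
proof -
  obtain u where u: "u \<in> adm 1" and opt: "\<And>u'. u' \<in> adm 1 \<Longrightarrow> J 1 u \<le> J 1 u'"
    using assms unfolding open_loop_solvable_def by blast
  let ?N = "\<integral>p. (U (sol 1 u) p)\<^sup>2 \<partial>P_inf" and ?V = "\<integral>p. (w 1 u p)\<^sup>2 \<partial>P_inf"
    and ?P = "\<integral>p. U (sol 1 u) p * w 1 u p \<partial>P_inf"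
  show ?thesis
  proof (rule no_minimiser[OF \<alpha>_pos])
    show "\<alpha> * ?N = 1 + ?V" using adm_energy[OF u] by simp
    show "?P\<^sup>2 \<le> ?N * ?V" by (rule Cauchy_Schwarz_integral[OF admD(5)[OF u] sqint_w[OF u]])
    fix \<theta> :: real assume \<theta>: "\<bar>\<theta>\<bar> < sqrt \<alpha>"
    obtain u' where u': "u' \<in> adm 1" "(J 1 u' + R) * (\<alpha> - \<theta>\<^sup>2) = \<beta> - 2 * c * \<theta>"
      using feedback_cost[OF \<theta>, of 1] by auto
    have "\<theta>\<^sup>2 < \<alpha>" using \<theta> by (metis real_sqrt_abs real_sqrt_less_iff)
    then have "(J 1 u + R) * (\<alpha> - \<theta>\<^sup>2) \<le> (J 1 u' + R) * (\<alpha> - \<theta>\<^sup>2)"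
      using opt[OF u'(1)] by (intro mult_right_mono) auto
    then show "(\<beta> * ?N - 2 * c * ?P) * (\<alpha> - \<theta>\<^sup>2) \<le> \<beta> - 2 * c * \<theta>"
      unfolding u'(2) using J_eq[OF u] by simp
  qed auto
qed

lemma closed_loop_optimal_iff:
  "closed_loop_optimal M W A B C 1 Q S R \<Theta> v \<longleftrightarrow>
    \<bar>\<Theta> + k\<bar> < sqrt \<alpha> \<and> v \<in> L2F M W \<and> (\<forall>x. \<forall>u\<in>adm x.
      J x (\<lambda>t \<omega>. \<Theta> * lsde_sol M W (A + B * \<Theta>) B (C + \<Theta>) 1 x v t \<omega> + v t \<omega>) \<le> J x u)"
  unfolding closed_loop_optimal_def stabilizer_iff Let_def mult_1 ..

lemma closed_loop_imp_open_loop: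
  assumes "closed_loop_optimal M W A B C 1 Q S R \<Theta> v"
  shows "open_loop_solvable M W A B C 1 Q S R"
  using assms closed_loop_control(1) unfolding closed_loop_optimal_iff open_loop_solvable_def by blast

lemma degenerate_closed_loop:
  assumes "\<beta> = 0" "c = 0"
  shows "closed_loop_optimal M W A B C 1 Q S R \<Theta> v \<longleftrightarrow> \<bar>\<Theta> + k\<bar> < sqrt \<alpha> \<and> v \<in> L2F M W"
proof -
  have "J x u = - R * x\<^sup>2" if "u \<in> adm x" for x u
    using J_eq[OF that] assms by simp
  then show ?thesis using closed_loop_control(1) unfolding closed_loop_optimal_iff by fastforce
qed

section \<open>The regular case: existence and uniqueness of the optimal feedback\<close>

context
  assumes pos: "2 * \<bar>c\<bar> * sqrt \<alpha> < \<beta>"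
begin

text \<open>\<open>p_opt - R\<close> is the solution \<open>P\<close> of the algebraic Riccati
  equation that makes \<open>P x^2\<close> the value function.\<close>

definition p_opt :: real where "p_opt = (\<beta> + sqrt (\<beta>\<^sup>2 - 4 * \<alpha> * c\<^sup>2)) / (2 * \<alpha>)"

definition \<theta>_opt :: real where "\<theta>_opt = c / p_opt"

text \<open>The larger root is at least \<open>\<beta> / (2 \<alpha>)\<close>, which exceeds
  \<open>|c| / sqrt \<alpha>\<close> in the regular case; hence \<open>c / p\<close> is stabilizing.
  For \<open>c \<noteq> 0\<close> the smaller root leads to a feedback beyond
  \<open>sqrt \<alpha>\<close>.\<close>

lemma p_opt: "0 < p_opt" "\<beta> = p_opt * (\<alpha> + \<theta>_opt\<^sup>2)" "c = p_opt * \<theta>_opt" "\<bar>\<theta>_opt\<bar> < sqrt \<alpha>"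
proof -
  have s: "0 < sqrt \<alpha>" "(sqrt \<alpha>)\<^sup>2 = \<alpha>" using \<alpha>_pos by auto
  have \<beta>0: "0 < \<beta>" using pos s by (meson le_less_trans mult_nonneg_nonneg abs_ge_zero less_imp_le zero_le_numeral)
  have "(2 * \<bar>c\<bar> * sqrt \<alpha>)\<^sup>2 \<le> \<beta>\<^sup>2" using pos s by (intro power_mono) auto
  then have d: "0 \<le> \<beta>\<^sup>2 - 4 * \<alpha> * c\<^sup>2" using s(2) by (simp add: power_mult_distrib mult_ac)
  have ge: "\<beta> / (2 * \<alpha>) \<le> p_opt" unfolding p_opt_def using d \<alpha>_pos by (intro divide_right_mono) auto
  then show p: "0 < p_opt" using \<beta>0 \<alpha>_pos by (meson divide_pos_pos less_le_trans mult_pos_pos zero_less_numeral)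
  then show c': "c = p_opt * \<theta>_opt" by (simp add: \<theta>_opt_def)
  have "(2 * \<alpha> * p_opt - \<beta>)\<^sup>2 = \<beta>\<^sup>2 - 4 * \<alpha> * c\<^sup>2"
    unfolding p_opt_def using d \<alpha>_pos by simp
  then have "4 * \<alpha> * (\<alpha> * p_opt\<^sup>2 - \<beta> * p_opt + c\<^sup>2) = 0" by (simp add: power2_eq_square algebra_simps)
  then have "\<alpha> * p_opt\<^sup>2 - \<beta> * p_opt + c\<^sup>2 = 0" using \<alpha>_pos by simp
  then have "p_opt * \<beta> = p_opt * (p_opt * (\<alpha> + \<theta>_opt\<^sup>2))"
    using c' by (simp add: power2_eq_square algebra_simps)
  then show "\<beta> = p_opt * (\<alpha> + \<theta>_opt\<^sup>2)" using p by simp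
  have "\<bar>c\<bar> / sqrt \<alpha> < \<beta> / (2 * \<alpha>)"
  proof -
    have "\<bar>c\<bar> / sqrt \<alpha> = (2 * \<bar>c\<bar> * sqrt \<alpha>) / (2 * \<alpha>)"
      using s \<alpha>_pos by (simp add: field_simps)
    also have "\<dots> < \<beta> / (2 * \<alpha>)" using pos \<alpha>_pos by (intro divide_strict_right_mono) auto
    finally show ?thesis .
  qed
  then have "\<bar>c\<bar> / sqrt \<alpha> < p_opt" using ge by simp
  then have "\<bar>c\<bar> < sqrt \<alpha> * p_opt" using s by (simp add: field_simps)
  then show "\<bar>\<theta>_opt\<bar> < sqrt \<alpha>" using p by (simp add: \<theta>_opt_def abs_divide field_simps)
qed

text \<open>With \<open>\<beta> = p (\<alpha> + \<theta>^2)\<close> and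
  \<open>c = p \<theta>\<close>, the integrand \<open>\<beta> X^2 - 2 c X w\<close> equals
  \<open>p (\<alpha> X^2 - w^2) + p (w - \<theta> X)^2\<close>, and the energy identity evaluates
  the first part to \<open>p x^2\<close>.\<close>

lemma J_square:
  assumes u: "u \<in> adm x"
  shows "J x u = (p_opt - R) * x\<^sup>2 + p_opt * (\<integral>p. (w x u p - \<theta>_opt * U (sol x u) p)\<^sup>2 \<partial>P_inf)"
proof -
  note sX = admD(5)[OF u] and sw = sqint_w[OF u]
  let ?X = "U (sol x u)"
  let ?N = "\<integral>p. (?X p)\<^sup>2 \<partial>P_inf" and ?V = "\<integral>p. (w x u p)\<^sup>2 \<partial>P_inf" and ?P = "\<integral>p. ?X p * w x u p \<partial>P_inf"
  have "(\<integral>p. (w x u p - \<theta>_opt * ?X p)\<^sup>2 \<partial>P_inf)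
     = (\<integral>p. (w x u p)\<^sup>2 - 2 * \<theta>_opt * (?X p * w x u p) + \<theta>_opt\<^sup>2 * (?X p)\<^sup>2 \<partial>P_inf)"
    by (rule integral_PP_cong) (simp add: power2_eq_square algebra_simps)
  also have "\<dots> = ?V - 2 * \<theta>_opt * ?P + \<theta>_opt\<^sup>2 * ?N"
    using sqint_integrable_sq[OF sX] sqint_integrable_sq[OF sw] sqint_mult[OF sX sw] by simp
  finally have e: "(\<integral>p. (w x u p - \<theta>_opt * ?X p)\<^sup>2 \<partial>P_inf) = ?V - 2 * \<theta>_opt * ?P + \<theta>_opt\<^sup>2 * ?N" .
  have "J x u = p_opt * (\<alpha> * ?N) + p_opt * \<theta>_opt\<^sup>2 * ?N - 2 * (p_opt * \<theta>_opt) * ?P - R * x\<^sup>2"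
    using J_eq[OF u] arg_cong2[where f="\<lambda>b c. b * ?N - 2 * c * ?P", OF p_opt(2,3)] by (simp add: algebra_simps)
  then show ?thesis unfolding e adm_energy[OF u] by (simp add: algebra_simps)
qed

lemma regular_closed_loop:
  "closed_loop_optimal M W A B C 1 Q S R (\<theta>_opt - k) (\<lambda>_ _. 0)"
proof -
  let ?\<Theta> = "\<theta>_opt - k"
  have \<theta>: "\<bar>?\<Theta> + k\<bar> < sqrt \<alpha>" using p_opt(4) by simp
  have "J x (\<lambda>t \<omega>. ?\<Theta> * lsde_sol M W (A + B * ?\<Theta>) B (C + ?\<Theta>) 1 x (\<lambda>_ _. 0) t \<omega> + 0) \<le> J x u" if u: "u \<in> adm x" for x u
  proof -
    let ?u = "\<lambda>t \<omega>. ?\<Theta> * lsde_sol M W (A + B * ?\<Theta>) B (C + ?\<Theta>) 1 x (\<lambda>_ _. 0) t \<omega> + 0"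
    have u': "?u \<in> adm x" by (rule closed_loop_control(1)[OF \<theta> zero_L2F])
    have "(\<integral>p. (w x ?u p - \<theta>_opt * U (sol x ?u) p)\<^sup>2 \<partial>P_inf) = 0"
      by (rule integral_eq_zero_AE) (use closed_loop_w[OF \<theta> zero_L2F, of x] in \<open>eventually_elim, simp\<close>)
    then have "J x ?u = (p_opt - R) * x\<^sup>2" using J_square[OF u'] by simp
    also have "\<dots> \<le> J x u" unfolding J_square[OF u] using p_opt(1) by simp
    finally show ?thesis .
  qed
  then show ?thesis unfolding closed_loop_optimal_iff using \<theta> zero_L2F by blast
qed

text \<open>Optimality forces \<open>w = \<theta>_opt X\<close>, while the strategy itself gives
  \<open>w = (\<Theta> + k) X + v\<close>. From initial state 0 the state vanishes, which leaves
  \<open>v = 0\<close>; from initial state 1 it does not vanish, which fixes \<Theta>. One pair has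
  to serve all initial states, and this is what makes it unique.\<close>

lemma closed_loop_unique:
  assumes opt: "closed_loop_optimal M W A B C 1 Q S R \<Theta> v"
  shows "\<Theta> = \<theta>_opt - k" "proc_eq M v (\<lambda>_ _. 0)"
proof -
  have \<theta>: "\<bar>\<Theta> + k\<bar> < sqrt \<alpha>" and v: "v \<in> L2F M W"
    using opt unfolding closed_loop_optimal_iff by auto
  define u where "u x = (\<lambda>t \<omega>. \<Theta> * lsde_sol M W (A + B * \<Theta>) B (C + \<Theta>) 1 x v t \<omega> + v t \<omega>)" for x
  have u: "u x \<in> adm x" for x unfolding u_def by (rule closed_loop_control(1)[OF \<theta> v])
  have w1: "AE p in P_inf. w x (u x) p = (\<Theta> + k) * U (sol x (u x)) p + U v p" for x
    unfolding u_def by (rule closed_loop_w[OF \<theta> v])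
  have w2: "AE p in P_inf. w x (u x) p = \<theta>_opt * U (sol x (u x)) p" for x
  proof -
    \<comment> \<open>The competitor is the feedback \<theta>_opt, whose cost is
      \<open>(p_opt - R) x^2\<close>; by \<open>J_square\<close> an optimal control then has square
      term 0.\<close>
    obtain u' where u': "u' \<in> adm x" "(J x u' + R * x\<^sup>2) * (\<alpha> - \<theta>_opt\<^sup>2) = (\<beta> - 2 * c * \<theta>_opt) * x\<^sup>2"
      using feedback_cost[OF p_opt(4), of x] by blast
    have pos: "0 < \<alpha> - \<theta>_opt\<^sup>2" using p_opt(4) by (metis diff_gt_0_iff_gt real_sqrt_abs real_sqrt_less_iff)
    have "\<beta> - 2 * c * \<theta>_opt = p_opt * (\<alpha> - \<theta>_opt\<^sup>2)"
      using arg_cong2[where f="\<lambda>b c. b - 2 * c * \<theta>_opt", OF p_opt(2,3)]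
      by (simp add: power2_eq_square algebra_simps)
    then have "(J x u' + R * x\<^sup>2) * (\<alpha> - \<theta>_opt\<^sup>2) = (p_opt * x\<^sup>2) * (\<alpha> - \<theta>_opt\<^sup>2)" using u'(2) by simp
    then have "J x u' + R * x\<^sup>2 = p_opt * x\<^sup>2"
      by (rule mult_right_cancel[THEN iffD1, rotated]) (use pos in simp)
    then have "J x u' = (p_opt - R) * x\<^sup>2" by (simp add: algebra_simps)
    moreover have "J x (u x) \<le> J x u'" using opt u'(1) unfolding closed_loop_optimal_iff u_def by blast
    ultimately have "p_opt * (\<integral>p. (w x (u x) p - \<theta>_opt * U (sol x (u x)) p)\<^sup>2 \<partial>P_inf) \<le> 0"
      using J_square[OF u, of x] by simp
    then have "(\<integral>p. (w x (u x) p - \<theta>_opt * U (sol x (u x)) p)\<^sup>2 \<partial>P_inf) = 0"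
      using p_opt(1) by (intro antisym) (auto simp: mult_le_0_iff)
    from integral_sq_zero_AE[OF sqint_diff[OF sqint_w[OF u] sqint_cmult[OF admD(5)[OF u]]] this]
    show ?thesis by eventually_elim simp
  qed
  have energy_w: "(\<alpha> - \<theta>_opt\<^sup>2) * (\<integral>p. (U (sol x (u x)) p)\<^sup>2 \<partial>P_inf) = x\<^sup>2" for x
  proof -
    have "(\<integral>p. (w x (u x) p)\<^sup>2 \<partial>P_inf) = (\<integral>p. \<theta>_opt\<^sup>2 * (U (sol x (u x)) p)\<^sup>2 \<partial>P_inf)"
      by (intro integral_cong_AE borel_measurable_power borel_measurable_times borel_measurable_const
          sqint_measurable[OF admD(5)[OF u]] sqint_measurable[OF sqint_w[OF u]])
        (use w2[of x] in \<open>eventually_elim, simp add: power_mult_distrib\<close>)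
    then show ?thesis using adm_energy[OF u, of x] by (simp add: algebra_simps)
  qed
  have ne: "\<alpha> - \<theta>_opt\<^sup>2 \<noteq> 0" using energy_w[of 1] by auto
  have "(\<integral>p. (U (sol 0 (u 0)) p)\<^sup>2 \<partial>P_inf) = 0" using energy_w[of 0] ne by simp
  from integral_sq_zero_AE[OF admD(5)[OF u] this] w1[of 0] w2[of 0]
  have v0: "AE p in P_inf. U v p = 0" by eventually_elim simp
  have "(\<integral>\<^sup>+p. ennreal ((U v p)\<^sup>2) \<partial>P_inf) = 0"
    by (subst nn_integral_0_iff_AE[OF measurable_ennreal_sq[OF sqint_measurable[OF L2F_sqint[OF v]]]])
      (use v0 in \<open>eventually_elim, simp\<close>)
  then have "sq_norm_on M {0..} v = 0"
    using sq_norm_on_PP[OF _ sqint_measurable[OF L2F_sqint[OF v]]] by simp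
  then have "AE \<omega> in M. (\<integral>\<^sup>+t\<in>{0..}. ennreal ((v t \<omega>)\<^sup>2) \<partial>lborel) = 0"
    unfolding sq_norm_on_def
    using nn_integral_0_iff_AE[OF path_nn_measurable[OF _ sqint_measurable[OF L2F_sqint[OF v]]]] by simp
  then show "proc_eq M v (\<lambda>_ _. 0)"
    unfolding proc_eq_def using AE_space
  proof eventually_elim
    fix \<omega> assume z: "(\<integral>\<^sup>+t\<in>{0..}. ennreal ((v t \<omega>)\<^sup>2) \<partial>lborel) = 0" and \<omega>: "\<omega> \<in> space M"
    have "(\<lambda>t. v t \<omega>) \<in> borel_measurable (restrict_space lborel {0..})"
      using PP_path_measurable[OF sqint_measurable[OF L2F_sqint[OF v]] \<omega>] by simp
    from measurable_ennreal_sq[OF this]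
    have "AE t in restrict_space lborel {0..}. ennreal ((v t \<omega>)\<^sup>2) = 0"
      using z nn_integral_0_iff_AE[of "\<lambda>t. ennreal ((v t \<omega>)\<^sup>2)" "restrict_space lborel {0..}"]
      by (simp add: nn_integral_restrict_space)
    then show "AE t in lborel. 0 \<le> t \<longrightarrow> v t \<omega> = 0"
      by (subst (asm) AE_restrict_space_iff) auto
  qed
  show "\<Theta> = \<theta>_opt - k"
  proof (rule ccontr)
    assume "\<Theta> \<noteq> \<theta>_opt - k"
    have X0: "AE p in P_inf. U (sol 1 (u 1)) p = 0"
      using w1[of 1] w2[of 1] v0
    proof eventually_elim
      fix p assume "w 1 (u 1) p = (\<Theta> + k) * U (sol 1 (u 1)) p + U v p"
        "w 1 (u 1) p = \<theta>_opt * U (sol 1 (u 1)) p" "U v p = 0"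
      then have "(\<Theta> - (\<theta>_opt - k)) * U (sol 1 (u 1)) p = 0" by (simp add: algebra_simps)
      then show "U (sol 1 (u 1)) p = 0" using \<open>\<Theta> \<noteq> \<theta>_opt - k\<close> by simp
    qed
    have "(\<integral>p. (U (sol 1 (u 1)) p)\<^sup>2 \<partial>P_inf) = 0"
      by (rule integral_eq_zero_AE) (use X0 in \<open>eventually_elim, simp\<close>)
    then show False using energy_w[of 1] by simp
  qed
qed

end

end

section \<open>The case distinction\<close>

lemma two_abs_less_iff:
  fixes b c s :: real
  assumes "0 \<le> s"
  shows "2 * \<bar>c\<bar> * s < b \<longleftrightarrow> 0 < b - 2 * c * s \<and> 0 < b + 2 * c * s"
proof (cases "0 \<le> c")
  case True
  then have "0 \<le> 2 * c * s" using assms by simp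
  then show ?thesis using True by auto
next
  case False
  then have "2 * c * s \<le> 0" using assms by (simp add: mult_nonpos_nonneg)
  then show ?thesis using False by auto
qed

text \<open>
  The regularity condition is the positivity of \<open>q\<close> at the two roots \<open>k \<plusminus> \<surd>\<alpha>\<close> of
  \<open>z\<^sup>2 - 2 k z + (2 A + C\<^sup>2)\<close>, where \<open>q z = Q + R z\<^sup>2 - 2 S z\<close>. When no root vanishes, dividing by
  \<open>z\<^sup>2\<close> gives two lower bounds for \<open>R\<close>, and the sign of \<open>(2 A + C\<^sup>2) S - k Q\<close> decides which is larger.
\<close>

lemma regular_iff_cases:
  fixes k m \<alpha> \<beta> c Q S R :: real
  assumes \<alpha>: "\<alpha> = k\<^sup>2 - m" "0 < \<alpha>" and c: "c = k * R - S" and \<beta>: "\<beta> = Q - m * R + 2 * k * c"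
  shows "2 * \<bar>c\<bar> * sqrt \<alpha> < \<beta> \<longleftrightarrow>
    (m \<noteq> 0 \<and> m * S \<ge> k * Q \<and> R > (2 * (k - sqrt \<alpha>) * S - Q) / (k - sqrt \<alpha>)\<^sup>2) \<or>
    (m \<noteq> 0 \<and> m * S < k * Q \<and> R > (2 * (k + sqrt \<alpha>) * S - Q) / (k + sqrt \<alpha>)\<^sup>2) \<or>
    (m = 0 \<and> Q > 0 \<and> R > (4 * k * S - Q) / (4 * k\<^sup>2))"
proof -
  define s where "s = sqrt \<alpha>"
  have s: "0 < s" "s * s = \<alpha>" using \<alpha>(2) by (auto simp: s_def)
  define q where "q z = Q + R * z\<^sup>2 - 2 * S * z" for z
  have m: "m = (k - s) * (k + s)" using \<alpha>(1) s(2) by (simp add: power2_eq_square algebra_simps)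
  have q1: "\<beta> - 2 * c * s = q (k - s)" and q2: "\<beta> + 2 * c * s = q (k + s)"
    unfolding \<beta> c q_def m by (simp_all add: power2_eq_square algebra_simps)
  have cond: "2 * \<bar>c\<bar> * s < \<beta> \<longleftrightarrow> 0 < q (k - s) \<and> 0 < q (k + s)"
    using two_abs_less_iff[of s c \<beta>] s(1) unfolding q1 q2 by simp
  have q_div: "0 < q z \<longleftrightarrow> (2 * z * S - Q) / z\<^sup>2 < R" if "z \<noteq> 0" for z
    using that by (simp add: q_def field_simps)
  show ?thesis
  proof (cases "m = 0")
    case True
    have "k \<noteq> 0"
    proof
      assume "k = 0" then show False using True \<alpha> by simp
    qed
    from True m have "k = s \<or> k = - s" by (auto simp: eq_neg_iff_add_eq_0)
    \<comment> \<open>One root is 0, where \<open>q\<close> takes the value \<open>Q\<close>, and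
      the other is \<open>2 k\<close>; comparing sets avoids distinguishing the sign of
      \<open>k\<close>.\<close>
    then have "{k - s, k + s} = {0, 2 * k}" by auto
    then have "(\<forall>z\<in>{k - s, k + s}. 0 < q z) \<longleftrightarrow> (\<forall>z\<in>{0, 2 * k}. 0 < q z)" by metis
    then have "2 * \<bar>c\<bar> * s < \<beta> \<longleftrightarrow> 0 < Q \<and> (2 * (2 * k) * S - Q) / (2 * k)\<^sup>2 < R"
      unfolding cond using q_div[of "2 * k"] \<open>k \<noteq> 0\<close> by (simp add: q_def)
    then show ?thesis unfolding s_def[symmetric] using True by (simp add: power_mult_distrib)
  next
    case False
    define a b where "a = k - s" and "b = k + s"
    have ab: "a \<noteq> 0" "b \<noteq> 0" "m = a * b" using False m by (auto simp: a_def b_def)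
    \<comment> \<open>The computation uses \<open>a + b = 2 k\<close>, \<open>a b = m\<close> and
      \<open>b - a = 2 s\<close>.\<close>
    have "(2 * a * S - Q) / a\<^sup>2 - (2 * b * S - Q) / b\<^sup>2 = (b - a) * (2 * (a * b) * S - (a + b) * Q) / (a * b)\<^sup>2"
      using ab by (simp add: field_simps power2_eq_square)
    also have "\<dots> = (4 * s) / (a * b)\<^sup>2 * (m * S - k * Q)"
      unfolding ab(3) by (simp add: a_def b_def algebra_simps)
    finally have diff: "(2 * a * S - Q) / a\<^sup>2 - (2 * b * S - Q) / b\<^sup>2 = (4 * s) / (a * b)\<^sup>2 * (m * S - k * Q)" .
    have f: "0 < (4 * s) / (a * b)\<^sup>2" using s ab by simp
    have c2: "2 * \<bar>c\<bar> * s < \<beta> \<longleftrightarrow> (2 * a * S - Q) / a\<^sup>2 < R \<and> (2 * b * S - Q) / b\<^sup>2 < R"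
      unfolding cond a_def[symmetric] b_def[symmetric] using q_div ab by simp
    show ?thesis
    proof (cases "k * Q \<le> m * S")
      case True
      then have "0 \<le> (4 * s) / (a * b)\<^sup>2 * (m * S - k * Q)" using f by (intro mult_nonneg_nonneg) auto
      then have "(2 * b * S - Q) / b\<^sup>2 \<le> (2 * a * S - Q) / a\<^sup>2" using diff by linarith
      then have "2 * \<bar>c\<bar> * s < \<beta> \<longleftrightarrow> (2 * a * S - Q) / a\<^sup>2 < R" unfolding c2 by linarith
      then show ?thesis using True False unfolding s_def[symmetric] a_def by auto
    next
      case lt: False
      then have "(4 * s) / (a * b)\<^sup>2 * (m * S - k * Q) \<le> 0" using f by (intro mult_nonneg_nonpos) auto
      then have "(2 * a * S - Q) / a\<^sup>2 \<le> (2 * b * S - Q) / b\<^sup>2" using diff by linarith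
      then have "2 * \<bar>c\<bar> * s < \<beta> \<longleftrightarrow> (2 * b * S - Q) / b\<^sup>2 < R" unfolding c2 by linarith
      then show ?thesis using lt False unfolding s_def[symmetric] b_def by auto
    qed
  qed
qed

theorem theorem7p2:
  fixes M :: "'a measure" and W :: "real \<Rightarrow> 'a \<Rightarrow> real"
    and A B C D Q S R \<alpha> \<beta> \<gamma> :: real
  assumes "prob_space M" and "complete_measure M" and "brownian_motion M W"
    and "\<alpha> = (B + C)\<^sup>2 - (2 * A + C\<^sup>2)"
    and "\<beta> = Q - (2 * A + C\<^sup>2) * R + 2 * (B + C) * ((B + C) * R - S)"
    and "\<gamma> = ((B + C) * R - S)\<^sup>2"
    and "D = 1" and "\<alpha> > 0"
  shows "let
      case_i = (Q = (2 * A + C\<^sup>2) * R \<and> S = (B + C) * R);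
      case_ii = (2 * A + C\<^sup>2 \<noteq> 0 \<and> (2 * A + C\<^sup>2) * S \<ge> (B + C) * Q \<and>
        R > (2 * (B + C - sqrt \<alpha>) * S - Q) / (B + C - sqrt \<alpha>)\<^sup>2);
      case_iii = (2 * A + C\<^sup>2 \<noteq> 0 \<and> (2 * A + C\<^sup>2) * S < (B + C) * Q \<and>
        R > (2 * (B + C + sqrt \<alpha>) * S - Q) / (B + C + sqrt \<alpha>)\<^sup>2);
      case_iv = (2 * A + C\<^sup>2 = 0 \<and> Q > 0 \<and>
        R > (4 * (B + C) * S - Q) / (4 * (B + C)\<^sup>2));
      \<Theta>' = 2 * \<alpha> * ((B + C) * R - S) / (\<beta> + sqrt (\<beta>\<^sup>2 - 4 * \<alpha> * \<gamma>)) - (B + C)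
    in
      (open_loop_solvable M W A B C D Q S R \<longleftrightarrow> case_i \<or> case_ii \<or> case_iii \<or> case_iv) \<and>
      (closed_loop_solvable M W A B C D Q S R \<longleftrightarrow> case_i \<or> case_ii \<or> case_iii \<or> case_iv) \<and>
      (case_i \<longrightarrow>
        (\<forall>\<Theta> v. closed_loop_optimal M W A B C D Q S R \<Theta> v \<longleftrightarrow>
           \<bar>\<Theta> + B + C\<bar> < sqrt \<alpha> \<and> v \<in> L2F M W)) \<and>
      (case_ii \<or> case_iii \<or> case_iv \<longrightarrow>
        closed_loop_optimal M W A B C D Q S R \<Theta>' (\<lambda>_ _. 0) \<and>
        (\<forall>\<Theta> v. closed_loop_optimal M W A B C D Q S R \<Theta> v \<longrightarrow>
           \<Theta> = \<Theta>' \<and> proc_eq M v (\<lambda>_ _. 0)))"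
proof -
  define k where "k = B + C"
  define c where "c = k * R - S"
  define m where "m = 2 * A + C\<^sup>2"
  interpret lq M W A B C Q S R k \<alpha> \<beta> c
  proof (intro lq.intro lq_axioms.intro brownian.intro brownian_axioms.intro)
  qed (use assms in \<open>simp_all add: k_def c_def\<close>)
  let ?deg = "Q = m * R \<and> S = k * R"
  let ?reg = "(m \<noteq> 0 \<and> m * S \<ge> k * Q \<and> R > (2 * (k - sqrt \<alpha>) * S - Q) / (k - sqrt \<alpha>)\<^sup>2) \<or>
    (m \<noteq> 0 \<and> m * S < k * Q \<and> R > (2 * (k + sqrt \<alpha>) * S - Q) / (k + sqrt \<alpha>)\<^sup>2) \<or>
    (m = 0 \<and> Q > 0 \<and> R > (4 * k * S - Q) / (4 * k\<^sup>2))"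
  have reg: "2 * \<bar>c\<bar> * sqrt \<alpha> < \<beta> \<longleftrightarrow> ?reg"
    by (rule regular_iff_cases) (use assms in \<open>simp_all add: k_def c_def m_def\<close>)
  have deg: "\<beta> = 0 \<and> c = 0 \<longleftrightarrow> ?deg"
    using \<beta> unfolding c_def m_def by auto
  let ?CL = "closed_loop_optimal M W A B C D Q S R"
  let ?\<Theta> = "2 * \<alpha> * (k * R - S) / (\<beta> + sqrt (\<beta>\<^sup>2 - 4 * \<alpha> * \<gamma>)) - k"
  have case_deg: "?CL \<Theta> v \<longleftrightarrow> \<bar>\<Theta> + k\<bar> < sqrt \<alpha> \<and> v \<in> L2F M W" if ?deg for \<Theta> v
    using degenerate_closed_loop[of \<Theta> v] deg that unfolding \<open>D = 1\<close> by blast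
  have case_reg: "?CL ?\<Theta> (\<lambda>_ _. 0)" "?CL \<Theta> v \<Longrightarrow> \<Theta> = ?\<Theta> \<and> proc_eq M v (\<lambda>_ _. 0)" if ?reg for \<Theta> v
  proof -
    have pos: "2 * \<bar>c\<bar> * sqrt \<alpha> < \<beta>" using reg that by blast
    have \<gamma>: "\<gamma> = c\<^sup>2" using assms(6) by (simp add: c_def k_def)
    have e: "\<theta>_opt - k = ?\<Theta>"
      unfolding \<theta>_opt_def[OF pos] p_opt_def[OF pos] \<gamma> c_def[symmetric] by simp
    show "?CL ?\<Theta> (\<lambda>_ _. 0)" using regular_closed_loop[OF pos] unfolding e \<open>D = 1\<close> .
    show "\<Theta> = ?\<Theta> \<and> proc_eq M v (\<lambda>_ _. 0)" if "?CL \<Theta> v"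
      using closed_loop_unique[OF pos, of \<Theta> v] that unfolding e \<open>D = 1\<close> by blast
  qed
  \<comment> \<open>The equivalences close in a circle: open-loop solvability forces one of the
    cases, each case has a closed-loop optimal strategy, and such a strategy yields an optimal
    control from every initial state.\<close>
  have nec: "open_loop_solvable M W A B C D Q S R \<Longrightarrow> ?deg \<or> ?reg"
    using open_loop_necessary unfolding \<open>D = 1\<close> deg reg .
  \<comment> \<open>The witness \<open>\<Theta> = - k\<close> is the feedback
    \<open>\<theta> = 0\<close>, which is stabilizing because \<alpha> > 0.\<close>
  have "?CL (- k) (\<lambda>_ _. 0)" if ?deg
    using case_deg[OF that] zero_L2F \<alpha>_pos by simp
  then have suf: "closed_loop_solvable M W A B C D Q S R" if "?deg \<or> ?reg"
    using that case_reg(1) unfolding closed_loop_solvable_def by blast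
  have imp: "closed_loop_solvable M W A B C D Q S R \<Longrightarrow> open_loop_solvable M W A B C D Q S R"
    using closed_loop_imp_open_loop unfolding closed_loop_solvable_def \<open>D = 1\<close> by blast
  have "(open_loop_solvable M W A B C D Q S R \<longleftrightarrow> ?deg \<or> ?reg) \<and>
      (closed_loop_solvable M W A B C D Q S R \<longleftrightarrow> ?deg \<or> ?reg) \<and>
      (?deg \<longrightarrow> (\<forall>\<Theta> v. ?CL \<Theta> v \<longleftrightarrow> \<bar>\<Theta> + k\<bar> < sqrt \<alpha> \<and> v \<in> L2F M W)) \<and>
      (?reg \<longrightarrow> ?CL ?\<Theta> (\<lambda>_ _. 0) \<and> (\<forall>\<Theta> v. ?CL \<Theta> v \<longrightarrow> \<Theta> = ?\<Theta> \<and> proc_eq M v (\<lambda>_ _. 0)))"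
    using nec suf imp case_deg case_reg by blast
  then show ?thesis
    unfolding Let_def k_def m_def add.assoc[of _ B C] .
qed

end
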